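(* Let $M\ge 2$, $l\in\{1,\dots,M\}$, $N\ge 1$, and $m\ge 2$ with $m\not\equiv 0\pmod{M+1}$. Consider the $l$-th type rogue wave solution $(v_{1,\mathcal N_l},\dots,v_{M,\mathcal N_l})$ of order $\mathcal N_l=N\mathbf e_l$ of the $M$-component Hirota equation (defined in the context), with free parameters $a_j:=a_{j,l}$, regarded as functions of $(\bar x,t)$ with $\bar x=x-3(\sum_{j=1}^M c_j\rho_j^2)t$. Assume $|a_m|\gg 1$ while all other parameters are $O(1)$, and assume that all nonzero roots of $W_N^{[m,M+1,l]}(z)$ are simple. Then: (1) (Outer region.) In the region $\sqrt{\bar x^2+t^2}=O(|a_m|^{1/m})$, the order-$\mathcal N_l$ rogue wave separates into $\Gamma-\Gamma_0$ fundamental rogue waves, which are $$\hat v_n(\bar x,t)=\rho_n e^{\mathrm i(k_n\bar x-\bar w_n t)}\,\frac{\big[p_1(\bar x-\hat x_0)+3p_0^2p_1(t-\hat t_0)+\theta_{1n}\big]\big[p_1^*(\bar x-\hat x_0)+3(p_0^2)^*p_1^*(t-\hat t_0)-\theta_{1n}^*\big]+|h_0|^2}{\big|p_1(\bar x-\hat x_0)+3p_0^2p_1(t-\hat t_0)\big|^2+|h_0|^2},\quad n=1,\dots,M,$$ with $|h_0|^2=|p_1|^2/(p_0+p_0^* )^2$ and $\bar w_n=k_n^3+3\sum_{i=1}^M c_i\rho_i^2k_i$. Their positions are $$\hat x_0=\frac{1}{\operatorname{Im}(p_0^2)}\operatorname{Re}\Big[\frac{\mathrm i(p_0^2)^*}{p_1}\big(z_0a_m^{1/m}-\Delta_l\big)\Big],\qquad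 \hat t_0=\frac{1}{3\operatorname{Im}(p_0^2)}\operatorname{Im}\Big[\frac1{p_1}\big(z_0a_m^{1/m}-\Delta_l\big)\Big],$$ where $z_0$ is any one of the nonzero simple roots of $W_N^{[m,M+1,l]}(z)$ and $\Delta_l=O(1)$ is the $z_0$-dependent quantity given in the context. The approximation error is $O(|a_m|^{-1/m})$; that is, when $|a_m|\gg1$ and $(\bar x-\hat x_0)^2+(t-\hat t_0)^2=O(1)$, $$v_{n,\mathcal N_l}(\bar x,t)=\hat v_n(\bar x,t)+O(|a_m|^{-1/m}),\qquad n=1,\dots,M.$$ (2) (Inner region.) In the region $\bar x^2+t^2=O(1)$, if zero is a root of $W_N^{[m,M+1,l]}(z)$, then the solution $(v_{1,\mathcal N_l},\dots,v_{M,\mathcal N_l})(\bar x,t)$ is approximately a lower-order rogue wave $(v_{1,\widehat{\mathcal N}_l},\dots,v_{M,\widehat{\mathcal N}_l})(\bar x,t)$ of order $\widehat{\mathcal N}_l=\sum_{j=1}^M N_{j,l}\mathbf e_j$, where $N_{j,l}$ is the integer $N_j$ produced by the procedure in the context with $k=M+1$ and the given $m,l,N$. The internal parameters $\hat a_{j,n}$ ($j\ge1$, $n=1,\dots,M$) of this lower-order rogue wave are related to those of the original rogue wave by $\hat a_{j,n}=a_j$ for $j\not\equiv0\pmod{M+1}$.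
   Context: **Equation.** The $M$-component Hirota equation is $v_{j,t}=v_{j,xxx}-3\big(\sum_{k=1}^M c_k|v_k|^2\big)v_{j,x}-3v_j\big(\sum_{k=1}^M c_kv_k^*v_{k,x}\big)$, $j=1,\dots,M$, $c_k=\pm1$; $*$ denotes complex conjugation. **Parameters.** Let $\lambda_1>0$, $k_1\in\mathbb R$. The reals $k_j$, $\rho_j>0$ and signs $c_j=\pm1$ satisfy, for $j=1,\dots,M$, $k_j=k_1+\lambda_1\big(\sin\frac{\pi}{M+1}\cot\frac{j\pi}{M+1}-\cos\frac{\pi}{M+1}\big)$, $\ c_j\rho_j^2=(-1)^j\prod_{i\ne j}(k_j-k_i)^{-1}\big(\lambda_1\sin\frac{\pi}{M+1}/\sin\frac{j\pi}{M+1}\big)^{M+1}.$ Put $\mathcal F_M(p)=p-\sum_{j=1}^M\frac{c_j\rho_j^2}{p-\mathrm ik_j}$. Then $\mathcal F_M'$ has the roots $\pm\lambda_1\sin\frac{\pi}{M+1}-\mathrm i\lambda_1\cos\frac{\pi}{M+1}+\mathrm ik_1$, each of multiplicity $M$; $p_0$ is such a root with $\operatorname{Re}(p_0)\operatorname{Im}(p_0)\ne0$. $p(\kappa)$ is a local analytic function near $\kappa=0$ with $p(0)=p_0$ and $\mathcal F_M(p(\kappa))=\frac{\mathcal F_M(p_0)}{M+1}\sum_{n=1}^{M+1}\exp[\cos(\frac{2n\pi}{M+1})\kappa]\cos[\sin(\frac{2n\pi}{M+1})\kappa]$; $p_1=p'(0)$, $p_2=p''(0)/2$, $h_0=p_1/(p_0+p_0^*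 )$. Define $\alpha_r,\beta_r,\theta_{rj},s_r$ by $p(\kappa)-p_0=\sum_{r\ge1}\alpha_r\kappa^r$, $p(\kappa)^3-p_0^3=\sum_{r\ge1}\beta_r\kappa^r$, $\ln\frac{p(\kappa)-\mathrm ik_j}{p_0-\mathrm ik_j}=\sum_{r\ge1}\theta_{rj}\kappa^r$, $\ln\big[\frac1\kappa\frac{p_0+p_0^*}{p_1}\frac{p(\kappa)-p_0}{p(\kappa)+p_0^*}\big]=\sum_{r\ge1}s_r\kappa^r$; $\mathbf s=(s_1,s_2,\dots)$. **Rogue waves.** Schur polynomials: $\sum_{n\ge0}S_n(\mathbf x)\lambda^n=\exp(\sum_{k\ge1}x_k\lambda^k)$, $S_n=0$ for $n<0$. For $\mathbf n=(n_1,\dots,n_M)\in\mathbb Z^M$ and arbitrary complex constants $a_{i,I}$ let $\mathbf x_I^\pm(\mathbf n)$ have entries $x^+_{i,I}=\alpha_ix+\beta_it+\sum_jn_j\theta_{ij}+a_{i,I}$, $x^-_{i,I}=\alpha_i^*x+\beta_i^*t-\sum_jn_j\theta_{ij}^*+a_{i,I}^*$, and $m^{(\mathbf n,I,J)}_{i,j}=\sum_{v=0}^{\min(i,j)}\big[\frac{|p_1|^2}{(p_0+p_0^* )^2}\big]^vS_{i-v}(\mathbf x_I^+(\mathbf n)+v\mathbf s)S_{j-v}(\mathbf x_J^-(\mathbf n)+v\mathbf s^* )$. For $\mathcal N=(N_1,\dots,N_M)\in\mathbb Z^M_{\ge0}$, nonzero, $\tau_{\mathbf n}(x,t)$ is the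 determinant of the block matrix with blocks $\big(m^{(\mathbf n,I,J)}_{(M+1)(i-1)+I,(M+1)(j-1)+J}\big)_{1\le i\le N_I,1\le j\le N_J}$, with $I,J$ running in increasing order over the indices with $N_I,N_J>0$. The order-$\mathcal N$ rogue wave, in the variables $(\bar x,t)$, is $v_{n,\mathcal N}(\bar x,t)=\rho_n\frac{\tau_{\mathbf e_n}(\bar x,t)}{\tau_{\mathbf 0}(\bar x,t)}e^{\mathrm i(k_n\bar x-\bar w_nt)}$, with $\mathbf e_n$ the standard unit vector. For $\mathcal N_l=N\mathbf e_l$ there is one block and the parameters are $a_j=a_{j,l}$. **Polynomials.** $\sum_{n\ge0}p_n^{[m]}(z)\epsilon^n=e^{z\epsilon+\epsilon^m}$, $p^{[m]}_n=0$ for $n<0$; for jump $k$ and $1\le l<k$, with $n_i=l+(i-1)k$, $W_N^{[m,k,l]}(z)=c_N^{[m,k,l]}\det_{1\le i,j\le N}[p^{[m]}_{n_i-j+1}(z)]$, $c_N^{[m,k,l]}=\prod_in_i!/\prod_{i<j}(n_j-n_i)$. Here $k=M+1$. $\Gamma=\frac N2((k-1)(N-1)+2l)$ is its degree, and $\Gamma_0=\sum_{i=1}^{k-1}\frac{N_i}2((k-1)(N_i-1)+2i)-\sum_{1\le i<j\le k-1}N_iN_j$ is the multiplicity of its root $z=0$, with $N_i$ given below. **$\Delta_l$.** $\Delta_l=\dfrac{\hat x_2^+}{a_m^{1/m}}\dfrac{\widetilde W(z_0)}{(W_N^{[m,M+1,l]})'(z_0)}$, where $\hat x_2^+=p_2x^\sharp+3p_0(p_1^2+p_0p_2)t^\sharp$,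 $(x^\sharp,t^\sharp)\in\mathbb R^2$ is the leading-order location determined by $p_1x^\sharp+3p_0^2p_1t^\sharp=z_0a_m^{1/m}$, and $\widetilde W(z)=c_N^{[m,M+1,l]}\sum_{j=1}^N\det(A^{(j)}(z))$, with $A^{(j)}$ obtained from the matrix $\big(p^{[m]}_{(M+1)(i-1)+l-s+1}(z)\big)_{1\le i,s\le N}$ by replacing its $j$-th column by $\big(p^{[m]}_{(M+1)(i-1)+l-j-1}(z)\big)_{1\le i\le N}$. A fixed branch of $a_m^{1/m}$ is used. **Procedure defining $N_i$** ($1\le i\le k-1$) from $(m,k,l,N)$ with $k\nmid m$. Let $d=\gcd(m,k)$, $\widehat m=m/d$, $\widehat k=k/d$, $m_1=\lfloor m/k\rfloor$, $k_N=\lfloor N/\widehat m\rfloor$; $m_0\equiv m\pmod k$, $1\le m_0\le k-1$; $N_0\equiv N\pmod{\widehat m}$, $0\le N_0\le\widehat m-1$. First define $\hat N_i$, $0\le i\le k-1$. *Case I:* $0\le N_0<\lfloor l/m_0\rfloor m_1+m_1+1$. If $m_1\ne0$: $\hat N_i=m_1$ for $i=l-(j-1)m_0$, $1\le j\le\lfloor N_0/m_1\rfloor$; $\hat N_i=N_0\bmod m_1$ for $i=l-\lfloor N_0/m_1\rfloor m_0$; $0$ otherwise. If $m_1=0$: all $\hat N_i=0$. *Case II:* $N_0\ge\lfloor l/m_0\rfloor m_1+m_1+1$. Let $r$, $1\le r\le m_0/d$, satisfy $\lfloor\frac{l+(r-1)k}{m_0}\rfloor m_1+m_1+r\le N_0<\lfloor\frac{l+rk}{m_0}\rfloor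 m_1+m_1+r+1$. If $m_1\ne0$: $\hat N_i=m_1+1$ for $i=(l+(j-1)k)\bmod m_0$, $1\le j\le r$; $\hat N_i=m_1$ for $i=l-(j-1)m_0$ with $1\le j\le\lfloor\frac l{m_0}\rfloor$, for $i=l+tk-(j-1)m_0$ with $\lfloor\frac{l+(t-1)k}{m_0}\rfloor+1<j\le\lfloor\frac{l+tk}{m_0}\rfloor$ ($t=1,\dots,r-1$), and for $i=l+rk-(j-1)m_0$ with $\lfloor\frac{l+(r-1)k}{m_0}\rfloor+1<j\le\lfloor\frac{N_0-r}{m_1}\rfloor$; $\hat N_i=(N_0-r)\bmod m_1$ for $i=l+rk-\lfloor\frac{N_0-r}{m_1}\rfloor m_0$; $0$ otherwise. If $m_1=0$: $\hat N_i=1$ for $i=(l+(j-1)k)\bmod m$, $1\le j\le N_0$; $0$ otherwise. *Then, Case 1:* $d=1$. (i) If $\hat N_0=0$: $N_i=\hat N_i$. (ii) If $\hat N_i\ne0$ for $0\le i\le j-1$ and $\hat N_j=0$ ($1\le j<k$): $N_i=\hat N_{i+j}$ for $1\le i\le k-j-1$, $N_i=\hat N_{i+j-k}-1$ for $k-j\le i<k$. (iii) If all $\hat N_i\ne0$: replace $\hat N_i$ by $\hat N_i-\min_j\hat N_j$ and apply (i) or (ii). *Case 2:* $d\ne1$. Let $l_1=l\bmod d$, $l_j=l_1+(j-1)d$ ($1\le j\le\widehat k$); $\tilde N^{(1)}_{l_j}=\lfloor k_N\widehat m/\widehat k\rfloor+1$ for $1\le j\le k_N\widehat m\bmod\widehat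 k$ and $\lfloor k_N\widehat m/\widehat k\rfloor$ for the other $j\le\widehat k$; with $e=(k_Nm)\bmod k$, $\tilde N^{(2)}_{l_j}=\tilde N^{(1)}_{l_j}+\hat N_{l_j+k-e}$ if $l_j<e$, $\tilde N^{(2)}_{l_j}=\tilde N^{(1)}_{l_j}+\hat N_{l_j-e}$ if $e\le l_j<k$. If $d\nmid l$: $N_{l_j}=\tilde N^{(2)}_{l_j}$, other $N_i=0$. If $d\mid l$ and $\tilde N^{(2)}_0=0$: $N_{l_j}=\tilde N^{(2)}_{l_j}$ for $2\le j\le\widehat k$, other $N_i=0$. If $d\mid l$ and $\tilde N^{(2)}_0>0$: $N_{k-1}=\tilde N^{(2)}_0-1$, $N_{l_j-1}=\tilde N^{(2)}_{l_j}$ for $2\le j\le\widehat k$, other $N_i=0$.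
   Formalization: The positions use z_0 a_m^{1/m} − Δ_l − a_1 instead of z_0 a_m^{1/m} − Δ_l: a nonzero a_1 = O(1) shifts every fundamental wave by O(1), so the printed formulas fail with the stated error unless a_1 is negligible; for a_1 = 0 the two agree. *)

theory Defs
  imports "HOL-Complex_Analysis.Complex_Analysis" "Jordan_Normal_Form.Determinant"
begin

text \<open>
  Component and block indices, written 1, ..., M in the mathematics, are natural numbers in
  \<open>{1..M}\<close>. Both HOL-Analysis and Jordan_Normal_Form export names such as \<open>det\<close> and \<open>mat\<close>;
  the size-indexed matrices \<open>Matrix.mat\<close> (with entries indexed from 0) and \<open>Determinant.det\<close> of the
  latter are used throughout, under their qualified names.
\<close>

section \<open>Background, local parametrisation and its expansion coefficients\<close>

definition FM :: "nat \<Rightarrow> (nat \<Rightarrow> real) \<Rightarrow> (nat \<Rightarrow> real) \<Rightarrow> (nat \<Rightarrow> real) \<Rightarrow> complex \<Rightarrow> complex" where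
  "FM M k c \<rho> q = q - (\<Sum>j=1..M. of_real (c j * (\<rho> j)\<^sup>2) / (q - \<i> * of_real (k j)))"

definition wbar :: "nat \<Rightarrow> (nat \<Rightarrow> real) \<Rightarrow> (nat \<Rightarrow> real) \<Rightarrow> (nat \<Rightarrow> real) \<Rightarrow> nat \<Rightarrow> real" where
  "wbar M k c \<rho> n = (k n) ^ 3 + 3 * (\<Sum>i=1..M. c i * (\<rho> i)\<^sup>2 * k i)"

text \<open>In what follows \<open>p\<close> is the local analytic function \<open>\<kappa> \<mapsto> p \<kappa>\<close>; the point called \<open>p\<^sub>0\<close> in the
  mathematics is \<open>p 0\<close>.\<close>

definition p1 :: "(complex \<Rightarrow> complex) \<Rightarrow> complex" where
  "p1 p = deriv p 0"

definition p2 :: "(complex \<Rightarrow> complex) \<Rightarrow> complex" where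
  "p2 p = (deriv ^^ 2) p 0 / 2"

definition h0 :: "(complex \<Rightarrow> complex) \<Rightarrow> complex" where
  "h0 p = p1 p / (p 0 + cnj (p 0))"

definition alpha :: "(complex \<Rightarrow> complex) \<Rightarrow> nat \<Rightarrow> complex" where
  "alpha p r = fps_nth (fps_expansion (\<lambda>\<kappa>. p \<kappa> - p 0) 0) r"

definition beta :: "(complex \<Rightarrow> complex) \<Rightarrow> nat \<Rightarrow> complex" where
  "beta p r = fps_nth (fps_expansion (\<lambda>\<kappa>. p \<kappa> ^ 3 - p 0 ^ 3) 0) r"

definition theta :: "(nat \<Rightarrow> real) \<Rightarrow> (complex \<Rightarrow> complex) \<Rightarrow> nat \<Rightarrow> nat \<Rightarrow> complex" where
  "theta k p r j =
     fps_nth (fps_expansion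
       (\<lambda>\<kappa>. Ln ((p \<kappa> - \<i> * of_real (k j)) / (p 0 - \<i> * of_real (k j)))) 0) r"

text \<open>The argument of the logarithm defining the \<open>s\<^sub>r\<close> has a removable singularity with value 1 at
  \<open>\<kappa> = 0\<close>; hence the value \<open>0\<close> of the logarithm there.\<close>

definition s_coeff :: "(complex \<Rightarrow> complex) \<Rightarrow> nat \<Rightarrow> complex" where
  "s_coeff p r =
     fps_nth (fps_expansion
       (\<lambda>\<kappa>. if \<kappa> = 0 then 0
            else Ln (1 / \<kappa> * ((p 0 + cnj (p 0)) / p1 p)
                       * ((p \<kappa> - p 0) / (p \<kappa> + cnj (p 0))))) 0) r"

section \<open>Rogue waves\<close>

text \<open>Sequences \<open>(x\<^sub>1, x\<^sub>2, ...)\<close> are functions on \<open>nat\<close> whose value at \<open>0\<close> is ignored.\<close>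

definition schur :: "(nat \<Rightarrow> complex) \<Rightarrow> int \<Rightarrow> complex" where
  "schur x n =
     (if n < 0 then 0
      else fps_nth (fps_compose (fps_exp 1) (Abs_fps (\<lambda>r. if r = 0 then 0 else x r))) (nat n))"

text \<open>The parameter argument of \<open>x_plus\<close> and \<open>x_minus\<close> is the sequence \<open>i \<mapsto> a\<^sub>i\<^sub>,\<^sub>I\<close> of one block \<open>I\<close>.\<close>

definition x_plus ::
  "nat \<Rightarrow> (nat \<Rightarrow> real) \<Rightarrow> (complex \<Rightarrow> complex) \<Rightarrow> (nat \<Rightarrow> complex) \<Rightarrow> (nat \<Rightarrow> int) \<Rightarrow>
    real \<Rightarrow> real \<Rightarrow> nat \<Rightarrow> complex" where
  "x_plus M k p a nn x t i =
     alpha p i * of_real x + beta p i * of_real t + (\<Sum>j=1..M. of_int (nn j) * theta k p i j) + a i"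

definition x_minus ::
  "nat \<Rightarrow> (nat \<Rightarrow> real) \<Rightarrow> (complex \<Rightarrow> complex) \<Rightarrow> (nat \<Rightarrow> complex) \<Rightarrow> (nat \<Rightarrow> int) \<Rightarrow>
    real \<Rightarrow> real \<Rightarrow> nat \<Rightarrow> complex" where
  "x_minus M k p a nn x t i =
     cnj (alpha p i) * of_real x + cnj (beta p i) * of_real t
       - (\<Sum>j=1..M. of_int (nn j) * cnj (theta k p i j)) + cnj (a i)"

definition m_elem ::
  "nat \<Rightarrow> (nat \<Rightarrow> real) \<Rightarrow> (complex \<Rightarrow> complex) \<Rightarrow> (nat \<Rightarrow> nat \<Rightarrow> complex) \<Rightarrow> (nat \<Rightarrow> int) \<Rightarrow>
    real \<Rightarrow> real \<Rightarrow> nat \<Rightarrow> nat \<Rightarrow> nat \<Rightarrow> nat \<Rightarrow> complex" where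
  "m_elem M k p a nn x t I J i j =
     (\<Sum>v=0..min i j.
        (of_real ((cmod (p1 p))\<^sup>2) / (p 0 + cnj (p 0))\<^sup>2) ^ v
        * schur (\<lambda>r. x_plus M k p (\<lambda>i. a i I) nn x t r + of_nat v * s_coeff p r) (int i - int v)
        * schur (\<lambda>r. x_minus M k p (\<lambda>i. a i J) nn x t r + of_nat v * cnj (s_coeff p r))
            (int j - int v))"

text \<open>The rows (and columns) of the block matrix, in order: each is given by its block index \<open>I\<close>
  and the subscript \<open>(M+1)(i-1)+I\<close> with \<open>1 \<le> i \<le> N\<^sub>I\<close>. Blocks with \<open>N\<^sub>I = 0\<close> contribute nothing.\<close>

definition block_rows :: "nat \<Rightarrow> (nat \<Rightarrow> nat) \<Rightarrow> (nat \<times> nat) list" where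
  "block_rows M Nv =
     concat (map (\<lambda>I. map (\<lambda>i. (I, (M + 1) * (i - 1) + I)) [1..<Suc (Nv I)]) [1..<Suc M])"

definition tau ::
  "nat \<Rightarrow> (nat \<Rightarrow> real) \<Rightarrow> (complex \<Rightarrow> complex) \<Rightarrow> (nat \<Rightarrow> nat) \<Rightarrow> (nat \<Rightarrow> nat \<Rightarrow> complex) \<Rightarrow>
    (nat \<Rightarrow> int) \<Rightarrow> real \<Rightarrow> real \<Rightarrow> complex" where
  "tau M k p Nv a nn x t =
     (let R = block_rows M Nv in
      Determinant.det (Matrix.mat (length R) (length R)
        (\<lambda>(u, w). m_elem M k p a nn x t (fst (R ! u)) (fst (R ! w)) (snd (R ! u)) (snd (R ! w)))))"

definition plane_wave ::
  "nat \<Rightarrow> (nat \<Rightarrow> real) \<Rightarrow> (nat \<Rightarrow> real) \<Rightarrow> (nat \<Rightarrow> real) \<Rightarrow> nat \<Rightarrow> real \<Rightarrow> real \<Rightarrow> complex" where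
  "plane_wave M k c \<rho> n x t =
     of_real (\<rho> n) * exp (\<i> * of_real (k n * x - wbar M k c \<rho> n * t))"

text \<open>The component \<open>v\<^sub>n\<close> of the rogue wave of order \<open>Nv\<close> with internal parameters \<open>a j I\<close>
  (\<open>j \<ge> 1\<close>, block \<open>I\<close>), as a function of the moving-frame coordinate
  \<open>x - 3 (\<Sum>j. c\<^sub>j \<rho>\<^sub>j\<^sup>2) t\<close> and \<open>t\<close>; that coordinate is the argument \<open>x\<close> here.\<close>

definition rogue_wave ::
  "nat \<Rightarrow> (nat \<Rightarrow> real) \<Rightarrow> (nat \<Rightarrow> real) \<Rightarrow> (nat \<Rightarrow> real) \<Rightarrow> (complex \<Rightarrow> complex) \<Rightarrow>
    (nat \<Rightarrow> nat) \<Rightarrow> (nat \<Rightarrow> nat \<Rightarrow> complex) \<Rightarrow> nat \<Rightarrow> real \<Rightarrow> real \<Rightarrow> complex" where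
  "rogue_wave M k c \<rho> p Nv a n x t =
     tau M k p Nv a (\<lambda>j. if j = n then 1 else 0) x t / tau M k p Nv a (\<lambda>_. 0) x t
       * plane_wave M k c \<rho> n x t"

definition single_order :: "nat \<Rightarrow> nat \<Rightarrow> nat \<Rightarrow> nat" where
  "single_order l N = (\<lambda>j. if j = l then N else 0)"

definition rogue_wave_type ::
  "nat \<Rightarrow> (nat \<Rightarrow> real) \<Rightarrow> (nat \<Rightarrow> real) \<Rightarrow> (nat \<Rightarrow> real) \<Rightarrow> (complex \<Rightarrow> complex) \<Rightarrow>
    nat \<Rightarrow> nat \<Rightarrow> (nat \<Rightarrow> complex) \<Rightarrow> nat \<Rightarrow> real \<Rightarrow> real \<Rightarrow> complex" where
  "rogue_wave_type M k c \<rho> p l N a n x t =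
     rogue_wave M k c \<rho> p (single_order l N) (\<lambda>j I. a j) n x t"

definition fundamental_wave ::
  "nat \<Rightarrow> (nat \<Rightarrow> real) \<Rightarrow> (nat \<Rightarrow> real) \<Rightarrow> (nat \<Rightarrow> real) \<Rightarrow> (complex \<Rightarrow> complex) \<Rightarrow>
    real \<Rightarrow> real \<Rightarrow> nat \<Rightarrow> real \<Rightarrow> real \<Rightarrow> complex" where
  "fundamental_wave M k c \<rho> p x0 t0 n x t =
     plane_wave M k c \<rho> n x t *
     (((p1 p * of_real (x - x0) + 3 * (p 0)\<^sup>2 * p1 p * of_real (t - t0) + theta k p 1 n)
       * (cnj (p1 p) * of_real (x - x0) + 3 * cnj ((p 0)\<^sup>2) * cnj (p1 p) * of_real (t - t0)
            - cnj (theta k p 1 n))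
       + of_real ((cmod (h0 p))\<^sup>2))
      / of_real ((cmod (p1 p * of_real (x - x0) + 3 * (p 0)\<^sup>2 * p1 p * of_real (t - t0)))\<^sup>2
          + (cmod (h0 p))\<^sup>2))"

section \<open>Wronskian polynomials with jump \<open>k\<close>\<close>

definition p_poly :: "nat \<Rightarrow> int \<Rightarrow> complex \<Rightarrow> complex" where
  "p_poly m n z =
     (if n < 0 then 0
      else fps_nth (fps_compose (fps_exp 1) (fps_const z * fps_X + fps_X ^ m)) (nat n))"

definition row_idx :: "nat \<Rightarrow> nat \<Rightarrow> nat \<Rightarrow> nat" where
  "row_idx k l i = l + (i - 1) * k"

definition W_const :: "nat \<Rightarrow> nat \<Rightarrow> nat \<Rightarrow> complex" where
  "W_const k l N =
     (\<Prod>i=1..N. fact (row_idx k l i)) /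
     (\<Prod>j=1..N. \<Prod>i=1..<j. of_nat (row_idx k l j) - of_nat (row_idx k l i))"

definition W_poly :: "nat \<Rightarrow> nat \<Rightarrow> nat \<Rightarrow> nat \<Rightarrow> complex \<Rightarrow> complex" where
  "W_poly m k l N z =
     W_const k l N *
     Determinant.det (Matrix.mat N N
       (\<lambda>(i, j). p_poly m (int (row_idx k l (Suc i)) - int (Suc j) + 1) z))"

definition W_tilde :: "nat \<Rightarrow> nat \<Rightarrow> nat \<Rightarrow> nat \<Rightarrow> complex \<Rightarrow> complex" where
  "W_tilde m k l N z =
     W_const k l N *
     (\<Sum>j=1..N. Determinant.det (Matrix.mat N N
       (\<lambda>(i, s). if Suc s = j then p_poly m (int (row_idx k l (Suc i)) - int j - 1) z
                 else p_poly m (int (row_idx k l (Suc i)) - int (Suc s) + 1) z)))"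

section \<open>Positions of the fundamental rogue waves\<close>

text \<open>The argument \<open>w\<close> of \<open>pos_x\<close> and \<open>pos_t\<close> is the quantity multiplied by \<open>1 / p\<^sub>1\<close> in the formulas for
  the position.\<close>

definition pos_x :: "(complex \<Rightarrow> complex) \<Rightarrow> complex \<Rightarrow> real" where
  "pos_x p w = 1 / Im ((p 0)\<^sup>2) * Re (\<i> * cnj ((p 0)\<^sup>2) / p1 p * w)"

definition pos_t :: "(complex \<Rightarrow> complex) \<Rightarrow> complex \<Rightarrow> real" where
  "pos_t p w = 1 / (3 * Im ((p 0)\<^sup>2)) * Im (1 / p1 p * w)"

text \<open>In \<open>leading_loc\<close> and \<open>Delta\<close> the argument \<open>b\<close> is the chosen value of \<open>a\<^sub>m\<^sup>1\<^sup>/\<^sup>m\<close>.\<close>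

definition leading_loc :: "(complex \<Rightarrow> complex) \<Rightarrow> complex \<Rightarrow> complex \<Rightarrow> real \<times> real" where
  "leading_loc p z0 b =
     (THE (xs, ts). p1 p * of_real xs + 3 * (p 0)\<^sup>2 * p1 p * of_real ts = z0 * b)"

definition Delta ::
  "(complex \<Rightarrow> complex) \<Rightarrow> nat \<Rightarrow> nat \<Rightarrow> nat \<Rightarrow> nat \<Rightarrow> complex \<Rightarrow> complex \<Rightarrow> complex" where
  "Delta p M m l N z0 b =
     (let (xs, ts) = leading_loc p z0 b;
          x2 = p2 p * of_real xs + 3 * p 0 * ((p1 p)\<^sup>2 + p 0 * p2 p) * of_real ts
      in x2 / b * (W_tilde m (M + 1) l N z0 / deriv (W_poly m (M + 1) l N) z0))"

text \<open>
  The number whose real coordinates are the position \<open>(pos_x, pos_t)\<close> belonging to the root \<open>z0\<close>.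
  The internal parameter \<open>a\<^sub>1\<close> enters \<open>x\<^sub>1\<^sup>+\<close> additively, so that it only translates the pattern, by an
  amount which is not small in the limit. In the normalisation \<open>a\<^sub>1 = 0\<close> this is
  \<open>z0 * a\<^sub>m\<^sup>1\<^sup>/\<^sup>m - Delta\<close>; since \<open>a\<^sub>1\<close> is arbitrary here, the translation has to be recorded.
\<close>

definition wave_centre ::
  "(complex \<Rightarrow> complex) \<Rightarrow> nat \<Rightarrow> nat \<Rightarrow> nat \<Rightarrow> nat \<Rightarrow> complex \<Rightarrow> complex \<Rightarrow> complex \<Rightarrow> complex" where
  "wave_centre p M m l N z0 b a1 = (z0 * b - Delta p M m l N z0 b) - a1"

section \<open>The integers \<open>N\<^sub>i\<close> of the lower-order rogue wave\<close>

text \<open>All quantities are integers, as differences with negative intermediate values occur.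
  Here \<open>m0 = m mod k\<close> is nonzero because \<open>k\<close> does not divide \<open>m\<close>.\<close>

definition N_hat :: "int \<Rightarrow> int \<Rightarrow> int \<Rightarrow> int \<Rightarrow> int \<Rightarrow> int" where
  "N_hat m k l N i =
    (let d = gcd m k; mh = m div d; m1 = m div k; m0 = m mod k; N0 = N mod mh in
     if N0 < (l div m0) * m1 + m1 + 1 then
       (if m1 \<noteq> 0 then
          (if \<exists>j. 1 \<le> j \<and> j \<le> N0 div m1 \<and> i = l - (j - 1) * m0 then m1
           else if i = l - (N0 div m1) * m0 then N0 mod m1
           else 0)
        else 0)
     else
       (let r = (THE r. 1 \<le> r \<and> r \<le> m0 div d \<and>
                   ((l + (r - 1) * k) div m0) * m1 + m1 + r \<le> N0 \<and>
                   N0 < ((l + r * k) div m0) * m1 + m1 + r + 1) in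
        if m1 \<noteq> 0 then
          (if \<exists>j. 1 \<le> j \<and> j \<le> r \<and> i = (l + (j - 1) * k) mod m0 then m1 + 1
           else if (\<exists>j. 1 \<le> j \<and> j \<le> l div m0 \<and> i = l - (j - 1) * m0)
                 \<or> (\<exists>t j. 1 \<le> t \<and> t \<le> r - 1 \<and> (l + (t - 1) * k) div m0 + 1 < j \<and>
                      j \<le> (l + t * k) div m0 \<and> i = l + t * k - (j - 1) * m0)
                 \<or> (\<exists>j. (l + (r - 1) * k) div m0 + 1 < j \<and> j \<le> (N0 - r) div m1 \<and>
                      i = l + r * k - (j - 1) * m0) then m1
           else if i = l + r * k - ((N0 - r) div m1) * m0 then (N0 - r) mod m1
           else 0)
        else
          (if \<exists>j. 1 \<le> j \<and> j \<le> N0 \<and> i = (l + (j - 1) * k) mod m then 1 else 0)))"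

text \<open>Steps (i) and (ii) of the case \<open>gcd m k = 1\<close>, applied to a family \<open>H 0, ..., H (k - 1)\<close> that has
  a zero.\<close>

definition shift_family :: "int \<Rightarrow> (int \<Rightarrow> int) \<Rightarrow> int \<Rightarrow> int" where
  "shift_family k H i =
    (if H 0 = 0 then H i
     else
       (let j = (THE j. 1 \<le> j \<and> j < k \<and> (\<forall>q\<in>{0..j-1}. H q \<noteq> 0) \<and> H j = 0) in
        if i \<le> k - j - 1 then H (i + j) else H (i + j - k) - 1))"

text \<open>The families indexed by \<open>l\<^sub>j = l\<^sub>1 + (j - 1) d\<close> are written as functions of \<open>q = l\<^sub>j\<close>, where
  \<open>j = (q - l\<^sub>1) div d + 1\<close>; the \<open>l\<^sub>j\<close> are the \<open>q\<close> in \<open>{0..k-1}\<close> with \<open>q mod d = l\<^sub>1\<close>.\<close>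

definition N_tilde1 :: "int \<Rightarrow> int \<Rightarrow> int \<Rightarrow> int \<Rightarrow> int \<Rightarrow> int" where
  "N_tilde1 m k l N q =
    (let d = gcd m k; mh = m div d; kh = k div d; kN = N div mh; l1 = l mod d in
     (kN * mh) div kh + (if (q - l1) div d + 1 \<le> (kN * mh) mod kh then 1 else 0))"

definition N_tilde2 :: "int \<Rightarrow> int \<Rightarrow> int \<Rightarrow> int \<Rightarrow> int \<Rightarrow> int" where
  "N_tilde2 m k l N q =
    (let d = gcd m k; mh = m div d; kN = N div mh; e = (kN * m) mod k in
     N_tilde1 m k l N q
       + (if q < e then N_hat m k l N (q + k - e) else N_hat m k l N (q - e)))"

definition N_low :: "int \<Rightarrow> int \<Rightarrow> int \<Rightarrow> int \<Rightarrow> int \<Rightarrow> int" where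
  "N_low m k l N i =
    (let d = gcd m k; H = N_hat m k l N; T = N_tilde2 m k l N in
     if d = 1 then
       (if \<forall>q\<in>{0..k-1}. H q \<noteq> 0
        then shift_family k (\<lambda>q. H q - Min (H ` {0..k-1})) i
        else shift_family k H i)
     else if \<not> d dvd l then (if i mod d = l mod d then T i else 0)
     else if T 0 = 0 then (if i mod d = 0 then T i else 0)
     else if i = k - 1 then T 0 - 1
     else if (i + 1) mod d = 0 then T (i + 1)
     else 0)"

definition low_order :: "nat \<Rightarrow> nat \<Rightarrow> nat \<Rightarrow> nat \<Rightarrow> nat \<Rightarrow> int" where
  "low_order M m l N j = N_low (int m) (int (M + 1)) (int l) (int N) (int j)"

definition Gam :: "nat \<Rightarrow> nat \<Rightarrow> nat \<Rightarrow> real" where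
  "Gam k l N = real N / 2 * ((real k - 1) * (real N - 1) + 2 * real l)"

text \<open>\<open>Nf i\<close> is \<open>N\<^sub>i\<close> for \<open>1 \<le> i \<le> k - 1\<close>.\<close>

definition Gam0 :: "nat \<Rightarrow> (nat \<Rightarrow> int) \<Rightarrow> real" where
  "Gam0 k Nf =
     (\<Sum>i=1..k-1. of_int (Nf i) / 2 * ((real k - 1) * (of_int (Nf i) - 1) + 2 * real i))
     - (\<Sum>j=1..k-1. \<Sum>i=1..<j. of_int (Nf i) * of_int (Nf j))"

section \<open>The asymptotic regime\<close>

text \<open>\<open>|a\<^sub>m| \<ge> A\<close>, all other parameters bounded by \<open>B\<close>. Asymptotic statements fix \<open>B\<close> first and are
  uniform in all parameter sequences with this bound as \<open>A\<close> becomes large.\<close>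

definition large_param :: "nat \<Rightarrow> real \<Rightarrow> real \<Rightarrow> (nat \<Rightarrow> complex) \<Rightarrow> bool" where
  "large_param m B A a \<longleftrightarrow> (\<forall>j\<ge>1. j \<noteq> m \<longrightarrow> cmod (a j) \<le> B) \<and> cmod (a m) \<ge> A"

end

(*
  By Cauchy-Binet, tau is a sum over N-element sets V of non-negative weights h^(sum V) times
  products of two Schur-type minors of the row set {l, l + K, l + 2K, ...}, where K = M + 1. Since p is
  the inverse of a K-valued map with cyclic symmetry, s_r = 0 unless K divides r.

  Outer region: rescaling degree r by a_m^(-r/m) turns the minor of V = {0, ..., N - 1} into the
  Wronskian polynomial W, whose derivative is the minor of {0, ..., N - 2, N}. Near a simple root of W
  these two minors alone give the fundamental wave, and the first-order correction of the first one is
  Delta; away from the roots the first minor dominates and the quotient of taus tends to 1.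

  Inner region: extracting the entry a_m moves the row set down along residue classes mod m, and the
  dominant term is its m-core. Arranged in residue classes mod K, the m-core is, up to a shift, the row
  set of the rogue wave with the orders N_i, and W has order sum(core) - N(N-1)/2 at 0.
*)
theory Submission
  imports Defs "HOL-Computational_Algebra.Fundamental_Theorem_Algebra"
begin

section \<open>Determinants of arrays indexed by sets of natural numbers\<close>

text \<open>Two obstacles shape the proof. All bounds have to be uniform in the parameter sequence
  and in the location, so the triple \<open>(a, x, t)\<close> is the variable of the Landau symbols,
  along a filter that pushes \<open>a m\<close> to infinity. And every wave is a quotient of
  determinants, so the denominator needs a lower bound: there the two minors of each Cauchy-Binet
  term are conjugate, so the terms are non-negative and cannot cancel. Determinants are attached to
  sets of row indices because manipulations of rows are then manipulations of sets: lowering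
  elements by \<open>m\<close>, or deleting an initial interval, which only replaces
  \<open>x\<close> by \<open>x + j * s\<close>. The vanishing of \<open>s\<close> off the multiples
  of \<open>K\<close> enters twice. As \<open>K\<close> is at least 3, \<open>s\<close> is invisible
  to first order, which is why \<open>Delta\<close> is free of it. And since the final row set is
  closed under subtraction of \<open>K\<close>, both \<open>s\<close> and the parameters at
  multiples of \<open>K\<close> drop out of the inner limit, which is why the latter are arbitrary
  in the lower-order wave.\<close>

definition dt :: "nat \<Rightarrow> (nat \<Rightarrow> nat \<Rightarrow> 'a::comm_ring_1) \<Rightarrow> 'a" where
  "dt n f = Determinant.det (Matrix.mat n n (\<lambda>(i, j). f i j))"

definition en :: "nat set \<Rightarrow> nat \<Rightarrow> nat" where
  "en V i = sorted_list_of_set V ! i"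

lemma dt_rows:
  "dt n f = (\<Sum>p | p permutes {0..<n}. signof p * (\<Prod>i=0..<n. f i (p i)))"
proof -
  have *: "(\<Prod>i=0..<n. Matrix.mat n n (\<lambda>(i, j). f i j) $$ (i, p i)) = (\<Prod>i=0..<n. f i (p i))"
    if "p permutes {0..<n}" for p
    using permutes_in_image[OF that] by (intro prod.cong) auto
  have "Matrix.mat n n (\<lambda>(i, j). f i j) \<in> carrier_mat n n" by simp
  from det_def'[OF this] show ?thesis
    unfolding dt_def
    by (rule trans) (intro sum.cong refl arg_cong[of _ _ "\<lambda>x. _ * x"] *, blast)
qed

lemma dt_cols:
  "dt n f = (\<Sum>p | p permutes {0..<n}. signof p * (\<Prod>i=0..<n. f (p i) i))"
proof -
  have *: "(\<Prod>i<n. Matrix.mat n n (\<lambda>(i, j). f i j) $$ (p i, i)) = (\<Prod>i=0..<n. f (p i) i)"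
    if "p permutes {0..<n}" for p
    by (rule prod.cong) (use permutes_in_image[OF that] in \<open>simp_all add: atLeast0LessThan\<close>)
  have "Matrix.mat n n (\<lambda>(i, j). f i j) \<in> carrier_mat n n" by simp
  from det_col[OF this] show ?thesis
    unfolding dt_def
    by (rule trans) (intro sum.cong refl arg_cong[of _ _ "\<lambda>x. _ * x"] *, blast)
qed

lemma dt_cong:
  assumes "\<And>i j. i < n \<Longrightarrow> j < n \<Longrightarrow> f i j = g i j"
  shows "dt n f = dt n g"
  unfolding dt_def by (rule arg_cong[of _ _ Determinant.det]) (auto simp: mat_eq_iff assms)

lemma dt_transpose: "dt n (\<lambda>i j. f j i) = dt n f"
  unfolding dt_rows[of n "\<lambda>i j. f j i"] dt_cols[of n f] ..

lemma dt_0 [simp]: "dt 0 f = 1"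
  by (simp add: dt_rows)

lemma dt_permute_rows:
  assumes "q permutes {0..<n}"
  shows "dt n (\<lambda>i j. f (q i) j) = signof q * dt n f"
proof -
  have "Matrix.mat n n (\<lambda>(i, j). Matrix.mat n n (\<lambda>(i, j). f i j) $$ (q i, j)) =
      Matrix.mat n n (\<lambda>(i, j). f (q i) j)"
    using assms by (auto simp: mat_eq_iff dest: permutes_in_image)
  with det_permute_rows[OF _ assms, of "Matrix.mat n n (\<lambda>(i, j). f i j)"]
  show ?thesis by (simp add: dt_def)
qed

lemma dt_permute_cols:
  assumes "q permutes {0..<n}"
  shows "dt n (\<lambda>i j. f i (q j)) = signof q * dt n f"
  using dt_permute_rows[OF assms, of "\<lambda>i j. f j i"]
  unfolding dt_transpose[of n f] dt_transpose[of n "\<lambda>i j. f i (q j)"] .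

lemma dt_equal_rows:
  assumes "i < n" "j < n" "i \<noteq> j" "\<And>c. c < n \<Longrightarrow> f i c = f j c"
  shows "dt n f = 0"
  unfolding dt_def
  by (rule det_identical_rows[where n = n and i = i and j = j]) (use assms in \<open>auto simp: vec_eq_iff\<close>)

lemma dt_equal_cols:
  assumes "i < n" "j < n" "i \<noteq> j" "\<And>r. r < n \<Longrightarrow> f r i = f r j"
  shows "dt n f = 0"
  using dt_equal_rows[OF assms(1-3), of "\<lambda>a b. f b a"] assms(4)
  unfolding dt_transpose[of n f] by blast

lemma dt_zero_row:
  assumes "i < n" "\<And>j. j < n \<Longrightarrow> f i j = 0"
  shows "dt n f = 0"
proof -
  have "(\<Prod>i=0..<n. f i (p i)) = 0" if "p permutes {0..<n}" for p
    using that assms by (intro prod_zero) (auto dest: permutes_in_image intro!: bexI[of _ i])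
  then show ?thesis unfolding dt_rows by simp
qed

lemma dt_nonzeroD:
  assumes "dt n f \<noteq> 0"
  obtains p where "p permutes {0..<n}" "\<And>i. i < n \<Longrightarrow> f i (p i) \<noteq> 0"
proof -
  from assms obtain p where p: "p permutes {0..<n}" "signof p * (\<Prod>i=0..<n. f i (p i)) \<noteq> 0"
    unfolding dt_rows by (metis (mono_tags, lifting) mem_Collect_eq sum.not_neutral_contains_not_neutral)
  have "f i (p i) \<noteq> 0" if "i < n" for i
  proof
    assume "f i (p i) = 0"
    then have "(\<Prod>i=0..<n. f i (p i)) = 0" using that by (intro prod_zero) auto
    with p show False by simp
  qed
  with p that show ?thesis by blast
qed

lemma dt_mult:
  "dt n (\<lambda>i j. \<Sum>u<n. A i u * B u j) = dt n A * dt n B"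
proof -
  have "Matrix.mat n n (\<lambda>(i, j). \<Sum>u<n. A i u * B u j) =
      Matrix.mat n n (\<lambda>(i, j). A i j) * Matrix.mat n n (\<lambda>(i, j). B i j)"
    by (auto simp: mat_eq_iff scalar_prod_def atLeast0LessThan intro!: sum.cong)
  then show ?thesis unfolding dt_def by (simp add: det_mult[where n = n])
qed

lemma dt_scale:
  "dt n (\<lambda>i j. a i * f i j * b j) = (\<Prod>i<n. a i) * dt n f * (\<Prod>i<n. b i)"
proof -
  have "(\<Prod>i=0..<n. a i * f i (p i) * b (p i)) = (\<Prod>i<n. a i) * (\<Prod>i=0..<n. f i (p i)) * (\<Prod>i<n. b i)"
    if "p permutes {0..<n}" for p
    using prod.permute[OF that, of b] by (simp add: prod.distrib atLeast0LessThan o_def)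
  then show ?thesis
    unfolding dt_rows by (simp add: sum_distrib_left sum_distrib_right mult_ac)
qed

lemma dt_cnj: "dt n (\<lambda>i j. cnj (f i j)) = cnj (dt n f)"
  unfolding dt_rows by (simp add: cnj_sum cnj_prod)

text \<open>The form in which minors are shown to be nonzero later: a relation between the columns
  is read as a polynomial with too many roots.\<close>

lemma dt_nonzero_if_kernel_trivial:
  fixes f :: "nat \<Rightarrow> nat \<Rightarrow> 'a::idom"
  assumes "\<And>v. (\<And>i. i < n \<Longrightarrow> (\<Sum>j<n. f i j * v j) = 0) \<Longrightarrow> (\<forall>j<n. v j = 0)"
  shows "dt n f \<noteq> 0"
proof
  assume "dt n f = 0"
  then obtain v where v: "v \<in> carrier_vec n" "v \<noteq> 0\<^sub>v n"
      "Matrix.mat n n (\<lambda>(i, j). f i j) *\<^sub>v v = 0\<^sub>v n"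
    unfolding dt_def by (subst (asm) det_0_iff_vec_prod_zero[where n = n]) auto
  have "(\<Sum>j<n. f i j * vec_index v j) = 0" if "i < n" for i
  proof -
    have "vec_index (Matrix.mat n n (\<lambda>(i, j). f i j) *\<^sub>v v) i = 0" using v that by simp
    then show ?thesis using v(1) that
      by (simp add: scalar_prod_def atLeast0LessThan)
  qed
  from assms[OF this] v show False by (auto simp: vec_eq_iff)
qed

text \<open>A term of the Leibniz sum survives only if \<open>g (p i) \<le> g i\<close> for all
  \<open>i\<close>. Both sides have the same sum over \<open>i\<close>, so equality holds throughout
  and \<open>p\<close> is the identity because \<open>g\<close> is injective.\<close>

lemma dt_unitriangular:
  fixes f :: "nat \<Rightarrow> nat \<Rightarrow> 'a::comm_ring_1" and g :: "nat \<Rightarrow> nat"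
  assumes "inj_on g {0..<n}" and "\<And>i. i < n \<Longrightarrow> f i i = 1"
    and "\<And>i j. i < n \<Longrightarrow> j < n \<Longrightarrow> f i j \<noteq> 0 \<Longrightarrow> g j \<le> g i"
  shows "dt n f = 1"
proof -
  have "signof p * (\<Prod>i=0..<n. f i (p i)) = 0" if p: "p permutes {0..<n}" and "p \<noteq> id" for p
  proof (rule ccontr)
    assume nz: "signof p * (\<Prod>i=0..<n. f i (p i)) \<noteq> 0"
    have ne: "f i (p i) \<noteq> 0" if "i < n" for i
    proof
      assume "f i (p i) = 0"
      then have "(\<Prod>i=0..<n. f i (p i)) = 0" using that by (intro prod_zero) auto
      with nz show False by simp
    qed
    have le: "g (p i) \<le> g i" if "i \<in> {0..<n}" for i
      using ne assms(3)[of i "p i"] that p by (auto dest: permutes_in_image)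
    have "(\<Sum>i=0..<n. g (p i)) = (\<Sum>i=0..<n. g i)"
      using sum.permute[OF p, of g] by (simp add: o_def)
    then have "g (p i) = g i" if "i < n" for i
      using sum_mono_inv[of "\<lambda>i. g (p i)" "{0..<n}" g i] le that by auto
    then have "p i = i" if "i < n" for i
      using assms(1) that p by (auto simp: inj_on_def dest: permutes_in_image)
    then have "p = id" using p by (auto simp: fun_eq_iff permutes_def)
    with \<open>p \<noteq> id\<close> show False by simp
  qed
  then have "dt n f = (\<Sum>p\<in>{id}. signof p * (\<Prod>i=0..<n. f i (p i)))"
    unfolding dt_rows by (intro sum.mono_neutral_right) (auto simp: finite_permutations permutes_id)
  also have "\<dots> = 1" by (simp add: assms(2))
  finally show ?thesis .
qed

section \<open>Enumeration of finite sets and the Cauchy-Binet formula\<close>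

lemma en_bij: "finite V \<Longrightarrow> bij_betw (en V) {0..<card V} V"
  unfolding en_def[abs_def] using bij_betw_nth[of "sorted_list_of_set V"]
  by (simp add: atLeast0LessThan)

lemma en_in: "finite V \<Longrightarrow> i < card V \<Longrightarrow> en V i \<in> V"
  using en_bij[of V] by (auto dest: bij_betwE)

lemma en_inj: "finite V \<Longrightarrow> inj_on (en V) {0..<card V}"
  using en_bij[of V] by (auto simp: bij_betw_def)

lemma en_image: "finite V \<Longrightarrow> en V ` {0..<card V} = V"
  using en_bij[of V] by (auto simp: bij_betw_def)

lemma sum_en: "finite V \<Longrightarrow> (\<Sum>i<card V. g (en V i)) = sum g V"
  using sum.reindex_bij_betw[OF en_bij[of V], of g] by (simp add: atLeast0LessThan)

lemma prod_en: "finite V \<Longrightarrow> (\<Prod>i<card V. g (en V i)) = prod g V"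
  using prod.reindex_bij_betw[OF en_bij[of V], of g] by (simp add: atLeast0LessThan)

lemma en_atLeastLessThan: "i < n \<Longrightarrow> en {0..<n} i = i"
  by (simp add: en_def)

lemma permutes_en:
  assumes "inj_on g {0..<n}" "g ` {0..<n} = V"
  obtains q where "q permutes {0..<n}" "\<And>i. i < n \<Longrightarrow> g i = en V (q i)"
proof -
  have fin: "finite V" and card: "card V = n" using assms by (auto simp: card_image)
  have b: "bij_betw (inv_into {0..<n} (en V)) V {0..<n}"
    using bij_betw_inv_into[OF en_bij[OF fin]] card by simp
  have g: "bij_betw g {0..<n} V" using assms by (simp add: bij_betw_def)
  define q where "q i = (if i < n then inv_into {0..<n} (en V) (g i) else i)" for i
  have "bij_betw (inv_into {0..<n} (en V) \<circ> g) {0..<n} {0..<n}"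
    using bij_betw_trans[OF g b] .
  then have "bij_betw q {0..<n} {0..<n}"
    by (rule iffD1[OF bij_betw_cong, rotated]) (auto simp: q_def)
  then have "q permutes {0..<n}" by (rule bij_imp_permutes) (auto simp: q_def)
  moreover have "g i = en V (q i)" if "i < n" for i
  proof -
    have "g i \<in> en V ` {0..<n}" using that assms(2) en_image[OF fin] card by auto
    from f_inv_into_f[OF this] show ?thesis using that by (simp add: q_def)
  qed
  ultimately show ?thesis using that by blast
qed

text \<open>Rows and columns undergo the same permutation, so the two signs cancel. Hence the block
  order of \<open>tau\<close> and the increasing order of the row indices give the same
  determinant.\<close>

lemma dt_reindex:
  assumes "inj_on g {0..<n}"
  shows "dt n (\<lambda>i j. f (g i) (g j)) = dt n (\<lambda>i j. f (en (g ` {0..<n}) i) (en (g ` {0..<n}) j))"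
proof -
  obtain q where q: "q permutes {0..<n}" "\<And>i. i < n \<Longrightarrow> g i = en (g ` {0..<n}) (q i)"
    using permutes_en[OF assms refl] by blast
  define e where "e = en (g ` {0..<n})"
  have "dt n (\<lambda>i j. f (g i) (g j)) = dt n (\<lambda>i j. f (e (q i)) (e (q j)))"
    by (rule dt_cong) (simp add: q(2) e_def)
  also have "\<dots> = signof q * (signof q * dt n (\<lambda>i j. f (e i) (e j)))"
    by (simp add: dt_permute_rows[OF q(1), of "\<lambda>i j. f (e i) (e (q j))"]
        dt_permute_cols[OF q(1), of "\<lambda>i j. f (e i) (e j)"])
  also have "\<dots> = dt n (\<lambda>i j. f (e i) (e j))" by (simp add: sign_def)
  finally show ?thesis by (simp add: e_def)
qed

text \<open>Expanding the sums gives one summand for each map \<open>f\<close> from the rows to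
  \<open>S\<close>. A map that is not injective produces two equal rows; the injective maps with
  image \<open>V\<close> are the permutations of the row positions followed by \<open>en V\<close>,
  and summing over them restores the first minor.\<close>

lemma Cauchy_Binet:
  fixes A B :: "nat \<Rightarrow> nat \<Rightarrow> 'a::comm_ring_1"
  assumes fin: "finite S"
  shows "dt n (\<lambda>i j. \<Sum>v\<in>S. A i v * B v j) =
    (\<Sum>V | V \<subseteq> S \<and> card V = n. dt n (\<lambda>i j. A i (en V j)) * dt n (\<lambda>i j. B (en V i) j))"
proof -
  let ?I = "{0..<n}" and ?P = "{p. p permutes {0..<n}}"
  let ?F = "PiE ?I (\<lambda>_. S)"
  let ?G = "{f \<in> ?F. inj_on f ?I}"
  let ?h = "\<lambda>f. (\<Prod>i=0..<n. A i (f i)) * dt n (\<lambda>i j. B (f i) j)"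
  have finF: "finite ?F" using fin by (simp add: finite_PiE)
  have "dt n (\<lambda>i j. \<Sum>v\<in>S. A i v * B v j)
      = (\<Sum>p\<in>?P. signof p * (\<Sum>f\<in>?F. \<Prod>i=0..<n. A i (f i) * B (f i) (p i)))"
    unfolding dt_rows by (subst prod_sum_PiE) (auto simp: fin)
  also have "\<dots> = (\<Sum>f\<in>?F. ?h f)"
    unfolding dt_rows sum_distrib_left
    by (subst sum.swap) (simp add: prod.distrib mult_ac)
  also have "\<dots> = (\<Sum>f\<in>?G. ?h f)"
  proof (rule sum.mono_neutral_right[OF finF])
    show "\<forall>f\<in>?F - ?G. ?h f = 0"
    proof
      fix f assume "f \<in> ?F - ?G"
      then obtain i j where "i < n" "j < n" "i \<noteq> j" "f i = f j" by (auto simp: inj_on_def)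
      then have "dt n (\<lambda>i j. B (f i) j) = 0" by (intro dt_equal_rows[of i n j]) auto
      then show "?h f = 0" by simp
    qed
  qed auto
  also have "\<dots> = (\<Sum>V\<in>{V. V \<subseteq> S \<and> card V = n}. \<Sum>f\<in>{f \<in> ?G. f ` ?I = V}. ?h f)"
    by (rule sum.group[symmetric]) (use finF fin in \<open>auto simp: card_image\<close>)
  also have "\<dots> = (\<Sum>V | V \<subseteq> S \<and> card V = n. dt n (\<lambda>i j. A i (en V j)) * dt n (\<lambda>i j. B (en V i) j))"
  proof (rule sum.cong[OF refl])
    fix V assume "V \<in> {V. V \<subseteq> S \<and> card V = n}"
    then have V: "V \<subseteq> S" "card V = n" and finV: "finite V" using fin finite_subset by auto
    let ?r = "\<lambda>q. restrict (\<lambda>i. en V (q i)) ?I"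
    have inj: "inj_on ?r ?P"
    proof (rule inj_onI)
      fix q q' assume q: "q \<in> ?P" "q' \<in> ?P" and eq: "?r q = ?r q'"
      have "q i = q' i" for i
      proof (cases "i < n")
        case True
        then have "en V (q i) = en V (q' i)" using fun_cong[OF eq, of i] by simp
        then show ?thesis using en_inj[OF finV] V q True permutes_in_image[of q ?I i]
          permutes_in_image[of q' ?I i]
          by (auto simp: inj_on_def)
      next
        case False
        then show ?thesis using q by (auto simp: permutes_def)
      qed
      then show "q = q'" by auto
    qed
    have im: "?r ` ?P = {f \<in> ?G. f ` ?I = V}"
    proof (intro equalityI subsetI)
      fix f assume "f \<in> ?r ` ?P"
      then obtain q where q: "q permutes ?I" and f: "f = ?r q" by auto
      have b: "bij_betw (\<lambda>i. en V (q i)) ?I V"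
        using bij_betw_trans[OF permutes_imp_bij[OF q] en_bij[OF finV, unfolded V]]
        by (simp add: o_def)
      have "inj_on f ?I" using b unfolding f by (simp add: bij_betw_def inj_on_def)
      moreover have "f ` ?I = V" using b unfolding f by (simp add: bij_betw_def)
      moreover have "f \<in> ?F" using bij_betwE[OF b] V(1) unfolding f by (auto simp: PiE_def)
      ultimately show "f \<in> {f \<in> ?G. f ` ?I = V}" by blast
    next
      fix f assume f: "f \<in> {f \<in> ?G. f ` ?I = V}"
      then have "inj_on f ?I" "f ` ?I = V" by blast+
      then obtain q where q: "q permutes ?I" "\<And>i. i < n \<Longrightarrow> f i = en V (q i)"
        by (rule permutes_en) blast
      have "f = ?r q" using f q(2) by (auto simp: fun_eq_iff PiE_def extensional_def)
      with q show "f \<in> ?r ` ?P" by auto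
    qed
    have "(\<Sum>f\<in>{f \<in> ?G. f ` ?I = V}. ?h f) = (\<Sum>q\<in>?P. ?h (?r q))"
      by (simp only: im[symmetric] sum.reindex[OF inj] o_def)
    also have "\<dots> = (\<Sum>q\<in>?P. (\<Prod>i=0..<n. A i (en V (q i))) * (signof q * dt n (\<lambda>i j. B (en V i) j)))"
    proof (rule sum.cong[OF refl])
      fix q assume "q \<in> ?P"
      then have q: "q permutes ?I" by simp
      have "dt n (\<lambda>i j. B (?r q i) j) = dt n (\<lambda>i j. B (en V (q i)) j)" by (rule dt_cong) simp
      also have "\<dots> = signof q * dt n (\<lambda>i j. B (en V i) j)" by (rule dt_permute_rows[OF q])
      finally show "?h (?r q) = (\<Prod>i=0..<n. A i (en V (q i))) * (signof q * dt n (\<lambda>i j. B (en V i) j))"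
        by simp
    qed
    also have "\<dots> = dt n (\<lambda>i j. A i (en V j)) * dt n (\<lambda>i j. B (en V i) j)"
      unfolding dt_rows[of n "\<lambda>i j. A i (en V j)"] sum_distrib_right
      by (intro sum.cong) (simp_all add: mult_ac)
    finally show "(\<Sum>f\<in>{f \<in> ?G. f ` ?I = V}. ?h f) =
        dt n (\<lambda>i j. A i (en V j)) * dt n (\<lambda>i j. B (en V i) j)" .
  qed
  finally show ?thesis .
qed

section \<open>Elementary Schur polynomials\<close>

definition sch :: "(nat \<Rightarrow> complex) \<Rightarrow> nat \<Rightarrow> complex" where
  "sch x n = fps_nth (fps_compose (fps_exp 1) (Abs_fps (\<lambda>r. if r = 0 then 0 else x r))) n"

lemma schur_nat: "schur x (int n) = sch x n"
  by (simp add: schur_def sch_def)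

lemma schur_diff: "schur x (int n - int v) = (if v \<le> n then sch x (n - v) else 0)"
proof (cases "v \<le> n")
  case True
  then have "int n - int v = int (n - v)" by simp
  with True show ?thesis by (simp only: schur_nat if_True)
qed (simp add: schur_def)

lemma fps_exp_compose_deriv:
  fixes G :: "complex fps"
  assumes "fps_nth G 0 = 0"
  shows "fps_deriv (fps_exp 1 oo G) = (fps_exp 1 oo G) * fps_deriv G"
  using fps_compose_deriv[OF assms, of "fps_exp 1"] by simp

lemma fps_linear_ode_unique:
  fixes A B H :: "complex fps"
  assumes "fps_deriv A = A * H" "fps_deriv B = B * H" "fps_nth A 0 = fps_nth B 0"
  shows "A = B"
proof (rule fps_ext)
  fix n
  show "fps_nth A n = fps_nth B n"
  proof (induction n rule: less_induct)
    case (less n)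
    show ?case
    proof (cases n)
      case (Suc k)
      have "of_nat (Suc k) * fps_nth A (Suc k) = (\<Sum>i=0..k. fps_nth A i * fps_nth H (k - i))"
        using arg_cong[OF assms(1), of "\<lambda>f. fps_nth f k"] by (simp add: fps_mult_nth)
      also have "\<dots> = (\<Sum>i=0..k. fps_nth B i * fps_nth H (k - i))"
        using less Suc by (intro sum.cong) auto
      also have "\<dots> = of_nat (Suc k) * fps_nth B (Suc k)"
        using arg_cong[OF assms(2), of "\<lambda>f. fps_nth f k"] by (simp add: fps_mult_nth)
      finally show ?thesis unfolding Suc by (metis mult_left_cancel of_nat_neq_0)
    qed (use assms in simp)
  qed
qed

text \<open>Both sides solve the same linear equation \<open>F' = F * (G + H)'\<close> with the same
  constant term.\<close>

lemma fps_exp_compose_add: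
  fixes G H :: "complex fps"
  assumes "fps_nth G 0 = 0" "fps_nth H 0 = 0"
  shows "fps_exp 1 oo (G + H) = (fps_exp 1 oo G) * (fps_exp 1 oo H)"
  by (rule fps_linear_ode_unique[where H = "fps_deriv (G + H)"])
     (use assms in \<open>simp_all add: fps_exp_compose_deriv algebra_simps\<close>)

lemma sch_0 [simp]: "sch x 0 = 1"
  by (simp add: sch_def)

text \<open>The coefficient form of \<open>E' = E * G'\<close> for the generating function
  \<open>E\<close>. The estimates and the support statement below are inductions along this
  recursion.\<close>

lemma sch_rec:
  "of_nat (Suc n) * sch x (Suc n) = (\<Sum>i=0..n. of_nat (Suc (n - i)) * x (Suc (n - i)) * sch x i)"
proof -
  let ?G = "Abs_fps (\<lambda>r. if r = 0 then 0 else x r)"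
  have "fps_nth (fps_deriv (fps_exp 1 oo ?G)) n = fps_nth ((fps_exp 1 oo ?G) * fps_deriv ?G) n"
    by (subst fps_exp_compose_deriv) simp_all
  also have "\<dots> = (\<Sum>i=0..n. of_nat (Suc (n - i)) * x (Suc (n - i)) * sch x i)"
    unfolding fps_mult_nth
    by (intro sum.cong refl) (simp add: sch_def del: of_nat_Suc)
  finally show ?thesis by (simp add: sch_def del: of_nat_Suc)
qed

lemma sch_1: "sch x (Suc 0) = x (Suc 0)"
  using sch_rec[of 0 x] by simp

lemma sch_2: "sch x 2 = x 2 + x 1 ^ 2 / 2"
  using sch_rec[of 1 x] by (simp add: sch_1 numeral_2_eq_2 power2_eq_square field_simps)

lemma sch_add: "sch (\<lambda>r. x r + y r) n = (\<Sum>j=0..n. sch x j * sch y (n - j))"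
proof -
  have "Abs_fps (\<lambda>r. if r = 0 then 0 else x r + y r) =
      Abs_fps (\<lambda>r. if r = 0 then 0 else x r) + Abs_fps (\<lambda>r. if r = 0 then 0 else y r)"
    by (simp add: fps_eq_iff)
  then show ?thesis unfolding sch_def by (simp add: fps_exp_compose_add fps_mult_nth)
qed

lemma sch_scale: "sch (\<lambda>r. b ^ r * x r) n = b ^ n * sch x n"
proof (induction n rule: less_induct)
  case (less n)
  show ?case
  proof (cases n)
    case (Suc k)
    have "of_nat (Suc k) * sch (\<lambda>r. b ^ r * x r) (Suc k) =
        (\<Sum>i=0..k. of_nat (Suc (k - i)) * (b ^ Suc (k - i) * x (Suc (k - i))) * (b ^ i * sch x i))"
      unfolding sch_rec using less Suc by (intro sum.cong) auto
    also have "\<dots> = (\<Sum>i=0..k. b ^ Suc k * (of_nat (Suc (k - i)) * x (Suc (k - i)) * sch x i))"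
    proof (intro sum.cong refl)
      fix i assume "i \<in> {0..k}"
      then have "b ^ Suc k = b ^ Suc (k - i) * b ^ i" by (simp flip: power_add)
      then show "of_nat (Suc (k - i)) * (b ^ Suc (k - i) * x (Suc (k - i))) * (b ^ i * sch x i) =
          b ^ Suc k * (of_nat (Suc (k - i)) * x (Suc (k - i)) * sch x i)" by (simp only: mult_ac)
    qed
    also have "\<dots> = of_nat (Suc k) * (b ^ Suc k * sch x (Suc k))"
      unfolding sum_distrib_left[symmetric] sch_rec[symmetric] by simp
    finally show ?thesis unfolding Suc by (metis mult_left_cancel of_nat_neq_0)
  qed simp
qed

lemma sch_cnj: "sch (\<lambda>r. cnj (x r)) n = cnj (sch x n)"
proof (induction n rule: less_induct)
  case (less n)
  show ?case
  proof (cases n)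
    case (Suc k)
    have "of_nat (Suc k) * sch (\<lambda>r. cnj (x r)) (Suc k) =
        (\<Sum>i=0..k. of_nat (Suc (k - i)) * cnj (x (Suc (k - i))) * cnj (sch x i))"
      unfolding sch_rec using less Suc by (intro sum.cong) auto
    also have "\<dots> = cnj (of_nat (Suc k) * sch x (Suc k))"
      unfolding sch_rec by (simp add: cnj_sum)
    also have "\<dots> = of_nat (Suc k) * cnj (sch x (Suc k))" by simp
    finally show ?thesis unfolding Suc by (metis mult_left_cancel of_nat_neq_0)
  qed simp
qed

lemma sch_single:
  assumes "m > 0"
  shows "sch (\<lambda>r. if r = m then a else 0) n = (if m dvd n then a ^ (n div m) / fact (n div m) else 0)"
proof -
  have "Abs_fps (\<lambda>r. if r = 0 then 0 else if r = m then a else 0) = fps_const a * fps_X ^ m"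
    using assms by (simp add: fps_eq_iff)
  moreover have "fps_nth ((fps_const a * fps_X ^ m) ^ i) n = (if n = m * i then a ^ i else 0)" for i
    by (simp add: power_mult_distrib fps_const_power flip: power_mult)
  ultimately have "sch (\<lambda>r. if r = m then a else 0) n =
      (\<Sum>i=0..n. if n = m * i then a ^ i / fact i else 0)"
    unfolding sch_def fps_compose_nth by (intro sum.cong) auto
  also have "\<dots> = (if m dvd n then a ^ (n div m) / fact (n div m) else 0)"
  proof (cases "m dvd n")
    case True
    then obtain q where q: "n = m * q" by blast
    then have "q \<le> n" using assms by simp
    have "(\<Sum>i=0..n. if n = m * i then a ^ i / fact i else 0) =
        (\<Sum>i=0..n. if q = i then a ^ i / fact i else 0)"
      using q assms by (intro sum.cong) auto
    then show ?thesis using \<open>q \<le> n\<close> q assms by simp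
  qed (auto intro!: sum.neutral)
  finally show ?thesis .
qed

lemma p_poly_eq_sch:
  assumes "m \<ge> 2"
  shows "p_poly m (int n) z = sch (\<lambda>r. if r = 1 then z else if r = m then 1 else 0) n"
proof -
  have "Abs_fps (\<lambda>r. if r = 0 then 0 else if r = 1 then z else if r = m then 1 else 0) =
      fps_const z * fps_X + fps_X ^ m"
    using assms by (auto simp: fps_eq_iff)
  then show ?thesis unfolding p_poly_def sch_def by (simp del: One_nat_def)
qed

text \<open>A nonzero value in degree \<open>j\<close> means that \<open>j\<close> is a sum of
  positions \<open>r\<close> with \<open>c r \<noteq> 0\<close>; subtracting them one by one never
  leaves \<open>X\<close>.\<close>

lemma sch_support:
  assumes "\<And>n r. n \<in> X \<Longrightarrow> 1 \<le> r \<Longrightarrow> r \<le> n \<Longrightarrow> c r \<noteq> 0 \<Longrightarrow> n - r \<in> X"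
  assumes "n \<in> X" "j \<le> n" "sch c j \<noteq> 0"
  shows "n - j \<in> X"
  using assms(2-)
proof (induction j arbitrary: n rule: less_induct)
  case (less j)
  show ?case
  proof (cases j)
    case 0
    then show ?thesis using less by simp
  next
    case (Suc k)
    then have "(\<Sum>i=0..k. of_nat (Suc (k - i)) * c (Suc (k - i)) * sch c i) \<noteq> 0"
      unfolding sch_rec[symmetric] using less.prems(3) by (simp del: of_nat_Suc)
    then obtain i where "i \<in> {0..k}" "of_nat (Suc (k - i)) * c (Suc (k - i)) * sch c i \<noteq> 0"
      by (rule sum.not_neutral_contains_not_neutral)
    then have i: "i \<le> k" "c (Suc (k - i)) \<noteq> 0" "sch c i \<noteq> 0" by (simp_all del: of_nat_Suc)

    note nz = i(2,3)
    have le: "Suc (k - i) \<le> n" "i < j" "i \<le> n - Suc (k - i)" using less.prems(2) Suc i(1) by linarith+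
    have "n - Suc (k - i) \<in> X" by (rule assms(1)[OF less.prems(1) _ le(1) nz(1)]) simp
    from less.IH[OF le(2) this le(3) nz(2)] have "n - Suc (k - i) - i \<in> X" .
    moreover have "n - Suc (k - i) - i = n - j" using Suc i(1) by linarith
    ultimately show ?thesis by simp
  qed
qed

section \<open>Asymptotic bounds for Schur polynomials\<close>

lemma of_nat_mult_bigo_iff:
  fixes f :: "'w \<Rightarrow> complex"
  shows "(\<lambda>w. of_nat (Suc k) * f w) \<in> O[F](g) \<longleftrightarrow> f \<in> O[F](g)"
  by (simp del: of_nat_Suc)

lemma sch_bigo_1:
  fixes x :: "'w \<Rightarrow> nat \<Rightarrow> complex"
  assumes "\<And>r. 1 \<le> r \<Longrightarrow> r \<le> n \<Longrightarrow> (\<lambda>w. x w r) \<in> O[F](\<lambda>_. 1 :: complex)"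
  shows "(\<lambda>w. sch (x w) n) \<in> O[F](\<lambda>_. 1 :: complex)"
  using assms
proof (induction n rule: less_induct)
  case (less n)
  show ?case
  proof (cases n)
    case (Suc k)
    have "(\<lambda>w. \<Sum>i=0..k. of_nat (Suc (k - i)) * x w (Suc (k - i)) * sch (x w) i) \<in> O[F](\<lambda>_. 1)"
    proof (rule big_sum_in_bigo)
      fix i assume "i \<in> {0..k}"
      then have "(\<lambda>w. x w (Suc (k - i))) \<in> O[F](\<lambda>_. 1)" "(\<lambda>w. sch (x w) i) \<in> O[F](\<lambda>_. 1)"
        using less.prems[of "Suc (k - i)"] less.IH[of i] less.prems Suc by auto
      from landau_o.big.mult[OF this]
      show "(\<lambda>w. of_nat (Suc (k - i)) * x w (Suc (k - i)) * sch (x w) i) \<in> O[F](\<lambda>_. 1)"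
        by (simp add: mult.assoc del: of_nat_Suc)
    qed
    then show ?thesis unfolding Suc sch_rec[symmetric] by (simp only: of_nat_mult_bigo_iff)
  qed simp
qed

lemma bigo_mult_1:
  fixes f g h :: "'w \<Rightarrow> complex"
  shows "f \<in> O[F](g) \<Longrightarrow> h \<in> O[F](\<lambda>_. 1 :: complex) \<Longrightarrow> (\<lambda>w. f w * h w) \<in> O[F](g)"
  using landau_o.big.mult[of f F g h "\<lambda>_. 1"] by simp

lemma bigo_1_mult:
  fixes f g h :: "'w \<Rightarrow> complex"
  shows "f \<in> O[F](\<lambda>_. 1 :: complex) \<Longrightarrow> h \<in> O[F](g) \<Longrightarrow> (\<lambda>w. f w * h w) \<in> O[F](g)"
  using landau_o.big.mult[of f F "\<lambda>_. 1" h g] by simp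

lemma sch_bigo:
  fixes x :: "'w \<Rightarrow> nat \<Rightarrow> complex" and g :: "'w \<Rightarrow> complex"
  assumes g: "g \<in> O[F](\<lambda>_. 1 :: complex)"
  assumes "\<And>r. 1 \<le> r \<Longrightarrow> r \<le> n \<Longrightarrow> (\<lambda>w. x w r) \<in> O[F](g)" "1 \<le> n"
  shows "(\<lambda>w. sch (x w) n) \<in> O[F](g)"
proof -
  obtain k where Suc: "n = Suc k" using assms(3) by (cases n) auto
  have "(\<lambda>w. \<Sum>i=0..k. of_nat (Suc (k - i)) * x w (Suc (k - i)) * sch (x w) i) \<in> O[F](g)"
  proof (rule big_sum_in_bigo)
    fix i assume i: "i \<in> {0..k}"
    have "(\<lambda>w. sch (x w) i) \<in> O[F](\<lambda>_. 1)"
      using assms(2) Suc i by (intro sch_bigo_1 landau_o.big_trans[OF _ g]) auto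
    moreover have "(\<lambda>w. x w (Suc (k - i))) \<in> O[F](g)" using assms(2) Suc i by auto
    ultimately have "(\<lambda>w. x w (Suc (k - i)) * sch (x w) i) \<in> O[F](g)" by (intro bigo_mult_1)
    then show "(\<lambda>w. of_nat (Suc (k - i)) * x w (Suc (k - i)) * sch (x w) i) \<in> O[F](g)"
      by (simp add: mult.assoc del: of_nat_Suc)
  qed
  then show ?thesis unfolding Suc sch_rec[symmetric] by (simp only: of_nat_mult_bigo_iff)
qed

lemma sch_perturb:
  fixes x y :: "'w \<Rightarrow> nat \<Rightarrow> complex" and g :: "'w \<Rightarrow> complex"
  assumes g: "g \<in> O[F](\<lambda>_. 1 :: complex)"
  assumes y: "\<And>r. 1 \<le> r \<Longrightarrow> r \<le> n \<Longrightarrow> (\<lambda>w. y w r) \<in> O[F](\<lambda>_. 1 :: complex)"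
  assumes h: "\<And>r. 1 \<le> r \<Longrightarrow> r \<le> n \<Longrightarrow> (\<lambda>w. x w r - y w r) \<in> O[F](g)"
  shows "(\<lambda>w. sch (x w) n - sch (y w) n) \<in> O[F](g)"
proof -
  have "sch (x w) n - sch (y w) n =
      (\<Sum>j=1..n. sch (\<lambda>r. x w r - y w r) j * sch (y w) (n - j))" for w
    using sch_add[of "\<lambda>r. x w r - y w r" "y w" n] by (simp add: sum.atLeast_Suc_atMost)
  moreover have "(\<lambda>w. \<Sum>j=1..n. sch (\<lambda>r. x w r - y w r) j * sch (y w) (n - j)) \<in> O[F](g)"
    by (intro big_sum_in_bigo bigo_mult_1 sch_bigo sch_bigo_1) (use assms in auto)
  ultimately show ?thesis by simp
qed

text \<open>In the weighted variables only the first two entries carry first-order perturbations.\<close>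

lemma sch_expand:
  fixes x y :: "'w \<Rightarrow> nat \<Rightarrow> complex" and g :: "'w \<Rightarrow> complex"
  assumes g: "g \<in> O[F](\<lambda>_. 1 :: complex)"
  assumes y: "\<And>r. 1 \<le> r \<Longrightarrow> r \<le> n \<Longrightarrow> (\<lambda>w. y w r) \<in> O[F](\<lambda>_. 1 :: complex)"
  assumes h1: "\<And>r. r \<in> {1, 2} \<Longrightarrow> (\<lambda>w. x w r - y w r) \<in> O[F](g)"
  assumes h3: "\<And>r. 3 \<le> r \<Longrightarrow> r \<le> n \<Longrightarrow> (\<lambda>w. x w r - y w r) \<in> O[F](\<lambda>w. g w ^ 2)"
  shows "(\<lambda>w. sch (x w) n - sch (y w) n
      - (x w 1 - y w 1) * (if 1 \<le> n then sch (y w) (n - 1) else 0)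
      - (x w 2 - y w 2) * (if 2 \<le> n then sch (y w) (n - 2) else 0)) \<in> O[F](\<lambda>w. g w ^ 2)"
    (is "?L \<in> _")
proof -
  define h where "h w r = x w r - y w r" for w r
  have g2: "(\<lambda>w. g w ^ 2) \<in> O[F](g)"
    using bigo_mult_1[OF _ g, of g] by (simp add: power2_eq_square)
  have g21: "(\<lambda>w. g w ^ 2) \<in> O[F](\<lambda>_. 1 :: complex)"
    using landau_o.big_trans[OF g2 g] .
  have hg: "(\<lambda>w. h w r) \<in> O[F](g)" if "1 \<le> r" "r \<le> n" for r
  proof (cases "r \<in> {1, 2}")
    case True
    then show ?thesis using h1 by (simp add: h_def)
  next
    case False
    then have "3 \<le> r" using that by auto
    from landau_o.big_trans[OF h3[OF this that(2)] g2] show ?thesis by (simp add: h_def)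
  qed
  have hS: "(\<lambda>w. sch (h w) j) \<in> O[F](g)" if "1 \<le> j" "j \<le> n" for j
    using that by (intro sch_bigo[OF g] hg) auto
  have hS0: "(\<lambda>w. sch (h w) j) \<in> O[F](\<lambda>_. 1 :: complex)" if "j \<le> n" for j
    using that by (intro sch_bigo_1 landau_o.big_trans[OF hg g]) auto
  \<comment> \<open>In the recursion for degree \<open>j\<close> the summand \<open>i = 0\<close> is
    the entry \<open>h w j\<close> itself, which is of second order as \<open>j \<ge> 3\<close>;
    every other summand has two first-order factors.\<close>
  have hS3: "(\<lambda>w. sch (h w) j) \<in> O[F](\<lambda>w. g w ^ 2)" if j: "3 \<le> j" "j \<le> n" for j
  proof -
    obtain k where Suc: "j = Suc k" using j by (cases j) auto
    have "(\<lambda>w. \<Sum>i=0..k. of_nat (Suc (k - i)) * h w (Suc (k - i)) * sch (h w) i) \<in> O[F](\<lambda>w. g w ^ 2)"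
    proof (rule big_sum_in_bigo)
      fix i assume i: "i \<in> {0..k}"
      have "(\<lambda>w. h w (Suc (k - i)) * sch (h w) i) \<in> O[F](\<lambda>w. g w ^ 2)"
      proof (cases "i = 0")
        case True
        then show ?thesis using h3[of j] j Suc by (simp add: h_def)
      next
        case False
        then have "(\<lambda>w. h w (Suc (k - i))) \<in> O[F](g)" "(\<lambda>w. sch (h w) i) \<in> O[F](g)"
          using i j Suc by (intro hg hS; simp)+
        from landau_o.big.mult[OF this] show ?thesis by (simp add: power2_eq_square)
      qed
      then show "(\<lambda>w. of_nat (Suc (k - i)) * h w (Suc (k - i)) * sch (h w) i) \<in> O[F](\<lambda>w. g w ^ 2)"
        by (simp add: mult.assoc del: of_nat_Suc)
    qed
    then show ?thesis unfolding Suc sch_rec[symmetric] by (simp only: of_nat_mult_bigo_iff)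
  qed
  define t where "t w j = sch (h w) j * sch (y w) (n - j)" for w j
  have decomp: "sch (x w) n = (\<Sum>j=0..n. t w j)" for w
    using sch_add[of "h w" "y w" n] by (simp add: h_def t_def)
  have ty: "(\<lambda>w. sch (y w) (n - j)) \<in> O[F](\<lambda>_. 1 :: complex)" for j
    by (intro sch_bigo_1 y) auto
  \<comment> \<open>The degrees up to 2 leave nothing but the square in
    \<open>sch_2\<close>.\<close>
  have "?L w = (if 2 \<le> n then (h w 1)\<^sup>2 / 2 * sch (y w) (n - 2) else 0) + (\<Sum>j=3..n. t w j)" for w
  proof -
    consider "n = 0" | "n = 1" | "2 \<le> n" by linarith
    then show ?thesis
    proof cases
      case 3
      then have "{0..n} = insert 0 (insert 1 (insert 2 {3..n}))" by auto
      then have "(\<Sum>j=0..n. t w j) = t w 0 + (t w 1 + (t w 2 + (\<Sum>j=3..n. t w j)))" by simp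
      then show ?thesis unfolding decomp using 3
        by (simp add: t_def sch_1 sch_2 h_def algebra_simps)
    qed (simp_all add: decomp t_def sch_1 h_def)
  qed
  moreover have "(\<lambda>w. if 2 \<le> n then (h w 1)\<^sup>2 / 2 * sch (y w) (n - 2) else 0) \<in> O[F](\<lambda>w. g w ^ 2)"
  proof (cases "2 \<le> n")
    case True
    have "(\<lambda>w. (h w 1)\<^sup>2) \<in> O[F](\<lambda>w. g w ^ 2)"
      using hg[of 1] True by (intro landau_o.big_power) auto
    with ty[of 2] True show ?thesis by (simp add: bigo_mult_1)
  qed simp
  moreover have "(\<lambda>w. \<Sum>j=3..n. t w j) \<in> O[F](\<lambda>w. g w ^ 2)"
    unfolding t_def by (intro big_sum_in_bigo bigo_mult_1 hS3 ty) auto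
  ultimately show ?thesis using sum_in_bigo(1) by (simp only:) blast
qed

section \<open>Rogue wave determinants attached to finite sets of row indices\<close>

text \<open>The variables depend on the row index because the internal parameters of a rogue wave
  depend on the block; the multiple of \<open>s\<close> depends on the column, as it does on the
  summation index \<open>v\<close> of \<open>m_elem\<close>.\<close>

definition Dm :: "nat set \<Rightarrow> nat set \<Rightarrow> (nat \<Rightarrow> nat \<Rightarrow> complex) \<Rightarrow> (nat \<Rightarrow> complex) \<Rightarrow> complex" where
  "Dm X V x s = dt (card X) (\<lambda>i j.
     schur (\<lambda>r. x (en X i) r + of_nat (en V j) * s r) (int (en X i) - int (en V j)))"

definition mm :: "complex \<Rightarrow> (nat \<Rightarrow> complex) \<Rightarrow> (nat \<Rightarrow> complex) \<Rightarrow> (nat \<Rightarrow> complex) \<Rightarrow>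
    (nat \<Rightarrow> complex) \<Rightarrow> nat \<Rightarrow> nat \<Rightarrow> complex" where
  "mm hh s s' x y n n' = (\<Sum>v=0..min n n'. hh ^ v
      * schur (\<lambda>r. x r + of_nat v * s r) (int n - int v)
      * schur (\<lambda>r. y r + of_nat v * s' r) (int n' - int v))"

text \<open>The sequences \<open>x\<close> and \<open>y\<close> are independent: in the numerator of
  a wave the shift by \<open>theta\<close> enters them with opposite signs, so they are not
  conjugate to each other.\<close>

definition tauS :: "nat set \<Rightarrow> complex \<Rightarrow> (nat \<Rightarrow> complex) \<Rightarrow> (nat \<Rightarrow> complex) \<Rightarrow>
    (nat \<Rightarrow> nat \<Rightarrow> complex) \<Rightarrow> (nat \<Rightarrow> nat \<Rightarrow> complex) \<Rightarrow> complex" where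
  "tauS X hh s s' x y =
     dt (card X) (\<lambda>u w. mm hh s s' (x (en X u)) (y (en X w)) (en X u) (en X w))"

lemma schur_neg: "n < v \<Longrightarrow> schur x (int n - int v) = 0"
  by (simp add: schur_def)

lemma schur_nonzeroD: "schur x (int n - int v) \<noteq> 0 \<Longrightarrow> v \<le> n"
  by (metis not_le schur_neg)

lemma schur_zero: "schur x 0 = 1"
  by (simp add: schur_def)

text \<open>Terms beyond \<open>min n n'\<close> vanish, so all entries can be summed over one
  common index set, as the Cauchy-Binet formula requires.\<close>

lemma mm_extend:
  assumes "n \<le> L"
  shows "mm hh s s' x y n n' = (\<Sum>v\<in>{0..L}. schur (\<lambda>r. x r + of_nat v * s r) (int n - int v)
      * (hh ^ v * schur (\<lambda>r. y r + of_nat v * s' r) (int n' - int v)))"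
proof -
  have "mm hh s s' x y n n' = (\<Sum>v=0..min n n'. schur (\<lambda>r. x r + of_nat v * s r) (int n - int v)
      * (hh ^ v * schur (\<lambda>r. y r + of_nat v * s' r) (int n' - int v)))"
    unfolding mm_def by (intro sum.cong) (simp_all only: mult_ac)
  also have "\<dots> = (\<Sum>v\<in>{0..L}. schur (\<lambda>r. x r + of_nat v * s r) (int n - int v)
      * (hh ^ v * schur (\<lambda>r. y r + of_nat v * s' r) (int n' - int v)))"
  proof (rule sum.mono_neutral_left)
    show "\<forall>v\<in>{0..L} - {0..min n n'}. schur (\<lambda>r. x r + of_nat v * s r) (int n - int v)
      * (hh ^ v * schur (\<lambda>r. y r + of_nat v * s' r) (int n' - int v)) = 0"
      using schur_neg by (auto simp: min_def split: if_splits)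
  qed (use assms in auto)
  finally show ?thesis .
qed

lemma tauS_expand:
  assumes "X \<subseteq> {0..L}"
  shows "tauS X hh s s' x y =
    (\<Sum>V | V \<subseteq> {0..L} \<and> card V = card X. hh ^ (\<Sum>V) * Dm X V x s * Dm X V y s')"
proof -
  have finX: "finite X" using assms finite_subset by blast
  let ?A = "\<lambda>i v. schur (\<lambda>r. x (en X i) r + of_nat v * s r) (int (en X i) - int v)"
  let ?B = "\<lambda>v j. hh ^ v * schur (\<lambda>r. y (en X j) r + of_nat v * s' r) (int (en X j) - int v)"
  have "tauS X hh s s' x y = dt (card X) (\<lambda>i j. \<Sum>v\<in>{0..L}. ?A i v * ?B v j)"
    unfolding tauS_def
    by (intro dt_cong mm_extend) (use en_in[OF finX] assms in force)
  also have "\<dots> = (\<Sum>V | V \<subseteq> {0..L} \<and> card V = card X.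
      dt (card X) (\<lambda>i j. ?A i (en V j)) * dt (card X) (\<lambda>i j. ?B (en V i) j))"
    by (rule Cauchy_Binet) simp
  also have "\<dots> = (\<Sum>V | V \<subseteq> {0..L} \<and> card V = card X. hh ^ (\<Sum>V) * Dm X V x s * Dm X V y s')"
  proof (rule sum.cong[OF refl])
    fix V assume "V \<in> {V. V \<subseteq> {0..L} \<and> card V = card X}"
    then have V: "V \<subseteq> {0..L}" "card V = card X" and finV: "finite V"
      using finite_subset by auto
    have "dt (card X) (\<lambda>i j. ?B (en V i) j) =
        dt (card X) (\<lambda>i j. hh ^ en V i *
          (schur (\<lambda>r. y (en X j) r + of_nat (en V i) * s' r) (int (en X j) - int (en V i))) * 1)"
      by simp
    also have "\<dots> = (\<Prod>i<card X. hh ^ en V i) *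
        dt (card X) (\<lambda>i j. schur (\<lambda>r. y (en X j) r + of_nat (en V i) * s' r)
          (int (en X j) - int (en V i))) * (\<Prod>i<card X. 1)"
      by (rule dt_scale)
    also have "(\<Prod>i<card X. hh ^ en V i) = hh ^ (\<Sum>V)"
      using prod_en[OF finV, of "\<lambda>v. hh ^ v"] V(2) by (simp add: power_sum)
    also have "dt (card X) (\<lambda>i j. schur (\<lambda>r. y (en X j) r + of_nat (en V i) * s' r)
          (int (en X j) - int (en V i))) = Dm X V y s'"
      unfolding Dm_def by (rule dt_transpose)
    finally show "dt (card X) (\<lambda>i j. ?A i (en V j)) * dt (card X) (\<lambda>i j. ?B (en V i) j) =
        hh ^ (\<Sum>V) * Dm X V x s * Dm X V y s'"
      by (simp add: Dm_def)
  qed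
  finally show ?thesis .
qed

lemma schur_cnj: "schur (\<lambda>r. cnj (x r)) i = cnj (schur x i)"
proof (cases "i < 0")
  case False
  then obtain n where "i = int n" by (metis nonneg_int_cases not_less)
  then show ?thesis by (simp only: schur_nat sch_cnj)
qed (simp add: schur_def)

lemma Dm_cnj: "Dm X V (\<lambda>n r. cnj (x n r)) (\<lambda>r. cnj (s r)) = cnj (Dm X V x s)"
  unfolding Dm_def dt_cnj[symmetric] schur_cnj[symmetric] by simp

text \<open>Each minor meets its own conjugate. This positivity, with the minor 1 of
  \<open>Dm_self\<close>, keeps denominators away from zero.\<close>

lemma tauS_cnj:
  assumes "X \<subseteq> {0..L}"
  shows "tauS X (of_real h) s (\<lambda>r. cnj (s r)) x (\<lambda>n r. cnj (x n r)) =
    of_real (\<Sum>V | V \<subseteq> {0..L} \<and> card V = card X. h ^ (\<Sum>V) * (cmod (Dm X V x s))\<^sup>2)"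
  unfolding tauS_expand[OF assms] Dm_cnj of_real_sum
  by (intro sum.cong refl) (simp add: mult.assoc complex_norm_square[symmetric])

lemma Dm_self:
  assumes "finite X"
  shows "Dm X X x s = 1"
  unfolding Dm_def
proof (rule dt_unitriangular[where g = "en X"])
  show "inj_on (en X) {0..<card X}" using en_inj[OF assms] .
next
  fix i j assume "schur (\<lambda>r. x (en X i) r + of_nat (en X j) * s r) (int (en X i) - int (en X j)) \<noteq> 0"
  then show "en X j \<le> en X i" by (metis not_le schur_neg)
qed (simp add: schur_zero)

text \<open>Splitting off \<open>c\<close> multiplies the matrix from the left by the Schur
  polynomials of \<open>c\<close>. By \<open>sch_support\<close> these only connect rows of
  \<open>X\<close>, and the factor is unitriangular. So entries of the variables whose position can
  be subtracted inside \<open>X\<close> have no influence on any minor.\<close>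

lemma Dm_closed:
  assumes fin: "finite X"
  assumes cl: "\<And>n n' r. n \<in> X \<Longrightarrow> n' \<in> X \<Longrightarrow> 1 \<le> r \<Longrightarrow> r \<le> n' \<Longrightarrow> c n r \<noteq> 0 \<Longrightarrow> n' - r \<in> X"
  shows "Dm X V (\<lambda>n r. c n r + x r) s = Dm X V (\<lambda>_. x) s"
proof -
  let ?L = "\<lambda>i u. if en X u \<le> en X i then sch (c (en X i)) (en X i - en X u) else 0"
  have key: "schur (\<lambda>r. c n r + x r + of_nat v * s r) (int n - int v) =
      (\<Sum>n'\<in>X. (if n' \<le> n then sch (c n) (n - n') else 0)
        * schur (\<lambda>r. x r + of_nat v * s r) (int n' - int v))" if n: "n \<in> X" for n v
  proof -
    let ?z = "\<lambda>r. x r + of_nat v * s r"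
    let ?g = "\<lambda>n'. (if n' \<le> n then sch (c n) (n - n') else 0) * schur ?z (int n' - int v)"
    have "(\<Sum>n'\<in>X. ?g n') = (\<Sum>n'\<in>X \<inter> {v..n}. ?g n')"
      using fin by (intro sum.mono_neutral_right) (auto dest: schur_nonzeroD)
    also have "\<dots> = (\<Sum>n'\<in>{v..n}. ?g n')"
    proof (rule sum.mono_neutral_left)
      show "\<forall>n'\<in>{v..n} - X \<inter> {v..n}. ?g n' = 0"
      proof
        fix n' assume n': "n' \<in> {v..n} - X \<inter> {v..n}"
        have "sch (c n) (n - n') = 0"
        proof (rule ccontr)
          assume "sch (c n) (n - n') \<noteq> 0"
          from sch_support[of X "c n", OF _ n _ this] cl[OF n] have "n - (n - n') \<in> X" by auto
          with n' show False by auto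
        qed
        then show "?g n' = 0" by simp
      qed
    qed auto
    also have "\<dots> = schur (\<lambda>r. c n r + x r + of_nat v * s r) (int n - int v)"
    proof (cases "v \<le> n")
      case True
      have "(\<Sum>n'\<in>{v..n}. ?g n') = (\<Sum>j\<in>{0..n - v}. sch (c n) j * sch ?z (n - v - j))"
        by (rule sum.reindex_bij_witness[of _ "\<lambda>j. n - j" "\<lambda>n'. n - n'"])
           (use True in \<open>auto simp: schur_diff intro!: arg_cong2[of _ _ _ _ "(*)"] arg_cong[of _ _ "sch _"]\<close>)
      also have "\<dots> = sch (\<lambda>r. c n r + ?z r) (n - v)" by (rule sch_add[symmetric])
      finally show ?thesis using True by (simp add: schur_diff add.assoc)
    qed (simp add: schur_neg)
    finally show ?thesis by simp
  qed
  have "Dm X V (\<lambda>n r. c n r + x r) s =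
      dt (card X) (\<lambda>i j. \<Sum>u<card X. ?L i u *
        schur (\<lambda>r. x r + of_nat (en V j) * s r) (int (en X u) - int (en V j)))"
    unfolding Dm_def
    by (intro dt_cong)
       (simp only: key[OF en_in[OF fin]] sum_en[OF fin, symmetric])
  also have "\<dots> = dt (card X) ?L * Dm X V (\<lambda>_. x) s"
    unfolding Dm_def by (rule dt_mult)
  also have "dt (card X) ?L = 1"
    by (rule dt_unitriangular[OF en_inj[OF fin]]) (auto split: if_splits)
  finally show ?thesis by simp
qed

section \<open>Deletion of an initial interval of rows\<close>

lemma dt_schur_complement:
  fixes f :: "nat \<Rightarrow> nat \<Rightarrow> complex"
  assumes "f 0 0 = 1"
  shows "dt (Suc n) f = dt n (\<lambda>i j. f (Suc i) (Suc j) - f (Suc i) 0 * f 0 (Suc j))"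
proof -
  let ?g = "\<lambda>i j. f i j - f i 0 * f 0 j"
  define L where "L i u = (if u = 0 then f i 0 else if i = u then 1 else 0)" for i u :: nat
  define U where "U u j = (if u = 0 then f 0 j else ?g u j)" for u j :: nat
  have "f i j = (\<Sum>u<Suc n. L i u * U u j)" if "i < Suc n" for i j
  proof -
    have "(\<Sum>u<Suc n. L i u * U u j) = L i 0 * U 0 j + (\<Sum>u<n. L i (Suc u) * U (Suc u) j)"
      by (rule sum.lessThan_Suc_shift)
    also have "(\<Sum>u<n. L i (Suc u) * U (Suc u) j) = (if i = 0 then 0 else ?g i j)"
    proof (cases i)
      case (Suc i')
      then have "(\<Sum>u<n. L i (Suc u) * U (Suc u) j) = (\<Sum>u<n. if u = i' then ?g i j else 0)"
        by (intro sum.cong) (auto simp: L_def U_def)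
      then show ?thesis using that Suc by simp
    qed (simp add: L_def)
    finally show ?thesis using assms by (simp add: L_def U_def)
  qed
  then have "dt (Suc n) f = dt (Suc n) (\<lambda>i j. \<Sum>u<Suc n. L i u * U u j)"
    by (intro dt_cong)
  also have "\<dots> = dt (Suc n) L * dt (Suc n) U" by (rule dt_mult)
  also have "dt (Suc n) L = 1"
    by (rule dt_unitriangular[where g = "\<lambda>i. i"]) (auto simp: L_def assms split: if_splits)
  also have "dt (Suc n) U = dt n (\<lambda>i j. ?g (Suc i) (Suc j))"
  proof -
    let ?M = "Matrix.mat (Suc n) (Suc n) (\<lambda>(i, j). U i j)"
    have "Determinant.det ?M = (\<Sum>i<Suc n. ?M $$ (i, 0) * cofactor ?M i 0)"
      by (rule laplace_expansion_column) auto
    also have "\<dots> = (\<Sum>i<Suc n. if i = 0 then cofactor ?M 0 0 else 0)"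
      by (intro sum.cong) (auto simp: U_def assms)
    also have "\<dots> = Determinant.det (mat_delete ?M 0 0)" by (simp add: cofactor_def)
    also have "mat_delete ?M 0 0 = Matrix.mat n n (\<lambda>(i, j). ?g (Suc i) (Suc j))"
      by (auto simp: mat_delete_def mat_eq_iff U_def)
    finally show ?thesis by (simp add: dt_def)
  qed
  finally show ?thesis by simp
qed

lemma en_insert_0_Suc:
  assumes "finite X" "i < card X"
  shows "en (insert 0 (Suc ` X)) 0 = 0" "en (insert 0 (Suc ` X)) (Suc i) = Suc (en X i)"
proof -
  let ?l = "0 # map Suc (sorted_list_of_set X)"
  have "sorted (map Suc l)" if "sorted l" for l using that by (induction l) auto
  then have "sorted ?l" "distinct ?l" by (auto simp: distinct_map)
  then have "sorted_list_of_set (set ?l) = ?l" by (rule sorted_list_of_set.idem_if_sorted_distinct)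
  then have "sorted_list_of_set (insert 0 (Suc ` X)) = ?l" using assms(1) by simp
  then show "en (insert 0 (Suc ` X)) 0 = 0" "en (insert 0 (Suc ` X)) (Suc i) = Suc (en X i)"
    using assms by (simp_all add: en_def)
qed

lemma en_insert_0: "finite X \<Longrightarrow> en (insert 0 X) 0 = 0"
  by (simp add: en_def sorted_list_of_set_nonempty)
     (metis Min_eqI finite_insert insertI1 le0)

text \<open>A row of index \<open>0\<close> is \<open>(1, 0, 0, \<dots>)\<close> in the expansion over column sets, and deleting it
  shifts the variables by \<open>s\<close>.\<close>

lemma tauS_shift:
  assumes fin: "finite X"
  shows "tauS (insert 0 (Suc ` X)) hh s s' (\<lambda>_. x) (\<lambda>_. y) =
    hh ^ card X * tauS X hh s s' (\<lambda>_ r. x r + s r) (\<lambda>_ r. y r + s' r)"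
proof -
  let ?Y = "insert 0 (Suc ` X)"
  have card: "card ?Y = Suc (card X)" using fin by (simp add: card_image)
  have e0: "en ?Y 0 = 0" using fin by (simp add: en_insert_0)
  let ?f = "\<lambda>n n'. mm hh s s' x y n n'"
  \<comment> \<open>Elimination with row and column 0 cancels exactly the term \<open>v = 0\<close>.
    In the others \<open>v\<close> becomes \<open>v + 1\<close>, which leaves one factor
    \<open>hh\<close> and turns \<open>x + (v + 1) * s\<close> into
    \<open>(x + s) + v * s\<close>.\<close>
  have step: "?f (Suc n) (Suc n') - ?f (Suc n) 0 * ?f 0 (Suc n') =
      hh * mm hh s s' (\<lambda>r. x r + s r) (\<lambda>r. y r + s' r) n n'" for n n'
  proof -
    let ?t = "\<lambda>v. hh ^ v * schur (\<lambda>r. x r + of_nat v * s r) (int (Suc n) - int v)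
      * schur (\<lambda>r. y r + of_nat v * s' r) (int (Suc n') - int v)"
    have "?f (Suc n) (Suc n') = ?t 0 + (\<Sum>v=Suc 0..Suc (min n n'). ?t v)"
      unfolding mm_def by (subst sum.atLeast_Suc_atMost) simp_all
    moreover have "?f (Suc n) 0 * ?f 0 (Suc n') = ?t 0"
      by (simp add: mm_def schur_def)
    moreover have "(\<Sum>v=Suc 0..Suc (min n n'). ?t v) = (\<Sum>v=0..min n n'. ?t (Suc v))"
      by (rule sum.shift_bounds_cl_Suc_ivl)
    moreover have "\<dots> = hh * mm hh s s' (\<lambda>r. x r + s r) (\<lambda>r. y r + s' r) n n'"
      unfolding mm_def sum_distrib_left by (intro sum.cong) (simp_all add: algebra_simps)
    ultimately show ?thesis by simp
  qed
  have "tauS ?Y hh s s' (\<lambda>_. x) (\<lambda>_. y) = dt (Suc (card X)) (\<lambda>u w. ?f (en ?Y u) (en ?Y w))"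
    by (simp add: tauS_def card)
  also have "\<dots> = dt (card X) (\<lambda>i j. ?f (en ?Y (Suc i)) (en ?Y (Suc j))
      - ?f (en ?Y (Suc i)) (en ?Y 0) * ?f (en ?Y 0) (en ?Y (Suc j)))"
    by (rule dt_schur_complement) (simp add: e0 mm_def schur_def)
  also have "\<dots> = dt (card X) (\<lambda>i j. hh *
      mm hh s s' (\<lambda>r. x r + s r) (\<lambda>r. y r + s' r) (en X i) (en X j) * 1)"
    by (intro dt_cong) (simp only: e0 en_insert_0_Suc(2)[OF fin] step mult_1_right)
  also have "\<dots> = hh ^ card X * tauS X hh s s' (\<lambda>_ r. x r + s r) (\<lambda>_ r. y r + s' r)"
    unfolding dt_scale by (simp add: tauS_def)
  finally show ?thesis .
qed

text \<open>The exponent \<open>e\<close> does not depend on \<open>x\<close> and \<open>y\<close>,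
  so the factor cancels in a quotient of two determinants over the same row set.\<close>

lemma tauS_shift_iter:
  assumes "finite X" "{0..<j} \<subseteq> X"
  shows "\<exists>e. \<forall>x y. tauS X hh s s' (\<lambda>_. x) (\<lambda>_. y) =
    hh ^ e * tauS {n. n + j \<in> X} hh s s' (\<lambda>_ r. x r + of_nat j * s r) (\<lambda>_ r. y r + of_nat j * s' r)"
  using assms
proof (induction j arbitrary: X)
  case 0
  then show ?case by (auto intro!: exI[of _ 0])
next
  case (Suc j)
  define X' where "X' = {n. Suc n \<in> X}"
  have X: "X = insert 0 (Suc ` X')"
  proof (intro equalityI subsetI)
    fix n assume "n \<in> X"
    then show "n \<in> insert 0 (Suc ` X')" by (cases n) (auto simp: X'_def)
  qed (use Suc.prems in \<open>auto simp: X'_def\<close>)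
  have fin: "finite X'"
    unfolding X'_def using Suc.prems(1) by (intro finite_vimageI[of X Suc, unfolded vimage_def]) auto
  have "{0..<j} \<subseteq> X'" using Suc.prems(2) by (auto simp: X'_def)
  from Suc.IH[OF fin this] obtain e where e: "\<And>x y. tauS X' hh s s' (\<lambda>_. x) (\<lambda>_. y) =
    hh ^ e * tauS {n. n + j \<in> X'} hh s s' (\<lambda>_ r. x r + of_nat j * s r) (\<lambda>_ r. y r + of_nat j * s' r)"
    by blast
  have "tauS X hh s s' (\<lambda>_. x) (\<lambda>_. y) = hh ^ (card X' + e) *
      tauS {n. n + Suc j \<in> X} hh s s' (\<lambda>_ r. x r + of_nat (Suc j) * s r)
        (\<lambda>_ r. y r + of_nat (Suc j) * s' r)" for x y
  proof -
    have "{n. n + j \<in> X'} = {n. n + Suc j \<in> X}" by (simp add: X'_def)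
    then show ?thesis
      by (subst X) (simp add: tauS_shift[OF fin] e power_add algebra_simps)
  qed
  then show ?case by blast
qed

text \<open>The Schur polynomial of degree \<open>n - r\<close> in the sequence whose only nonzero
  entry is \<open>a\<close> at position \<open>m\<close>, compare \<open>sch_single\<close>.\<close>

definition Cc :: "nat \<Rightarrow> complex \<Rightarrow> nat \<Rightarrow> nat \<Rightarrow> complex" where
  "Cc m a n r = (if r \<le> n \<and> m dvd n - r then a ^ ((n - r) div m) / fact ((n - r) div m) else 0)"

definition CW :: "nat \<Rightarrow> nat set \<Rightarrow> nat set \<Rightarrow> complex" where
  "CW m X W = dt (card X) (\<lambda>i j. Cc m 1 (en X i) (en W j))"

lemma Cc_scale:
  assumes "b ^ m = a" "m > 0"
  shows "Cc m a n r * b ^ r = b ^ n * Cc m 1 n r"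
proof (cases "r \<le> n \<and> m dvd n - r")
  case True
  then obtain q where q: "n - r = m * q" by blast
  then have n: "n = m * q + r" using True by linarith
  have "a ^ q * b ^ r = b ^ n" using assms(1) by (simp add: n power_add power_mult)
  then show ?thesis using True q assms(2) by (simp add: Cc_def)
qed (auto simp: Cc_def)

lemma schur_remove_entry:
  assumes "m > 0" "n \<le> L"
  shows "schur (\<lambda>r. x r + (if r = m then a else 0) + of_nat v * s r) (int n - int v) =
    (\<Sum>q\<in>{0..L}. Cc m a n q * schur (\<lambda>r. x r + of_nat v * s r) (int q - int v))"
proof -
  let ?z = "\<lambda>r. x r + of_nat v * s r"
  have "(\<Sum>q\<in>{0..L}. Cc m a n q * schur ?z (int q - int v)) =
      (\<Sum>q\<in>{v..n}. Cc m a n q * schur ?z (int q - int v))"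
    by (rule sum.mono_neutral_right) (use assms in \<open>auto simp: Cc_def schur_neg\<close>)
  also have "\<dots> = schur (\<lambda>r. x r + (if r = m then a else 0) + of_nat v * s r) (int n - int v)"
  proof (cases "v \<le> n")
    case True
    have "(\<Sum>q\<in>{v..n}. Cc m a n q * schur ?z (int q - int v)) =
        (\<Sum>j\<in>{0..n - v}. sch (\<lambda>r. if r = m then a else 0) j * sch ?z (n - v - j))"
      by (rule sum.reindex_bij_witness[of _ "\<lambda>j. n - j" "\<lambda>n'. n - n'"])
         (use True in \<open>auto simp: schur_diff sch_single[OF assms(1)] Cc_def algebra_simps\<close>)
    also have "\<dots> = sch (\<lambda>r. (if r = m then a else 0) + ?z r) (n - v)" by (rule sch_add[symmetric])
    also have "(\<lambda>r. (if r = m then a else 0) + ?z r) =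
        (\<lambda>r. x r + (if r = m then a else 0) + of_nat v * s r)" by auto
    finally show ?thesis using True by (simp add: schur_diff)
  qed (simp add: schur_neg)
  finally show ?thesis by simp
qed

text \<open>Removing the large entry \<open>a\<close> at position \<open>m\<close> turns the row set \<open>X\<close> into the row sets \<open>W\<close>
  that are obtained from it by lowering elements by multiples of \<open>m\<close>.\<close>

lemma Dm_remove_entry:
  assumes m: "m > 0" and X: "X \<subseteq> {0..L}" and b: "b ^ m = a" "b \<noteq> 0"
  shows "Dm X V (\<lambda>_ r. x r + (if r = m then a else 0)) s =
    (\<Sum>W | W \<subseteq> {0..L} \<and> card W = card X.
      b ^ (\<Sum>X) / b ^ (\<Sum>W) * CW m X W * Dm W V (\<lambda>_. x) s)"
proof -
  have finX: "finite X" using X finite_subset by blast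
  have "Dm X V (\<lambda>_ r. x r + (if r = m then a else 0)) s = dt (card X) (\<lambda>i j. \<Sum>q\<in>{0..L}.
      Cc m a (en X i) q * schur (\<lambda>r. x r + of_nat (en V j) * s r) (int q - int (en V j)))"
    unfolding Dm_def by (intro dt_cong schur_remove_entry m) (use en_in[OF finX] X in force)
  also have "\<dots> = (\<Sum>W | W \<subseteq> {0..L} \<and> card W = card X.
      dt (card X) (\<lambda>i j. Cc m a (en X i) (en W j)) *
      dt (card X) (\<lambda>i j. schur (\<lambda>r. x r + of_nat (en V j) * s r) (int (en W i) - int (en V j))))"
    by (rule Cauchy_Binet) simp
  also have "\<dots> = (\<Sum>W | W \<subseteq> {0..L} \<and> card W = card X.
      b ^ (\<Sum>X) / b ^ (\<Sum>W) * CW m X W * Dm W V (\<lambda>_. x) s)"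
  proof (rule sum.cong[OF refl])
    fix W assume "W \<in> {W. W \<subseteq> {0..L} \<and> card W = card X}"
    then have W: "card W = card X" and finW: "finite W" using finite_subset by auto
    \<comment> \<open>Scaling rows and columns by powers of \<open>b\<close> reduces the minor to
      \<open>a = 1\<close>, so the size of \<open>a\<close> enters only through the exponents
      \<open>\<Sum>X\<close> and \<open>\<Sum>W\<close>.\<close>
    have "dt (card X) (\<lambda>i j. 1 * Cc m a (en X i) (en W j) * b ^ en W j) =
        dt (card X) (\<lambda>i j. b ^ en X i * Cc m 1 (en X i) (en W j) * 1)"
      by (simp add: Cc_scale[OF b(1) m])
    then have "dt (card X) (\<lambda>i j. Cc m a (en X i) (en W j)) * (\<Prod>j<card X. b ^ en W j) =
        (\<Prod>i<card X. b ^ en X i) * CW m X W"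
      unfolding dt_scale CW_def by simp
    then have "dt (card X) (\<lambda>i j. Cc m a (en X i) (en W j)) * b ^ (\<Sum>W) = b ^ (\<Sum>X) * CW m X W"
      using prod_en[OF finW, of "\<lambda>v. b ^ v"] prod_en[OF finX, of "\<lambda>v. b ^ v"] W
      by (simp add: power_sum)
    then have "dt (card X) (\<lambda>i j. Cc m a (en X i) (en W j)) = b ^ (\<Sum>X) / b ^ (\<Sum>W) * CW m X W"
      using b(2) by (simp add: field_simps)
    then show "dt (card X) (\<lambda>i j. Cc m a (en X i) (en W j)) *
      dt (card X) (\<lambda>i j. schur (\<lambda>r. x r + of_nat (en V j) * s r) (int (en W i) - int (en V j)))
      = b ^ (\<Sum>X) / b ^ (\<Sum>W) * CW m X W * Dm W V (\<lambda>_. x) s"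
      by (simp add: Dm_def W)
  qed
  finally show ?thesis .
qed

section \<open>Cores of finite sets of natural numbers\<close>

definition cls :: "nat \<Rightarrow> nat set \<Rightarrow> nat \<Rightarrow> nat set" where
  "cls m X r = {x \<in> X. x mod m = r mod m}"

text \<open>In abacus terms, \<open>X\<close> is a set of bead positions (beta-numbers of a
  partition) and all beads are pushed down on the \<open>m\<close> runners. The quotient
  \<open>n div m\<close> is the height on the runner, so comparing it with the number of beads
  replaces any sorting.\<close>

definition core :: "nat \<Rightarrow> nat set \<Rightarrow> nat set" where
  "core m X = {n. n div m < card (cls m X n)}"

lemma cls_mod [simp]: "cls m X (r mod m) = cls m X r"
  by (simp add: cls_def)

lemma finite_cls: "finite X \<Longrightarrow> finite (cls m X r)"
  by (simp add: cls_def)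

lemma finite_core:
  assumes "m > 0" "finite X"
  shows "finite (core m X)"
proof (rule finite_subset)
  show "core m X \<subseteq> {..<m * Suc (card X)}"
  proof
    fix n assume "n \<in> core m X"
    then have "n div m < Suc (card X)"
      using card_mono[OF assms(2), of "cls m X n"] by (auto simp: core_def cls_def)
    then show "n \<in> {..<m * Suc (card X)}"
      using assms(1) by (metis div_less_iff_less_mult lessThan_iff mult.commute)
  qed
qed auto

lemma cls_core:
  assumes "m > 0"
  shows "cls m (core m X) r = (\<lambda>q. r mod m + m * q) ` {..<card (cls m X r)}"
proof (intro equalityI subsetI)
  fix n assume n: "n \<in> cls m (core m X) r"
  then have "cls m X n = cls m X r" by (auto simp: cls_def)
  with n have "n div m < card (cls m X r)" "n mod m = r mod m" by (auto simp: cls_def core_def)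
  then show "n \<in> (\<lambda>q. r mod m + m * q) ` {..<card (cls m X r)}"
    using mod_mult_div_eq[of n m] by (intro image_eqI[of _ _ "n div m"]) auto
next
  fix n assume "n \<in> (\<lambda>q. r mod m + m * q) ` {..<card (cls m X r)}"
  then obtain q where q: "n = r mod m + m * q" "q < card (cls m X r)" by auto
  have mod: "n mod m = r mod m" and dv: "n div m = q" using assms by (auto simp: q(1))
  then have "cls m X n = cls m X r" by (auto simp: cls_def)
  with q mod dv show "n \<in> cls m (core m X) r" by (auto simp: cls_def core_def)
qed

lemma card_cls_core: "m > 0 \<Longrightarrow> card (cls m (core m X) r) = card (cls m X r)"
  by (simp add: cls_core card_image inj_on_def)

lemma sum_by_cls:
  fixes f :: "nat \<Rightarrow> 'a::comm_monoid_add"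
  assumes "m > 0" "finite W"
  shows "sum f W = (\<Sum>r<m. sum f (cls m W r))"
proof -
  have "(\<Sum>r<m. sum f {x \<in> W. x mod m = r}) = sum f W"
    by (rule sum.group) (use assms in auto)
  then show ?thesis by (simp add: cls_def)
qed

lemma card_core: "m > 0 \<Longrightarrow> finite X \<Longrightarrow> card (core m X) = card X"
  using sum_by_cls[of m "core m X" "\<lambda>_. 1 :: nat"] sum_by_cls[of m X "\<lambda>_. 1 :: nat"]
  by (simp add: finite_core card_cls_core)

lemma core_diff: "m > 0 \<Longrightarrow> n \<in> core m X \<Longrightarrow> m \<le> n \<Longrightarrow> n - m \<in> core m X"
proof -
  assume *: "m > 0" "n \<in> core m X" "m \<le> n"
  have "(n - m) mod m = n mod m" using *(3) by (simp add: le_mod_geq)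
  then have "cls m X (n - m) = cls m X n" by (auto simp: cls_def)
  moreover have "(n - m) div m \<le> n div m" by (simp add: div_le_mono)
  ultimately show ?thesis using * by (simp add: core_def)
qed

text \<open>Removing the maximum, which is at least \<open>card T - 1\<close>, proves all three
  claims by induction. The smallest sum and the next one identify the column sets \<open>V0\<close>
  and \<open>V1\<close> that govern the outer region.\<close>

lemma sum_lower_set:
  fixes T :: "nat set"
  assumes "finite T"
  shows "(\<Sum>{..<card T}) \<le> \<Sum>T" "\<Sum>T = \<Sum>{..<card T} \<Longrightarrow> T = {..<card T}"
    "T \<noteq> {} \<Longrightarrow> \<Sum>T = Suc (\<Sum>{..<card T}) \<Longrightarrow> T = insert (card T) {..<card T - 1}"
proof -
  have main: "\<Sum>{..<n} \<le> \<Sum>T \<and> (\<Sum>T = \<Sum>{..<n} \<longrightarrow> T = {..<n}) \<and>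
      (T \<noteq> {} \<and> \<Sum>T = Suc (\<Sum>{..<n}) \<longrightarrow> T = insert n {..<n - 1})"
    if "finite T" "card T = n" for T n
    using that
  proof (induction n arbitrary: T)
    case (Suc n)
    define M where "M = Max T"
    have MT: "M \<in> T" "\<And>x. x \<in> T \<Longrightarrow> x \<le> M"
      using Suc.prems by (auto simp: M_def intro!: Max_in)
    define T' where "T' = T - {M}"
    have T': "finite T'" "card T' = n" "T = insert M T'" "M \<notin> T'"
      using Suc.prems MT by (auto simp: T'_def)
    have sumT: "\<Sum>T = M + \<Sum>T'" unfolding T'(3) using T' by simp
    have "T \<subseteq> {0..M}" using MT by auto
    then have "card T \<le> Suc M" using card_mono[of "{0..M}" T] by simp
    then have Mn: "n \<le> M" using Suc.prems by simp
    note IH = Suc.IH[OF T'(1,2)]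
    have S: "\<Sum>{..<Suc n} = n + \<Sum>{..<n}" by (simp add: lessThan_Suc)
    have "\<Sum>T = \<Sum>{..<Suc n} \<longrightarrow> T = {..<Suc n}"
    proof
      assume eq: "\<Sum>T = \<Sum>{..<Suc n}"
      then have "M = n" "\<Sum>T' = \<Sum>{..<n}" using IH Mn S sumT by linarith+
      then show "T = {..<Suc n}" using IH T'(3) by (auto simp: lessThan_Suc)
    qed
    moreover have "\<Sum>T = Suc (\<Sum>{..<Suc n}) \<longrightarrow> T = insert (Suc n) {..<n}"
    proof
      assume eq: "\<Sum>T = Suc (\<Sum>{..<Suc n})"
      then consider "M = n" "\<Sum>T' = Suc (\<Sum>{..<n})" | "M = Suc n" "\<Sum>T' = \<Sum>{..<n}"
        using IH Mn S sumT by linarith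
      then show "T = insert (Suc n) {..<n}"
      proof cases
        case 1
        then have "T' \<noteq> {}" by auto
        then have "T' = insert n {..<n - 1}" using IH 1 by blast
        then show ?thesis using T'(4) 1 by simp
      next
        case 2
        then show ?thesis using IH T'(3) by auto
      qed
    qed
    ultimately show ?case using IH Mn S sumT by simp
  qed auto
  from main[OF assms refl]
  show "(\<Sum>{..<card T}) \<le> \<Sum>T" "\<Sum>T = \<Sum>{..<card T} \<Longrightarrow> T = {..<card T}"
    "T \<noteq> {} \<Longrightarrow> \<Sum>T = Suc (\<Sum>{..<card T}) \<Longrightarrow> T = insert (card T) {..<card T - 1}"
    by blast+
qed

text \<open>In each residue class the quotients by \<open>m\<close> form a set of prescribed size,
  whose sum is smallest for an initial interval. Uniqueness of the minimum is what makes the core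
  the single dominant row set.\<close>

lemma core_minimal:
  assumes m: "m > 0" and fin: "finite X" "finite W"
    and same: "\<And>r. card (cls m W r) = card (cls m X r)"
  shows "\<Sum>(core m X) \<le> \<Sum>W" "\<Sum>W = \<Sum>(core m X) \<Longrightarrow> W = core m X"
proof -
  define T where "T r = (\<lambda>w. w div m) ` cls m W r" for r
  have inj: "inj_on (\<lambda>w. w div m) (cls m W r)" for r
  proof (rule inj_onI)
    fix u w assume "u \<in> cls m W r" "w \<in> cls m W r" "u div m = w div m"
    then have "u mod m = w mod m" "u div m = w div m" by (auto simp: cls_def)
    then show "u = w" by (metis div_mult_mod_eq)
  qed
  have cT: "card (T r) = card (cls m X r)" "finite (T r)" for r
    using same[of r] finite_cls[OF fin(2)] by (simp_all add: T_def card_image[OF inj])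
  have cls: "cls m W r = (\<lambda>q. r mod m + m * q) ` T r" for r
  proof -
    have "w = r mod m + m * (w div m)" if "w \<in> cls m W r" for w
      using that mod_mult_div_eq[of w m] by (simp add: cls_def)
    then show ?thesis unfolding T_def image_image by force
  qed
  have sW: "\<Sum>(cls m W r) = card (cls m X r) * (r mod m) + m * \<Sum>(T r)" for r
    unfolding cls using m cT(1)[of r]
    by (subst sum.reindex) (auto simp: inj_on_def sum.distrib sum_distrib_left)
  have sC: "\<Sum>(cls m (core m X) r) = card (cls m X r) * (r mod m) + m * \<Sum>{..<card (cls m X r)}" for r
    unfolding cls_core[OF m] using m
    by (subst sum.reindex) (auto simp: inj_on_def sum.distrib sum_distrib_left)
  have le: "\<Sum>(cls m (core m X) r) \<le> \<Sum>(cls m W r)" for r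
    unfolding sW sC using sum_lower_set(1)[OF cT(2)[of r]] cT(1)[of r] by simp
  have tot: "\<Sum>W = (\<Sum>r<m. \<Sum>(cls m W r))" "\<Sum>(core m X) = (\<Sum>r<m. \<Sum>(cls m (core m X) r))"
    by (rule sum_by_cls[OF m], use fin finite_core[OF m] in simp)+
  show "\<Sum>(core m X) \<le> \<Sum>W" unfolding tot using le by (intro sum_mono)
  assume eq: "\<Sum>W = \<Sum>(core m X)"
  have eqr: "cls m W r = cls m (core m X) r" if "r < m" for r
  proof -
    have "\<Sum>(cls m (core m X) r) = \<Sum>(cls m W r)"
      using sum_mono_inv[of "\<lambda>r. \<Sum>(cls m (core m X) r)" "{..<m}" "\<lambda>r. \<Sum>(cls m W r)" r]
        eq le that unfolding tot by auto
    then have "\<Sum>(T r) = \<Sum>{..<card (T r)}" unfolding sW sC cT(1) using m by simp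
    then have "T r = {..<card (T r)}" by (rule sum_lower_set(2)[OF cT(2)])
    then show ?thesis unfolding cls[of r] cls_core[OF m] using cT(1) by metis
  qed
  show "W = core m X"
  proof (rule Set.set_eqI)
    fix n
    have "n \<in> cls m W (n mod m) \<longleftrightarrow> n \<in> cls m (core m X) (n mod m)"
      using eqr[of "n mod m"] m by simp
    then show "n \<in> W \<longleftrightarrow> n \<in> core m X" by (simp add: cls_def)
  qed
qed

text \<open>A nonzero Leibniz term matches every element of \<open>X\<close> with an element of
  \<open>W\<close> that is not larger and congruent to it mod \<open>m\<close>.\<close>

lemma CW_nonzeroD:
  assumes fin: "finite X" "finite W" and card: "card W = card X" and nz: "CW m X W \<noteq> 0"
  shows "\<Sum>W \<le> \<Sum>X" "\<Sum>W = \<Sum>X \<Longrightarrow> W = X" "\<And>r. card (cls m W r) = card (cls m X r)"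
proof -
  obtain p where p: "p permutes {0..<card X}"
    "\<And>i. i < card X \<Longrightarrow> Cc m 1 (en X i) (en W (p i)) \<noteq> 0"
    using dt_nonzeroD[OF nz[unfolded CW_def]] by blast
  define g where "g i = en W (p i)" for i
  have g: "bij_betw g {0..<card X} W"
    using bij_betw_trans[OF permutes_imp_bij[OF p(1)] en_bij[OF fin(2), unfolded card]]
    by (simp add: g_def[abs_def] o_def)
  have e: "bij_betw (en X) {0..<card X} X" by (rule en_bij[OF fin(1)])
  have le: "g i \<le> en X i" and dv: "m dvd en X i - g i" if "i < card X" for i
    using p(2)[OF that] by (auto simp: g_def Cc_def split: if_splits)
  have md: "g i mod m = en X i mod m" if "i < card X" for i
    using le[OF that] dv[OF that] by (metis mod_eq_dvd_iff_nat)
  have sW: "\<Sum>W = (\<Sum>i=0..<card X. g i)" and sX: "\<Sum>X = (\<Sum>i=0..<card X. en X i)"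
    using sum.reindex_bij_betw[OF g, of "\<lambda>x. x"] sum.reindex_bij_betw[OF e, of "\<lambda>x. x"] by simp_all
  show "\<Sum>W \<le> \<Sum>X" unfolding sW sX by (intro sum_mono) (use le in auto)
  show "W = X" if eq: "\<Sum>W = \<Sum>X"
  proof -
    have "g i = en X i" if "i < card X" for i
      using sum_mono_inv[of g "{0..<card X}" "en X" i] le eq that unfolding sW sX by auto
    then have "g ` {0..<card X} = en X ` {0..<card X}" by (intro image_cong) auto
    then show ?thesis using g e by (simp add: bij_betw_def)
  qed
  show "card (cls m W r) = card (cls m X r)" for r
  proof -
    have "cls m W r = g ` {i \<in> {0..<card X}. g i mod m = r mod m}"
      using g by (auto simp: cls_def bij_betw_def)
    moreover have "cls m X r = en X ` {i \<in> {0..<card X}. en X i mod m = r mod m}"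
      using e unfolding cls_def bij_betw_def by force
    moreover have "{i \<in> {0..<card X}. g i mod m = r mod m} =
        {i \<in> {0..<card X}. en X i mod m = r mod m}" using md by auto
    moreover have "inj_on g {i \<in> {0..<card X}. en X i mod m = r mod m}"
      "inj_on (en X) {i \<in> {0..<card X}. en X i mod m = r mod m}"
      using g e by (auto simp: bij_betw_def elim: inj_on_subset)
    ultimately show ?thesis by (simp add: card_image)
  qed
qed

text \<open>Up to the factor \<open>fact a\<close>, the coefficients are the values at
  \<open>a\<close> of the falling factorials of degree \<open>t < c\<close>. A combination of these
  with \<open>c\<close> or more roots is the zero polynomial.\<close>

lemma falling_factorials_independent:
  fixes v :: "nat \<Rightarrow> complex"
  assumes fin: "finite A" and c: "c \<le> card A"
    and 0: "\<And>a. a \<in> A \<Longrightarrow> (\<Sum>t<c. (if t \<le> a then 1 / fact (a - t) else 0) * v t) = 0"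
  shows "\<forall>t<c. v t = 0"
proof -
  define ff where "ff t = (\<Prod>i<t. [:- of_nat i, 1 :: complex:])" for t :: nat
  have deg: "degree (ff t) = t" for t
    unfolding ff_def by (subst degree_prod_eq_sum_degree) auto
  have ev: "poly (ff t) (of_nat a) = fact a * (if t \<le> a then 1 / fact (a - t) else 0)" for t a
  proof (induction t)
    case (Suc t)
    have "poly (ff (Suc t)) (of_nat a) = poly (ff t) (of_nat a) * (of_nat a - of_nat t)"
      by (simp add: ff_def lessThan_Suc algebra_simps)
    also have "\<dots> = fact a * (if Suc t \<le> a then 1 / fact (a - Suc t) else 0)"
    proof (cases "Suc t \<le> a")
      case True
      then have "a - t = Suc (a - Suc t)" by simp
      then have "(fact (a - t) :: complex) = (of_nat a - of_nat t) * fact (a - Suc t)"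
        using True by (simp add: of_nat_diff)
      moreover have "(of_nat a - of_nat t :: complex) \<noteq> 0" using True by simp
      ultimately show ?thesis unfolding Suc using True by simp
    next
      case False
      then have "t = a \<or> a < t" by linarith
      then show ?thesis unfolding Suc using False by auto
    qed
    finally show ?case .
  qed (simp add: ff_def)
  define Q where "Q = (\<Sum>t<c. Polynomial.smult (v t) (ff t))"
  have evQ: "poly Q (of_nat a) = fact a * (\<Sum>t<c. (if t \<le> a then 1 / fact (a - t) else 0) * v t)" for a
    unfolding Q_def poly_sum sum_distrib_left
    by (intro sum.cong) (simp_all add: ev mult_ac)
  have "Q = 0"
  proof (rule ccontr)
    assume Q: "Q \<noteq> 0"
    then have "c \<noteq> 0" by (rule contrapos_nn) (simp add: Q_def)
    have "degree Q \<le> c - 1"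
      unfolding Q_def by (intro degree_sum_le) (auto simp: deg intro: order.trans[OF degree_smult_le])
    have "of_nat ` A \<subseteq> {x. poly Q x = 0}" using evQ 0 by auto
    then have "card (of_nat ` A :: complex set) \<le> card {x. poly Q x = 0}"
      by (intro card_mono poly_roots_finite[OF Q])
    also have "\<dots> \<le> degree Q" by (rule card_poly_roots_bound[OF Q])
    finally show False using \<open>degree Q \<le> c - 1\<close> \<open>c \<noteq> 0\<close> c by (simp add: card_image inj_on_def)
  qed
  \<comment> \<open>The relation now holds at every natural number, and at
    \<open>a = 0, 1, ...\<close> it is triangular.\<close>
  then have z: "(\<Sum>t<c. (if t \<le> a then 1 / fact (a - t) else 0) * v t) = 0" for a
    using evQ[of a] by simp
  show ?thesis
  proof (intro allI impI)
    fix a assume "a < c"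
    then show "v a = 0"
    proof (induction a rule: less_induct)
      case (less a)
      have "(\<Sum>t<c. (if t \<le> a then 1 / fact (a - t) else 0) * v t) = (\<Sum>t<c. if t = a then v t else 0)"
        using less by (intro sum.cong) auto
      then show ?case using z[of a] less.prems by simp
    qed
  qed
qed

text \<open>A relation between the columns splits into the residue classes mod \<open>m\<close>.
  Within one class the entries are inverse factorials of differences of quotients, and the core has
  as many columns there as \<open>X\<close> has rows.\<close>

lemma CW_core_nonzero:
  assumes m: "m > 0" and fin: "finite X"
  shows "CW m X (core m X) \<noteq> 0"
  unfolding CW_def
proof (rule dt_nonzero_if_kernel_trivial)
  fix v :: "nat \<Rightarrow> complex"
  let ?Y = "core m X"
  have finY: "finite ?Y" and cY: "card ?Y = card X" using finite_core card_core m fin by auto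
  define v' where "v' = (\<lambda>y. v (inv_into {0..<card X} (en ?Y) y))"
  have v': "v' (en ?Y j) = v j" if "j < card X" for j
    using that inv_into_f_f[OF en_inj[OF finY], of j] cY by (simp add: v'_def)
  assume "\<And>i. i < card X \<Longrightarrow> (\<Sum>j<card X. Cc m 1 (en X i) (en ?Y j) * v j) = 0"
  then have "(\<Sum>y\<in>?Y. Cc m 1 (en X i) y * v' y) = 0" if "i < card X" for i
    using that sum_en[OF finY, of "\<lambda>y. Cc m 1 (en X i) y * v' y"] cY v' by simp
  then have k: "(\<Sum>y\<in>?Y. Cc m 1 x y * v' y) = 0" if "x \<in> X" for x
    using that en_image[OF fin] by force
  have z: "v' (r + m * t) = 0" if r: "r < m" and t: "t < card (cls m X r)" for r t
  proof -
    let ?A = "(\<lambda>x. x div m) ` cls m X r"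
    have inj: "inj_on (\<lambda>w. w div m) (cls m X r)"
    proof (rule inj_onI)
      fix u w assume "u \<in> cls m X r" "w \<in> cls m X r" "u div m = w div m"
      then have "u mod m = w mod m" "u div m = w div m" by (auto simp: cls_def)
      then show "u = w" by (metis div_mult_mod_eq)
    qed
    have "\<forall>t<card (cls m X r). v' (r + m * t) = 0"
    proof (rule falling_factorials_independent[of ?A])
      show "finite ?A" using finite_cls[OF fin] by simp
      show "card (cls m X r) \<le> card ?A" by (simp add: card_image[OF inj])
      fix a assume "a \<in> ?A"
      then obtain x where x: "x \<in> X" "x mod m = r" "a = x div m" using r by (auto simp: cls_def)
      then have xa: "x = r + m * a" by (metis mod_mult_div_eq)
      have "0 = (\<Sum>y\<in>?Y. Cc m 1 x y * v' y)" using k x by simp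
      also have "\<dots> = (\<Sum>y\<in>cls m ?Y r. Cc m 1 x y * v' y)"
      proof (rule sum.mono_neutral_right[OF finY])
        show "\<forall>y\<in>?Y - cls m ?Y r. Cc m 1 x y * v' y = 0"
        proof
          fix y assume y: "y \<in> ?Y - cls m ?Y r"
          then have "y mod m \<noteq> x mod m" using x r by (auto simp: cls_def)
          then have "Cc m 1 x y = 0" unfolding Cc_def by (metis mod_eq_dvd_iff_nat)
          then show "Cc m 1 x y * v' y = 0" by simp
        qed
      qed (auto simp: cls_def)
      also have "\<dots> = (\<Sum>t<card (cls m X r). Cc m 1 x (r + m * t) * v' (r + m * t))"
        unfolding cls_core[OF m] using r m by (subst sum.reindex) (auto simp: inj_on_def)
      also have "\<dots> = (\<Sum>t<card (cls m X r). (if t \<le> a then 1 / fact (a - t) else 0) * v' (r + m * t))"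
      proof (intro sum.cong refl arg_cong2[of _ _ _ _ "(*)"])
        fix t
        have "x - (r + m * t) = m * (a - t)" by (simp add: xa diff_mult_distrib2)
        then show "Cc m 1 x (r + m * t) = (if t \<le> a then 1 / fact (a - t) else 0)"
          using m by (simp add: Cc_def xa)
      qed
      finally show "(\<Sum>t<card (cls m X r). (if t \<le> a then 1 / fact (a - t) else 0) * v' (r + m * t)) = 0"
        by simp
    qed
    with t show ?thesis by blast
  qed
  show "\<forall>j<card X. v j = 0"
  proof (intro allI impI)
    fix j assume j: "j < card X"
    then have y: "en ?Y j \<in> ?Y" using en_in[OF finY] cY by simp
    then have "v' (en ?Y j mod m + m * (en ?Y j div m)) = 0"
      using m by (intro z) (auto simp: core_def)
    then show "v j = 0" using v'[OF j] by simp
  qed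
qed

lemma CW_self_nonzero:
  assumes m: "m > 0" and fin: "finite X"
  shows "CW m X X = 1"
  unfolding CW_def
proof (rule dt_unitriangular[OF en_inj[OF fin]])
  fix i j assume "Cc m 1 (en X i) (en X j) \<noteq> 0"
  then show "en X j \<le> en X i" by (auto simp: Cc_def split: if_splits)
qed (simp add: Cc_def)

section \<open>The Wronskian polynomials: degree and order of vanishing at zero\<close>

lemma en_strict_mono_image:
  assumes "strict_mono f" "i < N"
  shows "en (f ` {0..<N}) i = f i"
proof -
  let ?l = "map f [0..<N]"
  have "sorted ?l"
    unfolding sorted_map sorted_wrt_upt by (rule sorted_wrt_mono_rel[of _ "(<)"]) (use assms(1) in \<open>auto simp: strict_mono_less_eq\<close>)
  moreover have "distinct ?l"
    using assms(1) by (simp add: distinct_map strict_mono_imp_inj_on)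
  ultimately have "sorted_list_of_set (set ?l) = ?l" by (rule sorted_list_of_set.idem_if_sorted_distinct)
  then show ?thesis using assms(2) by (simp add: en_def)
qed

definition X0 :: "nat \<Rightarrow> nat \<Rightarrow> nat \<Rightarrow> nat set" where
  "X0 k l N = (\<lambda>i. l + i * k) ` {0..<N}"

definition zz :: "nat \<Rightarrow> complex \<Rightarrow> nat \<Rightarrow> complex" where
  "zz m z r = (if r = 1 then z else if r = m then 1 else 0)"

lemma X0:
  assumes "k > 0"
  shows "finite (X0 k l N)" "card (X0 k l N) = N" "\<And>i. i < N \<Longrightarrow> en (X0 k l N) i = l + i * k"
proof -
  have sm: "strict_mono (\<lambda>i. l + i * k)" using assms by (auto simp: strict_mono_def)
  show "finite (X0 k l N)" by (simp add: X0_def)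
  show "card (X0 k l N) = N"
    unfolding X0_def using strict_mono_imp_inj_on[OF sm] by (subst card_image) (auto intro: inj_on_subset)
  show "en (X0 k l N) i = l + i * k" if "i < N" for i
    unfolding X0_def by (rule en_strict_mono_image[OF sm that])
qed

lemma p_poly_schur:
  assumes "m \<ge> 2"
  shows "p_poly m i z = schur (zz m z) i"
proof (cases "i < 0")
  case False
  then obtain n where "i = int n" by (metis nonneg_int_cases not_less)
  then show ?thesis by (simp only: schur_nat p_poly_eq_sch[OF assms] zz_def[abs_def])
qed (simp add: p_poly_def schur_def)

lemma W_poly_Dm:
  assumes "m \<ge> 2" "k > 0"
  shows "W_poly m k l N z = W_const k l N * Dm (X0 k l N) {0..<N} (\<lambda>_. zz m z) (\<lambda>_. 0)"
proof -
  have "dt N (\<lambda>i j. p_poly m (int (row_idx k l (Suc i)) - int (Suc j) + 1) z) =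
      Dm (X0 k l N) {0..<N} (\<lambda>_. zz m z) (\<lambda>_. 0)"
    unfolding Dm_def X0(2)[OF assms(2)]
    by (intro dt_cong)
       (simp add: p_poly_schur[OF assms(1)] X0(3)[OF assms(2)] en_atLeastLessThan row_idx_def add_diff_eq)
  then show ?thesis by (simp add: W_poly_def dt_def)
qed

lemma W_const_nonzero:
  assumes "k > 0"
  shows "W_const k l N \<noteq> 0"
proof -
  have "(of_nat (row_idx k l j) - of_nat (row_idx k l i) :: complex) \<noteq> 0" if "i \<in> {1..<j}" for i j
  proof -
    have "(i - 1) * k < (j - 1) * k" using that assms by (intro mult_strict_right_mono) auto
    then have "row_idx k l i \<noteq> row_idx k l j" by (simp add: row_idx_def)
    then show ?thesis by (simp only: right_minus_eq of_nat_eq_iff)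
  qed
  then have "(\<Prod>j=1..N. \<Prod>i=1..<j. of_nat (row_idx k l j) - of_nat (row_idx k l i) :: complex) \<noteq> 0"
    by (simp only: prod_zero_iff finite_atLeastAtMost finite_atLeastLessThan) blast
  moreover have "(\<Prod>i=1..N. fact (row_idx k l i) :: complex) \<noteq> 0"
    by (simp only: prod_zero_iff finite_atLeastAtMost) simp
  ultimately show ?thesis by (simp add: W_const_def)
qed

definition sigma0 :: "nat \<Rightarrow> nat" where
  "sigma0 N = \<Sum>{..<N}"

text \<open>The determinant with entries \<open>1 / fact (w - j)\<close>, that is, the Vandermonde
  product of \<open>W\<close> divided by the factorials of its elements.\<close>

definition Hn :: "nat set \<Rightarrow> complex" where
  "Hn W = Dm W {0..<card W} (\<lambda>_ r. if r = 1 then 1 else 0) (\<lambda>_. 0)"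

lemma sigma0_le: "finite W \<Longrightarrow> sigma0 (card W) \<le> \<Sum>W"
  unfolding sigma0_def by (rule sum_lower_set(1))

lemma schur_first:
  "schur (\<lambda>r. if r = 1 then z else 0) (int n - int j) = (if j \<le> n then z ^ (n - j) / fact (n - j) else 0)"
  unfolding schur_diff by (subst sch_single) auto

text \<open>Scaling rows and columns by powers of \<open>z\<close> reduces to \<open>z = 1\<close>.
  For \<open>z = 0\<close> the scaling cannot be undone, and both sides are computed
  directly.\<close>

lemma Dm_first:
  assumes fin: "finite W"
  shows "Dm W {0..<card W} (\<lambda>_ r. if r = 1 then z else 0) (\<lambda>_. 0) = z ^ (\<Sum>W - sigma0 (card W)) * Hn W"
proof (cases "W = {0..<card W}")
  case True
  then have "\<Sum>W = sigma0 (card W)" unfolding sigma0_def by (metis atLeast0LessThan)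
  moreover have "Dm W W (\<lambda>_ r. if r = 1 then y else 0) (\<lambda>_. 0) = 1" for y :: complex
    by (rule Dm_self[OF fin])
  ultimately show ?thesis unfolding Hn_def True[symmetric] by simp
next
  case False
  let ?h = "\<lambda>y i j. if en {0..<card W} j \<le> en W i
      then y ^ (en W i - en {0..<card W} j) / fact (en W i - en {0..<card W} j) else (0::complex)"
  have D: "Dm W {0..<card W} (\<lambda>_ r. if r = 1 then y else 0) (\<lambda>_. 0) = dt (card W) (?h y)" for y
    unfolding Dm_def mult_zero_right add_0_right schur_first ..
  show ?thesis
  proof (cases "z = 0")
    case True
    \<comment> \<open>At \<open>z = 0\<close> the row of an element beyond the columns vanishes,
      while the exponent on the right is positive.\<close>
    have "\<not> W \<subseteq> {0..<card W}" using False card_subset_eq[of "{0..<card W}" W] by auto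
    then obtain w where w: "w \<in> W" "card W \<le> w" by (metis atLeastLessThan_iff le0 not_le subsetI)
    then obtain i where i: "i < card W" "en W i = w" using en_image[OF fin] by force
    have "Dm W {0..<card W} (\<lambda>_ r. if r = 1 then z else 0) (\<lambda>_. 0) = 0"
      unfolding D
    proof (rule dt_zero_row[OF i(1)])
      fix j assume "j < card W"
      then show "?h z i j = 0" using i w True by (simp add: en_atLeastLessThan)
    qed
    moreover have "\<Sum>W - sigma0 (card W) > 0"
    proof (rule ccontr)
      assume "\<not> ?thesis"
      then have "\<Sum>W = \<Sum>{..<card W}" using sigma0_le[OF fin] by (simp add: sigma0_def)
      then have "W = {..<card W}" by (rule sum_lower_set(2)[OF fin])
      then show False using False by (simp add: atLeast0LessThan)
    qed
    ultimately show ?thesis using True by simp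
  next
    case z: False
    have "?h z i j * z ^ en {0..<card W} j = z ^ en W i * ?h 1 i j" for i j
      by (simp add: power_add[symmetric])
    then have "dt (card W) (\<lambda>i j. 1 * ?h z i j * z ^ en {0..<card W} j) =
        dt (card W) (\<lambda>i j. z ^ en W i * ?h 1 i j * 1)"
      by (simp only: mult_1_left mult_1_right)
    then have "dt (card W) (?h z) * (\<Prod>j<card W. z ^ en {0..<card W} j) =
        (\<Prod>i<card W. z ^ en W i) * dt (card W) (?h 1)"
      unfolding dt_scale by simp
    moreover have "(\<Prod>i<card W. z ^ en W i) = z ^ (\<Sum>W)"
      using prod_en[OF fin, of "\<lambda>v. z ^ v"] by (simp add: power_sum)
    moreover have "(\<Prod>j<card W. z ^ en {0..<card W} j) = z ^ sigma0 (card W)"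
      by (simp add: en_atLeastLessThan sigma0_def power_sum)
    ultimately have "dt (card W) (?h z) * z ^ sigma0 (card W) = z ^ (\<Sum>W) * dt (card W) (?h 1)"
      by simp
    also have "z ^ (\<Sum>W) = z ^ (\<Sum>W - sigma0 (card W)) * z ^ sigma0 (card W)"
      using sigma0_le[OF fin] by (simp flip: power_add)
    finally show ?thesis unfolding Hn_def D using z by simp
  qed
qed

lemma Hn_nonzero:
  assumes fin: "finite W"
  shows "Hn W \<noteq> 0"
  unfolding Hn_def Dm_def
proof (rule dt_nonzero_if_kernel_trivial)
  fix v :: "nat \<Rightarrow> complex"
  assume *: "\<And>i. i < card W \<Longrightarrow> (\<Sum>j<card W. schur (\<lambda>r. (if r = 1 then 1 else 0) +
      of_nat (en {0..<card W} j) * 0) (int (en W i) - int (en {0..<card W} j)) * v j) = 0"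
  show "\<forall>j<card W. v j = 0"
  proof (rule falling_factorials_independent[OF fin order.refl])
    fix a assume "a \<in> W"
    then obtain i where i: "i < card W" "en W i = a" using en_image[OF fin] by force
    have "(\<Sum>t<card W. (if t \<le> a then 1 / fact (a - t) else 0) * v t) =
        (\<Sum>j<card W. schur (\<lambda>r. (if r = 1 then 1 else 0) +
      of_nat (en {0..<card W} j) * 0) (int (en W i) - int (en {0..<card W} j)) * v j)"
      unfolding mult_zero_right add_0_right schur_first
      by (intro sum.cong refl) (simp add: en_atLeastLessThan i(2))
    with *[OF i(1)] show "(\<Sum>t<card W. (if t \<le> a then 1 / fact (a - t) else 0) * v t) = 0" by simp
  qed
qed

text \<open>\<open>W_poly\<close> after extraction of its entry 1 at position \<open>m\<close>: what
  remains has only the entry \<open>z\<close> at position 1, so every row set \<open>W\<close>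
  contributes one monomial.\<close>

definition PW :: "nat \<Rightarrow> nat \<Rightarrow> nat \<Rightarrow> nat \<Rightarrow> complex poly" where
  "PW m k l N = (\<Sum>W | W \<subseteq> {0..l + N * k} \<and> card W = N.
     monom (W_const k l N * CW m (X0 k l N) W * Hn W) (\<Sum>W - sigma0 N))"

lemma X0_bounded: "X0 k l N \<subseteq> {0..l + N * k}"
  by (auto simp: X0_def)

lemma poly_PW:
  assumes m: "m \<ge> 2" and k: "k > 0"
  shows "W_poly m k l N z = poly (PW m k l N) z"
proof -
  have zz: "zz m z = (\<lambda>r. (if r = 1 then z else 0) + (if r = m then 1 else 0))"
    using m by (auto simp: zz_def)
  have "Dm (X0 k l N) {0..<N} (\<lambda>_. zz m z) (\<lambda>_. 0) =
    (\<Sum>W | W \<subseteq> {0..l + N * k} \<and> card W = card (X0 k l N). 1 ^ (\<Sum>(X0 k l N)) / 1 ^ (\<Sum>W) *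
      CW m (X0 k l N) W * Dm W {0..<N} (\<lambda>_ r. if r = 1 then z else 0) (\<lambda>_. 0))"
    unfolding zz by (rule Dm_remove_entry) (use m X0_bounded in auto)
  also have "\<dots> = (\<Sum>W | W \<subseteq> {0..l + N * k} \<and> card W = N.
      CW m (X0 k l N) W * (z ^ (\<Sum>W - sigma0 N) * Hn W))"
  proof (rule sum.cong)
    fix W assume "W \<in> {W. W \<subseteq> {0..l + N * k} \<and> card W = N}"
    then have "finite W" "card W = N" using finite_subset by auto
    from Dm_first[OF this(1), of z, unfolded this(2)]
    show "1 ^ (\<Sum>(X0 k l N)) / 1 ^ (\<Sum>W) * CW m (X0 k l N) W *
        Dm W {0..<N} (\<lambda>_ r. if r = 1 then z else 0) (\<lambda>_. 0) =
        CW m (X0 k l N) W * (z ^ (\<Sum>W - sigma0 N) * Hn W)" by simp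
  qed (simp add: X0(2)[OF k])
  finally show ?thesis
    unfolding W_poly_Dm[OF m k] PW_def poly_sum sum_distrib_left poly_monom
    by (simp add: sum_distrib_left mult_ac)
qed

lemma coeff_PW:
  "coeff (PW m k l N) i = (\<Sum>W | W \<subseteq> {0..l + N * k} \<and> card W = N.
     if \<Sum>W - sigma0 N = i then W_const k l N * CW m (X0 k l N) W * Hn W else 0)"
  unfolding PW_def coeff_sum coeff_monom ..

lemma coeff_PW_single:
  assumes k: "k > 0" and fin: "finite Y" "Y \<subseteq> {0..l + N * k}" "card Y = N"
    and only: "\<And>W. W \<subseteq> {0..l + N * k} \<Longrightarrow> card W = N \<Longrightarrow> CW m (X0 k l N) W \<noteq> 0 \<Longrightarrow> \<Sum>W = \<Sum>Y \<Longrightarrow> W = Y"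
  shows "coeff (PW m k l N) (\<Sum>Y - sigma0 N) = W_const k l N * CW m (X0 k l N) Y * Hn Y"
proof -
  have "coeff (PW m k l N) (\<Sum>Y - sigma0 N) = (\<Sum>W | W \<subseteq> {0..l + N * k} \<and> card W = N.
     if W = Y then W_const k l N * CW m (X0 k l N) Y * Hn Y else 0)"
    unfolding coeff_PW
  proof (intro sum.cong refl)
    fix W assume "W \<in> {W. W \<subseteq> {0..l + N * k} \<and> card W = N}"
    then have W: "W \<subseteq> {0..l + N * k}" "card W = N" "finite W" using finite_subset by auto
    have "sigma0 N \<le> \<Sum>W" "sigma0 N \<le> \<Sum>Y"
      using sigma0_le[OF W(3)] sigma0_le[OF fin(1)] W(2) fin(3) by auto
    then have "\<Sum>W - sigma0 N = \<Sum>Y - sigma0 N \<longleftrightarrow> \<Sum>W = \<Sum>Y" by linarith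
    then show "(if \<Sum>W - sigma0 N = \<Sum>Y - sigma0 N then W_const k l N * CW m (X0 k l N) W * Hn W else 0) =
      (if W = Y then W_const k l N * CW m (X0 k l N) Y * Hn Y else 0)"
      using only[OF W(1,2)] by auto
  qed
  also have "\<dots> = W_const k l N * CW m (X0 k l N) Y * Hn Y"
    using fin by simp
  finally show ?thesis .
qed

text \<open>The range bound comes from the nonzero minor \<open>CW\<close>: one of its Leibniz terms
  puts every element of the core below an element of \<open>X0 k l N\<close>.\<close>

lemma core_X0:
  assumes m: "m > 0" and k: "k > 0"
  shows "finite (core m (X0 k l N))" "card (core m (X0 k l N)) = N"
    "core m (X0 k l N) \<subseteq> {0..l + N * k}"
proof -
  let ?X = "X0 k l N" and ?Y = "core m (X0 k l N)"
  show fin: "finite ?Y" and card: "card ?Y = N" using finite_core card_core X0 m k by auto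
  show "?Y \<subseteq> {0..l + N * k}"
  proof
    fix y assume "y \<in> ?Y"
    then obtain j where j: "j < N" "en ?Y j = y" using en_image[OF fin] card by force
    obtain p where p: "p permutes {0..<N}" "\<And>i. i < N \<Longrightarrow> Cc m 1 (en ?X i) (en ?Y (p i)) \<noteq> 0"
      by (rule dt_nonzeroD[OF CW_core_nonzero[OF m X0(1)[OF k], unfolded CW_def X0(2)[OF k]]]) blast
    have "j \<in> p ` {0..<N}" using permutes_image[OF p(1)] j(1) by simp
    then obtain i where i: "i < N" "p i = j" by auto
    have "y \<le> en ?X i" using p(2)[OF i(1)] i(2) j(2) by (auto simp: Cc_def split: if_splits)
    also have "\<dots> \<le> l + N * k"
      using en_in[OF X0(1)[OF k]] i(1) X0(2)[OF k] X0_bounded[of k l N] by fastforce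
    finally show "y \<in> {0..l + N * k}" by simp
  qed
qed

text \<open>Row sets with nonzero \<open>CW\<close> have sums between that of the core and that of
  \<open>X0 k l N\<close>, and each extreme is attained only once. So the lowest and the highest
  coefficient are products of nonzero factors.\<close>

lemma PW_order_degree:
  assumes m: "m > 0" and k: "k > 0"
  shows "degree (PW m k l N) = \<Sum>(X0 k l N) - sigma0 N"
    "\<And>i. i < \<Sum>(core m (X0 k l N)) - sigma0 N \<Longrightarrow> coeff (PW m k l N) i = 0"
    "coeff (PW m k l N) (\<Sum>(core m (X0 k l N)) - sigma0 N) \<noteq> 0"
proof -
  let ?X = "X0 k l N" and ?Y = "core m (X0 k l N)"
  note finX = X0(1)[OF k] and cX = X0(2)[OF k]
  have D: "\<Sum>W \<le> \<Sum>?X" "\<Sum>W = \<Sum>?X \<Longrightarrow> W = ?X" "\<Sum>?Y \<le> \<Sum>W" "\<Sum>W = \<Sum>?Y \<Longrightarrow> W = ?Y"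
    if W: "W \<subseteq> {0..l + N * k}" "card W = N" "CW m ?X W \<noteq> 0" for W
  proof -
    have finW: "finite W" using W(1) finite_subset by auto
    have cW: "card W = card ?X" using W(2) cX by simp
    note nz = CW_nonzeroD[OF finX finW cW W(3)]
    show "\<Sum>W \<le> \<Sum>?X" "\<Sum>W = \<Sum>?X \<Longrightarrow> W = ?X" using nz by auto
    show "\<Sum>?Y \<le> \<Sum>W" "\<Sum>W = \<Sum>?Y \<Longrightarrow> W = ?Y" using core_minimal[OF m finX finW nz(3)] by auto
  qed
  have cXc: "coeff (PW m k l N) (\<Sum>?X - sigma0 N) = W_const k l N * CW m ?X ?X * Hn ?X"
    by (rule coeff_PW_single[OF k finX X0_bounded cX]) (use D in auto)
  have cY: "coeff (PW m k l N) (\<Sum>?Y - sigma0 N) = W_const k l N * CW m ?X ?Y * Hn ?Y"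
    by (rule coeff_PW_single[OF k core_X0(1)[OF m k] core_X0(3)[OF m k] core_X0(2)[OF m k]]) (use D in auto)
  show "coeff (PW m k l N) (\<Sum>?Y - sigma0 N) \<noteq> 0"
    unfolding cY using W_const_nonzero[OF k] CW_core_nonzero[OF m finX] Hn_nonzero[OF core_X0(1)[OF m k]] by simp
  show "coeff (PW m k l N) i = 0" if "i < \<Sum>?Y - sigma0 N" for i
    unfolding coeff_PW
  proof (rule sum.neutral, rule ballI)
    fix W assume W: "W \<in> {W. W \<subseteq> {0..l + N * k} \<and> card W = N}"
    show "(if \<Sum>W - sigma0 N = i then W_const k l N * CW m ?X W * Hn W else 0) = 0"
    proof (cases "CW m ?X W = 0")
      case False
      then have "\<Sum>?Y \<le> \<Sum>W" using D(3) W by auto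
      then show ?thesis using that by auto
    qed simp
  qed
  show "degree (PW m k l N) = \<Sum>?X - sigma0 N"
  proof (rule antisym)
    show "degree (PW m k l N) \<le> \<Sum>?X - sigma0 N"
    proof (rule degree_le, intro allI impI)
      fix i assume i: "\<Sum>?X - sigma0 N < i"
      show "coeff (PW m k l N) i = 0"
        unfolding coeff_PW
      proof (rule sum.neutral, rule ballI)
        fix W assume W: "W \<in> {W. W \<subseteq> {0..l + N * k} \<and> card W = N}"
        show "(if \<Sum>W - sigma0 N = i then W_const k l N * CW m ?X W * Hn W else 0) = 0"
        proof (cases "CW m ?X W = 0")
          case False
          then have "\<Sum>W \<le> \<Sum>?X" using D(1) W by auto
          then show ?thesis using i by auto
        qed simp
      qed
    qed
    have "coeff (PW m k l N) (\<Sum>?X - sigma0 N) \<noteq> 0"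
      unfolding cXc CW_self_nonzero[OF m finX] using W_const_nonzero[OF k] Hn_nonzero[OF finX] by simp
    then show "\<Sum>?X - sigma0 N \<le> degree (PW m k l N)" by (rule le_degree)
  qed
qed

text \<open>The lowest nonzero coefficient gives the order \<open>a\<close> at zero, every other
  root has order 1, and over the complex numbers the orders add up to the degree.\<close>

lemma card_nonzero_simple_roots:
  fixes P :: "complex poly"
  assumes low: "\<And>i. i < a \<Longrightarrow> coeff P i = 0" "coeff P a \<noteq> 0"
    and simple: "\<And>z. z \<noteq> 0 \<Longrightarrow> poly P z = 0 \<Longrightarrow> poly (pderiv P) z \<noteq> 0"
  shows "finite {z. z \<noteq> 0 \<and> poly P z = 0}" "card {z. z \<noteq> 0 \<and> poly P z = 0} + a = degree P"
proof -
  have P: "P \<noteq> 0" using low(2) by auto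
  let ?Z = "{z. z \<noteq> 0 \<and> poly P z = 0}"
  show fin: "finite ?Z" using poly_roots_finite[OF P] by (rule rev_finite_subset) auto
  have ord0: "order 0 P = a"
  proof (rule antisym)
    have "monom 1 a dvd P" using low(1) by (subst monom_1_dvd_iff') auto
    then show "a \<le> order 0 P" using monom_1_dvd_iff[OF P] by blast
    show "order 0 P \<le> a"
    proof (rule ccontr)
      assume "\<not> order 0 P \<le> a"
      then have "monom 1 (Suc a) dvd P" using monom_1_dvd_iff[OF P] by auto
      then have "coeff P a = 0" by (subst (asm) monom_1_dvd_iff') auto
      with low(2) show False by simp
    qed
  qed
  have ord1: "order z P = 1" if "z \<in> ?Z" for z
  proof -
    have z: "z \<noteq> 0" "poly P z = 0" using that by auto
    have dz: "poly (pderiv P) z \<noteq> 0" using simple[OF z] .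
    have "order z P = Suc (order z (pderiv P))" by (rule order_pderiv[OF P z(2)])
    then show ?thesis using order_0I[OF dz] by simp
  qed
  have "degree P = size (proots P)" by (simp add: size_proots_complex)
  also have "\<dots> = (\<Sum>z\<in>set_mset (proots P). count (proots P) z)"
    by (simp add: size_multiset_overloaded_eq)
  also have "\<dots> = (\<Sum>z\<in>{z. poly P z = 0}. order z P)"
    using P by (intro sum.cong) (auto simp: count_proots)
  also have "\<dots> = (\<Sum>z\<in>insert 0 ?Z. order z P)"
    by (rule sum.mono_neutral_left) (use fin P order_root in auto)
  also have "\<dots> = a + card ?Z"
    using fin ord0 ord1 by simp
  finally show "card ?Z + a = degree P" by simp
qed

section \<open>First-order perturbation of determinants\<close>

lemma prod_bigo_1:
  fixes f :: "'w \<Rightarrow> nat \<Rightarrow> complex"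
  assumes "\<And>i. i \<in> I \<Longrightarrow> (\<lambda>w. f w i) \<in> O[F](\<lambda>_. 1 :: complex)" "finite I"
  shows "(\<lambda>w. \<Prod>i\<in>I. f w i) \<in> O[F](\<lambda>_. 1 :: complex)"
  using assms(2,1)
proof (induction I)
  case (insert a I)
  have "(\<lambda>w. f w a * (\<Prod>i\<in>I. f w i)) \<in> O[F](\<lambda>_. 1 :: complex)"
    by (intro bigo_mult_1 insert) (use insert in auto)
  then show ?case using insert.hyps by simp
qed simp

lemma bigo_1_of_diff:
  fixes f h g :: "'w \<Rightarrow> complex"
  assumes "(\<lambda>w. f w - h w) \<in> O[F](g)" "g \<in> O[F](\<lambda>_. 1 :: complex)" "h \<in> O[F](\<lambda>_. 1 :: complex)"
  shows "f \<in> O[F](\<lambda>_. 1 :: complex)"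
  using sum_in_bigo(1)[OF landau_o.big_trans[OF assms(1,2)] assms(3)] by simp

lemma prod_perturb:
  fixes f h :: "'w \<Rightarrow> nat \<Rightarrow> complex" and g :: "'w \<Rightarrow> complex"
  assumes g: "g \<in> O[F](\<lambda>_. 1 :: complex)" and I: "finite I"
    and h: "\<And>i. i \<in> I \<Longrightarrow> (\<lambda>w. h w i) \<in> O[F](\<lambda>_. 1 :: complex)"
    and d: "\<And>i. i \<in> I \<Longrightarrow> (\<lambda>w. f w i - h w i) \<in> O[F](g)"
  shows "(\<lambda>w. (\<Prod>i\<in>I. f w i) - (\<Prod>i\<in>I. h w i)) \<in> O[F](g)"
  using I h d
proof (induction I)
  case (insert a I)
  have f: "(\<lambda>w. f w a) \<in> O[F](\<lambda>_. 1 :: complex)"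
    by (rule bigo_1_of_diff[OF insert.prems(2) g insert.prems(1)]) auto
  have "(\<lambda>w. f w a * ((\<Prod>i\<in>I. f w i) - (\<Prod>i\<in>I. h w i)) + (f w a - h w a) * (\<Prod>i\<in>I. h w i)) \<in> O[F](g)"
    by (intro sum_in_bigo bigo_1_mult[OF f] bigo_mult_1 prod_bigo_1 insert) (use insert in auto)
  then show ?case using insert.hyps by (simp add: algebra_simps)
qed simp

lemma prod_expand:
  fixes f h E :: "'w \<Rightarrow> nat \<Rightarrow> complex" and g :: "'w \<Rightarrow> complex"
  assumes g: "g \<in> O[F](\<lambda>_. 1 :: complex)" and I: "finite I"
    and h: "\<And>i. i \<in> I \<Longrightarrow> (\<lambda>w. h w i) \<in> O[F](\<lambda>_. 1 :: complex)"
    and E: "\<And>i. i \<in> I \<Longrightarrow> (\<lambda>w. E w i) \<in> O[F](g)"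
    and d: "\<And>i. i \<in> I \<Longrightarrow> (\<lambda>w. f w i - h w i - E w i) \<in> O[F](\<lambda>w. g w ^ 2)"
  shows "(\<lambda>w. (\<Prod>i\<in>I. f w i) - (\<Prod>i\<in>I. h w i)
      - (\<Sum>c\<in>I. E w c * (\<Prod>i\<in>I - {c}. h w i))) \<in> O[F](\<lambda>w. g w ^ 2)"
  using I h E d
proof (induction I)
  case (insert a I)
  let ?S = "\<lambda>w. \<Sum>c\<in>I. E w c * (\<Prod>i\<in>I - {c}. h w i)"
  have g2: "(\<lambda>w. g w ^ 2) \<in> O[F](g)"
    using bigo_mult_1[OF _ g, of g] by (simp add: power2_eq_square)
  have fh: "(\<lambda>w. f w a - h w a) \<in> O[F](g)"
    using sum_in_bigo(1)[OF landau_o.big_trans[OF insert.prems(3)[of a] g2] insert.prems(2)[of a]] by simp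
  have f: "(\<lambda>w. f w a) \<in> O[F](\<lambda>_. 1 :: complex)"
    by (rule bigo_1_of_diff[OF fh g insert.prems(1)]) auto
  have S: "?S \<in> O[F](g)"
    by (intro big_sum_in_bigo bigo_mult_1 prod_bigo_1) (use insert in auto)
  have fhS: "(\<lambda>w. (f w a - h w a) * ?S w) \<in> O[F](\<lambda>w. g w ^ 2)"
    using landau_o.big.mult[OF fh S] by (simp add: power2_eq_square)
  have "(\<lambda>w. f w a * ((\<Prod>i\<in>I. f w i) - (\<Prod>i\<in>I. h w i) - ?S w)
      + (f w a - h w a - E w a) * (\<Prod>i\<in>I. h w i) + (f w a - h w a) * ?S w) \<in> O[F](\<lambda>w. g w ^ 2)"
    by (intro sum_in_bigo(1) bigo_1_mult[OF f] bigo_mult_1 prod_bigo_1 insert fhS) (use insert in auto)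
  moreover have "(\<Sum>c\<in>insert a I. E w c * (\<Prod>i\<in>insert a I - {c}. h w i)) =
      E w a * (\<Prod>i\<in>I. h w i) + h w a * ?S w" for w
  proof -
    have "(\<Sum>c\<in>I. E w c * (\<Prod>i\<in>insert a I - {c}. h w i)) = (\<Sum>c\<in>I. h w a * (E w c * (\<Prod>i\<in>I - {c}. h w i)))"
    proof (rule sum.cong[OF refl])
      fix c assume c: "c \<in> I"
      then have "insert a I - {c} = insert a (I - {c})" using insert.hyps by auto
      then show "E w c * (\<Prod>i\<in>insert a I - {c}. h w i) = h w a * (E w c * (\<Prod>i\<in>I - {c}. h w i))"
        using insert.hyps by simp
    qed
    then show ?thesis using insert.hyps by (simp add: sum_distrib_left)
  qed
  ultimately show ?case using insert.hyps by (simp add: algebra_simps)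
qed simp

lemma dt_bigo_1:
  fixes f :: "'w \<Rightarrow> nat \<Rightarrow> nat \<Rightarrow> complex"
  assumes "\<And>i j. i < n \<Longrightarrow> j < n \<Longrightarrow> (\<lambda>w. f w i j) \<in> O[F](\<lambda>_. 1 :: complex)"
  shows "(\<lambda>w. dt n (f w)) \<in> O[F](\<lambda>_. 1 :: complex)"
proof -
  have "(\<lambda>w. \<Prod>i=0..<n. f w i (p i)) \<in> O[F](\<lambda>_. 1 :: complex)" if "p permutes {0..<n}" for p
    by (rule prod_bigo_1) (use assms permutes_in_image[OF that] in auto)
  then show ?thesis unfolding dt_rows by (intro big_sum_in_bigo) auto
qed

lemma dt_perturb:
  fixes f h :: "'w \<Rightarrow> nat \<Rightarrow> nat \<Rightarrow> complex" and g :: "'w \<Rightarrow> complex"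
  assumes g: "g \<in> O[F](\<lambda>_. 1 :: complex)"
    and h: "\<And>i j. i < n \<Longrightarrow> j < n \<Longrightarrow> (\<lambda>w. h w i j) \<in> O[F](\<lambda>_. 1 :: complex)"
    and d: "\<And>i j. i < n \<Longrightarrow> j < n \<Longrightarrow> (\<lambda>w. f w i j - h w i j) \<in> O[F](g)"
  shows "(\<lambda>w. dt n (f w) - dt n (h w)) \<in> O[F](g)"
proof -
  have "(\<lambda>w. (\<Prod>i=0..<n. f w i (p i)) - (\<Prod>i=0..<n. h w i (p i))) \<in> O[F](g)"
    if "p permutes {0..<n}" for p
    by (rule prod_perturb[OF g]) (use h d permutes_in_image[OF that] in auto)
  then have "(\<lambda>w. \<Sum>p | p permutes {0..<n}. signof p * ((\<Prod>i=0..<n. f w i (p i)) - (\<Prod>i=0..<n. h w i (p i)))) \<in> O[F](g)"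
    by (intro big_sum_in_bigo) auto
  then show ?thesis unfolding dt_rows by (simp only: sum_subtractf right_diff_distrib)
qed

text \<open>The linear part changes one column at a time; this is the form in which the derivative
  of \<open>W\<close> and the sum \<open>W_tilde\<close> can be recognised in it.\<close>

lemma dt_expand:
  fixes f E :: "'w \<Rightarrow> nat \<Rightarrow> nat \<Rightarrow> complex" and h :: "nat \<Rightarrow> nat \<Rightarrow> complex" and g :: "'w \<Rightarrow> complex"
  assumes g: "g \<in> O[F](\<lambda>_. 1 :: complex)"
    and E: "\<And>i j. i < n \<Longrightarrow> j < n \<Longrightarrow> (\<lambda>w. E w i j) \<in> O[F](g)"
    and d: "\<And>i j. i < n \<Longrightarrow> j < n \<Longrightarrow> (\<lambda>w. f w i j - h i j - E w i j) \<in> O[F](\<lambda>w. g w ^ 2)"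
  shows "(\<lambda>w. dt n (f w) - dt n h
      - (\<Sum>c<n. dt n (\<lambda>i j. if j = c then E w i j else h i j))) \<in> O[F](\<lambda>w. g w ^ 2)"
proof -
  let ?t = "\<lambda>w p. (\<Prod>i=0..<n. f w (p i) i) - (\<Prod>i=0..<n. h (p i) i)
      - (\<Sum>c\<in>{0..<n}. E w (p c) c * (\<Prod>i\<in>{0..<n} - {c}. h (p i) i))"
  have "(\<lambda>w. ?t w p) \<in> O[F](\<lambda>w. g w ^ 2)" if "p permutes {0..<n}" for p
    by (rule prod_expand[OF g]) (use E d permutes_in_image[OF that] in auto)
  then have "(\<lambda>w. \<Sum>p | p permutes {0..<n}. signof p * ?t w p) \<in> O[F](\<lambda>w. g w ^ 2)"
    by (intro big_sum_in_bigo) auto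
  moreover have "dt n (f w) - dt n h - (\<Sum>c<n. dt n (\<lambda>i j. if j = c then E w i j else h i j)) =
      (\<Sum>p | p permutes {0..<n}. signof p * ?t w p)" for w
  proof -
    have "(\<Prod>i=0..<n. if i = c then E w (p i) i else h (p i) i) =
        E w (p c) c * (\<Prod>i\<in>{0..<n} - {c}. h (p i) i)" if "c \<in> {0..<n}" for c p
    proof -
      have "(\<Prod>i=0..<n. if i = c then E w (p i) i else h (p i) i) =
          E w (p c) c * (\<Prod>i\<in>{0..<n} - {c}. if i = c then E w (p i) i else h (p i) i)"
        using that by (subst prod.remove[of _ c]) auto
      also have "(\<Prod>i\<in>{0..<n} - {c}. if i = c then E w (p i) i else h (p i) i) =
          (\<Prod>i\<in>{0..<n} - {c}. h (p i) i)" by (rule prod.cong) auto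
      finally show ?thesis .
    qed
    then have "(\<Sum>c<n. dt n (\<lambda>i j. if j = c then E w i j else h i j)) =
        (\<Sum>c\<in>{0..<n}. \<Sum>p | p permutes {0..<n}. signof p * (E w (p c) c * (\<Prod>i\<in>{0..<n} - {c}. h (p i) i)))"
      unfolding dt_cols by (simp only: atLeast0LessThan cong: sum.cong)
    also have "\<dots> = (\<Sum>p | p permutes {0..<n}. signof p * (\<Sum>c\<in>{0..<n}. E w (p c) c * (\<Prod>i\<in>{0..<n} - {c}. h (p i) i)))"
      by (subst sum.swap) (simp only: sum_distrib_left)
    finally show ?thesis unfolding dt_cols by (simp only: sum_subtractf right_diff_distrib)
  qed
  ultimately show ?thesis by (simp only:)
qed

lemma dt_col_scale:
  assumes "c < n"
  shows "dt n (\<lambda>i j. if j = c then a * A i j else h i j) = a * dt n (\<lambda>i j. if j = c then A i j else h i j)"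
proof -
  have "dt n (\<lambda>i j. if j = c then a * A i j else h i j) =
      dt n (\<lambda>i j. 1 * (if j = c then A i j else h i j) * (if j = c then a else 1))"
    by (rule dt_cong) (simp add: mult.commute)
  also have "\<dots> = a * dt n (\<lambda>i j. if j = c then A i j else h i j)"
    unfolding dt_scale using assms by (simp add: prod.delta)
  finally show ?thesis .
qed

lemma dt_col_add:
  assumes "c < n"
  shows "dt n (\<lambda>i j. if j = c then A i j + B i j else h i j) =
    dt n (\<lambda>i j. if j = c then A i j else h i j) + dt n (\<lambda>i j. if j = c then B i j else h i j)"
proof -
  have *: "(\<Prod>i=0..<n. if i = c then C (p i) i else h (p i) i) =
      C (p c) c * (\<Prod>i\<in>{0..<n} - {c}. h (p i) i)" for C p
  proof -
    have "(\<Prod>i=0..<n. if i = c then C (p i) i else h (p i) i) =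
        C (p c) c * (\<Prod>i\<in>{0..<n} - {c}. if i = c then C (p i) i else h (p i) i)"
      using assms by (subst prod.remove[of _ c]) auto
    also have "(\<Prod>i\<in>{0..<n} - {c}. if i = c then C (p i) i else h (p i) i) =
        (\<Prod>i\<in>{0..<n} - {c}. h (p i) i)" by (rule prod.cong) auto
    finally show ?thesis .
  qed
  show ?thesis unfolding dt_cols *[of A] *[of B] *[of "\<lambda>i j. A i j + B i j"]
    by (simp only: distrib_right distrib_left sum.distrib)
qed

section \<open>Scaling and perturbation of minors\<close>

lemma Dm_scale:
  assumes "finite X" "finite V" "card V = card X"
  shows "Dm X V (\<lambda>_. x) s * e ^ (\<Sum>X) = e ^ (\<Sum>V) * Dm X V (\<lambda>_ r. e ^ r * x r) (\<lambda>r. e ^ r * s r)"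
proof -
  have entry: "schur z (int n - int v) * e ^ n = e ^ v * schur (\<lambda>r. e ^ r * z r) (int n - int v)" for z n v
  proof (cases "v \<le> n")
    case True
    then have "e ^ n = e ^ v * e ^ (n - v)" by (simp flip: power_add)
    then show ?thesis using True by (simp add: schur_diff sch_scale)
  qed (simp add: schur_neg)
  let ?f = "\<lambda>i j. schur (\<lambda>r. x r + of_nat (en V j) * s r) (int (en X i) - int (en V j))"
  let ?f' = "\<lambda>i j. schur (\<lambda>r. e ^ r * x r + of_nat (en V j) * (e ^ r * s r)) (int (en X i) - int (en V j))"
  have "e ^ en X i * ?f i j * 1 = 1 * ?f' i j * e ^ en V j" for i j
    using entry[of "\<lambda>r. x r + of_nat (en V j) * s r" "en X i" "en V j"] by (simp add: algebra_simps)
  then have "dt (card X) (\<lambda>i j. e ^ en X i * ?f i j * 1) = dt (card X) (\<lambda>i j. 1 * ?f' i j * e ^ en V j)"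
    by simp
  moreover have "(\<Prod>i<card X. e ^ en X i) = e ^ (\<Sum>X)" "(\<Prod>i<card X. e ^ en V i) = e ^ (\<Sum>V)"
    using prod_en[OF assms(1), of "\<lambda>v. e ^ v"] prod_en[OF assms(2), of "\<lambda>v. e ^ v"] assms(3)
    by (simp_all add: power_sum)
  ultimately show ?thesis unfolding dt_scale by (simp add: Dm_def mult_ac)
qed

lemma schur_bigo_1:
  fixes x :: "'w \<Rightarrow> nat \<Rightarrow> complex"
  assumes "\<And>r. 1 \<le> r \<Longrightarrow> (\<lambda>w. x w r) \<in> O[F](\<lambda>_. 1 :: complex)"
  shows "(\<lambda>w. schur (x w) (int n - int v)) \<in> O[F](\<lambda>_. 1 :: complex)"
  unfolding schur_diff using sch_bigo_1[of "n - v" x F] assms by (cases "v \<le> n") auto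

lemma schur_perturb:
  fixes x y :: "'w \<Rightarrow> nat \<Rightarrow> complex" and g :: "'w \<Rightarrow> complex"
  assumes "g \<in> O[F](\<lambda>_. 1 :: complex)" "\<And>r. 1 \<le> r \<Longrightarrow> (\<lambda>w. y w r) \<in> O[F](\<lambda>_. 1 :: complex)"
    "\<And>r. 1 \<le> r \<Longrightarrow> (\<lambda>w. x w r - y w r) \<in> O[F](g)"
  shows "(\<lambda>w. schur (x w) (int n - int v) - schur (y w) (int n - int v)) \<in> O[F](g)"
  unfolding schur_diff using sch_perturb[of g F "n - v" y x] assms by (cases "v \<le> n") auto

lemma Dm_bigo_1:
  fixes x :: "'w \<Rightarrow> nat \<Rightarrow> complex"
  assumes "\<And>r. 1 \<le> r \<Longrightarrow> (\<lambda>w. x w r) \<in> O[F](\<lambda>_. 1 :: complex)"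
    "\<And>r. 1 \<le> r \<Longrightarrow> (\<lambda>w. s w r) \<in> O[F](\<lambda>_. 1 :: complex)"
  shows "(\<lambda>w. Dm X V (\<lambda>_. x w) (s w)) \<in> O[F](\<lambda>_. 1 :: complex)"
  unfolding Dm_def
  by (intro dt_bigo_1 schur_bigo_1 sum_in_bigo bigo_1_mult assms) auto

lemma Dm_perturb:
  fixes x y :: "'w \<Rightarrow> nat \<Rightarrow> complex" and g :: "'w \<Rightarrow> complex"
  assumes g: "g \<in> O[F](\<lambda>_. 1 :: complex)" and y: "\<And>r. 1 \<le> r \<Longrightarrow> (\<lambda>w. y w r) \<in> O[F](\<lambda>_. 1 :: complex)"
    and d: "\<And>r. 1 \<le> r \<Longrightarrow> (\<lambda>w. x w r - y w r) \<in> O[F](g)"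
    and s: "\<And>r. 1 \<le> r \<Longrightarrow> (\<lambda>w. s w r) \<in> O[F](g)"
  shows "(\<lambda>w. Dm X V (\<lambda>_. x w) (s w) - Dm X V (\<lambda>_. y w) (\<lambda>_. 0)) \<in> O[F](g)"
  unfolding Dm_def
proof (intro dt_perturb g schur_bigo_1 schur_perturb)
  fix j r assume r: "1 \<le> (r::nat)"
  show "(\<lambda>w. y w r + of_nat (en V j) * 0) \<in> O[F](\<lambda>_. 1 :: complex)" using y[OF r] by simp
  then show "(\<lambda>w. y w r + of_nat (en V j) * 0) \<in> O[F](\<lambda>_. 1 :: complex)" .
  have "(\<lambda>w. (x w r - y w r) + of_nat (en V j) * s w r) \<in> O[F](g)"
    by (intro sum_in_bigo d[OF r] bigo_1_mult s[OF r]) auto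
  then show "(\<lambda>w. x w r + of_nat (en V j) * s w r - (y w r + of_nat (en V j) * 0)) \<in> O[F](g)"
    by (simp add: algebra_simps)
qed

text \<open>Since \<open>e\<close> tends to 0, \<open>g\<close> eventually inherits half of the
  lower bound of \<open>g0\<close>, so the common denominator of the two quotients stays away from
  zero.\<close>

lemma ratio_perturb:
  fixes f g f0 g0 e :: "'w \<Rightarrow> complex"
  assumes e: "(e \<longlongrightarrow> 0) F" and f: "(\<lambda>w. f w - f0 w) \<in> O[F](e)" and g: "(\<lambda>w. g w - g0 w) \<in> O[F](e)"
    and f0: "f0 \<in> O[F](\<lambda>_. 1 :: complex)" and c: "c > 0" "\<forall>\<^sub>F w in F. c \<le> cmod (g0 w)"
    and g0: "g0 \<in> O[F](\<lambda>_. 1 :: complex)"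
  shows "(\<lambda>w. f w / g w - f0 w / g0 w) \<in> O[F](e)"
proof -
  have "e \<in> o[F](\<lambda>_. 1 :: complex)" using e by (intro smalloI_tendsto) simp_all
  from smalloD_tendsto[OF landau_o.big_small_trans[OF g this]]
  have "((\<lambda>w. g w - g0 w) \<longlongrightarrow> 0) F" by simp
  from tendstoD[OF this, of "c / 2"] c have "\<forall>\<^sub>F w in F. cmod (g w - g0 w) < c / 2" by simp
  then have g2: "\<forall>\<^sub>F w in F. c / 2 \<le> cmod (g w) \<and> c \<le> cmod (g0 w)"
    using c(2)
  proof eventually_elim
    case (elim w)
    have "cmod (g0 w) \<le> cmod (g w - g0 w) + cmod (g w)"
      by (metis norm_minus_commute norm_triangle_sub add.commute)
    then show ?case using elim by linarith
  qed
  have inv: "(\<lambda>w. 1 / (g w * g0 w)) \<in> O[F](\<lambda>_. 1 :: complex)"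
  proof (rule bigoI[where c = "1 / (c / 2 * c)"])
    show "\<forall>\<^sub>F w in F. cmod (1 / (g w * g0 w)) \<le> 1 / (c / 2 * c) * cmod 1"
      using g2
    proof eventually_elim
      case (elim w)
      have "c / 2 * c \<le> cmod (g w) * cmod (g0 w)" using elim c(1) by (intro mult_mono) auto
      then have "1 / (cmod (g w) * cmod (g0 w)) \<le> 1 / (c / 2 * c)"
        using c(1) by (intro frac_le) auto
      then show ?case by (simp add: norm_divide norm_mult)
    qed
  qed
  have m: "(\<lambda>w. ((f w - f0 w) * g0 w - f0 w * (g w - g0 w)) * (1 / (g w * g0 w))) \<in> O[F](e)"
    by (intro bigo_mult_1 inv sum_in_bigo(2) f g0 bigo_1_mult f0 g)
  have ev: "\<forall>\<^sub>F w in F. f w / g w - f0 w / g0 w = ((f w - f0 w) * g0 w - f0 w * (g w - g0 w)) * (1 / (g w * g0 w))"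
    using g2
  proof eventually_elim
    case (elim w)
    then have "g w \<noteq> 0" "g0 w \<noteq> 0" using c(1) by auto
    then show ?case by (simp add: field_simps)
  qed
  show ?thesis by (rule iffD2[OF landau_o.big.in_cong[OF ev] m])
qed

section \<open>The integers \<open>N\<^sub>i\<close> as residue counts of a core\<close>

lemma le_div_iff_mult_le:
  fixes b s z :: int
  assumes b: "0 < b"
  shows "s \<le> z div b \<longleftrightarrow> s * b \<le> z"
proof
  assume "s \<le> z div b"
  then have "s * b \<le> z div b * b" using b by (intro mult_right_mono) auto
  also have "\<dots> \<le> z" using pos_mod_sign[OF b, of z] div_mult_mod_eq[of z b] by linarith
  finally show "s * b \<le> z" .
next
  assume "s * b \<le> z"
  then have "s * b div b \<le> z div b" using b by (intro zdiv_mono1)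
  then show "s \<le> z div b" using b by simp
qed

text \<open>Following the multiples \<open>l + n k\<close> modulo \<open>m = m\<^sub>1 k + m\<^sub>0\<close> from residue to residue: the pass number
  \<open>s\<close> through \<open>{0..m-1}\<close> starts at \<open>q = l + t k - s m\<^sub>0\<close>, where \<open>t\<close> is the number of passes before it that
  had \<open>m\<^sub>1 + 1\<close> elements instead of \<open>m\<^sub>1\<close>, and it starts with \<open>n = s m\<^sub>1 + t\<close>.\<close>

lemma passes:
  fixes m k l N0 q i :: int
  defines "m1 \<equiv> m div k" and "m0 \<equiv> m mod k"
  assumes k: "0 < k" and m: "0 < m" and l: "0 \<le> l" "l < k" and q: "0 \<le> q" "q < k" and i: "0 \<le> i"
  shows "(\<exists>n. 0 \<le> n \<and> n < N0 \<and> (l + n * k) mod m = q + i * k) \<longleftrightarrow>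
    i < m1 + (if q < m0 then 1 else 0) \<and>
    (\<exists>s t. 0 \<le> s \<and> 0 \<le> t \<and> q = l + t * k - s * m0 \<and> s * m1 + t + i < N0)"
proof -
  have m_eq: "m = m1 * k + m0" by (simp add: m1_def m0_def)
  have m0: "0 \<le> m0" "m0 < k" using k by (simp_all add: m0_def)
  \<comment> \<open>The number of places \<open>q, q + k, ...\<close> below \<open>m\<close> is
    \<open>m1\<close>, and one more if \<open>q < m0\<close>.\<close>
  have small: "q + i * k < m \<longleftrightarrow> i < m1 + (if q < m0 then 1 else 0)"
  proof
    assume *: "q + i * k < m"
    show "i < m1 + (if q < m0 then 1 else 0)"
    proof (rule ccontr)
      assume "\<not> ?thesis"
      then have "m1 + (if q < m0 then 1 else 0) \<le> i" by simp
      then have "(m1 + (if q < m0 then 1 else 0)) * k \<le> i * k" using k by (intro mult_right_mono) auto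
      then show False using * m0 q unfolding m_eq by (auto simp: distrib_right split: if_splits)
    qed
  next
    assume *: "i < m1 + (if q < m0 then 1 else 0)"
    show "q + i * k < m"
    proof (cases "i < m1")
      case True
      then have "(i + 1) * k \<le> m1 * k" using k by (intro mult_right_mono) auto
      then show ?thesis using q m0 unfolding m_eq by (simp add: distrib_right)
    next
      case False
      then have "i = m1" "q < m0" using * by (auto split: if_splits)
      then show ?thesis unfolding m_eq by simp
    qed
  qed
  have "(\<exists>n. 0 \<le> n \<and> n < N0 \<and> (l + n * k) mod m = q + i * k) \<longleftrightarrow> q + i * k < m \<and>
    (\<exists>s t. 0 \<le> s \<and> 0 \<le> t \<and> q = l + t * k - s * m0 \<and> s * m1 + t + i < N0)"
  proof
    assume "\<exists>n. 0 \<le> n \<and> n < N0 \<and> (l + n * k) mod m = q + i * k"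
    then obtain n where n: "0 \<le> n" "n < N0" "(l + n * k) mod m = q + i * k" by blast
    define s where "s = (l + n * k) div m"
    have s0: "0 \<le> s" using n(1) k l m by (simp add: s_def pos_imp_zdiv_nonneg_iff)
    have e: "l + n * k = s * m + (q + i * k)" unfolding s_def n(3)[symmetric] by simp
    \<comment> \<open>\<open>s\<close> counts the completed passes and \<open>i\<close> the steps
      within the current one, so \<open>t\<close> is the surplus collected in the earlier passes. A
      negative \<open>t\<close> would force \<open>q < 0\<close>.\<close>
    define t where "t = n - s * m1 - i"
    have qe: "q = l + t * k - s * m0" using e unfolding m_eq t_def by (simp add: algebra_simps)
    have t0: "0 \<le> t"
    proof (rule ccontr)
      assume "\<not> 0 \<le> t"
      then have "t * k \<le> -1 * k" using k by (intro mult_right_mono) auto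
      moreover have "0 \<le> s * m0" using s0 m0 by simp
      ultimately show False using qe q l by linarith
    qed
    have "s * m1 + t + i < N0" using n(2) by (simp add: t_def)
    moreover have "q + i * k < m" using n(3) m by (metis pos_mod_bound)
    ultimately show "q + i * k < m \<and> (\<exists>s t. 0 \<le> s \<and> 0 \<le> t \<and> q = l + t * k - s * m0 \<and> s * m1 + t + i < N0)"
      using s0 t0 qe by blast
  next
    assume *: "q + i * k < m \<and> (\<exists>s t. 0 \<le> s \<and> 0 \<le> t \<and> q = l + t * k - s * m0 \<and> s * m1 + t + i < N0)"
    then obtain s t where st: "0 \<le> s" "0 \<le> t" "q = l + t * k - s * m0" "s * m1 + t + i < N0" by blast
    have "l + (s * m1 + t + i) * k = (q + i * k) + s * m"
      unfolding st(3) m_eq by (simp add: algebra_simps)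
    then have "(l + (s * m1 + t + i) * k) mod m = (q + i * k) mod m" by simp
    also have "\<dots> = q + i * k" using * q i k by (intro mod_pos_pos_trivial) auto
    finally have "(l + (s * m1 + t + i) * k) mod m = q + i * k" .
    moreover have "0 \<le> m1" using m k by (simp add: m1_def pos_imp_zdiv_nonneg_iff)
    ultimately show "\<exists>n. 0 \<le> n \<and> n < N0 \<and> (l + n * k) mod m = q + i * k"
      using st i by (intro exI[of _ "s * m1 + t + i"]) auto
  qed
  then show ?thesis unfolding small .
qed

text \<open>The first \<open>N mod (m div gcd m k)\<close> members of \<open>l, l + k, ...\<close>,
  reduced modulo \<open>m\<close>, are sorted by their class mod \<open>k\<close>. In each class
  they fill an initial segment \<open>q, q + k, ...\<close>, and \<open>N_hat\<close> is its length;
  the equivalence contains both facts.\<close>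

lemma N_hat_count:
  fixes m k l N q i :: int
  assumes k: "0 < k" and m: "0 < m" and ndvd: "\<not> k dvd m" and l: "0 \<le> l" "l < k"
    and N: "0 \<le> N" and q: "0 \<le> q" "q < k"
  shows "0 \<le> N_hat m k l N q"
    "0 \<le> i \<Longrightarrow> i < N_hat m k l N q \<longleftrightarrow>
      (\<exists>n. 0 \<le> n \<and> n < N mod (m div gcd m k) \<and> (l + n * k) mod m = q + i * k)"
proof -
  define d m1 m0 N0 where "d = gcd m k" and "m1 = m div k" and "m0 = m mod k" and "N0 = N mod (m div d)"
  \<comment> \<open>The last pass number possible for a given \<open>t\<close>: the start
    \<open>l + t * k - s * m0\<close> is non-negative iff \<open>s \<le> sg t\<close>. For
    \<open>s = sg t\<close> it is below \<open>m0\<close>, and the pass is a long one with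
    \<open>m1 + 1\<close> elements.\<close>
  define sg where "sg t = (l + t * k) div m0" for t
  have m0: "0 < m0" "m0 < k" using k ndvd pos_mod_sign[OF k, of m] pos_mod_bound[OF k, of m]
    by (auto simp: m0_def dvd_eq_mod_eq_0 less_le)
  have m1: "0 \<le> m1" using m k by (simp add: m1_def pos_imp_zdiv_nonneg_iff)
  have d: "0 < d" "d dvd m" "d dvd k" using k by (auto simp: d_def)
  then have mh: "0 < m div d" using m by (simp add: pos_imp_zdiv_pos_iff zdvd_imp_le)
  have N0: "0 \<le> N0" "N0 < m div d" using mh by (auto simp: N0_def)
  have sgI: "s \<le> sg t \<longleftrightarrow> s * m0 \<le> l + t * k" for s t
    unfolding sg_def by (rule le_div_iff_mult_le[OF m0(1)])
  have sg0: "0 \<le> sg 0" using l by (simp add: sgI)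
  have sg_mono: "sg t \<le> sg t'" if "t \<le> t'" for t t'
    unfolding sg_def using that m0 k by (intro zdiv_mono1) (auto intro: mult_right_mono)
  have sg_step: "sg (t - 1) < s" if "l + t * k - s * m0 < k" for s t
  proof (rule ccontr)
    assume "\<not> ?thesis"
    then have "s \<le> sg (t - 1)" by simp
    then have "s * m0 \<le> l + (t - 1) * k" by (simp only: sgI)
    then show False using that by (simp add: algebra_simps)
  qed
  have sg_mod: "q = l + t * k - s * m0 \<Longrightarrow> q < m0 \<Longrightarrow> s = sg t" for s t
  proof -
    assume *: "q = l + t * k - s * m0" "q < m0"
    have "s \<le> sg t" using * q by (simp add: sgI)
    moreover have "\<not> s + 1 \<le> sg t" using * by (simp add: sgI distrib_right)
    ultimately show "s = sg t" by linarith
  qed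
  have mod_sg: "(l + t * k) mod m0 = l + t * k - sg t * m0" for t
    unfolding sg_def by (simp add: minus_div_mult_eq_mod)
  let ?S = "\<lambda>i s t. 0 \<le> s \<and> 0 \<le> t \<and> q = l + t * k - s * m0 \<and> s * m1 + t + i < N0"
  have SI: "i < m1 + (if q < m0 then 1 else 0) \<and> (\<exists>s t. ?S i s t)"
    if S: "?S i s t" and i: "i < m1" for i s t
  proof (rule conjI)
    show "i < m1 + (if q < m0 then 1 else 0)" using i by simp
    show "\<exists>s t. ?S i s t" using S by blast
  qed
  have char: "(\<exists>n. 0 \<le> n \<and> n < N0 \<and> (l + n * k) mod m = q + i * k) \<longleftrightarrow>
      i < m1 + (if q < m0 then 1 else 0) \<and> (\<exists>s t. ?S i s t)" if "0 \<le> i" for i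
    using passes[OF k m l q that, of N0] unfolding m1_def m0_def .
  note defs = N_hat_def Let_def d_def[symmetric] m1_def[symmetric] m0_def[symmetric] N0_def[symmetric]
  have main: "0 \<le> N_hat m k l N q \<and> (\<forall>i\<ge>0. i < N_hat m k l N q \<longleftrightarrow>
      i < m1 + (if q < m0 then 1 else 0) \<and> (\<exists>s t. ?S i s t))"
  proof (cases "N0 < (l div m0) * m1 + m1 + 1")
    case I: True
    have l0: "l div m0 = sg 0" by (simp add: sg_def)
    \<comment> \<open>In Case I the first long pass, number \<open>sg 0\<close>, is not completed,
      so no pass with \<open>t \<ge> 1\<close> is reached.\<close>
    have t0: "t = 0 \<and> s \<le> sg 0" if "?S i s t" "0 \<le> i" for i s t
    proof -
      have "t = 0"
      proof (rule ccontr)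
        assume "t \<noteq> 0"
        then have "1 \<le> t" using that by auto
        then have "sg 0 \<le> sg (t - 1)" by (intro sg_mono) auto
        also have "sg (t - 1) < s" by (rule sg_step) (use that q in auto)
        finally have "(sg 0 + 1) * m1 \<le> s * m1" using m1 by (intro mult_right_mono) auto
        then show False using I that \<open>1 \<le> t\<close> by (simp add: l0 distrib_right)
      qed
      then show ?thesis using that q by (auto simp: sgI)
    qed
    show ?thesis
    proof (cases "m1 = 0")
      case True
      then have "N0 = 0" using I N0 by simp
      then show ?thesis using True I by (auto simp: defs)
    next
      case False
      then have m1p: "0 < m1" using m1 by simp
      show ?thesis
      proof (cases "\<exists>j. 1 \<le> j \<and> j \<le> N0 div m1 \<and> q = l - (j - 1) * m0")
        case A: True
        then obtain j where j: "1 \<le> j" "j \<le> N0 div m1" "q = l - (j - 1) * m0" by blast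
        have jm: "j * m1 \<le> N0" using j(2) le_div_iff_mult_le[OF m1p] by blast
        have H: "N_hat m k l N q = m1" using I False A by (simp add: defs)
        have "i < m1 \<longleftrightarrow> i < m1 + (if q < m0 then 1 else 0) \<and> (\<exists>s t. ?S i s t)" if i: "0 \<le> i" for i
        proof
          assume "i < m1"
          then have "?S i (j - 1) 0" using j jm by (simp add: left_diff_distrib)
          from this \<open>i < m1\<close> show "i < m1 + (if q < m0 then 1 else 0) \<and> (\<exists>s t. ?S i s t)" by (rule SI)
        next
          assume *: "i < m1 + (if q < m0 then 1 else 0) \<and> (\<exists>s t. ?S i s t)"
          then obtain s t where st: "?S i s t" by blast
          show "i < m1"
          proof (rule ccontr)
            assume "\<not> i < m1"
            then have "i = m1" "q < m0" using * by (auto split: if_splits)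
            then have "s = sg 0" using t0[OF st i] st sg_mod[of 0 s] by auto
            then show False using st t0[OF st i] I \<open>i = m1\<close> by (simp add: l0)
          qed
        qed
        then show ?thesis unfolding H using m1 by blast
      next
        case notA: False
        \<comment> \<open>\<open>s0\<close> passes contribute \<open>m1\<close> elements each; pass
          number \<open>s0\<close> gets the remainder.\<close>
        define s0 where "s0 = N0 div m1"
        have s0: "0 \<le> s0" using N0 m1p by (simp add: s0_def pos_imp_zdiv_nonneg_iff)
        have Ns: "N0 = s0 * m1 + N0 mod m1" by (simp add: s0_def)
        have uniq: "s = s0" if "?S i s t" "0 \<le> i" for i s t
        proof -
          have t: "t = 0" using t0[OF that] by simp
          have "s * m1 \<le> N0" using that t by simp
          then have "s \<le> s0" using le_div_iff_mult_le[OF m1p] by (simp add: s0_def)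
          moreover have "\<not> s + 1 \<le> s0"
          proof
            assume "s + 1 \<le> s0"
            then have "1 \<le> s + 1 \<and> s + 1 \<le> N0 div m1 \<and> q = l - (s + 1 - 1) * m0"
              using that t by (simp add: s0_def)
            with notA show False by blast
          qed
          ultimately show ?thesis by linarith
        qed
        have H: "N_hat m k l N q = (if q = l - s0 * m0 then N0 mod m1 else 0)"
          by (simp only: defs s0_def I if_True False notA if_False not_False_eq_True)
        show ?thesis
        proof (cases "q = l - s0 * m0")
          case True
          have "i < N0 mod m1 \<longleftrightarrow> i < m1 + (if q < m0 then 1 else 0) \<and> (\<exists>s t. ?S i s t)" if i: "0 \<le> i" for i
          proof
            assume *: "i < N0 mod m1"
            then have "?S i s0 0" using s0 True Ns by simp
            moreover have "i < m1" using * pos_mod_bound[OF m1p, of N0] by linarith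
            ultimately show "i < m1 + (if q < m0 then 1 else 0) \<and> (\<exists>s t. ?S i s t)" by (rule SI)
          next
            assume "i < m1 + (if q < m0 then 1 else 0) \<and> (\<exists>s t. ?S i s t)"
            then obtain s t where st: "?S i s t" by blast
            have "s = s0" "t = 0" using uniq[OF st i] t0[OF st i] by blast+
            with st have "s0 * m1 + i < N0" by simp
            then show "i < N0 mod m1" using Ns by linarith
          qed
          moreover have "0 \<le> N0 mod m1" using m1p by simp
          ultimately show ?thesis using True unfolding H by simp
        next
          case False
          have none: "\<not> (\<exists>s t. ?S i s t)" if i: "0 \<le> i" for i
          proof
            assume "\<exists>s t. ?S i s t"
            then obtain s t where S: "?S i s t" by blast
            have "s = s0" "t = 0" using uniq[OF S i] t0[OF S i] by blast+
            with S False show False by simp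
          qed
          have "N_hat m k l N q = 0" unfolding H using False by simp
          then show ?thesis using none by (simp only:) auto
        qed
      qed
    qed
  next
    case II: False
    \<comment> \<open>Pass number \<open>sg t\<close> is long and starts with step
      \<open>sg t * m1 + t\<close>, so it is completed after \<open>g t\<close> steps. The
      \<open>r\<close> of the procedure counts the long passes completed within \<open>N0\<close>
      steps.\<close>
    define g where "g t = sg t * m1 + m1 + t + 1" for t
    have g_mono: "g t < g t'" if "t < t'" for t t'
      using mult_right_mono[OF sg_mono[of t t'] m1] that by (simp add: g_def)
    have g0: "g 0 \<le> N0" using II by (simp add: g_def sg_def)
    \<comment> \<open>The residues have period \<open>m div d\<close>, which comprises
      \<open>k div d\<close> passes, \<open>m0 div d\<close> of them long. As \<open>N0\<close> is
      smaller than the period, \<open>r\<close> is at most \<open>m0 div d\<close>.\<close>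
    have g_end: "N0 < g (m0 div d)"
    proof -
      have dm0: "d dvd m0" unfolding m0_def using d by (simp add: dvd_mod_iff)
      have "k div d \<le> sg (m0 div d)"
      proof -
        have "(k div d) * m0 = (m0 div d) * k"
          using d(3) dm0 by (metis div_mult_swap dvd_div_mult mult.commute)
        then show ?thesis unfolding sgI using l by simp
      qed
      then have "(k div d) * m1 \<le> sg (m0 div d) * m1" using m1 by (intro mult_right_mono)
      moreover have "m div d = (k div d) * m1 + m0 div d"
      proof -
        have "m = k * m1 + m0" by (simp add: m1_def m0_def)
        then have "m div d = (k * m1 + m0) div d" by simp
        also have "\<dots> = (k * m1) div d + m0 div d" using d dm0 by (intro div_plus_div_distrib_dvd_right)
        also have "(k * m1) div d = (k div d) * m1" using d by (simp add: dvd_div_mult)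
        finally show ?thesis .
      qed
      ultimately show ?thesis using N0 m1 unfolding g_def by linarith
    qed
    define r where "r = int (LEAST t. N0 < g (int t))"
    have m0d: "0 \<le> m0 div d" using m0 d by (simp add: pos_imp_zdiv_nonneg_iff)
    have ex: "N0 < g (int (nat (m0 div d)))" using g_end m0d by simp
    have r1: "N0 < g r" unfolding r_def by (rule LeastI[of "\<lambda>t. N0 < g (int t)", OF ex])
    have rle: "r \<le> m0 div d"
      unfolding r_def using Least_le[of "\<lambda>t. N0 < g (int t)", OF ex] m0d by linarith
    have r0: "1 \<le> r"
    proof (rule ccontr)
      assume "\<not> 1 \<le> r"
      then have "r = 0" by (simp add: r_def)
      then show False using r1 g0 by simp
    qed
    have r2: "g (r - 1) \<le> N0"
    proof (rule ccontr)
      assume "\<not> g (r - 1) \<le> N0"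
      then have "N0 < g (int (nat (r - 1)))" using r0 by simp
      then have "(LEAST t. N0 < g (int t)) \<le> nat (r - 1)" by (rule Least_le)
      then show False using r0 by (simp add: r_def)
    qed
    \<comment> \<open>\<open>g\<close> is strictly increasing, so \<open>N0\<close> lies between
      consecutive values for one \<open>r\<close> only.\<close>
    have rthe: "(THE r. 1 \<le> r \<and> r \<le> m0 div d \<and>
                   ((l + (r - 1) * k) div m0) * m1 + m1 + r \<le> N0 \<and>
                   N0 < ((l + r * k) div m0) * m1 + m1 + r + 1) = r"
    proof (rule the_equality)
      show "1 \<le> r \<and> r \<le> m0 div d \<and> ((l + (r - 1) * k) div m0) * m1 + m1 + r \<le> N0 \<and>
          N0 < ((l + r * k) div m0) * m1 + m1 + r + 1"
        using r0 rle r1 r2 by (simp add: g_def sg_def)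
    next
      fix r' assume "1 \<le> r' \<and> r' \<le> m0 div d \<and> ((l + (r' - 1) * k) div m0) * m1 + m1 + r' \<le> N0 \<and>
          N0 < ((l + r' * k) div m0) * m1 + m1 + r' + 1"
      then have r': "g (r' - 1) \<le> N0" "N0 < g r'" by (simp_all add: g_def sg_def)
      have "\<not> r < r'" using g_mono[of r "r' - 1"] r' r1 by (cases "r = r' - 1") auto
      moreover have "\<not> r' < r" using g_mono[of r' "r - 1"] r' r2 by (cases "r' = r - 1") auto
      ultimately show "r' = r" by linarith
    qed
    have tr: "t \<le> r \<and> s \<le> sg t \<and> (1 \<le> t \<longrightarrow> sg (t - 1) < s)" if "?S i s t" "0 \<le> i" for i s t
    proof -
      have step: "sg (t - 1) < s" by (rule sg_step) (use that q in auto)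
      have "t \<le> r"
      proof (rule ccontr)
        assume "\<not> t \<le> r"
        then have "sg r \<le> sg (t - 1)" by (intro sg_mono) auto
        then have "(sg r + 1) * m1 \<le> s * m1" using step m1 by (intro mult_right_mono) auto
        then show False using r1 that \<open>\<not> t \<le> r\<close> by (simp add: g_def distrib_right)
      qed
      then show ?thesis using that q step by (auto simp: sgI)
    qed
    let ?A = "\<exists>j. 1 \<le> j \<and> j \<le> r \<and> q = (l + (j - 1) * k) mod m0"
    have gr: "sg t * m1 + t + m1 + 1 \<le> N0" if "t \<le> r - 1" for t
    proof -
      have "g t \<le> g (r - 1)" using g_mono[of t "r - 1"] that by (cases "t = r - 1") auto
      then show ?thesis using r2 by (simp add: g_def)
    qed
    show ?thesis
    proof (cases "m1 = 0")
      case True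
      have mk: "m = m0" using True by (metis add_0 m1_def m0_def mult_zero_left div_mult_mod_eq)
      have H: "N_hat m k l N q = (if \<exists>j. 1 \<le> j \<and> j \<le> N0 \<and> q = (l + (j - 1) * k) mod m then 1 else 0)"
        using II True by (simp add: defs)
      have "i < N_hat m k l N q \<longleftrightarrow> i < m1 + (if q < m0 then 1 else 0) \<and> (\<exists>s t. ?S i s t)" if i: "0 \<le> i" for i
      proof -
        have "i < N_hat m k l N q \<longleftrightarrow> i = 0 \<and> (\<exists>j. 1 \<le> j \<and> j \<le> N0 \<and> q = (l + (j - 1) * k) mod m)"
          unfolding H using i by auto
        also have "\<dots> \<longleftrightarrow> i = 0 \<and> (\<exists>n. 0 \<le> n \<and> n < N0 \<and> (l + n * k) mod m = q + i * k)"
        proof (intro conj_cong refl iffI; elim exE conjE)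
          fix j assume "i = 0" "1 \<le> j" "j \<le> N0" "q = (l + (j - 1) * k) mod m"
          then show "\<exists>n. 0 \<le> n \<and> n < N0 \<and> (l + n * k) mod m = q + i * k" by (intro exI[of _ "j - 1"]) auto
        next
          fix n assume "i = 0" "0 \<le> n" "n < N0" "(l + n * k) mod m = q + i * k"
          then show "\<exists>j. 1 \<le> j \<and> j \<le> N0 \<and> q = (l + (j - 1) * k) mod m" by (intro exI[of _ "n + 1"]) auto
        qed
        also have "\<dots> \<longleftrightarrow> (\<exists>n. 0 \<le> n \<and> n < N0 \<and> (l + n * k) mod m = q + i * k)"
          unfolding char[OF i] using True i by (auto split: if_splits)
        finally show ?thesis unfolding char[OF i] .
      qed
      then show ?thesis unfolding H by auto
    next
      case False
      then have m1p: "0 < m1" using m1 by simp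
      let ?B = "(\<exists>j. 1 \<le> j \<and> j \<le> l div m0 \<and> q = l - (j - 1) * m0)
                 \<or> (\<exists>t j. 1 \<le> t \<and> t \<le> r - 1 \<and> (l + (t - 1) * k) div m0 + 1 < j \<and>
                      j \<le> (l + t * k) div m0 \<and> q = l + t * k - (j - 1) * m0)
                 \<or> (\<exists>j. (l + (r - 1) * k) div m0 + 1 < j \<and> j \<le> (N0 - r) div m1 \<and>
                      q = l + r * k - (j - 1) * m0)"
      define s0 where "s0 = (N0 - r) div m1"
      have H: "N_hat m k l N q = (if ?A then m1 + 1 else if ?B then m1
          else if q = l + r * k - s0 * m0 then (N0 - r) mod m1 else 0)"
        by (simp only: defs s0_def II False if_False rthe not_False_eq_True if_True)
      have Ns: "N0 = s0 * m1 + (N0 - r) mod m1 + r" by (simp add: s0_def)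
      \<comment> \<open>A start that belongs to neither family comes after the last completed long
        pass, hence has \<open>t = r\<close>.\<close>
      have noA: "t = r \<and> sg (r - 1) < s" if "\<not> ?A" "\<not> ?B" "?S i s t" "0 \<le> i" for i s t
      proof -
        note tr = tr[OF that(3,4)]
        have "t = r"
        proof (rule ccontr)
          assume "t \<noteq> r"
          then have t: "t \<le> r - 1" using tr by linarith
          show False
          proof (cases "s = sg t")
            case True
            then have "1 \<le> t + 1 \<and> t + 1 \<le> r \<and> q = (l + (t + 1 - 1) * k) mod m0"
              using that(3) t by (simp add: mod_sg)
            then show False using that(1) by blast
          next
            case False
            then have s: "s + 1 \<le> sg t" using tr by linarith
            show False
            proof (cases "t = 0")
              case True
              then have "1 \<le> s + 1 \<and> s + 1 \<le> l div m0 \<and> q = l - (s + 1 - 1) * m0"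
                using that(3) s by (simp add: sg_def)
              then show False using that(2) by blast
            next
              case False
              then have "1 \<le> t \<and> t \<le> r - 1 \<and> (l + (t - 1) * k) div m0 + 1 < s + 1 \<and>
                  s + 1 \<le> (l + t * k) div m0 \<and> q = l + t * k - (s + 1 - 1) * m0"
                using that(3) s t tr by (simp add: sg_def)
              then show False using that(2) by blast
            qed
          qed
        qed
        then show ?thesis using tr r0 by auto
      qed
      show ?thesis
      proof (cases ?A)
        case A: True
        then obtain j where j: "1 \<le> j" "j \<le> r" "q = (l + (j - 1) * k) mod m0" by blast
        have qj: "q < m0" "q = l + (j - 1) * k - sg (j - 1) * m0"
          using j(3) m0 by (auto simp: mod_sg[symmetric])
        have SA: "?S i (sg (j - 1)) (j - 1)" if "0 \<le> i" "i \<le> m1" for i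
        proof (intro conjI)
          show "0 \<le> sg (j - 1)" using sg0 sg_mono[of 0 "j - 1"] j(1) by linarith
          show "sg (j - 1) * m1 + (j - 1) + i < N0" using gr[of "j - 1"] j(2) that by linarith
        qed (use j(1) qj(2) in auto)
        have "i < m1 + 1 \<longleftrightarrow> i < m1 + (if q < m0 then 1 else 0) \<and> (\<exists>s t. ?S i s t)" if i: "0 \<le> i" for i
        proof
          assume *: "i < m1 + 1"
          then have "\<exists>s t. ?S i s t" using SA[OF i] by (metis zle_add1_eq_le)
          then show "i < m1 + (if q < m0 then 1 else 0) \<and> (\<exists>s t. ?S i s t)"
            using * qj(1) by (simp only: if_True)
        qed (use qj(1) in \<open>simp only: if_True\<close>)
        moreover have "N_hat m k l N q = m1 + 1" unfolding H by (simp only: A if_True)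
        ultimately show ?thesis using m1 by (simp only:) auto
      next
        case notA: False
        show ?thesis
        proof (cases ?B)
          case B: True
          have "\<exists>s t. 0 \<le> s \<and> 0 \<le> t \<and> q = l + t * k - s * m0 \<and> s * m1 + m1 + t \<le> N0"
          proof -
            have 1: "\<exists>s t. 0 \<le> s \<and> 0 \<le> t \<and> q = l + t * k - s * m0 \<and> s * m1 + m1 + t \<le> N0"
              if "0 \<le> t" "t \<le> r - 1" "1 \<le> j" "j \<le> sg t" "q = l + t * k - (j - 1) * m0" for t j
            proof -
              have "(j - 1) * m1 + m1 \<le> sg t * m1"
                using mult_right_mono[OF that(4) m1] by (simp add: left_diff_distrib)
              then show ?thesis using gr[OF that(2)] that m1 by (intro exI[of _ "j - 1"] exI[of _ t]) auto
            qed
            from B show ?thesis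
            proof (elim disjE exE conjE)
              fix j assume "1 \<le> j" "j \<le> l div m0" "q = l - (j - 1) * m0"
              then show ?thesis using 1[of 0 j] r0 by (simp add: sg_def)
            next
              fix t j assume *: "1 \<le> t" "t \<le> r - 1" "(l + (t - 1) * k) div m0 + 1 < j"
                "j \<le> (l + t * k) div m0" "q = l + t * k - (j - 1) * m0"
              have "0 \<le> sg (t - 1)" using sg0 sg_mono[of 0 "t - 1"] *(1) by linarith
              then show ?thesis using 1[of t j] * by (simp add: sg_def)
            next
              fix j assume *: "(l + (r - 1) * k) div m0 + 1 < j" "j \<le> (N0 - r) div m1" "q = l + r * k - (j - 1) * m0"
              have "0 \<le> sg (r - 1)" using sg0 sg_mono[of 0 "r - 1"] r0 by linarith
              moreover have "j * m1 \<le> N0 - r" using *(2) le_div_iff_mult_le[OF m1p] by blast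
              ultimately show ?thesis using * r0
                by (intro exI[of _ "j - 1"] exI[of _ r]) (auto simp: left_diff_distrib sg_def)
            qed
          qed
          then obtain s t where st: "0 \<le> s" "0 \<le> t" "q = l + t * k - s * m0" "s * m1 + m1 + t \<le> N0" by blast
          have "i < m1 \<longleftrightarrow> i < m1 + (if q < m0 then 1 else 0) \<and> (\<exists>s t. ?S i s t)" if i: "0 \<le> i" for i
          proof
            assume "i < m1"
            then have "?S i s t" using st by auto
            from this \<open>i < m1\<close> show "i < m1 + (if q < m0 then 1 else 0) \<and> (\<exists>s t. ?S i s t)" by (rule SI)
          next
            assume *: "i < m1 + (if q < m0 then 1 else 0) \<and> (\<exists>s t. ?S i s t)"
            then obtain s' t' where S: "?S i s' t'" by blast
            show "i < m1"
            proof (rule ccontr)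
              assume "\<not> i < m1"
              then have im: "i = m1" "q < m0" using * by (auto split: if_splits)
              then have s': "s' = sg t'" using S sg_mod by blast
              have "t' < r"
              proof (rule ccontr)
                assume "\<not> t' < r"
                then have "g r \<le> g t'" using g_mono[of r t'] by (cases "r = t'") auto
                then show False using r1 S im s' by (simp add: g_def)
              qed
              then have "1 \<le> t' + 1 \<and> t' + 1 \<le> r \<and> q = (l + (t' + 1 - 1) * k) mod m0"
                using S s' by (simp add: mod_sg)
              then show False using notA by blast
            qed
          qed
          moreover have "N_hat m k l N q = m1" unfolding H by (simp only: notA B if_False if_True)
          ultimately show ?thesis using m1 by (simp only:) blast
        next
          case notB: False
          have nn: "0 \<le> (N0 - r) mod m1" "(N0 - r) mod m1 < m1" using m1p by simp_all
          have uniq: "t = r \<and> s = s0" if S: "?S i s t" and i: "0 \<le> i" for i s t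
          proof -
            have t: "t = r" and s: "sg (r - 1) < s" using noA[OF notA notB S i] by auto
            have "s * m1 \<le> N0 - r" using S t i by linarith
            then have "s \<le> s0" using le_div_iff_mult_le[OF m1p] by (simp add: s0_def)
            moreover have "\<not> s + 1 \<le> s0"
            proof
              assume "s + 1 \<le> s0"
              then have "(l + (r - 1) * k) div m0 + 1 < s + 1 \<and> s + 1 \<le> (N0 - r) div m1 \<and>
                  q = l + r * k - (s + 1 - 1) * m0"
                using s S t by (simp add: s0_def sg_def)
              with notB show False by blast
            qed
            ultimately show ?thesis using t by linarith
          qed
          show ?thesis
          proof (cases "q = l + r * k - s0 * m0")
            case True
            have s00: "0 \<le> s0"
            proof -
              have "sg (r - 1) < s0" by (rule sg_step) (use True q in auto)
              then show ?thesis using sg0 sg_mono[of 0 "r - 1"] r0 by linarith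
            qed
            have "i < (N0 - r) mod m1 \<longleftrightarrow> i < m1 + (if q < m0 then 1 else 0) \<and> (\<exists>s t. ?S i s t)" if i: "0 \<le> i" for i
            proof
              assume *: "i < (N0 - r) mod m1"
              then have "?S i s0 r" using s00 True Ns r0 by auto
              moreover have "i < m1" using * nn by linarith
              ultimately show "i < m1 + (if q < m0 then 1 else 0) \<and> (\<exists>s t. ?S i s t)" by (rule SI)
            next
              assume "i < m1 + (if q < m0 then 1 else 0) \<and> (\<exists>s t. ?S i s t)"
              then obtain s t where st: "?S i s t" by blast
              have "s = s0" "t = r" using uniq[OF st i] by blast+
              with st have "s0 * m1 + r + i < N0" by simp
              then show "i < (N0 - r) mod m1" using Ns by linarith
            qed
            moreover have "N_hat m k l N q = (N0 - r) mod m1"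
              unfolding H if_not_P[OF notA] if_not_P[OF notB] if_P[OF True] ..
            ultimately show ?thesis using nn by (simp only:) blast
          next
            case False
            have none: "\<not> (\<exists>s t. ?S i s t)" if i: "0 \<le> i" for i
            proof
              assume "\<exists>s t. ?S i s t"
              then obtain s t where S: "?S i s t" by blast
              have "s = s0" "t = r" using uniq[OF S i] by blast+
              with S False show False by simp
            qed
            have "N_hat m k l N q = 0" unfolding H by (simp only: notA notB False if_False)
            then show ?thesis using none by (simp only:) auto
          qed
        qed
      qed
    qed
  qed
  show "0 \<le> N_hat m k l N q" using main by blast
  show "i < N_hat m k l N q \<longleftrightarrow>
      (\<exists>n. 0 \<le> n \<and> n < N mod (m div gcd m k) \<and> (l + n * k) mod m = q + i * k)" if "0 \<le> i"
    using main char[OF that] that by (simp add: N0_def d_def)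
qed

section \<open>The core of an arithmetic progression\<close>

lemma mod_diff_multiple:
  fixes b d n :: nat
  assumes "d dvd b" "b \<le> n"
  shows "(n - b) mod d = n mod d"
proof -
  obtain c where c: "b = d * c" using assms(1) by blast
  have "n mod d = ((n - b) + d * c) mod d" using assms(2) c by simp
  also have "\<dots> = (n - b) mod d" by (rule mod_mult_self2)
  finally show ?thesis ..
qed

lemma mod_add_multiple:
  fixes a b d :: nat
  assumes "d dvd b"
  shows "(a + b) mod d = a mod d"
  using mod_diff_multiple[OF assms, of "a + b"] by simp

lemma card_residue_class:
  fixes N q i0 :: nat
  assumes "i0 < q"
  shows "card {i. i < N \<and> i mod q = i0} = N div q + (if i0 < N mod q then 1 else 0)"
proof -
  let ?c = "N div q + (if i0 < N mod q then 1 else 0)"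
  have "{i. i < N \<and> i mod q = i0} = (\<lambda>t. i0 + q * t) ` {..<?c}"
  proof (intro equalityI subsetI)
    fix i assume "i \<in> {i. i < N \<and> i mod q = i0}"
    then have i: "i < N" "i mod q = i0" by auto
    have e: "i = i0 + q * (i div q)" using i(2) by (metis mod_mult_div_eq)
    have le: "i div q \<le> N div q" using i(1) by (simp add: div_le_mono)
    have "i div q < ?c"
    proof (cases "i div q = N div q")
      case True
      then have "i0 < N mod q" using i(1) e mod_mult_div_eq[of N q] by (metis nat_add_left_cancel_less add.commute)
      then show ?thesis using True by simp
    qed (use le in auto)
    then show "i \<in> (\<lambda>t. i0 + q * t) ` {..<?c}" using e by blast
  next
    fix i assume "i \<in> (\<lambda>t. i0 + q * t) ` {..<?c}"
    then obtain t where t: "i = i0 + q * t" "t < ?c" by blast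
    have "i < N"
    proof (cases "t < N div q")
      case True
      then have "q * Suc t \<le> q * (N div q)" by (intro mult_le_mono) auto
      also have "\<dots> \<le> N" by simp
      finally show ?thesis using t(1) assms by simp
    next
      case False
      then have "t = N div q" and i0: "i0 < N mod q" using t(2) by (auto split: if_splits)
      then have "i = i0 + q * (N div q)" using t(1) by simp
      then show ?thesis using i0 mod_mult_div_eq[of N q] by linarith
    qed
    then show "i \<in> {i. i < N \<and> i mod q = i0}" using t(1) assms by simp
  qed
  moreover have "inj_on (\<lambda>t. i0 + q * t) {..<?c}" using assms by (auto simp: inj_on_def)
  ultimately show ?thesis by (simp only: card_image card_lessThan)
qed

text \<open>By Bezout the congruence is solvable, because \<open>gcd m k\<close> divides
  \<open>n - l\<close>, and its solution is unique modulo \<open>m div gcd m k\<close>.\<close>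

lemma progression_residue:
  fixes m k l n :: nat
  assumes m: "0 < m" and k: "0 < k" and nl: "n mod gcd m k = l mod gcd m k"
  obtains i0 where "i0 < m div gcd m k"
    "\<And>i. (l + i * k) mod m = n mod m \<longleftrightarrow> i mod (m div gcd m k) = i0"
proof -
  define d mh where "d = gcd m k" and "mh = m div d"
  have d: "0 < d" "d dvd m" "d dvd k" using m by (auto simp: d_def)
  have mm: "m = d * mh" and kk: "k = d * (k div d)" using d by (simp_all add: mh_def)
  have mh: "0 < mh" using m mm by (metis mult_0_right neq0_conv)
  have cop: "coprime (int mh) (int (k div d))"
    using div_gcd_coprime[of m k] m by (simp add: mh_def d_def)
  have "int n mod int d = int l mod int d" using nl by (metis d_def zmod_int)
  then have "int d dvd int n - int l" by (rule mod_eq_dvd_iff[THEN iffD1])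
  then obtain c where c: "int n - int l = int d * c" by blast
  obtain u v where uv: "u * int m + v * int k = gcd (int m) (int k)" using bezout_int by blast
  define i0 where "i0 = nat ((c * v) mod int mh)"
  have i0: "int i0 = (c * v) mod int mh" using mh by (simp add: i0_def)
  have i0lt: "i0 < mh" using mh by (simp add: i0_def nat_less_iff)
  have sol: "int m dvd (int l + int i0 * int k) - int n"
  proof -
    define w where "w = (c * v) div int mh"
    have i0': "int i0 = c * v - int mh * w" unfolding i0 w_def by (simp add: minus_mult_div_eq_mod)
    have n': "int n = int l + int d * c" using c by linarith
    have "(int l + int i0 * int k) - int n = c * (v * int k) - int mh * w * int k - int d * c"
      unfolding i0' n' by (simp add: algebra_simps)
    also have "v * int k = int d - u * int m" using uv by (simp add: d_def)
    also have "c * (int d - u * int m) - int mh * w * int k - int d * c =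
        - (c * u * int m) - int mh * int k * w"
      by (simp add: algebra_simps)
    also have "int mh * int k = int m * int (k div d)"
      using mm kk by (metis mult.assoc mult.commute of_nat_mult)
    finally show ?thesis by (simp add: dvd_diff dvd_minus_iff)
  qed
  have "(l + i * k) mod m = n mod m \<longleftrightarrow> i mod mh = i0" for i
  proof -
    have "(l + i * k) mod m = n mod m \<longleftrightarrow> int m dvd (int l + int i * int k) - int n"
      by (metis mod_eq_dvd_iff of_nat_add of_nat_eq_iff of_nat_mult zmod_int)
    also have "\<dots> \<longleftrightarrow> int m dvd ((int l + int i * int k) - int n) - ((int l + int i0 * int k) - int n)"
      using sol by (metis dvd_diff diff_add_cancel dvd_add)
    also have "((int l + int i * int k) - int n) - ((int l + int i0 * int k) - int n) = int d * ((int i - int i0) * int (k div d))"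
    proof -
      have e: "int k = int d * int (k div d)" using kk by (metis of_nat_mult)
      have "((int l + int i * int k) - int n) - ((int l + int i0 * int k) - int n) = (int i - int i0) * int k"
        by (simp add: algebra_simps)
      also have "\<dots> = int d * ((int i - int i0) * int (k div d))"
        by (subst e) (simp only: mult_ac)
      finally show ?thesis .
    qed
    also have "int m dvd int d * ((int i - int i0) * int (k div d)) \<longleftrightarrow> int mh dvd (int i - int i0) * int (k div d)"
      using d(1) unfolding mm by simp
    also have "\<dots> \<longleftrightarrow> int mh dvd int i - int i0" using cop by (simp add: coprime_dvd_mult_left_iff)
    also have "\<dots> \<longleftrightarrow> i mod mh = i0 mod mh" by (metis mod_eq_dvd_iff of_nat_eq_iff zmod_int)
    finally show ?thesis using i0lt by simp
  qed
  with i0lt that show ?thesis by (auto simp: mh_def d_def)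
qed

text \<open>Every period of \<open>m div d\<close> steps meets each residue congruent to
  \<open>l\<close> mod \<open>d\<close> exactly once. So the \<open>kN\<close> full periods fill all
  such numbers below \<open>kN * m\<close>, and the remaining \<open>N0\<close> steps put one more
  layer on top.\<close>

lemma core_X0_eq:
  fixes m k l N :: nat
  assumes m: "0 < m" and k: "0 < k"
  defines "d \<equiv> gcd m k" and "kN \<equiv> N div (m div gcd m k)" and "N0 \<equiv> N mod (m div gcd m k)"
  shows "n \<in> core m (X0 k l N) \<longleftrightarrow> (n < kN * m \<and> n mod d = l mod d) \<or>
    (kN * m \<le> n \<and> (\<exists>i<N0. (l + i * k) mod m = n - kN * m))"
proof -
  have d: "d dvd m" "d dvd k" by (simp_all add: d_def)
  have modd: "(l + i * k) mod m mod d = l mod d" for i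
  proof -
    have "(l + i * k) mod m mod d = (l + i * k) mod d" using d by (simp add: mod_mod_cancel)
    also have "\<dots> = l mod d" using d by (intro mod_add_multiple) simp
    finally show ?thesis .
  qed
  have "cls m (X0 k l N) n = (\<lambda>i. l + i * k) ` {i. i < N \<and> (l + i * k) mod m = n mod m}"
    by (auto simp: cls_def X0_def)
  moreover have "inj_on (\<lambda>i. l + i * k) {i. i < N \<and> (l + i * k) mod m = n mod m}"
    using k by (auto simp: inj_on_def)
  ultimately have card: "card (cls m (X0 k l N) n) = card {i. i < N \<and> (l + i * k) mod m = n mod m}"
    by (simp add: card_image)
  have dm: "n mod m mod d = n mod d" using d by (simp add: mod_mod_cancel)
  have kNd: "n mod d = (n - kN * m) mod d" if "kN * m \<le> n"
    using mod_diff_multiple[OF _ that, of d] d by simp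
  show ?thesis
  proof (cases "n mod d = l mod d")
    case False
    have ne: "(l + i * k) mod m \<noteq> n mod m" for i
    proof
      assume "(l + i * k) mod m = n mod m"
      then show False using False modd[of i] dm by simp
    qed
    then have E: "{i. i < N \<and> (l + i * k) mod m = n mod m} = {}" by simp
    have "n \<notin> core m (X0 k l N)" unfolding core_def mem_Collect_eq card E by simp
    moreover have "\<not> (kN * m \<le> n \<and> (\<exists>i<N0. (l + i * k) mod m = n - kN * m))"
    proof
      assume *: "kN * m \<le> n \<and> (\<exists>i<N0. (l + i * k) mod m = n - kN * m)"
      then obtain i where "(l + i * k) mod m = n - kN * m" by blast
      then show False using False modd[of i] kNd * by simp
    qed
    ultimately show ?thesis using False by blast
  next
    case True
    then obtain i0 where i0: "i0 < m div d" "\<And>i. (l + i * k) mod m = n mod m \<longleftrightarrow> i mod (m div d) = i0"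
      using progression_residue[OF m k, of n l] unfolding d_def by blast
    have "card (cls m (X0 k l N) n) = kN + (if i0 < N0 then 1 else 0)"
      unfolding card i0(2) kN_def N0_def d_def[symmetric] by (rule card_residue_class[OF i0(1)])
    then have c: "n \<in> core m (X0 k l N) \<longleftrightarrow> n div m < kN \<or> (n div m = kN \<and> i0 < N0)"
      by (auto simp: core_def)
    have N0: "N0 < m div d" using i0(1) by (simp add: N0_def d_def)
    have ex: "i0 < N0 \<longleftrightarrow> (\<exists>i<N0. (l + i * k) mod m = n mod m)"
      unfolding i0(2)
    proof
      assume "i0 < N0"
      then show "\<exists>i<N0. i mod (m div d) = i0" using i0(1) by (intro exI[of _ i0]) simp
    next
      assume "\<exists>i<N0. i mod (m div d) = i0"
      then obtain i where i: "i < N0" "i mod (m div d) = i0" by blast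
      then have "i mod (m div d) = i" using N0 by (intro mod_less) simp
      then show "i0 < N0" using i by simp
    qed
    have lt: "n div m < kN \<longleftrightarrow> n < kN * m" using m by (rule div_less_iff_less_mult)
    have eq: "n div m = kN \<and> (\<exists>i<N0. (l + i * k) mod m = n mod m) \<longleftrightarrow>
        kN * m \<le> n \<and> (\<exists>i<N0. (l + i * k) mod m = n - kN * m)"
    proof
      assume *: "n div m = kN \<and> (\<exists>i<N0. (l + i * k) mod m = n mod m)"
      then have "n = kN * m + n mod m" using div_mult_mod_eq[of n m] by simp
      then have "kN * m \<le> n" "n mod m = n - kN * m" by linarith+
      then show "kN * m \<le> n \<and> (\<exists>i<N0. (l + i * k) mod m = n - kN * m)"
        using * by simp
    next
      assume *: "kN * m \<le> n \<and> (\<exists>i<N0. (l + i * k) mod m = n - kN * m)"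
      then obtain i where i: "i < N0" "(l + i * k) mod m = n - kN * m" by blast
      define y where "y = n - kN * m"
      have y: "y < m" unfolding y_def i(2)[symmetric] using m by simp
      have n: "n = y + kN * m" using * by (simp add: y_def)
      have "n div m = kN" "n mod m = n - kN * m"
        unfolding y_def[symmetric] using y m by (simp_all add: n)
      then show "n div m = kN \<and> (\<exists>i<N0. (l + i * k) mod m = n mod m)" using i by auto
    qed
    show ?thesis unfolding c ex lt eq using True by blast
  qed
qed

section \<open>Sets packed in residue classes mod k, their shifts and their normal form\<close>

definition SH :: "nat \<Rightarrow> (int \<Rightarrow> int) \<Rightarrow> nat set" where
  "SH k H = {n. int (n div k) < H (int (n mod k))}"

lemma SH_cong:
  assumes "k > 0" "\<And>q. 0 \<le> q \<Longrightarrow> q < int k \<Longrightarrow> H q = H' q"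
  shows "SH k H = SH k H'"
  unfolding SH_def using assms by (intro Collect_cong) simp

lemma SH_shift_mult:
  assumes k: "k > 0" and H: "\<And>q. 0 \<le> q \<Longrightarrow> q < int k \<Longrightarrow> int \<mu> \<le> H q"
  shows "{0..<k * \<mu>} \<subseteq> SH k H" "{n. n + k * \<mu> \<in> SH k H} = SH k (\<lambda>q. H q - int \<mu>)"
proof -
  show "{0..<k * \<mu>} \<subseteq> SH k H"
  proof
    fix n assume "n \<in> {0..<k * \<mu>}"
    then have "n div k < \<mu>" using k by (simp add: div_less_iff_less_mult mult.commute)
    then show "n \<in> SH k H" using H[of "int (n mod k)"] k by (simp add: SH_def)
  qed
  show "{n. n + k * \<mu> \<in> SH k H} = SH k (\<lambda>q. H q - int \<mu>)"
    unfolding SH_def using k by (intro Collect_cong) auto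
qed

text \<open>Subtracting \<open>j\<close> from all elements rotates the classes; those that pass
  below class 0 arrive one level lower, which is the origin of the \<open>- 1\<close>.\<close>

lemma SH_shift:
  assumes k: "k > 0" and j: "j < k" and H: "\<And>q. 0 \<le> q \<Longrightarrow> q < int j \<Longrightarrow> 1 \<le> H q"
  shows "{0..<j} \<subseteq> SH k H"
    "{n. n + j \<in> SH k H} = SH k (\<lambda>i. if i \<le> int k - int j - 1 then H (i + int j) else H (i + int j - int k) - 1)"
proof -
  show "{0..<j} \<subseteq> SH k H"
  proof
    fix n assume "n \<in> {0..<j}"
    then show "n \<in> SH k H" using H[of "int n"] j by (simp add: SH_def)
  qed
  show "{n. n + j \<in> SH k H} =
      SH k (\<lambda>i. if i \<le> int k - int j - 1 then H (i + int j) else H (i + int j - int k) - 1)"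
    unfolding SH_def mem_Collect_eq
  proof (intro Collect_cong)
    fix n
    define q i where "q = n div k" and "i = n mod k"
    have n: "n = q * k + i" and i: "i < k" using k by (simp_all add: q_def i_def)
    show "int ((n + j) div k) < H (int ((n + j) mod k)) \<longleftrightarrow>
      int (n div k) < (if int (n mod k) \<le> int k - int j - 1 then H (int (n mod k) + int j)
        else H (int (n mod k) + int j - int k) - 1)"
      unfolding q_def[symmetric] i_def[symmetric]
    proof (cases "i + j < k")
      case True
      have e: "n + j = (i + j) + q * k" using n by simp
      have "(i + j + q * k) div k = q" "(i + j + q * k) mod k = i + j" using True k by simp_all
      then have "(n + j) div k = q" "(n + j) mod k = i + j" by (simp_all only: e)
      then show "int ((n + j) div k) < H (int ((n + j) mod k)) \<longleftrightarrow>
        int q < (if int i \<le> int k - int j - 1 then H (int i + int j) else H (int i + int j - int k) - 1)"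
        using True by (simp add: of_nat_add)
    next
      case False
      define z where "z = i + j - k"
      have z: "z < k" "i + j = z + k" using False i j by (auto simp: z_def)
      have e: "n + j = z + (q + 1) * k" using n z by (simp add: algebra_simps)
      have "(z + (q + 1) * k) div k = (q + 1) + z div k" by (rule div_mult_self1) (use k in simp)
      moreover have "(z + (q + 1) * k) mod k = z mod k" by (rule mod_mult_self1)
      ultimately have "(n + j) div k = q + 1" "(n + j) mod k = z" using z(1) by (simp_all only: e div_less mod_less add_0_right)
      moreover have "int i + int j - int k = int z" using z by linarith
      ultimately show "int ((n + j) div k) < H (int ((n + j) mod k)) \<longleftrightarrow>
        int q < (if int i \<le> int k - int j - 1 then H (int i + int j) else H (int i + int j - int k) - 1)"
        using False by (simp add: of_nat_add algebra_simps)
    qed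
  qed
qed

text \<open>The row set of a rogue wave contains no multiple of \<open>k = M + 1\<close>. So an
  initial interval is deleted such that class 0 becomes empty, and the sizes of the other classes
  are the orders \<open>L i\<close>.\<close>

definition normalises :: "nat \<Rightarrow> nat set \<Rightarrow> (int \<Rightarrow> int) \<Rightarrow> bool" where
  "normalises k Y L \<longleftrightarrow> (\<exists>j. {0..<j} \<subseteq> Y \<and> {n. n + j \<in> Y} = SH k (\<lambda>i. if i = 0 then 0 else L i)) \<and>
     (\<forall>i. 1 \<le> i \<longrightarrow> i < int k \<longrightarrow> 0 \<le> L i)"

lemma normalises_shift:
  assumes "{0..<a} \<subseteq> Y" "normalises k {n. n + a \<in> Y} L"
  shows "normalises k Y L"
proof -
  obtain b where b: "{0..<b} \<subseteq> {n. n + a \<in> Y}"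
    "{n. n + b \<in> {n. n + a \<in> Y}} = SH k (\<lambda>i. if i = 0 then 0 else L i)"
    using assms(2) by (auto simp: normalises_def)
  have "{0..<b + a} \<subseteq> Y"
  proof
    fix n assume n: "n \<in> {0..<b + a}"
    show "n \<in> Y"
    proof (cases "n < a")
      case False
      then have "n - a \<in> {0..<b}" using n by auto
      then have "n - a + a \<in> Y" using b(1) by blast
      then show ?thesis using False by simp
    qed (use assms(1) in auto)
  qed
  moreover have "{n. n + (b + a) \<in> Y} = SH k (\<lambda>i. if i = 0 then 0 else L i)"
    using b(2) by (simp add: add.assoc)
  ultimately show ?thesis using assms(2) unfolding normalises_def by blast
qed

text \<open>Shifting by the first empty class \<open>j\<close> makes class 0 empty. No count becomes
  negative, since every class before \<open>j\<close> has an element to lose.\<close>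

lemma normalises_shift_family:
  assumes k: "k > 0" and H: "\<And>q. 0 \<le> q \<Longrightarrow> q < int k \<Longrightarrow> 0 \<le> H q"
    and z: "0 \<le> z" "z < int k" "H z = 0"
  shows "normalises k (SH k H) (shift_family (int k) H)"
proof (cases "H 0 = 0")
  case True
  have "SH k H = SH k (\<lambda>i. if i = 0 then 0 else shift_family (int k) H i)"
    by (rule SH_cong[OF k]) (simp add: shift_family_def True)
  then show ?thesis unfolding normalises_def
    using H True by (intro conjI exI[of _ 0]) (auto simp: shift_family_def)
next
  case False
  define j where "j = (LEAST j. H (int j) = 0)"
  have Hj: "H (int j) = 0" unfolding j_def by (rule LeastI[of _ "nat z"]) (use z in simp)
  have jz: "j \<le> nat z" unfolding j_def by (rule Least_le) (use z in simp)
  have least: "H q \<noteq> 0" if "0 \<le> q" "q < int j" for q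
    using not_less_Least[of "nat q" "\<lambda>j. H (int j) = 0"] that by (auto simp: j_def nat_less_iff)
  have j: "1 \<le> j" "j < k" using False Hj jz z by (cases j; auto)+
  have the: "(THE j. 1 \<le> j \<and> j < int k \<and> (\<forall>q\<in>{0..j-1}. H q \<noteq> 0) \<and> H j = 0) = int j"
  proof (rule the_equality)
    show "1 \<le> int j \<and> int j < int k \<and> (\<forall>q\<in>{0..int j-1}. H q \<noteq> 0) \<and> H (int j) = 0"
      using j Hj least by auto
  next
    fix j' assume *: "1 \<le> j' \<and> j' < int k \<and> (\<forall>q\<in>{0..j'-1}. H q \<noteq> 0) \<and> H j' = 0"
    have "\<not> j' < int j" using least[of j'] * by auto
    moreover have "\<not> int j < j'"
    proof
      assume "int j < j'"
      then have "int j \<in> {0..j'-1}" by simp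
      then show False using * Hj by blast
    qed
    ultimately show "j' = int j" by linarith
  qed
  have sf: "shift_family (int k) H i =
      (if i \<le> int k - int j - 1 then H (i + int j) else H (i + int j - int k) - 1)" for i
    by (simp add: shift_family_def False the)
  have H1: "1 \<le> H q" if "0 \<le> q" "q < int j" for q
    using H[of q] least[OF that] that j by (smt (verit) of_nat_less_iff)
  note sh = SH_shift[OF k j(2) H1]
  have "SH k (shift_family (int k) H) = SH k (\<lambda>i. if i = 0 then 0 else shift_family (int k) H i)"
  proof (rule SH_cong[OF k])
    fix q :: int
    have "shift_family (int k) H 0 = 0" unfolding sf using j Hj by auto
    then show "shift_family (int k) H q = (if q = 0 then 0 else shift_family (int k) H q)" by simp
  qed
  moreover have "{n. n + j \<in> SH k H} = SH k (shift_family (int k) H)"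
  proof -
    have "shift_family (int k) H =
        (\<lambda>i. if i \<le> int k - int j - 1 then H (i + int j) else H (i + int j - int k) - 1)"
      by (rule ext) (rule sf)
    then show ?thesis using sh(2) by (simp only:)
  qed
  moreover have "0 \<le> shift_family (int k) H i" if "1 \<le> i" "i < int k" for i
    unfolding sf using H[of "i + int j"] H1[of "i + int j - int k"] that j by auto
  ultimately show ?thesis using sh(1) unfolding normalises_def by (intro conjI exI[of _ j]) auto
qed

text \<open>Below \<open>kN * m\<close> the core consists of all numbers congruent to
  \<open>l\<close> mod \<open>d\<close>; above, by \<open>N_hat_count\<close>, it is a translate of
  \<open>SH k H\<close>. The cases of the procedure are the ways to bring this set into the form
  with empty class 0.\<close>

lemma N_low_core:
  fixes m k l N :: nat
  assumes k: "1 < k" and m: "0 < m" and ndvd: "\<not> k dvd m" and l: "l < k"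
  shows "normalises k (core m (X0 k l N)) (N_low (int m) (int k) (int l) (int N))"
proof -
  define d mh kN where "d = gcd m k" and "mh = m div d" and "kN = N div mh"
  define H where "H = N_hat (int m) (int k) (int l) (int N)"
  have k0: "0 < k" using k by simp
  have d: "0 < d" "d dvd m" "d dvd k" using m by (auto simp: d_def)
  have ndvd': "\<not> int k dvd int m" using ndvd by simp
  have dint: "gcd (int m) (int k) = int d" by (simp add: d_def)
  note count = N_hat_count[of "int k" "int m" "int l" "int N", unfolded dint, folded H_def]
  have H0: "0 \<le> H q" if "0 \<le> q" "q < int k" for q
    using count(1)[of q] k0 m ndvd' l that by simp
  have Hc: "int i < H (int q) \<longleftrightarrow> (\<exists>n<N mod mh. (l + n * k) mod m = q + i * k)" if "q < k" for i q
  proof -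
    have "int i < H (int q) \<longleftrightarrow> (\<exists>n. 0 \<le> n \<and> n < int N mod (int m div int d) \<and>
        (int l + n * int k) mod int m = int q + int i * int k)"
      using count(2)[of "int q" "int i"] k0 m ndvd' l that by simp
    also have "int N mod (int m div int d) = int (N mod mh)" by (simp add: mh_def zdiv_int zmod_int)
    also have "(\<exists>n. 0 \<le> n \<and> n < int (N mod mh) \<and> (int l + n * int k) mod int m = int q + int i * int k) \<longleftrightarrow>
        (\<exists>n<N mod mh. (l + n * k) mod m = q + i * k)"
    proof
      assume "\<exists>n. 0 \<le> n \<and> n < int (N mod mh) \<and> (int l + n * int k) mod int m = int q + int i * int k"
      then obtain n where n: "0 \<le> n" "n < int (N mod mh)" "(int l + n * int k) mod int m = int q + int i * int k" by blast
      then obtain n' where n': "n = int n'" by (metis nonneg_int_cases)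
      have "int ((l + n' * k) mod m) = int (q + i * k)" using n(3) by (simp add: n' zmod_int)
      then have "(l + n' * k) mod m = q + i * k" by (simp only: of_nat_eq_iff)
      then show "\<exists>n<N mod mh. (l + n * k) mod m = q + i * k" using n(2) n' by auto
    next
      assume "\<exists>n<N mod mh. (l + n * k) mod m = q + i * k"
      then obtain n where n: "n < N mod mh" "(l + n * k) mod m = q + i * k" by blast
      have "int ((l + n * k) mod m) = int (q + i * k)" using n(2) by simp
      then have "(int l + int n * int k) mod int m = int q + int i * int k" by (simp add: zmod_int)
      then show "\<exists>n. 0 \<le> n \<and> n < int (N mod mh) \<and> (int l + n * int k) mod int m = int q + int i * int k"
        using n(1) by (intro exI[of _ "int n"]) auto
    qed
    finally show ?thesis .
  qed
  have SHH: "n \<in> SH k H \<longleftrightarrow> (\<exists>i<N mod mh. (l + i * k) mod m = n)" for n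
    using Hc[of "n mod k" "n div k"] k0 by (simp add: SH_def)
  have Y: "n \<in> core m (X0 k l N) \<longleftrightarrow> (n < kN * m \<and> n mod d = l mod d) \<or>
    (kN * m \<le> n \<and> n - kN * m \<in> SH k H)" for n
    unfolding core_X0_eq[OF m k0] SHH unfolding kN_def mh_def d_def ..
  show ?thesis
  proof (cases "d = 1")
    case True
    \<comment> \<open>For \<open>d = 1\<close> the lower part is a full interval and is deleted as a
      whole.\<close>
    have sub: "{0..<kN * m} \<subseteq> core m (X0 k l N)"
    proof
      fix n assume "n \<in> {0..<kN * m}"
      then have "n < kN * m \<and> n mod d = l mod d" using True by simp
      then show "n \<in> core m (X0 k l N)" unfolding Y by blast
    qed
    have eq: "{n. n + kN * m \<in> core m (X0 k l N)} = SH k H"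
    proof (rule Set.set_eqI)
      fix n
      show "n \<in> {n. n + kN * m \<in> core m (X0 k l N)} \<longleftrightarrow> n \<in> SH k H"
        unfolding mem_Collect_eq Y by simp
    qed
    have c1: "int d = 1" using True by simp
    have "normalises k (SH k H) (N_low (int m) (int k) (int l) (int N))"
    proof (cases "\<forall>q\<in>{0..int k-1}. H q \<noteq> 0")
      case all: True
      \<comment> \<open>With no class empty, the lowest \<open>\<mu>\<close> levels form an initial
        interval of length \<open>k * \<mu>\<close>; deleting it empties at least one class.\<close>
      define \<mu> where "\<mu> = Min (H ` {0..int k-1})"
      have ne: "finite (H ` {0..int k-1})" "H ` {0..int k-1} \<noteq> {}" using k0 by auto
      have mu_le: "\<mu> \<le> H q" if "0 \<le> q" "q < int k" for q
        unfolding \<mu>_def using ne that by (intro Min_le) auto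
      have "\<mu> \<in> H ` {0..int k-1}" unfolding \<mu>_def by (rule Min_in[OF ne])
      then obtain z where z: "0 \<le> z" "z < int k" "H z = \<mu>" by auto
      have "0 \<le> \<mu>" using H0[OF z(1,2)] z(3) by simp
      then obtain u where u: "\<mu> = int u" by (metis nonneg_int_cases)
      have L: "N_low (int m) (int k) (int l) (int N) i = shift_family (int k) (\<lambda>q. H q - \<mu>) i" for i
        unfolding N_low_def Let_def dint H_def[symmetric] c1 if_P[OF refl] if_P[OF all] \<mu>_def ..
      have ule: "int u \<le> H q" if "0 \<le> q" "q < int k" for q using mu_le[OF that] u by simp
      have sh: "{0..<k * u} \<subseteq> SH k H" "{n. n + k * u \<in> SH k H} = SH k (\<lambda>q. H q - \<mu>)"
        unfolding u using SH_shift_mult[of k u H] k0 ule by blast+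
      have "normalises k {n. n + k * u \<in> SH k H} (N_low (int m) (int k) (int l) (int N))"
        unfolding sh(2) L[abs_def]
        by (rule normalises_shift_family[OF k0 _ z(1,2)]) (use mu_le z in auto)
      then show ?thesis by (rule normalises_shift[OF sh(1)])
    next
      case notall: False
      then obtain z where z: "0 \<le> z" "z < int k" "H z = 0" by auto
      have L: "N_low (int m) (int k) (int l) (int N) i = shift_family (int k) H i" for i
        unfolding N_low_def Let_def dint H_def[symmetric] c1 if_P[OF refl] if_not_P[OF notall] ..
      show ?thesis unfolding L[abs_def] using normalises_shift_family[of k H z] k0 H0 z by blast
    qed
    then show ?thesis using normalises_shift[OF sub] eq by simp
  next
    case False
    then have d2: "2 \<le> d" using d(1) by linarith
    define T where "T = N_tilde2 (int m) (int k) (int l) (int N)"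
    \<comment> \<open>The lower part ends at place \<open>e\<close> of level \<open>E\<close>. So,
      among the classes congruent to \<open>l\<close> mod \<open>d\<close>, those before
      \<open>e\<close> have \<open>E + 1\<close> elements in it and the others \<open>E\<close>; the
      upper part is rotated by \<open>e\<close>.\<close>
    define e E where "e = (kN * m) mod k" and "E = (kN * m) div k"
    have kNm: "kN * m = E * k + e" "e < k" using k0 by (simp_all add: e_def E_def)
    have T1: "N_tilde1 (int m) (int k) (int l) (int N) (int q) = int E + (if q < e then 1 else 0)"
      if q: "q mod d = l mod d" "q < k" for q
    proof -
      define a b e' where "a = kN * mh" and "b = k div d" and "e' = a mod b"
      have mm: "m = d * mh" and kk: "k = d * b" using d by (simp_all add: mh_def b_def)
      have am: "kN * m = d * a" unfolding a_def mm by (simp add: mult_ac)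
      have E': "E = a div b" unfolding E_def am kk using d by simp
      have ee: "e = d * e'" unfolding e_def am kk e'_def by (rule mult_mod_right[symmetric])
      define j where "j = q div d"
      have qj: "q = d * j + l mod d" unfolding j_def using q(1) by (metis mult_div_mod_eq)
      have ld: "l mod d < d" using d by simp
      have jj: "(int q - int l mod int d) div int d + 1 = int j + 1"
        using d by (simp add: qj zmod_int[symmetric])
      have lt: "q < e \<longleftrightarrow> j < e'"
      proof
        assume "q < e"
        then have "d * j < d * e'" using qj ee by linarith
        then show "j < e'" by simp
      next
        assume "j < e'"
        then have "d * Suc j \<le> d * e'" by (intro mult_le_mono) auto
        then show "q < e" using qj ee ld by simp
      qed
      have "N_tilde1 (int m) (int k) (int l) (int N) (int q) = int (a div b) + (if int j + 1 \<le> int e' then 1 else 0)"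
        unfolding N_tilde1_def Let_def dint jj a_def b_def e'_def kN_def mh_def
        by (simp only: zdiv_int[symmetric] zmod_int[symmetric] of_nat_mult[symmetric])
      then show ?thesis unfolding E' lt by auto
    qed
    have Tq: "T (int q) = int E + (if q < e then 1 else 0) + (if q < e then H (int q + int k - int e) else H (int q - int e))"
      if q: "q mod d = l mod d" "q < k" for q
    proof -
      have "int N div (int m div int d) * int m mod int k = int e"
        by (simp only: e_def kN_def mh_def zdiv_int[symmetric] zmod_int[symmetric] of_nat_mult[symmetric])
      moreover have "(int q < int e) = (q < e)" by simp
      ultimately show ?thesis unfolding T_def N_tilde2_def Let_def dint T1[OF q] H_def[symmetric] by (simp only:)
    qed
    have T0: "0 \<le> T (int q)" if q: "q mod d = l mod d" "q < k" for q
    proof (cases "q < e")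
      case True
      have "0 \<le> H (int q + int k - int e)" by (rule H0) (use True kNm(2) in linarith)+
      then show ?thesis unfolding Tq[OF q] if_P[OF True] by linarith
    next
      case False
      have "0 \<le> H (int q - int e)" by (rule H0) (use False q(2) in linarith)+
      then show ?thesis unfolding Tq[OF q] if_not_P[OF False] by linarith
    qed
    \<comment> \<open>Classes not congruent to \<open>l\<close> mod \<open>d\<close> are empty,
      since \<open>d\<close> divides both \<open>m\<close> and \<open>k\<close>.\<close>
    define G where "G q = (if q mod int d = int l mod int d then T q else 0)" for q
    have G0: "0 \<le> G q" if "0 \<le> q" "q < int k" for q
    proof -
      define q' where "q' = nat q"
      have q': "q = int q'" using that(1) by (simp add: q'_def)
      have "q' < k" using that q' by simp
      show ?thesis
      proof (cases "q' mod d = l mod d")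
        case True
        then show ?thesis using T0[OF True \<open>q' < k\<close>] by (simp add: G_def q')
      next
        case False
        then have "\<not> int q' mod int d = int l mod int d" by (simp flip: zmod_int)
        then show ?thesis by (simp add: G_def q')
      qed
    qed
    have dm: "r < k \<Longrightarrow> (v * k + r) div k = v \<and> (v * k + r) mod k = r" for r v using k0 by simp
    have core: "core m (X0 k l N) = SH k G"
    proof (rule Set.set_eqI)
      fix n
      define q i where "q = n mod k" and "i = n div k"
      have n: "n = i * k + q" and q: "q < k" using k0 by (simp_all add: q_def i_def)
      have nd: "n mod d = q mod d" unfolding q_def using d by (simp add: mod_mod_cancel)
      have in_SH: "n \<in> SH k G \<longleftrightarrow> int i < G (int q)" by (simp add: SH_def q_def i_def)
      show "n \<in> core m (X0 k l N) \<longleftrightarrow> n \<in> SH k G"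
      proof (cases "q mod d = l mod d")
        case False
        have "n - kN * m \<notin> SH k H" if "kN * m \<le> n"
        proof
          assume "n - kN * m \<in> SH k H"
          then obtain i where "(l + i * k) mod m = n - kN * m" using SHH by blast
          then have "(n - kN * m) mod d = (l + i * k) mod d" using d by (metis mod_mod_cancel)
          also have "\<dots> = l mod d" using d by (intro mod_add_multiple) simp
          finally have "(n - kN * m) mod d = l mod d" .
          moreover have "(n - kN * m) mod d = n mod d"
            using mod_diff_multiple[OF _ that, of d] d by simp
          ultimately show False using False nd by simp
        qed
        moreover have "\<not> int i < G (int q)" using False by (simp add: G_def zmod_int[symmetric])
        moreover have "n mod d \<noteq> l mod d" using False nd by simp
        ultimately show ?thesis unfolding Y in_SH by blast
      next
        case True
        have GT: "G (int q) = T (int q)" using True by (simp add: G_def zmod_int[symmetric])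
        have Y': "n \<in> core m (X0 k l N) \<longleftrightarrow> n < kN * m \<or> (kN * m \<le> n \<and> n - kN * m \<in> SH k H)"
          unfolding Y using trans[OF nd True] by blast
        show ?thesis
        proof (cases "q < e")
          case qe: True
          have lt: "n < kN * m \<longleftrightarrow> i \<le> E"
          proof
            assume "n < kN * m"
            show "i \<le> E"
            proof (rule ccontr)
              assume "\<not> i \<le> E"
              then have "Suc E * k \<le> i * k" by (intro mult_le_mono) auto
              then show False using \<open>n < kN * m\<close> n kNm by simp
            qed
          next
            assume "i \<le> E"
            then have "i * k \<le> E * k" by simp
            then show "n < kN * m" using n kNm qe by linarith
          qed
          have "n - kN * m \<in> SH k H \<longleftrightarrow> int i - int E - 1 < H (int q + int k - int e)" if "E < i"
          proof -
            define v where "v = i - Suc E"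
            have v: "i = Suc (E + v)" using that by (simp add: v_def)
            have "n - kN * m = v * k + (q + k - e)" using n kNm v qe by (simp add: algebra_simps)
            then have "(n - kN * m) div k = v" "(n - kN * m) mod k = q + k - e"
              using dm[of "q + k - e" v] qe kNm(2) by simp_all
            moreover have "int (q + k - e) = int q + int k - int e" using kNm(2) by simp
            ultimately show ?thesis using v by (simp add: SH_def)
          qed
          note iff = this
          have H1: "0 \<le> H (int q + int k - int e)" by (rule H0) (use qe kNm(2) in linarith)+
          have nlt: "kN * m \<le> n \<longleftrightarrow> E < i" using lt by linarith
          show ?thesis unfolding Y' in_SH GT Tq[OF True q] if_P[OF qe] lt nlt
          proof (cases "E < i")
            case True
            then show "(i \<le> E \<or> E < i \<and> n - kN * m \<in> SH k H) \<longleftrightarrow> int i < int E + 1 + H (int q + int k - int e)"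
              unfolding iff[OF True] by linarith
          next
            case False
            then show "(i \<le> E \<or> E < i \<and> n - kN * m \<in> SH k H) \<longleftrightarrow> int i < int E + 1 + H (int q + int k - int e)"
              using H1 by linarith
          qed
        next
          case qe: False
          have lt: "n < kN * m \<longleftrightarrow> i < E"
          proof
            assume "n < kN * m"
            show "i < E"
            proof (rule ccontr)
              assume "\<not> i < E"
              then have "E * k \<le> i * k" by simp
              then show False using \<open>n < kN * m\<close> n kNm qe by linarith
            qed
          next
            assume "i < E"
            then have "Suc i * k \<le> E * k" by (intro mult_le_mono) auto
            then show "n < kN * m" using n kNm q by simp
          qed
          have "n - kN * m \<in> SH k H \<longleftrightarrow> int i - int E < H (int q - int e)" if "E \<le> i"
          proof -
            define v where "v = i - E"
            have v: "i = E + v" using that by (simp add: v_def)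
            have "n - kN * m = v * k + (q - e)" using n kNm v qe by (simp add: algebra_simps)
            then have "(n - kN * m) div k = v" "(n - kN * m) mod k = q - e"
              using dm[of "q - e" v] q by simp_all
            moreover have "int (q - e) = int q - int e" using qe by simp
            ultimately show ?thesis using v by (simp add: SH_def)
          qed
          note iff = this
          have H1: "0 \<le> H (int q - int e)" by (rule H0) (use qe q in linarith)+
          have nlt: "kN * m \<le> n \<longleftrightarrow> E \<le> i" using lt by linarith
          show ?thesis unfolding Y' in_SH GT Tq[OF True q] if_not_P[OF qe] lt nlt
          proof (cases "E \<le> i")
            case True
            then show "(i < E \<or> E \<le> i \<and> n - kN * m \<in> SH k H) \<longleftrightarrow> int i < int E + 0 + H (int q - int e)"
              unfolding iff[OF True] by linarith
          next
            case False
            then show "(i < E \<or> E \<le> i \<and> n - kN * m \<in> SH k H) \<longleftrightarrow> int i < int E + 0 + H (int q - int e)"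
              using H1 by linarith
          qed
        qed
      qed
    qed
    have dk: "int d dvd int k" "d < k \<or> d = k" using d k0 by (auto dest: dvd_imp_le)
    have Ndef: "N_low (int m) (int k) (int l) (int N) i =
       (if \<not> int d dvd int l then (if i mod int d = int l mod int d then T i else 0)
        else if T 0 = 0 then (if i mod int d = 0 then T i else 0)
        else if i = int k - 1 then T 0 - 1
        else if (i + 1) mod int d = 0 then T (i + 1) else 0)" for i
      using False unfolding N_low_def Let_def dint T_def[symmetric] by simp
    show ?thesis
    proof (cases "\<not> int d dvd int l \<or> T 0 = 0")
      case True
      have L: "N_low (int m) (int k) (int l) (int N) i = G i" for i
      proof (cases "int d dvd int l")
        case dl: True
        then have T00: "T 0 = 0" and ld: "int l mod int d = 0" using True dvd_imp_mod_0 by blast+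
        show ?thesis unfolding Ndef G_def
          by (simp only: T00 ld dl not_True_eq_False if_False if_True simp_thms)
      next
        case False
        then show ?thesis unfolding Ndef G_def by (simp only: not_False_eq_True if_True)
      qed
      have G00: "G 0 = 0"
      proof (cases "int d dvd int l")
        case dl: True
        then have "T 0 = 0" using True by blast
        then show ?thesis by (simp add: G_def)
      next
        case False
        then have "int l mod int d \<noteq> 0" using mod_0_imp_dvd by blast
        then have "\<not> 0 mod int d = int l mod int d" by (metis mod_0)
        then show ?thesis unfolding G_def by (rule if_not_P)
      qed
      have eq: "SH k G = SH k (\<lambda>i. if i = 0 then 0 else N_low (int m) (int k) (int l) (int N) i)"
        by (rule SH_cong[OF k0]) (simp add: L G00)
      show ?thesis unfolding normalises_def core
      proof (intro conjI exI[of _ 0] allI impI)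
        show "{0..<0} \<subseteq> SH k G" by simp
        show "{n. n + 0 \<in> SH k G} = SH k (\<lambda>i. if i = 0 then 0 else N_low (int m) (int k) (int l) (int N) i)"
          unfolding add_0_right Collect_mem_eq by (rule eq)
      next
        fix i :: int assume "1 \<le> i" "i < int k"
        then show "0 \<le> N_low (int m) (int k) (int l) (int N) i" unfolding L by (intro G0) linarith+
      qed
    next
      case False
      \<comment> \<open>Class 0 is not empty. One shift puts class 1 in its place, and class 1 is
        empty because \<open>d\<close> does not divide 1.\<close>
      then have dl: "int d dvd int l" "T 0 \<noteq> 0" by blast+
      have ld: "int l mod int d = 0" by (rule dvd_imp_mod_0[OF dl(1)])
      have G0T: "G 0 = T 0" by (simp add: G_def ld)
      have "0 \<le> G 0" by (rule G0) (use k0 in auto)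
      then have T01: "1 \<le> T 0" using dl(2) G0T by linarith
      have nz: "(1::int) mod int d \<noteq> 0" using d2 by simp
      have k1: "(1::nat) < k" by (rule k)
      have H1: "1 \<le> G q" if "0 \<le> q" "q < int 1" for q
      proof -
        have "q = 0" using that by simp
        then show ?thesis using T01 G0T by simp
      qed
      define L where "L i = (if i \<le> int k - int 1 - 1 then G (i + int 1) else G (i + int 1 - int k) - 1)" for i
      have sh: "{0..<1} \<subseteq> SH k G" "{n. n + 1 \<in> SH k G} = SH k L"
        using SH_shift[of k 1 G] k0 k1 H1 unfolding L_def[abs_def] by blast+
      have L: "N_low (int m) (int k) (int l) (int N) i = L i" if i: "0 \<le> i" "i < int k" for i
      proof (cases "i = int k - 1")
        case True
        have 1: "i + int 1 - int k = 0" "\<not> i \<le> int k - int 1 - 1" using True by simp_all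
        show ?thesis unfolding Ndef L_def if_not_P[OF 1(2)] 1(1) G0T
          by (simp only: True dl not_True_eq_False if_False if_True refl)
      next
        case False
        then have 1: "i \<le> int k - int 1 - 1" using i by simp
        show ?thesis unfolding Ndef L_def if_P[OF 1] G_def ld
          by (simp only: False dl not_True_eq_False if_False of_nat_1)
      qed
      have z: "L 0 = 0" using k nz by (simp add: L_def G_def ld)
      have eq: "SH k L = SH k (\<lambda>i. if i = 0 then 0 else N_low (int m) (int k) (int l) (int N) i)"
      proof (rule SH_cong[OF k0])
        fix i :: int assume i: "0 \<le> i" "i < int k"
        show "L i = (if i = 0 then 0 else N_low (int m) (int k) (int l) (int N) i)"
          using L[OF i] z by (cases "i = 0") simp_all
      qed
      show ?thesis unfolding normalises_def core
      proof (intro conjI exI[of _ 1] allI impI)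
        show "{0..<1} \<subseteq> SH k G" by (rule sh(1))
        show "{n. n + 1 \<in> SH k G} = SH k (\<lambda>i. if i = 0 then 0 else N_low (int m) (int k) (int l) (int N) i)"
          unfolding sh(2) by (rule eq)
      next
        fix i :: int assume i: "1 \<le> i" "i < int k"
        have "0 \<le> L i"
        proof (cases "i \<le> int k - int 1 - 1")
          case True
          have "0 \<le> G (i + int 1)" by (rule G0) (use True i in simp_all)
          then show ?thesis by (simp only: L_def if_P[OF True])
        next
          case False
          then have "i + int 1 - int k = 0" using i by simp
          then show ?thesis using False T01 G0T by (simp only: L_def if_False)
        qed
        then show "0 \<le> N_low (int m) (int k) (int l) (int N) i" using L[of i] i by simp
      qed
    qed
  qed
qed

section \<open>The local parametrisation near the multiple critical point\<close>

lemma poly_eq_smult_prod_roots: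
  fixes P :: "complex poly"
  assumes "finite R" "degree P \<le> card R" "\<And>x. x \<in> R \<Longrightarrow> poly P x = 0"
  shows "P = Polynomial.smult (coeff P (card R)) (\<Prod>x\<in>R. [:- x, 1:])"
proof -
  define Q :: "complex poly" where "Q = (\<Prod>x\<in>R. [:- x, 1:])"
  define D where "D = P - Polynomial.smult (coeff P (card R)) Q"
  have degQ: "degree Q = card R" unfolding Q_def by (subst degree_prod_eq_sum_degree) auto
  have "lead_coeff Q = 1" unfolding Q_def by (simp add: lead_coeff_prod)
  then have cQ: "coeff Q (card R) = 1" using degQ by simp
  have D0: "poly D x = 0" if "x \<in> R" for x
    using that assms by (auto simp: D_def Q_def poly_prod)
  have "coeff D i = 0" if "i \<ge> card R" for i
    using that assms(2) degQ cQ by (cases "i = card R") (auto simp: D_def coeff_eq_0)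
  then have degD: "D = 0 \<or> degree D < card R"
    by (metis leading_coeff_0_iff not_le)
  have "D = 0"
  proof (rule ccontr)
    assume D: "D \<noteq> 0"
    have "card R \<le> card {x. poly D x = 0}" using D0 by (intro card_mono poly_roots_finite[OF D]) auto
    also have "\<dots> \<le> degree D" by (rule card_poly_roots_bound[OF D])
    finally show False using degD D by simp
  qed
  then show ?thesis by (simp add: D_def Q_def)
qed

locale mk_background =
  fixes M :: nat and lam1 :: real and k \<rho> c :: "nat \<Rightarrow> real" and p0 :: complex
  assumes M: "M \<ge> 2" and lam1: "lam1 > 0"
    and k_eq: "\<forall>j\<in>{1..M}. k j = k 1 + lam1 * (sin (pi / (M + 1)) * cot (j * pi / (M + 1)) - cos (pi / (M + 1)))"
    and c\<rho>: "\<forall>j\<in>{1..M}. c j * (\<rho> j)\<^sup>2 =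
           (-1) ^ j * (\<Prod>i\<in>{1..M} - {j}. inverse (k j - k i))
             * (lam1 * sin (pi / (M + 1)) / sin (j * pi / (M + 1))) ^ (M + 1)"
    and p0: "p0 = Complex (lam1 * sin (pi / (M + 1))) (k 1 - lam1 * cos (pi / (M + 1))) \<or>
         p0 = Complex (- lam1 * sin (pi / (M + 1))) (k 1 - lam1 * cos (pi / (M + 1)))"
    and Re_p0: "Re p0 \<noteq> 0"
begin

definition "phi = pi / (M + 1)"

definition "rr j = lam1 * sin phi / sin (j * phi)" for j :: nat

definition "sg = p0 + cnj p0"

lemma sg: "sg = of_real (2 * Re p0)" "sg \<noteq> 0"
  using Re_p0 by (auto simp: sg_def complex_eq_iff)

lemma phi_bounds: "j \<in> {1..M} \<Longrightarrow> 0 < j * phi" "j \<in> {1..M} \<Longrightarrow> j * phi < pi"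
proof -
  assume j: "j \<in> {1..M}"
  then show "0 < j * phi" by (auto simp: phi_def)
  have "real j * pi < (real M + 1) * pi" using j by (intro mult_strict_right_mono) auto
  then show "j * phi < pi" by (simp add: phi_def field_simps)
qed

lemma sin_pos: "j \<in> {1..M} \<Longrightarrow> sin (j * phi) > 0"
  using phi_bounds by (intro sin_gt_zero)

lemma k_phi: "j \<in> {1..M} \<Longrightarrow> k j = k 1 - lam1 * cos phi + rr j * cos (j * phi)"
proof -
  assume j: "j \<in> {1..M}"
  have "k j = k 1 + lam1 * (sin phi * cot (j * phi) - cos phi)"
    using bspec[OF k_eq j] by (simp add: phi_def add.commute)
  then show ?thesis by (simp add: rr_def cot_def algebra_simps)
qed

lemma k_inj: "inj_on k {1..M}"
proof (rule inj_onI)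
  fix i j assume ij: "i \<in> {1..M}" "j \<in> {1..M}" "k i = k j"
  have s1: "sin phi > 0" using sin_pos[of 1] M by simp
  have "rr i * cos (i * phi) = rr j * cos (j * phi)" using k_phi[OF ij(1)] k_phi[OF ij(2)] ij(3) by simp
  then have "cos (i * phi) * sin (j * phi) = cos (j * phi) * sin (i * phi)"
    using sin_pos[OF ij(1)] sin_pos[OF ij(2)] s1 lam1 by (simp add: rr_def field_simps)
  then have z: "sin (j * phi - i * phi) = 0" by (simp add: sin_diff algebra_simps)
  have "j * phi - i * phi < pi" "- pi < j * phi - i * phi"
    using phi_bounds[OF ij(1)] phi_bounds[OF ij(2)] by linarith+
  then have "j * phi - i * phi = 0" using z sin_eq_0_pi by blast
  then show "i = j" using s1 by (auto simp flip: left_diff_distrib)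
qed

text \<open>From \<open>p0\<close> and from its mirror image \<open>- cnj p0\<close> the pole number
  \<open>j\<close> is seen at distance \<open>rr j\<close> and at angle \<open>j * phi\<close> from
  the imaginary axis. Since \<open>(M + 1) * phi = pi\<close>, the power \<open>M + 1\<close> leaves
  of the angle only the sign \<open>(-1) ^ j\<close>, the same for both points.\<close>

lemma pole_power:
  assumes j: "j \<in> {1..M}" and q: "q = p0 \<or> q = - cnj p0"
  shows "(\<i> * of_real (k j) - q) ^ (M + 1) = \<i> ^ (M + 1) * (-1) ^ j * of_real (rr j) ^ (M + 1)"
proof -
  have sj: "sin (j * phi) > 0" using sin_pos j by blast
  have r: "rr j * sin (j * phi) = lam1 * sin phi" using sj by (simp add: rr_def)
  have c1: "(cis (j * phi)) ^ (M + 1) = (-1) ^ j"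
  proof -
    have "(cis (j * phi)) ^ (M + 1) = cis (real (M + 1) * (j * phi))" by (rule Complex.DeMoivre)
    also have "real (M + 1) * (j * phi) = j * pi" by (simp add: phi_def field_simps)
    also have "cis (j * pi) = (-1) ^ j" by (simp flip: Complex.DeMoivre)
    finally show ?thesis .
  qed
  have c2: "(cis (- (j * phi))) ^ (M + 1) = (-1) ^ j"
    using arg_cong[OF c1, of cnj] by (simp add: cis_cnj)
  have "Im p0 = k 1 - lam1 * cos phi" "Re p0 = lam1 * sin phi \<or> Re p0 = - (lam1 * sin phi)"
    using p0 by (auto simp: phi_def add.commute)
  then have "Im q = k 1 - lam1 * cos phi" "Re q = rr j * sin (j * phi) \<or> Re q = - (rr j * sin (j * phi))"
    using q r by auto
  then have "\<i> * of_real (k j) - q = \<i> * of_real (rr j) * cis (j * phi) \<or>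
      \<i> * of_real (k j) - q = \<i> * of_real (rr j) * cis (- (j * phi))"
    using k_phi[OF j] by (auto simp: complex_eq_iff)
  then show ?thesis using c1 c2 by (auto simp: power_mult_distrib algebra_simps simp del: power_Suc)
qed

definition "Rts = (\<lambda>j. \<i> * complex_of_real (k j)) ` {1..M}"

definition "QQ = (\<Prod>x\<in>Rts. [:- x, 1:])"

lemma inj_Rts: "inj_on (\<lambda>j. \<i> * complex_of_real (k j)) {1..M}"
proof (rule inj_onI)
  fix i j assume *: "i \<in> {1..M}" "j \<in> {1..M}" "\<i> * complex_of_real (k i) = \<i> * complex_of_real (k j)"
  have "complex_of_real (k i) = complex_of_real (k j)" using *(3) by (metis complex_i_not_zero mult_left_cancel)
  then have "k i = k j" by (simp only: of_real_eq_iff)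
  then show "i = j" using *(1,2) by (rule inj_onD[OF k_inj])
qed

lemma Rts: "finite Rts" "card Rts = M"
  using inj_Rts by (simp_all add: Rts_def card_image)

lemma QQ_poly: "poly QQ q = (\<Prod>j\<in>{1..M}. q - \<i> * of_real (k j))"
  unfolding QQ_def Rts_def by (subst prod.reindex[OF inj_Rts]) (simp add: poly_prod)

lemma QQ_nonzero: "Re x \<noteq> 0 \<Longrightarrow> poly QQ x \<noteq> 0"
proof -
  assume "Re x \<noteq> 0"
  then have "x - \<i> * of_real (k j) \<noteq> 0" for j by (auto simp: complex_eq_iff)
  then show ?thesis by (simp add: QQ_poly)
qed

lemma QQ_degree: "degree QQ = M" "coeff QQ M = 1"
proof -
  show d: "degree QQ = M" unfolding QQ_def by (subst degree_prod_eq_sum_degree) (auto simp: Rts)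
  have "lead_coeff QQ = 1" unfolding QQ_def by (simp add: lead_coeff_prod)
  then show "coeff QQ M = 1" using d by simp
qed

definition "Qj j = (\<Prod>i\<in>{1..M} - {j}. [:- (\<i> * of_real (k i)), 1 :: complex:])"

lemma Qj_poly: "poly (Qj j) q = (\<Prod>i\<in>{1..M} - {j}. q - \<i> * of_real (k i))"
  by (simp add: Qj_def poly_prod)

lemma Qj_degree: "j \<in> {1..M} \<Longrightarrow> degree (Qj j) < M"
  unfolding Qj_def by (subst degree_prod_eq_sum_degree) auto

text \<open>This is what the formula for \<open>c j * (\<rho> j)\<^sup>2\<close> is made for: the
  residues of \<open>FM\<close> are those of \<open>(q - p0) ^ (M + 1)\<close> divided by the
  product of the factors \<open>q - \<i> * k j\<close>.\<close>

lemma residue_value: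
  assumes j: "j \<in> {1..M}"
  shows "of_real (c j * (\<rho> j)\<^sup>2) * poly (Qj j) (\<i> * of_real (k j)) = - ((\<i> * of_real (k j) - p0) ^ (M + 1))"
proof -
  have "poly (Qj j) (\<i> * of_real (k j)) = (\<Prod>i\<in>{1..M} - {j}. \<i> * of_real (k j - k i))"
    unfolding Qj_poly by (simp add: algebra_simps)
  also have "\<dots> = \<i> ^ (M - 1) * of_real (\<Prod>i\<in>{1..M} - {j}. k j - k i)"
    using j by (simp add: prod.distrib)
  finally have Q: "poly (Qj j) (\<i> * of_real (k j)) = \<i> ^ (M - 1) * of_real (\<Prod>i\<in>{1..M} - {j}. k j - k i)" .
  have nz: "(\<Prod>i\<in>{1..M} - {j}. k j - k i) \<noteq> 0"
  proof
    assume "(\<Prod>i\<in>{1..M} - {j}. k j - k i) = 0"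
    then obtain i where i: "i \<in> {1..M} - {j}" "k j - k i = 0" by (simp only: prod_zero_iff finite_Diff finite_atLeastAtMost) blast
    then have "k i = k j" by linarith
    then have "i = j" by (rule inj_onD[OF k_inj]) (use i j in blast)+
    with i(1) show False by blast
  qed
  have "c j * (\<rho> j)\<^sup>2 * (\<Prod>i\<in>{1..M} - {j}. k j - k i) = (-1) ^ j * rr j ^ (M + 1)"
  proof -
    let ?P = "\<Prod>i\<in>{1..M} - {j}. k j - k i"
    have inv: "(\<Prod>i\<in>{1..M} - {j}. inverse (k j - k i)) = inverse ?P"
      using prod_inversef[of "\<lambda>i. k j - k i" "{1..M} - {j}"] by (simp add: o_def)
    have arg: "j * pi / (M + 1) = j * phi" by (simp add: phi_def)
    have "c j * (\<rho> j)\<^sup>2 = (-1) ^ j * inverse ?P * rr j ^ (M + 1)"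
      using bspec[OF c\<rho> j] unfolding inv arg rr_def phi_def[symmetric] .
    then have "c j * (\<rho> j)\<^sup>2 * ?P = (-1) ^ j * rr j ^ (M + 1) * (inverse ?P * ?P)"
      by (simp only: mult_ac)
    then show ?thesis using nz by simp
  qed
  then have "of_real (c j * (\<rho> j)\<^sup>2) * poly (Qj j) (\<i> * of_real (k j)) =
      \<i> ^ (M - 1) * of_real ((-1) ^ j * rr j ^ (M + 1))"
    unfolding Q by (simp only: mult.left_commute[of "complex_of_real (c j * (\<rho> j)\<^sup>2)"] flip: of_real_mult)
  also have "\<i> ^ (M - 1) = - (\<i> ^ (M + 1))"
  proof -
    have "M + 1 = (M - 1) + 2" using M by simp
    then have "\<i> ^ (M + 1) = \<i> ^ (M - 1) * \<i> ^ 2" by (simp only: power_add)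
    then show ?thesis by simp
  qed
  finally show ?thesis
    unfolding pole_power[OF j disjI1[OF refl]] by simp
qed

abbreviation "F0 \<equiv> FM M k c \<rho> p0"

text \<open>\<open>FM\<close> is totally ramified over two values: \<open>FM - F0\<close> has
  \<open>p0\<close> as its only zero, of order \<open>M + 1\<close>, and another translate of
  \<open>FM\<close> has \<open>- cnj p0\<close> as its only zero. The quotient of the two identities
  expresses the power \<open>M + 1\<close> of a Moebius coordinate through
  \<open>FM\<close>.\<close>

lemma mobius:
  assumes "poly QQ q \<noteq> 0"
  shows "(q - p0) ^ (M + 1) = (FM M k c \<rho> q - F0) * poly QQ q"
    "(q + cnj p0) ^ (M + 1) = (FM M k c \<rho> q - F0 + of_nat (M + 1) * sg) * poly QQ q"
proof -
  define S where "S = (\<Sum>j=1..M. Polynomial.smult (of_real (c j * (\<rho> j)\<^sup>2)) (Qj j))"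
  have degS: "degree S < M" unfolding S_def
    using M Qj_degree by (intro degree_sum_less) (auto intro: le_less_trans[OF degree_smult_le])
  define B where "B = [:- p0, 1:] ^ (M + 1)"
  define A where "A = [:cnj p0, 1:] ^ (M + 1)"
  define R where "R = B - [:0, 1:] * QQ + S"
  have dAB: "degree A = M + 1" "degree B = M + 1" by (simp_all add: A_def B_def degree_linear_power del: power_Suc)
  have cAB: "coeff A (M + 1) = 1" "coeff B (M + 1) = 1" by (simp_all add: A_def B_def coeff_linear_power del: power_Suc)
  have dX: "degree ([:0, 1:] * QQ) \<le> M + 1"
    by (rule order.trans[OF degree_mult_le]) (simp add: QQ_degree)
  have cX: "coeff ([:0, 1:] * QQ) (M + 1) = 1" by (simp add: QQ_degree coeff_eq_0)
  have degR: "degree R \<le> M"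
  proof (rule degree_le, intro allI impI)
    fix i assume i: "i > M"
    show "coeff R i = 0"
    proof (cases "i = M + 1")
      case True
      then show ?thesis using cAB cX degS by (simp add: R_def coeff_eq_0 del: mult_pCons_left)
    next
      case False
      then have "i > M + 1" using i by simp
      then have "coeff B i = 0" "coeff ([:0, 1:] * QQ) i = 0" "coeff S i = 0"
        using dAB dX degS by (intro coeff_eq_0; linarith)+
      then show ?thesis by (simp add: R_def del: mult_pCons_left)
    qed
  qed
  have polyB: "poly B x = (x - p0) ^ (M + 1)" and polyA: "poly A x = (x + cnj p0) ^ (M + 1)" for x
    by (simp_all add: A_def B_def add.commute del: power_Suc)
  have polyS: "poly S x = (\<Sum>j=1..M. of_real (c j * (\<rho> j)\<^sup>2) * poly (Qj j) x)" for x
    by (simp add: S_def poly_sum)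
  have S_at: "poly S (\<i> * of_real (k i)) = of_real (c i * (\<rho> i)\<^sup>2) * poly (Qj i) (\<i> * of_real (k i))"
    if i: "i \<in> {1..M}" for i
  proof -
    have "poly (Qj j) (\<i> * of_real (k i)) = 0" if "j \<in> {1..M} - {i}" for j
      unfolding Qj_poly using that i by (intro prod_zero) auto
    then show ?thesis unfolding polyS using i by (subst sum.remove[of _ i]) auto
  qed
  have R0: "poly R x = 0" if "x \<in> Rts" for x
  proof -
    from that obtain i where i: "i \<in> {1..M}" "x = \<i> * of_real (k i)" by (auto simp: Rts_def)
    have "poly QQ x = 0" unfolding QQ_poly using i by (intro prod_zero) auto
    then show ?thesis using residue_value[OF i(1)] S_at[OF i(1)] i(2)
      by (simp add: R_def polyB)
  qed
  have AB0: "poly (A - B) x = 0" if "x \<in> Rts" for x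
  proof -
    from that obtain i where i: "i \<in> {1..M}" "x = \<i> * of_real (k i)" by (auto simp: Rts_def)
    have "(x - p0) ^ (M + 1) = (x - (- cnj p0)) ^ (M + 1)"
      unfolding i(2) pole_power[OF i(1) disjI1[OF refl]] pole_power[OF i(1) disjI2[OF refl]] ..
    then show ?thesis by (simp add: polyA polyB)
  qed
  have degAB: "degree (A - B) \<le> M"
  proof (rule degree_le, intro allI impI)
    fix i assume i: "i > M"
    show "coeff (A - B) i = 0"
      using i dAB cAB by (cases "i = M + 1") (auto simp: coeff_eq_0)
  qed
  have cABM: "coeff (A - B) M = of_nat (M + 1) * sg"
    unfolding A_def B_def sg_def by (simp add: coeff_linear_poly_power algebra_simps del: power_Suc)
  \<comment> \<open>Both powers agree at all \<open>M\<close> poles, so their difference, of degree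
    at most \<open>M\<close>, is a multiple of \<open>QQ\<close>; the factor is its coefficient in
    degree \<open>M\<close>.\<close>
  have AB: "A - B = Polynomial.smult (of_nat (M + 1) * sg) QQ"
    by (rule poly_eq_smult_prod_roots[OF Rts(1) _ AB0, unfolded Rts(2) cABM, OF degAB, folded QQ_def])
  have RQ: "R = Polynomial.smult (coeff R M) QQ"
    by (rule poly_eq_smult_prod_roots[OF Rts(1) _ R0, unfolded Rts(2), OF degR, folded QQ_def])
  \<comment> \<open>This coefficient is identified only afterwards, as \<open>- F0\<close>, by
    evaluation at \<open>p0\<close>.\<close>
  define r where "r = coeff R M"
  have FQ: "FM M k c \<rho> x * poly QQ x = x * poly QQ x - poly S x" if nz: "poly QQ x \<noteq> 0" for x
  proof -
    have "of_real (c j * (\<rho> j)\<^sup>2) / (x - \<i> * of_real (k j)) * poly QQ x =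
        of_real (c j * (\<rho> j)\<^sup>2) * poly (Qj j) x" if j: "j \<in> {1..M}" for j
    proof -
      have "poly QQ x = (x - \<i> * of_real (k j)) * poly (Qj j) x"
        unfolding QQ_poly Qj_poly using j by (subst prod.remove[of _ j]) auto
      then show ?thesis using nz by simp
    qed
    then show ?thesis unfolding FM_def polyS left_diff_distrib sum_distrib_right
      by (intro arg_cong2[of _ _ _ _ "(-)"] sum.cong refl) auto
  qed
  have main: "(x - p0) ^ (M + 1) = (FM M k c \<rho> x - (- r)) * poly QQ x - 2 * 0" if nz: "poly QQ x \<noteq> 0" for x
  proof -
    have "poly R x = r * poly QQ x" using RQ by (metis poly_smult r_def)
    then have "(x - p0) ^ (M + 1) = r * poly QQ x + (x * poly QQ x - poly S x)"
      by (simp add: R_def polyB algebra_simps del: power_Suc)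
    then show ?thesis unfolding FQ[OF nz, symmetric] by (simp only: ring_distribs) simp
  qed
  have QQp0: "poly QQ p0 \<noteq> 0" using QQ_nonzero Re_p0 by blast
  have "F0 = - r" using main[OF QQp0] QQp0 by (simp add: eq_neg_iff_add_eq_0)
  then show 1: "(q - p0) ^ (M + 1) = (FM M k c \<rho> q - F0) * poly QQ q"
    using main[OF assms] by simp
  have "poly (A - B) q = of_nat (M + 1) * sg * poly QQ q" unfolding AB by simp
  then show "(q + cnj p0) ^ (M + 1) = (FM M k c \<rho> q - F0 + of_nat (M + 1) * sg) * poly QQ q"
    using 1 by (simp add: polyA polyB algebra_simps del: power_Suc)
qed

text \<open>The second identity of \<open>mobius\<close> at its zero \<open>- cnj p0\<close>,
  combined with the reflection symmetry of \<open>FM\<close>, which holds since the poles are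
  imaginary and the weights real. It yields \<open>F0 \<noteq> 0\<close>, so the equation for
  \<open>p\<close> does not degenerate.\<close>

lemma Re_F0: "2 * Re F0 = (M + 1) * (2 * Re p0)"
proof -
  have nz: "poly QQ (- cnj p0) \<noteq> 0"
    using QQ_nonzero[of "- cnj p0"] Re_p0 by simp
  have "FM M k c \<rho> (- cnj p0) - F0 + of_nat (M + 1) * sg = 0"
    using mobius(2)[OF nz] nz by simp
  moreover have "FM M k c \<rho> (- cnj p0) = - cnj F0"
  proof -
    have "of_real (c j * (\<rho> j)\<^sup>2) / (- cnj p0 - \<i> * of_real (k j)) =
        - cnj (of_real (c j * (\<rho> j)\<^sup>2) / (p0 - \<i> * of_real (k j)))" for j
    proof -
      have "- cnj p0 - \<i> * of_real (k j) = - cnj (p0 - \<i> * of_real (k j))"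
        by (simp add: complex_eq_iff)
      then show ?thesis by (simp del: complex_cnj_diff)
    qed
    then show ?thesis by (simp add: FM_def cnj_sum sum_negf del: complex_cnj_divide)
  qed
  ultimately have "of_nat (M + 1) * sg = F0 + cnj F0" by (simp add: algebra_simps)
  from arg_cong[OF this, of Re] show ?thesis by (simp add: sg)
qed

lemma F0_nonzero: "F0 \<noteq> 0"
  using Re_F0 Re_p0 by auto

end

section \<open>Rotational symmetry of the local parametrisation\<close>

lemma has_fps_expansion_eq_fps_expansion:
  fixes F :: "complex fps"
  assumes "f has_fps_expansion F"
  shows "fps_expansion f 0 = F"
  using analytic_at_imp_has_fps_expansion_0[OF has_fps_expansion_imp_analytic_0[OF assms]] assms
  by (rule fps_expansion_unique_complex)

lemma sum_roots_of_unity: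
  fixes w :: complex
  assumes "w ^ K = 1" "w \<noteq> 1"
  shows "(\<Sum>n=1..K. w ^ n) = 0"
proof -
  have "(\<Sum>n=1..K. w ^ n) = w * (\<Sum>n<K. w ^ n)"
    by (simp add: sum_distrib_left sum.atLeast1_atMost_eq)
  then show ?thesis using assms geometric_sum[of w K] by simp
qed

lemma tendsto_scaled_0: "((\<lambda>x. c * x) \<longlongrightarrow> 0) (nhds (0::complex))"
  using tendsto_mult_right_zero[OF filterlim_ident, of "c"] by (simp add: tendsto_mult_right_zero)

locale mk_param = mk_background +
  fixes p :: "complex \<Rightarrow> complex"
  assumes p_an: "p analytic_on {0}" and p_0: "p 0 = p0"
    and p_eq: "\<forall>\<^sub>F \<kappa> in nhds 0. FM M k c \<rho> (p \<kappa>) =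
           FM M k c \<rho> p0 / of_nat (M + 1) *
             (\<Sum>n=1..M+1. exp (of_real (cos (2 * n * pi / (M + 1))) * \<kappa>)
                          * cos (of_real (sin (2 * n * pi / (M + 1))) * \<kappa>))"
begin

definition "om = cis (2 * pi / (M + 1))"

definition "K = M + 1"

text \<open>The right-hand side of the equation for \<open>p\<close> is
  \<open>F0 * (1 + eh \<kappa>)\<close>. Written with roots of unity, it visibly contains only
  powers of \<open>\<kappa>\<close> divisible by \<open>K\<close> and is invariant under rotation by
  \<open>om\<close>.\<close>

definition "eh \<kappa> = (\<Sum>n=1..K. (exp (om ^ n * \<kappa>) + exp (cnj om ^ n * \<kappa>)) * (1 / 2)) * (1 / of_nat K) - 1" for \<kappa>

lemma K_nz: "K > 0" "of_nat K \<noteq> (0::complex)"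
proof -
  show "K > 0" by (simp add: K_def)
  then show "of_nat K \<noteq> (0::complex)" by simp
qed

lemma om_K: "om ^ K = 1"
  by (simp add: om_def K_def Complex.DeMoivre del: power_Suc)

lemma om_power_eq_1: "om ^ r = 1 \<longleftrightarrow> K dvd r"
proof
  assume "om ^ r = 1"
  then have "cis (real r * (2 * pi / (M + 1))) = 1" by (simp add: om_def Complex.DeMoivre)
  then have "cos (real r * (2 * pi / (M + 1))) = 1" by (simp add: complex_eq_iff)
  then obtain n :: int where "real r * (2 * pi / (M + 1)) = real_of_int n * 2 * pi"
    using cos_one_2pi_int by blast
  then have "(real r - of_int n * real K) * (2 * pi) = 0" by (simp add: K_def field_simps)
  then have "real r = of_int n * real K" by simp
  then have "int r = n * int K" by (metis of_int_eq_iff of_int_mult of_int_of_nat_eq)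
  then show "K dvd r" by (metis dvd_triv_right int_dvd_int_iff)
next
  assume "K dvd r"
  then show "om ^ r = 1" by (auto simp: power_mult om_K)
qed

lemma cnj_om: "cnj om ^ r = 1 \<longleftrightarrow> K dvd r"
  by (metis complex_cnj_cnj complex_cnj_one complex_cnj_power om_power_eq_1)

lemma om_nz: "om \<noteq> 0"
  by (simp add: om_def)

lemma eh_eq:
  "(\<Sum>n=1..M+1. exp (of_real (cos (2 * n * pi / (M + 1))) * \<kappa>)
      * cos (of_real (sin (2 * n * pi / (M + 1))) * \<kappa>)) = of_nat (M + 1) * (1 + eh \<kappa>)"
proof -
  have "exp (of_real (cos (2 * n * pi / (M + 1))) * \<kappa>) * cos (of_real (sin (2 * n * pi / (M + 1))) * \<kappa>)
      = (exp (om ^ n * \<kappa>) + exp (cnj om ^ n * \<kappa>)) * (1 / 2)" for n :: nat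
  proof -
    let ?a = "2 * n * pi / (M + 1)"
    have 1: "om ^ n = of_real (cos ?a) + \<i> * of_real (sin ?a)"
      by (simp add: om_def Complex.DeMoivre complex_eq_iff mult_ac)
    then have 2: "cnj om ^ n = of_real (cos ?a) - \<i> * of_real (sin ?a)"
      by (metis complex_cnj_add complex_cnj_complex_of_real complex_cnj_i complex_cnj_mult
          complex_cnj_power diff_conv_add_uminus mult_minus_left)
    show ?thesis unfolding 1 2
      by (simp add: cos_exp_eq ring_distribs exp_add exp_diff exp_minus field_simps)
  qed
  then have "(\<Sum>n=1..M+1. exp (of_real (cos (2 * n * pi / (M + 1))) * \<kappa>)
      * cos (of_real (sin (2 * n * pi / (M + 1))) * \<kappa>)) =
      (\<Sum>n=1..K. (exp (om ^ n * \<kappa>) + exp (cnj om ^ n * \<kappa>)) * (1 / 2))"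
    unfolding K_def by (intro sum.cong refl)
  also have "\<dots> = of_nat K * (1 + eh \<kappa>)"
    unfolding eh_def using K_nz(2) by (simp only: add_diff_cancel_left' diff_add_cancel add.commute[of 1]) simp
  finally show ?thesis unfolding K_def .
qed

definition "EH = Abs_fps (\<lambda>r. if r > 0 \<and> K dvd r then 1 / fact r else 0 :: complex)"

lemma eh_expansion: "eh has_fps_expansion EH"
proof -
  let ?F = "(\<Sum>n=1..K. (fps_exp (om ^ n) + fps_exp (cnj om ^ n)) * fps_const (1 / 2)) * fps_const (1 / of_nat K) - 1"
  have "(\<lambda>\<kappa>. (\<Sum>n=1..K. (exp (om ^ n * \<kappa>) + exp (cnj om ^ n * \<kappa>)) * (1 / 2)) * (1 / of_nat K) - 1)
      has_fps_expansion ?F"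
    by (intro fps_expansion_intros)
  moreover have "?F = EH"
  proof (rule fps_ext)
    fix r
    have K0: "K > 0" by (simp add: K_def)
    have s: "(\<Sum>n=1..K. (om ^ n) ^ r) = (if K dvd r then of_nat K else 0)"
            "(\<Sum>n=1..K. (cnj om ^ n) ^ r) = (if K dvd r then of_nat K else 0)"
    proof -
      have e: "(a ^ n) ^ r = (a ^ r) ^ n" for a :: complex and n by (simp add: mult.commute flip: power_mult)
      have g: "(\<Sum>n=1..K. (a ^ r) ^ n) = (if K dvd r then of_nat K else 0)"
        if a: "a ^ K = 1" "a ^ r = 1 \<longleftrightarrow> K dvd r" for a :: complex
      proof (cases "K dvd r")
        case False
        have "(a ^ r) ^ K = 1" using a(1) by (metis e power_one)
        then show ?thesis using sum_roots_of_unity[of "a ^ r" K] a(2) False by simp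
      qed (use a in simp)
      show "(\<Sum>n=1..K. (om ^ n) ^ r) = (if K dvd r then of_nat K else 0)"
        unfolding e by (rule g[OF om_K om_power_eq_1])
      show "(\<Sum>n=1..K. (cnj om ^ n) ^ r) = (if K dvd r then of_nat K else 0)"
        unfolding e by (rule g[OF _ cnj_om]) (simp add: cnj_om)
    qed
    have t: "fps_nth (fps_exp a + fps_exp b) r = (a ^ r + b ^ r) * (1 / fact r)" for a b :: complex
      by (simp add: add_divide_distrib)
    have "fps_nth ?F r = (\<Sum>n=1..K. ((om ^ n) ^ r + (cnj om ^ n) ^ r)) * (1 / fact r) * (1 / 2) * (1 / of_nat K) - fps_nth 1 r"
      by (simp only: fps_sub_nth fps_mult_right_const_nth fps_sum_nth t sum_distrib_right[symmetric])
    also have "\<dots> = fps_nth EH r"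
      unfolding sum.distrib s using K0 by (cases "r = 0") (auto simp: EH_def)
    finally show "fps_nth ?F r = fps_nth EH r" .
  qed
  ultimately show ?thesis unfolding eh_def[abs_def] by simp
qed

lemma eh_rotate: "eh (om * \<kappa>) = eh \<kappa>"
proof -
  have shift: "(\<Sum>n=1..K. exp (a ^ n * (a * \<kappa>))) = (\<Sum>n=1..K. exp (a ^ n * \<kappa>))" if "a ^ K = 1" for a
  proof -
    have "(\<Sum>n=1..K. exp (a ^ n * (a * \<kappa>))) = (\<Sum>n=1..K. exp (a ^ Suc n * \<kappa>))"
      by (simp add: mult_ac)
    also have "\<dots> = (\<Sum>n=Suc 1..Suc K. exp (a ^ n * \<kappa>))"
      by (rule sum.shift_bounds_cl_Suc_ivl[symmetric])
    also have "\<dots> = (\<Sum>n=1..K. exp (a ^ n * \<kappa>))"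
    proof -
      have "(\<Sum>n=1..Suc K. exp (a ^ n * \<kappa>)) = exp (a ^ 1 * \<kappa>) + (\<Sum>n=Suc 1..Suc K. exp (a ^ n * \<kappa>))"
        by (rule sum.atLeast_Suc_atMost) simp
      moreover have "(\<Sum>n=1..Suc K. exp (a ^ n * \<kappa>)) = (\<Sum>n=1..K. exp (a ^ n * \<kappa>)) + exp (a ^ Suc K * \<kappa>)"
        by simp
      ultimately show ?thesis using that by simp
    qed
    finally show ?thesis .
  qed
  have om_cnj: "om * cnj om = 1" by (simp add: om_def cis_cnj cis_mult)
  have 1: "(\<Sum>n=1..K. exp (om ^ n * (om * \<kappa>))) = (\<Sum>n=1..K. exp (om ^ n * \<kappa>))"
    by (rule shift[OF om_K])
  have 2: "(\<Sum>n=1..K. exp (cnj om ^ n * (om * \<kappa>))) = (\<Sum>n=1..K. exp (cnj om ^ n * \<kappa>))"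
  proof -
    have "cnj om ^ K = 1" by (simp add: cnj_om)
    note * = shift[OF this]
    have "(\<Sum>n=1..K. exp (cnj om ^ n * (om * \<kappa>))) = (\<Sum>n=1..K. exp (cnj om ^ (n - 1) * \<kappa>))"
    proof (intro sum.cong refl arg_cong[of _ _ exp])
      fix n assume "n \<in> {1..K}"
      then have "cnj om ^ n = cnj om ^ (n - 1) * cnj om" by (metis atLeastAtMost_iff less_eq_Suc_le One_nat_def power_minus_mult)
      then show "cnj om ^ n * (om * \<kappa>) = cnj om ^ (n - 1) * \<kappa>" using om_cnj by (simp add: mult_ac)
    qed
    also have "\<dots> = (\<Sum>n<K. exp (cnj om ^ n * \<kappa>))" by (simp add: sum.atLeast1_atMost_eq)
    also have "\<dots> = (\<Sum>n=1..K. exp (cnj om ^ n * \<kappa>))"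
    proof -
      have "(\<Sum>n<Suc K. exp (cnj om ^ n * \<kappa>)) = exp (cnj om ^ 0 * \<kappa>) + (\<Sum>n<K. exp (cnj om ^ Suc n * \<kappa>))"
        by (rule sum.lessThan_Suc_shift)
      moreover have "(\<Sum>n<K. exp (cnj om ^ Suc n * \<kappa>)) = (\<Sum>n=1..K. exp (cnj om ^ n * \<kappa>))"
        by (simp add: sum.atLeast1_atMost_eq)
      ultimately show ?thesis using \<open>cnj om ^ K = 1\<close> by simp
    qed
    finally show ?thesis .
  qed
  show ?thesis unfolding eh_def
    by (simp only: distrib_right sum.distrib sum_distrib_right[symmetric] 1 2)
qed

text \<open>The Moebius coordinate along \<open>p\<close>: it sends \<open>p0\<close> to 0 and
  \<open>- cnj p0\<close> to infinity, so \<open>mobius\<close> determines its power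
  \<open>K\<close>.\<close>

definition "uu \<kappa> = (p \<kappa> - p0) / (p \<kappa> + cnj p0)" for \<kappa>

definition "P = fps_expansion p 0"

definition "U = (P - fps_const p0) / (P + fps_const (cnj p0))"

lemma P: "p has_fps_expansion P" "fps_nth P 0 = p0" "fps_nth P 1 = p1 p" "fps_nth P 2 = p2 p"
proof -
  show e: "p has_fps_expansion P" unfolding P_def by (rule analytic_at_imp_has_fps_expansion_0[OF p_an])
  show "fps_nth P 0 = p0" "fps_nth P 1 = p1 p" "fps_nth P 2 = p2 p"
    by (simp_all add: P_def fps_expansion_def p_0 p1_def p2_def fact_2)
qed

lemma sg_P: "fps_nth (P + fps_const (cnj p0)) 0 \<noteq> 0"
  using sg P(2) by (simp add: sg_def)

lemma uu_expansion: "uu has_fps_expansion U"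
  unfolding uu_def[abs_def] U_def
  using sg_P by (intro fps_expansion_intros P(1)) auto

lemma U_nth: "fps_nth U 0 = 0" "fps_nth U 1 = p1 p / sg"
proof -
  have m: "U * (P + fps_const (cnj p0)) = P - fps_const p0"
    unfolding U_def using sg_P by (metis fps_zero_nth mult.commute fps_divide_times_eq dvd_div_mult_self fps_is_unit_iff unit_imp_dvd)
  from arg_cong[OF m, of "\<lambda>f. fps_nth f 0"] sg_P P show 0: "fps_nth U 0 = 0" by simp
  from arg_cong[OF m, of "\<lambda>f. fps_nth f 1"] 0 P(2,3) have "fps_nth U 1 * sg = p1 p"
    by (simp add: fps_mult_nth sg_def)
  then show "fps_nth U 1 = p1 p / sg" using sg(2) by (simp add: field_simps)
qed

lemma uu_power: "\<forall>\<^sub>F \<kappa> in nhds 0. uu \<kappa> ^ K * (F0 * eh \<kappa> + of_nat K * sg) = F0 * eh \<kappa>"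
proof -
  have "isCont p 0" using p_an by (simp add: analytic_at_imp_isCont)
  then have t: "(p \<longlongrightarrow> p0) (nhds 0)" using p_0 by (simp add: isCont_def tendsto_nhds_iff)
  have t1: "((\<lambda>\<kappa>. poly QQ (p \<kappa>)) \<longlongrightarrow> poly QQ p0) (nhds 0)" by (intro tendsto_intros t)
  have t2: "((\<lambda>\<kappa>. p \<kappa> + cnj p0) \<longlongrightarrow> p0 + cnj p0) (nhds 0)" by (intro tendsto_intros t)
  have "\<forall>\<^sub>F \<kappa> in nhds 0. poly QQ (p \<kappa>) \<noteq> 0"
    by (rule tendsto_imp_eventually_ne[OF t1]) (use QQ_nonzero Re_p0 in blast)
  moreover have "\<forall>\<^sub>F \<kappa> in nhds 0. p \<kappa> + cnj p0 \<noteq> 0"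
    by (rule tendsto_imp_eventually_ne[OF t2]) (use sg in \<open>simp add: sg_def\<close>)
  ultimately show ?thesis using p_eq
  proof eventually_elim
    case (elim \<kappa>)
    have F: "FM M k c \<rho> (p \<kappa>) - F0 = F0 * eh \<kappa>"
      using elim(3) unfolding eh_eq by (simp add: algebra_simps del: of_nat_Suc)
    have "(p \<kappa> - p0) ^ K * (F0 * eh \<kappa> + of_nat K * sg) = F0 * eh \<kappa> * (p \<kappa> + cnj p0) ^ K"
      using mobius[OF elim(1)] unfolding F K_def by (simp add: mult_ac del: power_Suc)
    then show ?case using elim(2) by (simp add: uu_def power_divide divide_simps del: power_Suc)
  qed
qed

text \<open>Otherwise \<open>U\<close> vanishes to order 2, so the left side of
  \<open>uu_power\<close> vanishes to order \<open>2 * K\<close>, whereas \<open>F0 * EH\<close> has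
  the coefficient \<open>F0 / fact K \<noteq> 0\<close> in degree \<open>K\<close>.\<close>

lemma p1_nonzero: "p1 p \<noteq> 0"
proof
  assume "p1 p = 0"
  then have U1: "fps_nth U 1 = 0" using U_nth by simp
  have K3: "K \<ge> 3" using M by (simp add: K_def)
  have "U ^ K * (fps_const F0 * EH + fps_const (of_nat K * sg)) = fps_const F0 * EH"
  proof (rule fps_expansion_unique_complex)
    show "(\<lambda>\<kappa>. F0 * eh \<kappa>) has_fps_expansion fps_const F0 * EH"
      by (intro fps_expansion_intros eh_expansion)
    have "(\<lambda>\<kappa>. uu \<kappa> ^ K * (F0 * eh \<kappa> + of_nat K * sg)) has_fps_expansion
        U ^ K * (fps_const F0 * EH + fps_const (of_nat K * sg))"
      by (intro fps_expansion_intros eh_expansion uu_expansion)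
    then show "(\<lambda>\<kappa>. F0 * eh \<kappa>) has_fps_expansion
        U ^ K * (fps_const F0 * EH + fps_const (of_nat K * sg))"
      using has_fps_expansion_cong[OF uu_power refl] by blast
  qed
  then have "fps_nth (U ^ K * (fps_const F0 * EH + fps_const (of_nat K * sg))) K = F0 / fact K"
    by (simp add: EH_def K_def del: power_Suc fact_Suc)
  moreover obtain W where W: "U = fps_X ^ 2 * W"
  proof (cases "U = 0")
    case False
    have "2 \<le> subdegree U"
    proof (rule ccontr)
      assume "\<not> 2 \<le> subdegree U"
      then have "subdegree U = 0 \<or> subdegree U = 1" by linarith
      then have "fps_nth U (subdegree U) = 0" using U_nth(1) U1 by metis
      with nth_subdegree_nonzero[OF False] show False by contradiction
    qed
    then have "fps_X ^ 2 dvd U" by (simp add: fps_dvd_iff False)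
    then show ?thesis using that by (auto elim: dvdE)
  qed (use that[of 0] in simp)
  have E: "U ^ K * (fps_const F0 * EH + fps_const (of_nat K * sg)) =
      fps_X ^ (2 * K) * (W ^ K * (fps_const F0 * EH + fps_const (of_nat K * sg)))"
    unfolding W by (simp add: power_mult_distrib mult_ac flip: power_mult)
  have "fps_nth (U ^ K * (fps_const F0 * EH + fps_const (of_nat K * sg))) K = 0"
    unfolding E fps_X_power_mult_nth using K3 by simp
  ultimately show False using F0_nonzero by simp
qed

definition "ww \<kappa> = (if \<kappa> = 0 then p1 p / sg else uu \<kappa> / \<kappa>)" for \<kappa>

lemma ww_analytic: "ww analytic_on {0}"
proof -
  have "U \<noteq> 0" using U_nth(2) p1_nonzero sg by auto
  have "1 \<le> subdegree U" using U_nth(1) \<open>U \<noteq> 0\<close>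
    by (metis less_one not_le nth_subdegree_nonzero)
  have "(\<lambda>x. if x = 0 then p1 p / sg else uu x / x ^ 1) has_fps_expansion fps_shift 1 U"
    by (rule has_fps_expansion_shift[OF uu_expansion \<open>1 \<le> subdegree U\<close>]) (use U_nth in simp)
  then have "ww has_fps_expansion fps_shift 1 U" unfolding ww_def[abs_def] power_one_right .
  then show ?thesis by (rule has_fps_expansion_imp_analytic_0)
qed

definition "LL \<kappa> = Ln (ww \<kappa> / (p1 p / sg))" for \<kappa>

lemma LL_analytic: "LL analytic_on {0}"
  unfolding LL_def[abs_def]
  by (intro analytic_intros ww_analytic) (use p1_nonzero sg in \<open>auto simp: ww_def\<close>)

text \<open>By \<open>uu_power\<close> the powers \<open>K\<close> of \<open>ww\<close> at
  \<open>\<kappa>\<close> and \<open>om * \<kappa>\<close> agree. Near 0 both logarithms are smaller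
  than \<open>pi / K\<close>, so after multiplication by \<open>K\<close> they still lie on the
  principal branch and have to coincide.\<close>

lemma LL_rotate: "\<forall>\<^sub>F \<kappa> in nhds 0. LL (om * \<kappa>) = LL \<kappa>"
proof -
  have tL: "(LL \<longlongrightarrow> 0) (nhds 0)"
  proof -
    have "isCont LL 0" by (rule analytic_at_imp_isCont[OF LL_analytic])
    moreover have "LL 0 = 0" using p1_nonzero sg by (simp add: LL_def ww_def)
    ultimately show ?thesis by (simp add: isCont_def tendsto_nhds_iff)
  qed
  have tw: "(ww \<longlongrightarrow> p1 p / sg) (nhds 0)"
  proof -
    have "isCont ww 0" by (rule analytic_at_imp_isCont[OF ww_analytic])
    then show ?thesis by (simp add: isCont_def tendsto_nhds_iff ww_def)
  qed
  have te: "((\<lambda>\<kappa>. F0 * eh \<kappa> + of_nat K * sg) \<longlongrightarrow> F0 * 0 + of_nat K * sg) (nhds 0)"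
  proof -
    have "isCont eh 0"
      by (rule analytic_at_imp_isCont[OF has_fps_expansion_imp_analytic_0[OF eh_expansion]])
    moreover have "eh 0 = 0" using has_fps_expansion_imp_0_eq_fps_nth_0[OF eh_expansion] by (simp add: EH_def)
    ultimately have "(eh \<longlongrightarrow> 0) (nhds 0)" by (simp add: isCont_def tendsto_nhds_iff)
    then show ?thesis by (intro tendsto_intros)
  qed
  have rot: "filterlim (\<lambda>\<kappa>. om * \<kappa>) (nhds 0) (nhds 0)" by (rule tendsto_scaled_0)
  have Ksg: "of_nat K * sg \<noteq> 0" using sg(2) K_nz by simp
  have small: "\<forall>\<^sub>F \<kappa> in nhds 0. cmod (LL \<kappa>) < pi / K"
    using tendstoD[OF tL, of "pi / K"] by (simp add: K_def)
  have wnz: "\<forall>\<^sub>F \<kappa> in nhds 0. ww \<kappa> \<noteq> 0"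
    by (rule tendsto_imp_eventually_ne[OF tw]) (use p1_nonzero sg in simp)
  have enz: "\<forall>\<^sub>F \<kappa> in nhds 0. F0 * eh \<kappa> + of_nat K * sg \<noteq> 0"
    by (rule tendsto_imp_eventually_ne[OF te]) (use Ksg in simp)
  note rots = small wnz uu_power
  show ?thesis
    using small eventually_compose_filterlim[OF small rot] wnz eventually_compose_filterlim[OF wnz rot]
      uu_power eventually_compose_filterlim[OF uu_power rot] enz
  proof eventually_elim
    case (elim \<kappa>)
    have wK: "ww (om * \<kappa>) ^ K = ww \<kappa> ^ K"
    proof (cases "\<kappa> = 0")
      case False
      have "uu (om * \<kappa>) ^ K = uu \<kappa> ^ K"
        using elim(5,6,7) unfolding eh_rotate by (metis mult_right_cancel)
      then show ?thesis using False om_nz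
        by (simp add: ww_def power_divide power_mult_distrib om_K)
    qed simp
    let ?c = "p1 p / sg"
    have c: "?c \<noteq> 0" using p1_nonzero sg by simp
    have ex: "exp (of_nat K * LL z) = (ww z / ?c) ^ K" if "ww z \<noteq> 0" for z
      using that c by (simp add: exp_of_nat_mult LL_def)
    have im: "\<bar>Im (of_nat K * LL z)\<bar> < pi" if "cmod (LL z) < pi / K" for z
    proof -
      have "\<bar>Im (of_nat K * LL z)\<bar> \<le> cmod (of_nat K * LL z)" by (rule abs_Im_le_cmod)
      also have "\<dots> < pi" using that K_nz(1) by (simp add: norm_mult field_simps)
      finally show ?thesis .
    qed
    have "exp (of_nat K * LL (om * \<kappa>)) = exp (of_nat K * LL \<kappa>)"
      by (simp only: ex[OF elim(3)] ex[OF elim(4)] power_divide wK)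
    moreover have "Ln (exp (of_nat K * LL z)) = of_nat K * LL z" if "cmod (LL z) < pi / K" for z
      using im[OF that] by (intro Ln_exp) auto
    ultimately have "of_nat K * LL (om * \<kappa>) = of_nat K * LL \<kappa>" using elim(1,2) by metis
    then show ?case using K_nz by simp
  qed
qed

text \<open>\<open>LL\<close> is the generating function of the \<open>s_coeff\<close>. Rotation by
  \<open>om\<close> multiplies its coefficient \<open>r\<close> by \<open>om ^ r\<close>, which
  differs from 1 here.\<close>

lemma s_coeff_zero:
  assumes "\<not> K dvd r"
  shows "s_coeff p r = 0"
proof -
  have s: "s_coeff p r = fps_nth (fps_expansion LL 0) r"
  proof -
    have "(\<lambda>\<kappa>. if \<kappa> = 0 then 0 else Ln (1 / \<kappa> * ((p 0 + cnj (p 0)) / p1 p) * ((p \<kappa> - p 0) / (p \<kappa> + cnj (p 0))))) = LL"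
      using p1_nonzero sg by (auto simp: fun_eq_iff LL_def ww_def uu_def p_0 sg_def field_simps)
    then show ?thesis by (simp add: s_coeff_def)
  qed
  define FL where "FL = fps_expansion LL 0"
  have e: "LL has_fps_expansion FL"
    unfolding FL_def by (rule analytic_at_imp_has_fps_expansion_0[OF LL_analytic])
  have "(\<lambda>x. om * x) has_fps_expansion fps_const om * fps_X"
    by (intro fps_expansion_intros)
  from has_fps_expansion_compose[OF e this]
  have "(LL \<circ> (\<lambda>x. om * x)) has_fps_expansion (FL oo (fps_const om * fps_X))" by simp
  then have "LL has_fps_expansion (FL oo (fps_const om * fps_X))"
    using has_fps_expansion_cong[OF LL_rotate refl] by (simp add: o_def)
  then have "FL oo (fps_const om * fps_X) = FL" using e by (rule fps_expansion_unique_complex)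
  then have "om ^ r * fps_nth FL r = fps_nth FL r"
    by (metis fps_nth_compose_linear)
  then have "FL $ r = 0 \<or> om ^ r = 1" by (metis mult_cancel_right2)
  then show ?thesis using assms s om_power_eq_1 by (simp add: FL_def)
qed

lemma alpha_beta:
  "alpha p 1 = p1 p" "alpha p 2 = p2 p"
  "beta p 1 = 3 * p0\<^sup>2 * p1 p" "beta p 2 = 3 * p0 * ((p1 p)\<^sup>2 + p0 * p2 p)"
proof -
  have "(\<lambda>\<kappa>. p \<kappa> - p 0) has_fps_expansion P - fps_const p0"
    unfolding p_0 by (intro fps_expansion_intros P(1))
  from has_fps_expansion_eq_fps_expansion[OF this]
  show "alpha p 1 = p1 p" "alpha p 2 = p2 p" by (simp_all add: alpha_def P(3,4)[unfolded One_nat_def])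
  have "(\<lambda>\<kappa>. p \<kappa> ^ 3 - p 0 ^ 3) has_fps_expansion P ^ 3 - fps_const (p0 ^ 3)"
    unfolding p_0 by (intro fps_expansion_intros P(1))
  from has_fps_expansion_eq_fps_expansion[OF this]
  have b: "beta p r = fps_nth (P * P * P) r - fps_nth (fps_const (p0 ^ 3)) r" for r
    by (simp add: beta_def power3_eq_cube)
  have n1: "fps_nth (A * B) 1 = fps_nth A 0 * fps_nth B 1 + fps_nth A 1 * fps_nth B 0"
    and n2: "fps_nth (A * B) 2 = fps_nth A 0 * fps_nth B 2 + fps_nth A 1 * fps_nth B 1 + fps_nth A 2 * fps_nth B 0"
    for A B :: "complex fps"
    by (simp_all add: fps_mult_nth numeral_2_eq_2)
  show "beta p 1 = 3 * p0\<^sup>2 * p1 p" "beta p 2 = 3 * p0 * ((p1 p)\<^sup>2 + p0 * p2 p)"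
    unfolding b n1 n2 P(2-4) by (simp_all add: P(2) power2_eq_square algebra_simps)
qed

end

section \<open>Rogue waves as ratios of determinants over row sets\<close>

definition Xset :: "nat \<Rightarrow> (nat \<Rightarrow> nat) \<Rightarrow> nat set" where
  "Xset M Nv = {n. n mod (M + 1) \<in> {1..M} \<and> n div (M + 1) < Nv (n mod (M + 1))}"

lemma set_block_rows:
  "set (block_rows M Nv) = {(I, (M + 1) * i + I) | I i. I \<in> {1..M} \<and> i < Nv I}"
proof -
  have row: "(\<lambda>i. (I, (M + 1) * (i - 1) + I)) ` {1..<Suc n} = (\<lambda>i. (I, (M + 1) * i + I)) ` {..<n}" for I n
  proof -
    have "{1..<Suc n} = Suc ` {..<n}"
      by (simp add: image_Suc_lessThan atLeastLessThanSuc_atLeastAtMost)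
    then show ?thesis by (simp add: image_image)
  qed
  have "set (block_rows M Nv) = (\<Union>I\<in>{1..<Suc M}. (\<lambda>i. (I, (M + 1) * (i - 1) + I)) ` {1..<Suc (Nv I)})"
    by (simp only: block_rows_def set_concat set_map set_upt image_image)
  also have "\<dots> = (\<Union>I\<in>{1..<Suc M}. (\<lambda>i. (I, (M + 1) * i + I)) ` {..<Nv I})"
    unfolding row ..
  also have "\<dots> = {(I, (M + 1) * i + I) | I i. I \<in> {1..M} \<and> i < Nv I}"
    unfolding atLeastLessThanSuc_atLeastAtMost by blast
  finally show ?thesis .
qed

lemma row_mod_div:
  fixes M I z :: nat
  assumes "I \<le> M"
  shows "((M + 1) * z + I) mod (M + 1) = I" "((M + 1) * z + I) div (M + 1) = z"
proof -
  have "I < M + 1" using assms by simp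
  moreover have "((M + 1) * z + I) mod (M + 1) = I mod (M + 1)" by (rule mod_mult_self4)
  moreover have "((M + 1) * z + I) div (M + 1) = z + I div (M + 1)" by (rule div_mult_self4) simp
  ultimately show "((M + 1) * z + I) mod (M + 1) = I" "((M + 1) * z + I) div (M + 1) = z"
    by (simp_all only: mod_less div_less add_0_right)
qed

lemma distinct_block_rows: "distinct (map snd (block_rows M Nv))"
proof -
  define row where "row I = map (\<lambda>i. (I, (M + 1) * (i - 1) + I)) [1..<Suc (Nv I)]" for I
  have mod: "snd x mod (M + 1) = I" if "x \<in> set (row I)" "I \<le> M" for x I
  proof -
    have "snd x \<in> snd ` (\<lambda>i. (I, (M + 1) * (i - 1) + I)) ` set [1..<Suc (Nv I)]"
      using that(1) unfolding row_def set_map by (rule imageI)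
    then obtain i where "snd x = (M + 1) * (i - 1) + I" unfolding image_image snd_conv by blast
    then show ?thesis using row_mod_div(1)[OF that(2)] by (simp only:)
  qed
  have drow: "distinct (map snd (row I))" for I
  proof -
    have "inj_on (\<lambda>i. (M + 1) * (i - 1) + I) {1..<Suc (Nv I)}"
    proof (rule inj_onI)
      fix i j assume ij: "i \<in> {1..<Suc (Nv I)}" "j \<in> {1..<Suc (Nv I)}"
        "(M + 1) * (i - 1) + I = (M + 1) * (j - 1) + I"
      from ij(3) have "(M + 1) * (i - 1) = (M + 1) * (j - 1)" by (simp only: add_right_cancel)
      then have "i - 1 = j - 1" by (simp only: mult_cancel1) simp
      then show "i = j" using ij(1,2) by auto
    qed
    then show ?thesis by (simp only: row_def map_map o_def snd_conv distinct_map set_upt distinct_upt simp_thms)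
  qed
  have "distinct (map snd (concat (map row [1..<Suc M'])))" if "M' \<le> M" for M'
    using that
  proof (induction M')
    case (Suc M')
    have "snd x \<noteq> snd y" if xy: "x \<in> set (row (Suc M'))" "y \<in> set (row I)" "I \<in> {1..<Suc M'}" for x y I
      using mod[OF xy(1)] mod[OF xy(2)] xy(3) Suc.prems by force
    then have "set (map snd (concat (map row [1..<Suc M']))) \<inter> set (map snd (row (Suc M'))) = {}"
      by (force simp del: upt_Suc)
    moreover have "concat (map row [1..<Suc (Suc M')]) = concat (map row [1..<Suc M']) @ row (Suc M')"
      by simp
    moreover have "distinct (map snd (concat (map row [1..<Suc M'])))" using Suc by simp
    ultimately show ?case using drow[of "Suc M'"] by (simp only: map_append distinct_append simp_thms)
  qed simp
  from this[of M] show ?thesis by (simp add: block_rows_def row_def[abs_def])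
qed

text \<open>The block of a row is recovered from its index as \<open>n mod (M + 1)\<close>, so the
  parameters become functions of the row index, and the order of the blocks is irrelevant by
  \<open>dt_reindex\<close>.\<close>

lemma tau_as_tauS:
  "tau M k p Nv a nn x t = tauS (Xset M Nv) (of_real ((cmod (p1 p))\<^sup>2) / (p 0 + cnj (p 0))\<^sup>2)
     (s_coeff p) (\<lambda>r. cnj (s_coeff p r))
     (\<lambda>n. x_plus M k p (\<lambda>i. a i (n mod (M + 1))) nn x t)
     (\<lambda>n. x_minus M k p (\<lambda>i. a i (n mod (M + 1))) nn x t)"
proof -
  define R where "R = block_rows M Nv"
  define g where "g u = snd (R ! u)" for u
  define f where "f n n' = mm (of_real ((cmod (p1 p))\<^sup>2) / (p 0 + cnj (p 0))\<^sup>2)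
     (s_coeff p) (\<lambda>r. cnj (s_coeff p r))
     (x_plus M k p (\<lambda>i. a i (n mod (M + 1))) nn x t)
     (x_minus M k p (\<lambda>i. a i (n' mod (M + 1))) nn x t) n n'" for n n'
  have fst: "fst (R ! u) = g u mod (M + 1)" if "u < length R" for u
  proof -
    have "R ! u \<in> {(I, (M + 1) * i + I) | I i. I \<in> {1..M} \<and> i < Nv I}"
      using nth_mem[OF that] unfolding R_def set_block_rows .
    then obtain I i where Ii: "R ! u = (I, (M + 1) * i + I)" "I \<le> M" by auto
    have "g u = (M + 1) * i + I" by (simp only: g_def Ii(1) snd_conv)
    then show ?thesis using row_mod_div(1)[OF Ii(2)] Ii(1) by (simp only: fst_conv)
  qed
  have inj: "inj_on g {0..<length R}"
  proof (rule inj_onI)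
    fix u v assume uv: "u \<in> {0..<length R}" "v \<in> {0..<length R}" "g u = g v"
    then have "map snd R ! u = map snd R ! v" by (simp add: g_def)
    then show "u = v"
      using nth_eq_iff_index_eq[OF distinct_block_rows[of M Nv], of u v] uv(1,2)
      unfolding R_def by simp
  qed
  have "g ` {0..<length R} = snd ` set R"
  proof -
    have "set R = (\<lambda>u. R ! u) ` {0..<length R}" by (auto simp: set_conv_nth)
    then show ?thesis by (simp only: g_def[abs_def] image_image)
  qed
  also have "\<dots> = Xset M Nv"
  proof (intro equalityI subsetI)
    fix n assume "n \<in> Xset M Nv"
    then have "(n mod (M + 1), (M + 1) * (n div (M + 1)) + n mod (M + 1)) \<in> set R"
      unfolding R_def set_block_rows Xset_def by blast
    then have "snd (n mod (M + 1), (M + 1) * (n div (M + 1)) + n mod (M + 1)) \<in> snd ` set R"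
      by (rule imageI)
    then show "n \<in> snd ` set R" by (simp only: snd_conv mult_div_mod_eq)
  next
    fix n assume "n \<in> snd ` set R"
    then obtain I i where n: "n = (M + 1) * i + I" "I \<in> {1..M}" "i < Nv I"
      unfolding R_def set_block_rows by auto
    have "I \<le> M" using n(2) by simp
    then have "n mod (M + 1) = I" "n div (M + 1) = i" unfolding n(1) by (rule row_mod_div)+
    then show "n \<in> Xset M Nv" using n by (simp add: Xset_def)
  qed
  finally have im: "g ` {0..<length R} = Xset M Nv" .
  have card: "card (Xset M Nv) = length R" using card_image[OF inj] im by simp
  have "tau M k p Nv a nn x t = dt (length R) (\<lambda>u w. f (g u) (g w))"
    unfolding tau_def Let_def R_def[symmetric] dt_def[symmetric]
    by (rule dt_cong) (simp only: f_def mm_def m_elem_def fst g_def)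
  also have "\<dots> = dt (card (Xset M Nv)) (\<lambda>u w. f (en (Xset M Nv) u) (en (Xset M Nv) w))"
    unfolding card dt_reindex[OF inj] im ..
  finally show ?thesis by (simp only: tauS_def f_def)
qed

lemma Xset_single:
  assumes "l \<in> {1..M}"
  shows "Xset M (single_order l N) = X0 (M + 1) l N"
proof (intro equalityI subsetI)
  fix n assume n: "n \<in> Xset M (single_order l N)"
  then have "n mod (M + 1) = l" "n div (M + 1) < N"
    by (auto simp: Xset_def single_order_def split: if_splits)
  then show "n \<in> X0 (M + 1) l N"
    unfolding X0_def using mod_div_mult_eq[of n "M + 1"] by (intro image_eqI[of _ _ "n div (M + 1)"]) auto
next
  fix n assume "n \<in> X0 (M + 1) l N"
  then obtain i where i: "n = l + i * (M + 1)" "i < N" by (auto simp: X0_def)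
  have e: "n = (M + 1) * i + l" using i(1) by simp
  have "l \<le> M" using assms by simp
  then have "n mod (M + 1) = l" "n div (M + 1) = i" unfolding e by (rule row_mod_div)+
  then show "n \<in> Xset M (single_order l N)" using i(2) assms by (simp add: Xset_def single_order_def)
qed

text \<open>The limit of large \<open>A\<close> along nested sets of triples
  \<open>(a, x, t)\<close>. The constant hidden in a Landau symbol is valid on all of some
  \<open>S A\<close>, which is the uniformity that the theorem demands.\<close>

definition regime :: "(real \<Rightarrow> 'w set) \<Rightarrow> 'w filter" where
  "regime S = (INF A\<in>{0<..}. principal (S A))"

lemma eventually_regime:
  assumes "\<And>A B. 0 < A \<Longrightarrow> A \<le> B \<Longrightarrow> S B \<subseteq> S A"
  shows "eventually P (regime S) \<longleftrightarrow> (\<exists>A>0. \<forall>w\<in>S A. P w)"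
proof -
  have "eventually P (regime S) \<longleftrightarrow> (\<exists>A\<in>{0<..}. eventually P (principal (S A)))"
    unfolding regime_def
  proof (rule eventually_INF_base)
    fix A B :: real assume "A \<in> {0<..}" "B \<in> {0<..}"
    then show "\<exists>x\<in>{0<..}. principal (S x) \<le> inf (principal (S A)) (principal (S B))"
      using assms[of A "max A B"] assms[of B "max A B"] by (intro bexI[of _ "max A B"]) auto
  qed (auto intro: exI[of _ 1])
  then show ?thesis by (auto simp: eventually_principal)
qed

lemma schur_expand:
  fixes x :: "'w \<Rightarrow> nat \<Rightarrow> complex" and y :: "nat \<Rightarrow> complex" and g :: "'w \<Rightarrow> complex"
  assumes g: "g \<in> O[F](\<lambda>_. 1 :: complex)"
    and h1: "\<And>r. r \<in> {1, 2} \<Longrightarrow> (\<lambda>w. x w r - y r) \<in> O[F](g)"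
    and h3: "\<And>r. 3 \<le> r \<Longrightarrow> (\<lambda>w. x w r - y r) \<in> O[F](\<lambda>w. g w ^ 2)"
  shows "(\<lambda>w. schur (x w) (int n - int v) - schur y (int n - int v)
      - ((x w 1 - y 1) * schur y (int n - int (v + 1)) + (x w 2 - y 2) * schur y (int n - int (v + 2))))
      \<in> O[F](\<lambda>w. g w ^ 2)"
proof (cases "v \<le> n")
  case True
  have 1: "schur y (int n - int (v + 1)) = (if 1 \<le> n - v then sch y (n - v - 1) else 0)"
    "schur y (int n - int (v + 2)) = (if 2 \<le> n - v then sch y (n - v - 2) else 0)"
    using True unfolding schur_diff by auto
  have 2: "schur (x w) (int n - int v) = sch (x w) (n - v)" "schur y (int n - int v) = sch y (n - v)" for w
    using True by (simp_all add: schur_diff)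
  have "(\<lambda>w. sch (x w) (n - v) - sch y (n - v)
      - (x w 1 - y 1) * (if 1 \<le> n - v then sch y (n - v - 1) else 0)
      - (x w 2 - y 2) * (if 2 \<le> n - v then sch y (n - v - 2) else 0)) \<in> O[F](\<lambda>w. g w ^ 2)"
    by (rule sch_expand[OF g]) (use h1 h3 in auto)
  then show ?thesis unfolding 1 2 by (simp only: diff_diff_eq add.assoc)
next
  case False
  then have "n < v" "n < v + 1" "n < v + 2" by auto
  then show ?thesis by (simp only: schur_neg) simp
qed

definition Dcol :: "nat set \<Rightarrow> nat \<Rightarrow> nat \<Rightarrow> (nat \<Rightarrow> complex) \<Rightarrow> complex" where
  "Dcol X c v y = dt (card X) (\<lambda>i j. if j = c then schur y (int (en X i) - int v)
     else schur y (int (en X i) - int j))"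

text \<open>To first order, an increment of \<open>x 1\<close> moves a single column by one place
  and an increment of \<open>x 2\<close> by two. Since \<open>s\<close> vanishes at 1 and 2 and is
  of second order beyond, the dependence of the variables on the column has no first-order
  effect.\<close>

lemma Dm_expand:
  fixes x :: "'w \<Rightarrow> nat \<Rightarrow> complex" and y :: "nat \<Rightarrow> complex" and g :: "'w \<Rightarrow> complex"
  assumes g: "g \<in> O[F](\<lambda>_. 1 :: complex)" and N: "card X = Suc N"
    and h1: "\<And>r. r \<in> {1, 2} \<Longrightarrow> (\<lambda>w. x w r - y r) \<in> O[F](g)"
    and h3: "\<And>r. 3 \<le> r \<Longrightarrow> (\<lambda>w. x w r - y r) \<in> O[F](\<lambda>w. g w ^ 2)"
    and s: "\<And>r. 1 \<le> r \<Longrightarrow> (\<lambda>w. s w r) \<in> O[F](\<lambda>w. g w ^ 2)"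
    and s12: "\<And>w. s w 1 = 0" "\<And>w. s w 2 = 0"
  shows "(\<lambda>w. Dm X {0..<Suc N} (\<lambda>_. x w) (s w) - Dm X {0..<Suc N} (\<lambda>_. y) (\<lambda>_. 0)
      - ((x w 1 - y 1) * Dcol X N (Suc N) y + (x w 2 - y 2) * (\<Sum>c<Suc N. Dcol X c (c + 2) y)))
      \<in> O[F](\<lambda>w. g w ^ 2)"
proof -
  let ?n = "Suc N"
  let ?P = "\<lambda>i v. schur y (int (en X i) - int v)"
  let ?E = "\<lambda>w i j. (x w 1 - y 1) * ?P i (j + 1) + (x w 2 - y 2) * ?P i (j + 2)"
  have g2: "(\<lambda>w. g w ^ 2) \<in> O[F](g)"
    using bigo_mult_1[OF _ g, of g] by (simp add: power2_eq_square)
  have e: "en {0..<?n} j = j" if "j < ?n" for j using that by (rule en_atLeastLessThan)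
  have "(\<lambda>w. dt ?n (\<lambda>i j. schur (\<lambda>r. x w r + of_nat j * s w r) (int (en X i) - int j)) - dt ?n ?P
      - (\<Sum>c<?n. dt ?n (\<lambda>i j. if j = c then ?E w i j else ?P i j))) \<in> O[F](\<lambda>w. g w ^ 2)"
  proof (rule dt_expand[OF g])
    fix i j :: nat
    show "(\<lambda>w. ?E w i j) \<in> O[F](g)"
      by (intro sum_in_bigo bigo_mult_1 h1) auto
    have "(\<lambda>w. (x w r - y r) + of_nat j * s w r) \<in> O[F](\<lambda>w. g w ^ 2)" if "3 \<le> r" for r
      by (intro sum_in_bigo bigo_1_mult h3 s) (use that in auto)
    then have 3: "(\<lambda>w. x w r + of_nat j * s w r - y r) \<in> O[F](\<lambda>w. g w ^ 2)" if "3 \<le> r" for r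
      using that by (simp add: algebra_simps)
    have 1: "(\<lambda>w. x w r + of_nat j * s w r - y r) \<in> O[F](g)" if "r \<in> {1, 2}" for r
      using that h1[OF that] s12 by (auto simp: numeral_2_eq_2)
    have "(\<lambda>w. schur (\<lambda>r. x w r + of_nat j * s w r) (int (en X i) - int j) - ?P i j
        - ((x w 1 + of_nat j * s w 1 - y 1) * ?P i (j + 1) + (x w 2 + of_nat j * s w 2 - y 2) * ?P i (j + 2)))
        \<in> O[F](\<lambda>w. g w ^ 2)"
      using schur_expand[OF g 1 3] .
    then show "(\<lambda>w. schur (\<lambda>r. x w r + of_nat j * s w r) (int (en X i) - int j) - ?P i j - ?E w i j)
        \<in> O[F](\<lambda>w. g w ^ 2)" by (simp only: s12 mult_zero_right add_0_right)
  qed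
  moreover have "dt ?n (\<lambda>i j. schur (\<lambda>r. x w r + of_nat j * s w r) (int (en X i) - int j)) =
      Dm X {0..<?n} (\<lambda>_. x w) (s w)" for w
    unfolding Dm_def N by (rule dt_cong) (simp only: e)
  moreover have "dt ?n ?P = Dm X {0..<?n} (\<lambda>_. y) (\<lambda>_. 0)"
    unfolding Dm_def N by (rule dt_cong) (simp only: e mult_zero_right add_0_right)
  moreover have "(\<Sum>c<?n. dt ?n (\<lambda>i j. if j = c then ?E w i j else ?P i j)) =
      (x w 1 - y 1) * Dcol X N (Suc N) y + (x w 2 - y 2) * (\<Sum>c<?n. Dcol X c (c + 2) y)" for w
  proof -
    have col: "dt ?n (\<lambda>i j. if j = c then ?P i (j + a) else ?P i j) = Dcol X c (c + a) y" for c a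
      unfolding Dcol_def N by (rule dt_cong) simp
    have "(\<Sum>c<?n. dt ?n (\<lambda>i j. if j = c then ?E w i j else ?P i j)) =
        (\<Sum>c<?n. (x w 1 - y 1) * Dcol X c (c + 1) y + (x w 2 - y 2) * Dcol X c (c + 2) y)"
    proof (rule sum.cong[OF refl])
      fix c assume "c \<in> {..<?n}"
      then have c: "c < ?n" by simp
      show "dt ?n (\<lambda>i j. if j = c then ?E w i j else ?P i j) =
          (x w 1 - y 1) * Dcol X c (c + 1) y + (x w 2 - y 2) * Dcol X c (c + 2) y"
        unfolding dt_col_add[OF c] dt_col_scale[OF c] col ..
    qed
    also have "\<dots> = (x w 1 - y 1) * (\<Sum>c<?n. Dcol X c (c + 1) y) + (x w 2 - y 2) * (\<Sum>c<?n. Dcol X c (c + 2) y)"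
      by (simp only: sum.distrib sum_distrib_left)
    \<comment> \<open>A column moved by one place coincides with its right neighbour, unless it is
      the last one.\<close>
    also have "(\<Sum>c<?n. Dcol X c (c + 1) y) = Dcol X N (Suc N) y"
    proof -
      have "Dcol X c (c + 1) y = 0" if "c < N" for c
        unfolding Dcol_def N
        by (rule dt_equal_cols[of c _ "c + 1"]) (use that in auto)
      then show ?thesis by simp
    qed
    finally show ?thesis .
  qed
  ultimately show ?thesis by (simp only:)
qed

lemma en_replace_last: "j < Suc N \<Longrightarrow> en (insert (Suc N) {0..<N}) j = (if j = N then Suc N else j)"
proof -
  assume j: "j < Suc N"
  let ?l = "[0..<N] @ [Suc N]"
  have "sorted ?l" "distinct ?l" by (auto simp: sorted_append)
  then have "sorted_list_of_set (set ?l) = ?l" by (rule sorted_list_of_set.idem_if_sorted_distinct)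
  then have "sorted_list_of_set (insert (Suc N) {0..<N}) = ?l" by simp
  then show ?thesis using j by (auto simp: en_def nth_append)
qed

lemma Dcol_last:
  assumes "card X = Suc N"
  shows "Dcol X N (Suc N) y = Dm X (insert (Suc N) {0..<N}) (\<lambda>_. y) (\<lambda>_. 0)"
  unfolding Dcol_def Dm_def assms mult_zero_right add_0_right
  by (rule dt_cong) (auto simp: en_replace_last)

lemma W_tilde_Dcol:
  assumes "m \<ge> 2" "k > 0"
  shows "W_tilde m k l N z = W_const k l N * (\<Sum>c<N. Dcol (X0 k l N) c (c + 2) (zz m z))"
proof -
  have "(\<Sum>j=1..N. Determinant.det (Matrix.mat N N
       (\<lambda>(i, s). if Suc s = j then p_poly m (int (row_idx k l (Suc i)) - int j - 1) z
                 else p_poly m (int (row_idx k l (Suc i)) - int (Suc s) + 1) z))) =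
      (\<Sum>c<N. Determinant.det (Matrix.mat N N
       (\<lambda>(i, s). if Suc s = Suc c then p_poly m (int (row_idx k l (Suc i)) - int (Suc c) - 1) z
                 else p_poly m (int (row_idx k l (Suc i)) - int (Suc s) + 1) z)))"
    unfolding One_nat_def by (rule sum.atLeast1_atMost_eq)
  also have "\<dots> = (\<Sum>c<N. Dcol (X0 k l N) c (c + 2) (zz m z))"
  proof (rule sum.cong[OF refl])
    fix c
    have "Dcol (X0 k l N) c (c + 2) (zz m z) = dt N (\<lambda>i s. if Suc s = Suc c
        then p_poly m (int (row_idx k l (Suc i)) - int (Suc c) - 1) z
        else p_poly m (int (row_idx k l (Suc i)) - int (Suc s) + 1) z)"
      unfolding Dcol_def X0(2)[OF assms(2)] p_poly_schur[OF assms(1)]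
      by (rule dt_cong) (simp add: X0(3)[OF assms(2)] row_idx_def algebra_simps)
    then show "Determinant.det (Matrix.mat N N
       (\<lambda>(i, s). if Suc s = Suc c then p_poly m (int (row_idx k l (Suc i)) - int (Suc c) - 1) z
                 else p_poly m (int (row_idx k l (Suc i)) - int (Suc s) + 1) z)) =
       Dcol (X0 k l N) c (c + 2) (zz m z)" by (simp add: dt_def)
  qed
  finally show ?thesis by (simp add: W_tilde_def)
qed

text \<open>\<open>Dm_expand\<close> for an increment of \<open>x 1\<close> alone: only the move of
  the last column survives, and it gives the column set of the claim.\<close>

lemma deriv_W_poly:
  assumes m: "m \<ge> 2" and k: "k > 0"
  shows "deriv (W_poly m k l (Suc N)) z =
    W_const k l (Suc N) * Dm (X0 k l (Suc N)) (insert (Suc N) {0..<N}) (\<lambda>_. zz m z) (\<lambda>_. 0)"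
proof -
  let ?X = "X0 k l (Suc N)" and ?D = "\<lambda>z. Dm (X0 k l (Suc N)) {0..<Suc N} (\<lambda>_. zz m z) (\<lambda>_. 0)"
  let ?d = "Dm ?X (insert (Suc N) {0..<N}) (\<lambda>_. zz m z) (\<lambda>_. 0)"
  have g: "(\<lambda>w. w) \<in> O[at 0](\<lambda>_. 1 :: complex)"
    by (rule bigoI_tendsto[where c = 0]) auto
  have "(\<lambda>w. Dm ?X {0..<Suc N} (\<lambda>_. zz m (z + w)) (\<lambda>_. 0) - ?D z
      - ((zz m (z + w) 1 - zz m z 1) * Dcol ?X N (Suc N) (zz m z)
        + (zz m (z + w) 2 - zz m z 2) * (\<Sum>c<Suc N. Dcol ?X c (c + 2) (zz m z)))) \<in> O[at 0](\<lambda>w. w ^ 2)"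
    by (rule Dm_expand[OF g X0(2)[OF k]]) (auto simp: zz_def)
  note * = this
  have *: "(\<lambda>w. ?D (z + w) - ?D z - w * ?d) \<in> O[at 0](\<lambda>w. w ^ 2)"
  proof -
    have z1: "zz m (z + w) 1 - zz m z 1 = w" for w by (simp add: zz_def)
    have z2: "zz m (z + w) 2 - zz m z 2 = 0" for w by (simp add: zz_def)
    show ?thesis
      using * unfolding z1 z2 Dcol_last[OF X0(2)[OF k]] mult_zero_left add_0_right .
  qed
  have "(\<lambda>w. (?D (z + w) - ?D z - w * ?d) / w) \<in> O[at 0](\<lambda>w. w ^ 2 / w)"
    by (intro landau_o.big.divide_right *) (auto simp: eventually_at_filter)
  moreover have "(\<lambda>w::complex. w ^ 2 / w) \<in> o[at 0](\<lambda>_. 1 :: complex)"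
    by (rule smalloI_tendsto) (auto simp: power2_eq_square intro!: tendsto_eq_intros)
  ultimately have "((\<lambda>w. (?D (z + w) - ?D z - w * ?d) / w) \<longlongrightarrow> 0) (at 0)"
    using smalloD_tendsto[OF landau_o.big_small_trans] by fastforce
  then have "((\<lambda>w. (?D (z + w) - ?D z - w * ?d) / w + ?d) \<longlongrightarrow> 0 + ?d) (at 0)"
    by (intro tendsto_add tendsto_const)
  then have "((\<lambda>w. (?D (z + w) - ?D z) / w) \<longlongrightarrow> ?d) (at 0)"
    unfolding add_0_left by (rule Lim_transform_eventually) (auto simp: eventually_at_filter field_simps)
  then have "(?D has_field_derivative ?d) (at z)" by (simp add: DERIV_def)
  then have "((\<lambda>z. W_const k l (Suc N) * ?D z) has_field_derivative W_const k l (Suc N) * ?d) (at z)"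
    by (rule DERIV_cmult)
  then have "(W_poly m k l (Suc N) has_field_derivative W_const k l (Suc N) * ?d) (at z)"
    unfolding W_poly_Dm[OF m k, abs_def] .
  then show ?thesis by (rule DERIV_imp_deriv)
qed

text \<open>At most one factor can be smaller than half the distance between points of
  \<open>Z\<close>, and that one is at least \<open>r\<close>. Hence the bound is linear in
  \<open>r\<close>, however many points there are.\<close>

lemma prod_dist_lower:
  fixes Z :: "complex set"
  assumes "finite Z"
  shows "\<exists>c>0. \<forall>u r. 0 \<le> r \<longrightarrow> r \<le> 1 \<longrightarrow> (\<forall>z\<in>Z. r \<le> cmod (u - z)) \<longrightarrow> c * r \<le> (\<Prod>z\<in>Z. cmod (u - z))"
  using assms
proof (induction Z)
  case empty
  show ?case by (intro exI[of _ 1]) auto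
next
  case (insert a Z)
  then obtain c where c: "c > 0" "\<And>u r. 0 \<le> r \<Longrightarrow> r \<le> 1 \<Longrightarrow> (\<forall>z\<in>Z. r \<le> cmod (u - z)) \<Longrightarrow> c * r \<le> (\<Prod>z\<in>Z. cmod (u - z))"
    by blast
  obtain d where d: "d > 0" "\<And>z. z \<in> Z \<Longrightarrow> z \<noteq> a \<Longrightarrow> d \<le> dist a z"
    using finite_set_avoid[OF insert.hyps(1), of a] by blast
  define \<rho> where "\<rho> = min 1 (d / 2)"
  have \<rho>: "0 < \<rho>" "\<rho> \<le> 1" "2 * \<rho> \<le> d" using d(1) by (auto simp: \<rho>_def)
  have "c * \<rho> * r \<le> (\<Prod>z\<in>insert a Z. cmod (u - z))"
    if r: "0 \<le> r" "r \<le> 1" "\<forall>z\<in>insert a Z. r \<le> cmod (u - z)" for u r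
  proof -
    have cr: "c * r \<le> (\<Prod>z\<in>Z. cmod (u - z))" using c(2)[of r u] r by auto
    have nn: "0 \<le> (\<Prod>z\<in>Z. cmod (u - z))" by (intro prod_nonneg) auto
    have "c * \<rho> * r \<le> cmod (u - a) * (\<Prod>z\<in>Z. cmod (u - z))"
    proof (cases "\<rho> \<le> cmod (u - a)")
      case True
      have "\<rho> * (c * r) \<le> cmod (u - a) * (\<Prod>z\<in>Z. cmod (u - z))"
        by (intro mult_mono True cr) (use r c \<rho> in auto)
      then show ?thesis by (simp add: mult_ac)
    next
      case False
      have "\<rho> \<le> cmod (u - z)" if z: "z \<in> Z" for z
      proof -
        have "d \<le> cmod (a - z)" using d(2)[OF z] z insert.hyps by (auto simp: dist_norm)
        also have "a - z = (u - z) - (u - a)" by simp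
        also have "cmod ((u - z) - (u - a)) \<le> cmod (u - z) + cmod (u - a)" by (rule norm_triangle_ineq4)
        finally show ?thesis using False \<rho> by linarith
      qed
      then have "c * \<rho> \<le> (\<Prod>z\<in>Z. cmod (u - z))" using c(2)[of \<rho> u] \<rho> by auto
      then have "r * (c * \<rho>) \<le> cmod (u - a) * (\<Prod>z\<in>Z. cmod (u - z))"
        by (intro mult_mono) (use r c \<rho> in auto)
      then show ?thesis by (simp add: mult_ac)
    qed
    then show ?thesis using insert.hyps by simp
  qed
  then show ?case using c(1) \<rho>(1) by (intro exI[of _ "c * \<rho>"]) auto
qed

section \<open>The two asymptotic regimes\<close>

lemma bigo_cnj:
  fixes f g :: "'w \<Rightarrow> complex"
  shows "(\<lambda>w. cnj (f w)) \<in> O[F](g) \<longleftrightarrow> f \<in> O[F](g)"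
  by (simp add: bigo_def)

lemma bigo_power_le:
  fixes e :: "'w \<Rightarrow> complex"
  assumes "e \<in> O[F](\<lambda>_. 1 :: complex)" "j \<le> i"
  shows "(\<lambda>w. e w ^ i) \<in> O[F](\<lambda>w. e w ^ j)"
proof -
  have "(\<lambda>w. e w ^ (i - j)) \<in> O[F](\<lambda>_. 1 :: complex)"
    using landau_o.big_power[OF assms(1), of "i - j"] by simp
  then have "(\<lambda>w. e w ^ (i - j) * e w ^ j) \<in> O[F](\<lambda>w. e w ^ j)"
    by (rule bigo_1_mult) simp
  then show ?thesis using assms(2) by (simp flip: power_add)
qed

lemma bigo_eventually_eq:
  assumes "f \<in> O[F](h)" "\<forall>\<^sub>F w in F. g w = f w"
  shows "g \<in> O[F](h)"
  using landau_o.big.in_cong[OF assms(2), of h] assms(1) by simp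

section \<open>Rescaled variables and the dominant column sets\<close>

locale mk_wave = mk_param +
  fixes l N m :: nat and rt :: "complex \<Rightarrow> complex"
  assumes l: "l \<in> {1..M}" and N: "N \<ge> 1" and m: "m \<ge> 2" and ndvd: "\<not> (M + 1) dvd m"
    and rt: "\<forall>w. rt w ^ m = w" and Im_p0: "Im p0 \<noteq> 0"
begin

definition "hh = (cmod (p1 p))\<^sup>2 / (2 * Re p0)\<^sup>2"

definition "sc = s_coeff p"

definition "ee w = 1 / rt (fst w m)" for w :: "(nat \<Rightarrow> complex) \<times> real \<times> real"

definition "bs w r = alpha p r * of_real (fst (snd w)) + beta p r * of_real (snd (snd w)) + fst w r"
  for w :: "(nat \<Rightarrow> complex) \<times> real \<times> real" and r :: nat

definition "XX = X0 (M + 1) l N"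

text \<open>\<open>sh\<close> is the sequence of the \<open>theta\<close> in the numerator of a
  component and 0 in the denominator. The second sequence is the conjugate of the first one taken
  with \<open>- sh\<close>, so each Cauchy-Binet term pairs the shifts \<open>sh\<close> and
  \<open>- sh\<close>.\<close>

definition "TT sh w = tauS XX (of_real hh) sc (\<lambda>r. cnj (sc r)) (\<lambda>_ r. bs w r + sh r) (\<lambda>_ r. cnj (bs w r - sh r))"

definition "zsh sh w r = ee w ^ r * (bs w r + sh r)"

definition "zs w r = ee w ^ r * sc r"

definition "DD V sh w = Dm XX V (\<lambda>_. zsh sh w) (zs w)"

definition "VS = {V. V \<subseteq> {0..l + N * (M + 1)} \<and> card V = N}"

definition "qq w = hh * (cmod (ee w))\<^sup>2"

definition "TN sh w = (\<Sum>V\<in>VS. of_real (qq w ^ (\<Sum>V - sigma0 N)) * DD V sh w * cnj (DD V (\<lambda>r. - sh r) w))"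

lemma hh_pos: "hh > 0"
  using p1_nonzero Re_p0 by (simp add: hh_def)

lemma hh_eq: "of_real ((cmod (p1 p))\<^sup>2) / (p 0 + cnj (p 0))\<^sup>2 = complex_of_real hh"
proof -
  have "p 0 + cnj (p 0) = of_real (2 * Re p0)" using sg(1) by (simp add: sg_def p_0)
  then show ?thesis by (simp add: hh_def)
qed

lemma hh_h0: "(cmod (h0 p))\<^sup>2 = hh"
proof -
  have "p 0 + cnj (p 0) = of_real (2 * Re p0)" using sg(1) by (simp add: sg_def p_0)
  then show ?thesis by (simp add: h0_def hh_def norm_divide power_divide)
qed

lemma sc12: "sc 1 = 0" "sc 2 = 0"
proof -
  have "\<not> K dvd 1" "\<not> K dvd 2" using M dvd_imp_le[of K 1] dvd_imp_le[of K 2] unfolding K_def by linarith+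
  then show "sc 1 = 0" "sc 2 = 0" unfolding sc_def by (simp_all only: s_coeff_zero not_False_eq_True)
qed

lemma XX: "finite XX" "card XX = N" "XX \<subseteq> {0..l + N * (M + 1)}"
proof -
  show "finite XX" "card XX = N" unfolding XX_def using X0[of "M + 1"] by auto
  show "XX \<subseteq> {0..l + N * (M + 1)}" unfolding XX_def by (rule X0_bounded)
qed

lemma tau_low:
  assumes n: "sh = (\<lambda>r. \<Sum>j=1..M. of_int (nn j) * theta k p r j)"
  shows "tau M k p Nv a nn x t = tauS (Xset M Nv) (of_real hh) sc (\<lambda>r. cnj (sc r))
    (\<lambda>n r. bs (\<lambda>i. a i (n mod (M + 1)), x, t) r + sh r)
    (\<lambda>n r. cnj (bs (\<lambda>i. a i (n mod (M + 1)), x, t) r - sh r))"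
proof -
  have 1: "x_plus M k p b nn x t = (\<lambda>r. bs (b, x, t) r + sh r)" for b
    by (simp add: fun_eq_iff x_plus_def bs_def n algebra_simps)
  have 2: "x_minus M k p b nn x t = (\<lambda>r. cnj (bs (b, x, t) r - sh r))" for b
    by (simp add: fun_eq_iff x_minus_def bs_def n cnj_sum algebra_simps)
  show ?thesis unfolding tau_as_tauS hh_eq sc_def 1 2 ..
qed

lemma shift_delta:
  "n \<in> {1..M} \<Longrightarrow> (\<lambda>r. \<Sum>j=1..M. of_int (if j = n then 1 else 0) * theta k p r j) = (\<lambda>r. theta k p r n)"
proof -
  assume n: "n \<in> {1..M}"
  have "(\<Sum>j=1..M. of_int (if j = n then 1 else 0) * theta k p r j) = theta k p r n" for r
  proof -
    have "(\<Sum>j=1..M. of_int (if j = n then 1 else 0) * theta k p r j) = (\<Sum>j=1..M. if j = n then theta k p r n else 0)"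
      by (intro sum.cong) auto
    then show ?thesis using n by simp
  qed
  then show ?thesis by (rule ext)
qed

lemma rogue_wave_low:
  assumes n: "n \<in> {1..M}"
  shows "rogue_wave M k c \<rho> p Nv a n x t =
    tauS (Xset M Nv) (of_real hh) sc (\<lambda>r. cnj (sc r))
      (\<lambda>n' r. bs (\<lambda>i. a i (n' mod (M + 1)), x, t) r + theta k p r n)
      (\<lambda>n' r. cnj (bs (\<lambda>i. a i (n' mod (M + 1)), x, t) r - theta k p r n)) /
    tauS (Xset M Nv) (of_real hh) sc (\<lambda>r. cnj (sc r))
      (\<lambda>n' r. bs (\<lambda>i. a i (n' mod (M + 1)), x, t) r + 0)
      (\<lambda>n' r. cnj (bs (\<lambda>i. a i (n' mod (M + 1)), x, t) r - 0)) * plane_wave M k c \<rho> n x t"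
proof -
  have zero: "(\<lambda>r. 0) = (\<lambda>r. \<Sum>j=1..M. of_int 0 * theta k p r j)" by simp
  show ?thesis
    unfolding rogue_wave_def tau_low[OF shift_delta[OF n, symmetric]] tau_low[OF zero] ..
qed

lemma v_ratio:
  assumes n: "n \<in> {1..M}"
  shows "rogue_wave_type M k c \<rho> p l N a n x t =
    TT (\<lambda>r. theta k p r n) (a, x, t) / TT (\<lambda>_. 0) (a, x, t) * plane_wave M k c \<rho> n x t"
  unfolding rogue_wave_type_def rogue_wave_low[OF n] Xset_single[OF l] TT_def XX_def ..

text \<open>Weighted homogeneity moves the powers of \<open>ee\<close> from the rows to the columns.
  There they combine with \<open>hh\<close> into \<open>qq\<close>, and the power
  \<open>sigma0 N\<close> is split off so that \<open>V0\<close> gets weight 1.\<close>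

lemma TT_TN:
  "TT sh w * of_real ((cmod (ee w)) ^ (2 * \<Sum>XX)) = of_real (qq w ^ sigma0 N) * TN sh w"
proof -
  have ab: "of_real ((cmod (ee w)) ^ (2 * i)) = ee w ^ i * cnj (ee w ^ i)" for i
  proof -
    have "of_real ((cmod (ee w)) ^ (2 * i)) = (of_real ((cmod (ee w))\<^sup>2) :: complex) ^ i"
      by (simp add: power_mult)
    also have "\<dots> = (ee w * cnj (ee w)) ^ i" by (simp only: complex_norm_square)
    finally show ?thesis by (simp add: power_mult_distrib)
  qed
  have D: "Dm XX V (\<lambda>_ r. bs w r + sh r) sc * ee w ^ (\<Sum>XX) = ee w ^ (\<Sum>V) * DD V sh w"
    if V: "V \<in> VS" for V sh
  proof -
    have "finite V" "card V = card XX" using V XX by (auto simp: VS_def intro: finite_subset)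
    from Dm_scale[OF XX(1) this, of "\<lambda>r. bs w r + sh r" sc "ee w"]
    show ?thesis unfolding DD_def zsh_def[abs_def] zs_def[abs_def] .
  qed
  have "TT sh w = (\<Sum>V\<in>VS. of_real hh ^ (\<Sum>V) * Dm XX V (\<lambda>_ r. bs w r + sh r) sc *
      cnj (Dm XX V (\<lambda>_ r. bs w r + - sh r) sc))"
    unfolding TT_def tauS_expand[OF XX(3)] Dm_cnj[symmetric] XX(2) VS_def by simp
  then have "TT sh w * of_real ((cmod (ee w)) ^ (2 * \<Sum>XX)) =
      (\<Sum>V\<in>VS. of_real hh ^ (\<Sum>V) * (Dm XX V (\<lambda>_ r. bs w r + sh r) sc * ee w ^ (\<Sum>XX)) *
      cnj (Dm XX V (\<lambda>_ r. bs w r + - sh r) sc * ee w ^ (\<Sum>XX)))"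
    unfolding ab by (simp only: sum_distrib_right complex_cnj_mult) (simp only: mult_ac)
  also have "\<dots> = (\<Sum>V\<in>VS. of_real (qq w ^ (\<Sum>V)) * DD V sh w * cnj (DD V (\<lambda>r. - sh r) w))"
  proof (rule sum.cong[OF refl])
    fix V assume V: "V \<in> VS"
    have "of_real (qq w ^ (\<Sum>V)) = of_real hh ^ (\<Sum>V) * (ee w ^ (\<Sum>V) * cnj (ee w ^ (\<Sum>V)))"
      unfolding ab[symmetric] by (simp add: qq_def power_mult_distrib power_mult)
    then show "of_real hh ^ (\<Sum>V) * (Dm XX V (\<lambda>_ r. bs w r + sh r) sc * ee w ^ (\<Sum>XX)) *
      cnj (Dm XX V (\<lambda>_ r. bs w r + - sh r) sc * ee w ^ (\<Sum>XX)) =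
      of_real (qq w ^ (\<Sum>V)) * DD V sh w * cnj (DD V (\<lambda>r. - sh r) w)"
      unfolding D[OF V] by (simp only: complex_cnj_mult mult_ac)
  qed
  also have "\<dots> = of_real (qq w ^ sigma0 N) * TN sh w"
    unfolding TN_def sum_distrib_left
  proof (rule sum.cong[OF refl])
    fix V assume V: "V \<in> VS"
    then have "sigma0 N \<le> \<Sum>V" using sigma0_le[of V] by (auto simp: VS_def intro: finite_subset)
    then have "qq w ^ (\<Sum>V) = qq w ^ sigma0 N * qq w ^ (\<Sum>V - sigma0 N)" by (simp flip: power_add)
    then show "of_real (qq w ^ (\<Sum>V)) * DD V sh w * cnj (DD V (\<lambda>r. - sh r) w) =
      of_real (qq w ^ sigma0 N) * (of_real (qq w ^ (\<Sum>V - sigma0 N)) * DD V sh w * cnj (DD V (\<lambda>r. - sh r) w))"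
      by (simp only: of_real_mult mult.assoc)
  qed
  finally show ?thesis .
qed

lemma TT_ratio:
  assumes "ee w \<noteq> 0"
  shows "TT sh w / TT sh' w = TN sh w / TN sh' w"
proof -
  let ?a = "complex_of_real ((cmod (ee w)) ^ (2 * \<Sum>XX))" and ?b = "complex_of_real (qq w ^ sigma0 N)"
  have "qq w \<noteq> 0" using assms hh_pos by (simp add: qq_def)
  then have a: "?a \<noteq> 0" "?b \<noteq> 0" using assms by simp_all
  have "TT sh w / TT sh' w = (TT sh w * ?a) / (TT sh' w * ?a)"
    by (rule mult_divide_mult_cancel_right[OF a(1), symmetric])
  also have "\<dots> = (?b * TN sh w) / (?b * TN sh' w)" by (simp only: TT_TN)
  also have "\<dots> = TN sh w / TN sh' w" by (rule mult_divide_mult_cancel_left[OF a(2)])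
  finally show ?thesis .
qed

text \<open>The outer scaling, in which \<open>x\<close> and \<open>t\<close> are at most of the
  size of \<open>1 / ee\<close>, with all parameters other than \<open>a m\<close> bounded.\<close>

definition "good F \<longleftrightarrow> (ee \<longlongrightarrow> 0) F \<and> (\<forall>\<^sub>F w in F. ee w \<noteq> 0) \<and>
  (\<forall>r\<ge>1. r \<noteq> m \<longrightarrow> (\<lambda>w. fst w r) \<in> O[F](\<lambda>_. 1 :: complex)) \<and>
  (\<lambda>w. of_real (fst (snd w)) * ee w) \<in> O[F](\<lambda>_. 1 :: complex) \<and>
  (\<lambda>w. of_real (snd (snd w)) * ee w) \<in> O[F](\<lambda>_. 1 :: complex)"

lemma goodD:
  assumes "good F"
  shows "(ee \<longlongrightarrow> 0) F" "\<forall>\<^sub>F w in F. ee w \<noteq> 0"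
    "\<And>r. 1 \<le> r \<Longrightarrow> r \<noteq> m \<Longrightarrow> (\<lambda>w. fst w r) \<in> O[F](\<lambda>_. 1 :: complex)"
    "(\<lambda>w. of_real (fst (snd w)) * ee w) \<in> O[F](\<lambda>_. 1 :: complex)"
    "(\<lambda>w. of_real (snd (snd w)) * ee w) \<in> O[F](\<lambda>_. 1 :: complex)"
    "ee \<in> O[F](\<lambda>_. 1 :: complex)"
proof -
  show t: "(ee \<longlongrightarrow> 0) F" using assms by (simp add: good_def)
  show "ee \<in> O[F](\<lambda>_. 1 :: complex)"
    by (rule landau_o.small_imp_big, rule smalloI_tendsto) (use t in auto)
qed (use assms in \<open>auto simp: good_def\<close>)

definition "XL w r = alpha p r * (of_real (fst (snd w)) * ee w) + beta p r * (of_real (snd (snd w)) * ee w)"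

lemma XL_bigo: "good F \<Longrightarrow> (\<lambda>w. XL w r) \<in> O[F](\<lambda>_. 1 :: complex)"
  unfolding XL_def by (intro sum_in_bigo bigo_1_mult goodD) auto

lemma zsh_1: "zsh sh w 1 = XL w 1 + ee w * (fst w 1 + sh 1)"
  by (simp add: zsh_def XL_def bs_def algebra_simps)

lemma zsh_1_bigo:
  assumes F: "good F"
  shows "(\<lambda>w. zsh sh w 1) \<in> O[F](\<lambda>_. 1 :: complex)"
  unfolding zsh_1 by (intro sum_in_bigo XL_bigo[OF F] bigo_mult_1 goodD[OF F]) (use m in auto)

text \<open>At position \<open>m\<close> the large parameter becomes exactly 1, while bounded
  parameters and the shift are of order \<open>ee ^ r\<close>. The location contributes
  \<open>ee ^ (r - 1) * XL w r\<close>, which for \<open>r \<ge> 3\<close> is already of second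
  order.\<close>

lemma zsh_rest:
  assumes F: "good F" and r: "2 \<le> r"
  shows "(\<lambda>w. zsh sh w r - (if r = m then 1 else 0) - ee w ^ (r - 1) * XL w r) \<in> O[F](\<lambda>w. ee w ^ 2)"
proof -
  have e2: "(\<lambda>w. ee w ^ r) \<in> O[F](\<lambda>w. ee w ^ 2)" by (rule bigo_power_le[OF goodD(6)[OF F] r])
  have fb: "(\<lambda>w. if r = m then 0 else fst w r) \<in> O[F](\<lambda>_. 1 :: complex)"
    by (cases "r = m") (use goodD(3)[OF F, of r] r in simp_all)
  have "(\<lambda>w. ee w ^ r * ((if r = m then 0 else fst w r) + sh r)) \<in> O[F](\<lambda>w. ee w ^ 2)"
    by (intro bigo_mult_1 e2 sum_in_bigo fb) simp
  moreover have "\<forall>\<^sub>F w in F. zsh sh w r - (if r = m then 1 else 0) - ee w ^ (r - 1) * XL w r =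
      ee w ^ r * ((if r = m then 0 else fst w r) + sh r)"
    using goodD(2)[OF F]
  proof eventually_elim
    case (elim w)
    define y where "y = ee w ^ (r - 1)"
    have er: "ee w ^ r = y * ee w" unfolding y_def using r by (metis power_minus_mult gr0I not_numeral_le_zero)
    have em: "ee w ^ m * fst w m = 1"
    proof -
      have "rt (fst w m) \<noteq> 0" using elim by (auto simp: ee_def)
      moreover have "rt (fst w m) ^ m = fst w m" using rt by blast
      ultimately have "fst w m \<noteq> 0" by (metis power_not_zero)
      then show ?thesis using \<open>rt (fst w m) ^ m = fst w m\<close> by (simp add: ee_def power_divide)
    qed
    show ?case
    proof (cases "r = m")
      case True
      have "ee w ^ r * fst w r = 1" using em by (simp only: True)
      then have "y * ee w * fst w r = 1" unfolding er .
      then show ?thesis unfolding zsh_def bs_def XL_def er y_def[symmetric] if_P[OF True]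
        by (simp add: ring_distribs mult_ac)
    next
      case False
      show ?thesis unfolding zsh_def bs_def XL_def er y_def[symmetric] if_not_P[OF False]
        by (simp add: ring_distribs mult_ac)
    qed
  qed
  ultimately show ?thesis by (rule bigo_eventually_eq)
qed

lemma zsh_3:
  assumes F: "good F" and r: "3 \<le> r"
  shows "(\<lambda>w. zsh sh w r - (if r = m then 1 else 0)) \<in> O[F](\<lambda>w. ee w ^ 2)"
proof -
  have "(\<lambda>w. ee w ^ (r - 1)) \<in> O[F](\<lambda>w. ee w ^ 2)"
    by (rule bigo_power_le[OF goodD(6)[OF F]]) (use r in simp)
  then have "(\<lambda>w. ee w ^ (r - 1) * XL w r) \<in> O[F](\<lambda>w. ee w ^ 2)" by (intro bigo_mult_1 XL_bigo[OF F])
  from sum_in_bigo(1)[OF zsh_rest[OF F, of r sh] this] r show ?thesis by simp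
qed

lemma ee2_bigo: "good F \<Longrightarrow> (\<lambda>w. ee w ^ 2) \<in> O[F](ee)"
  using bigo_power_le[OF goodD(6), of F 1 2] by simp

lemma zsh_2:
  assumes F: "good F" and r: "2 \<le> r"
  shows "(\<lambda>w. zsh sh w r - (if r = m then 1 else 0)) \<in> O[F](ee)"
proof -
  have "(\<lambda>w. ee w ^ (r - 1)) \<in> O[F](\<lambda>w. ee w ^ 1)"
    by (rule bigo_power_le[OF goodD(6)[OF F]]) (use r in simp)
  then have "(\<lambda>w. ee w ^ (r - 1) * XL w r) \<in> O[F](ee)" by (intro bigo_mult_1 XL_bigo[OF F]) simp
  from sum_in_bigo(1)[OF landau_o.big_trans[OF zsh_rest[OF F r, of sh] ee2_bigo[OF F]] this]
  show ?thesis by simp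
qed

lemma zs_bigo:
  assumes F: "good F" and r: "1 \<le> r"
  shows "(\<lambda>w. zs w r) \<in> O[F](\<lambda>w. ee w ^ 2)"
proof (cases "r = 1")
  case False
  then have "(\<lambda>w. ee w ^ r) \<in> O[F](\<lambda>w. ee w ^ 2)" using r by (intro bigo_power_le[OF goodD(6)[OF F]]) auto
  then show ?thesis unfolding zs_def by (intro bigo_mult_1) auto
qed (use sc12 in \<open>simp add: zs_def\<close>)

lemma DD_perturb:
  assumes F: "good F" and u: "(\<lambda>w. zsh sh w 1 - u w) \<in> O[F](ee)" "u \<in> O[F](\<lambda>_. 1 :: complex)"
  shows "(\<lambda>w. DD V sh w - Dm XX V (\<lambda>_. zz m (u w)) (\<lambda>_. 0)) \<in> O[F](ee)"
  unfolding DD_def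
proof (rule Dm_perturb[OF goodD(6)[OF F]])
  fix r :: nat assume r: "1 \<le> r"
  show "(\<lambda>w. zz m (u w) r) \<in> O[F](\<lambda>_. 1 :: complex)"
    using u(2) by (cases "r = 1") (auto simp: zz_def)
  show "(\<lambda>w. zsh sh w r - zz m (u w) r) \<in> O[F](ee)"
  proof (cases "r = 1")
    case True
    then show ?thesis using u(1) by (simp add: zz_def)
  next
    case False
    then show ?thesis using zsh_2[OF F, of r sh] r by (simp add: zz_def)
  qed
  show "(\<lambda>w. zs w r) \<in> O[F](ee)" by (rule landau_o.big_trans[OF zs_bigo[OF F r] ee2_bigo[OF F]])
qed

lemma DD_bigo_1:
  assumes F: "good F"
  shows "(\<lambda>w. DD V sh w) \<in> O[F](\<lambda>_. 1 :: complex)"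
  unfolding DD_def
proof (rule Dm_bigo_1)
  fix r :: nat assume r: "1 \<le> r"
  show "(\<lambda>w. zsh sh w r) \<in> O[F](\<lambda>_. 1 :: complex)"
  proof (cases "r = 1")
    case True
    then show ?thesis using zsh_1_bigo[OF F] by simp
  next
    case False
    then show ?thesis using r by (intro bigo_1_of_diff[OF zsh_2[OF F] goodD(6)[OF F]]) auto
  qed
  show "(\<lambda>w. zs w r) \<in> O[F](\<lambda>_. 1 :: complex)"
    by (rule landau_o.big_trans[OF landau_o.big_trans[OF zs_bigo[OF F r] ee2_bigo[OF F]] goodD(6)[OF F]])
qed

definition "V0 = {0..<N}"

definition "V1 = insert N {0..<N - 1}"

lemma VS_facts: "finite VS" "V0 \<in> VS" "V1 \<in> VS" "V0 \<noteq> V1" "\<Sum>V0 = sigma0 N" "\<Sum>V1 = Suc (sigma0 N)"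
  "\<And>V. V \<in> VS \<Longrightarrow> V \<noteq> V0 \<Longrightarrow> V \<noteq> V1 \<Longrightarrow> sigma0 N + 2 \<le> \<Sum>V"
proof -
  obtain n where n: "N = Suc n" using N by (cases N) auto
  have NL: "N \<le> l + N * (M + 1)" by simp
  show "finite VS" unfolding VS_def by (rule finite_subset[of _ "Pow {0..l + N * (M + 1)}"]) auto
  have "V0 \<subseteq> {0..l + N * (M + 1)}" "card V0 = N" unfolding V0_def using NL by (auto simp del: add_Suc_right)
  then show "V0 \<in> VS" unfolding VS_def by blast
  have "V1 \<subseteq> {0..l + N * (M + 1)}" unfolding V1_def using NL by auto
  moreover have "card V1 = N" unfolding V1_def using N by simp
  ultimately show "V1 \<in> VS" unfolding VS_def by blast
  have "n \<in> V0" unfolding V0_def unfolding n by simp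
  moreover have "n \<notin> V1" unfolding V1_def unfolding n by simp
  ultimately show "V0 \<noteq> V1" by blast
  show s0: "\<Sum>V0 = sigma0 N" by (simp add: V0_def sigma0_def atLeast0LessThan)
  show "\<Sum>V1 = Suc (sigma0 N)"
    unfolding V1_def sigma0_def unfolding n by (simp add: atLeast0LessThan)
  fix V assume V: "V \<in> VS" "V \<noteq> V0" "V \<noteq> V1"
  then have fin: "finite V" and c: "card V = N" by (auto simp: VS_def intro: finite_subset)
  have ne: "V \<noteq> {}" using c n by auto
  note sl = sum_lower_set[OF fin, unfolded c]
  have "\<Sum>V \<noteq> sigma0 N" using sl(2) V(2) by (auto simp: sigma0_def V0_def atLeast0LessThan)
  moreover have "\<Sum>V \<noteq> Suc (sigma0 N)" using sl(3)[OF ne] V(3) by (auto simp: sigma0_def V1_def atLeast0LessThan)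
  ultimately show "sigma0 N + 2 \<le> \<Sum>V" using sl(1) by (simp add: sigma0_def)
qed

text \<open>By \<open>VS_facts\<close> the sum of every other column set exceeds that of
  \<open>V0\<close> by at least 2, so its weight contains \<open>qq\<close> squared, and
  \<open>qq\<close> is of order \<open>ee ^ 2\<close>.\<close>

lemma TN_split:
  assumes F: "good F"
  shows "(\<lambda>w. TN sh w - (DD V0 sh w * cnj (DD V0 (\<lambda>r. - sh r) w)
      + of_real (qq w) * DD V1 sh w * cnj (DD V1 (\<lambda>r. - sh r) w))) \<in> O[F](\<lambda>w. ee w ^ 4)"
proof -
  let ?t = "\<lambda>w V. of_real (qq w ^ (\<Sum>V - sigma0 N)) * DD V sh w * cnj (DD V (\<lambda>r. - sh r) w)"
  have "TN sh w = ?t w V0 + (?t w V1 + (\<Sum>V\<in>VS - {V0} - {V1}. ?t w V))" for w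
    unfolding TN_def using VS_facts(1-4) by (simp add: sum.remove[of VS V0] sum.remove[of "VS - {V0}" V1])
  then have eq: "TN sh w - (DD V0 sh w * cnj (DD V0 (\<lambda>r. - sh r) w)
      + of_real (qq w) * DD V1 sh w * cnj (DD V1 (\<lambda>r. - sh r) w)) = (\<Sum>V\<in>VS - {V0} - {V1}. ?t w V)" for w
    by (simp add: VS_facts(5,6))
  have "(\<lambda>w. ?t w V) \<in> O[F](\<lambda>w. ee w ^ 4)" if V: "V \<in> VS - {V0} - {V1}" for V
  proof -
    define i where "i = \<Sum>V - sigma0 N"
    have i: "4 \<le> 2 * i" using VS_facts(7)[of V] V by (auto simp: i_def)
    have "(\<lambda>w. complex_of_real (qq w ^ i)) \<in> O[F](\<lambda>w. ee w ^ (2 * i))"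
      by (rule bigoI[where c = "hh ^ i"])
         (use hh_pos in \<open>simp add: qq_def norm_power norm_mult power_mult_distrib power_mult\<close>)
    then have "(\<lambda>w. complex_of_real (qq w ^ i)) \<in> O[F](\<lambda>w. ee w ^ 4)"
      by (rule landau_o.big_trans) (rule bigo_power_le[OF goodD(6)[OF F] i])
    then show ?thesis unfolding i_def[symmetric]
      by (intro bigo_mult_1) (simp_all add: bigo_cnj DD_bigo_1[OF F])
  qed
  then show ?thesis unfolding eq by (intro big_sum_in_bigo)
qed

end

lemma pow_three_over_square:
  fixes f e :: "'w \<Rightarrow> complex" and d :: complex
  assumes "f \<in> O[F](\<lambda>w. e w ^ 3)"
  shows "(\<lambda>w. f w * (1 / (e w * cnj (e w) * d))) \<in> O[F](e)"
proof (rule landau_o.big_trans)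
  show "(\<lambda>w. f w * (1 / (e w * cnj (e w) * d))) \<in> O[F](\<lambda>w. e w ^ 3 * (1 / (e w * cnj (e w) * d)))"
    by (intro landau_o.big.mult assms) simp
  show "(\<lambda>w. e w ^ 3 * (1 / (e w * cnj (e w) * d))) \<in> O[F](e)"
  proof (rule bigoI[where c = "1 / cmod d"], rule always_eventually, rule allI)
    fix w
    show "cmod (e w ^ 3 * (1 / (e w * cnj (e w) * d))) \<le> 1 / cmod d * cmod (e w)"
      by (cases "e w = 0") (simp_all add: norm_mult norm_divide norm_power power3_eq_cube)
  qed
qed

text \<open>The linear factors of the nonzero roots occur once each and are handled by
  \<open>prod_dist_lower\<close>; the root 0 may be multiple, but it is kept at distance
  \<open>\<delta>\<close>.\<close>

lemma poly_lower_bound: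
  fixes P :: "complex poly"
  assumes P: "P \<noteq> 0" and \<delta>: "\<delta> > 0"
    and simple: "\<And>z. z \<noteq> 0 \<Longrightarrow> poly P z = 0 \<Longrightarrow> poly (pderiv P) z \<noteq> 0"
  shows "\<exists>c>0. \<forall>u r. \<delta> \<le> cmod u \<longrightarrow> 0 \<le> r \<longrightarrow> r \<le> 1 \<longrightarrow>
    (\<forall>z. z \<noteq> 0 \<and> poly P z = 0 \<longrightarrow> r \<le> cmod (u - z)) \<longrightarrow> c * r \<le> cmod (poly P u)"
proof -
  define R where "R = {z. poly P z = 0}"
  define Z where "Z = {z. z \<noteq> 0 \<and> poly P z = 0}"
  have finR: "finite R" unfolding R_def by (rule poly_roots_finite[OF P])
  have finZ: "finite Z" by (rule finite_subset[OF _ finR]) (auto simp: R_def Z_def)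
  have ord1: "order z P = 1" if "z \<in> Z" for z
  proof -
    have z: "z \<noteq> 0" "poly P z = 0" using that by (auto simp: Z_def)
    have "order z P = Suc (order z (pderiv P))" by (rule order_pderiv[OF P z(2)])
    then show ?thesis using order_0I[OF simple[OF z]] by simp
  qed
  obtain c where c: "c > 0" "\<And>u r. 0 \<le> r \<Longrightarrow> r \<le> 1 \<Longrightarrow> (\<forall>z\<in>Z. r \<le> cmod (u - z)) \<Longrightarrow> c * r \<le> (\<Prod>z\<in>Z. cmod (u - z))"
    using prod_dist_lower[OF finZ] by blast
  define lc where "lc = cmod (lead_coeff P)"
  have lc: "lc > 0" using P by (simp add: lc_def)
  define o0 where "o0 = order 0 P"
  have dec: "cmod (poly P u) = lc * (cmod u ^ o0 * (\<Prod>z\<in>Z. cmod (u - z)))" for u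
  proof -
    have "poly P u = lead_coeff P * (\<Prod>z\<in>R. (u - z) ^ order z P)"
      using arg_cong[OF complex_poly_decompose[of P], of "\<lambda>q. poly q u"]
      by (simp add: poly_prod R_def add.commute)
    also have "(\<Prod>z\<in>R. (u - z) ^ order z P) = (\<Prod>z\<in>insert 0 Z. (u - z) ^ order z P)"
    proof (rule prod.mono_neutral_left)
      show "\<forall>z\<in>insert 0 Z - R. (u - z) ^ order z P = 1"
      proof
        fix z assume "z \<in> insert 0 Z - R"
        then have "poly P z \<noteq> 0" by (auto simp: R_def)
        then show "(u - z) ^ order z P = 1" by (simp add: order_0I)
      qed
    qed (use finZ in \<open>auto simp: R_def Z_def\<close>)
    also have "\<dots> = u ^ o0 * (\<Prod>z\<in>Z. u - z)"
      using finZ ord1 by (subst prod.insert) (auto simp: Z_def o0_def)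
    finally show ?thesis by (simp add: norm_mult norm_power prod_norm lc_def)
  qed
  have "lc * \<delta> ^ o0 * c * r \<le> cmod (poly P u)"
    if u: "\<delta> \<le> cmod u" and r: "0 \<le> r" "r \<le> 1" "\<forall>z. z \<noteq> 0 \<and> poly P z = 0 \<longrightarrow> r \<le> cmod (u - z)" for u r
  proof -
    have "\<delta> ^ o0 * (c * r) \<le> cmod u ^ o0 * (\<Prod>z\<in>Z. cmod (u - z))"
      by (intro mult_mono power_mono c(2)) (use u r \<delta> c(1) in \<open>auto simp: Z_def\<close>)
    then show ?thesis unfolding dec using lc by (simp add: mult.assoc)
  qed
  then show ?thesis using lc \<delta> c(1) by (intro exI[of _ "lc * \<delta> ^ o0 * c"]) simp
qed

section \<open>The outer region: near a root and away from the roots\<close>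

context mk_wave
begin

lemma NS: "Suc (N - 1) = N"
  using N by simp

lemma V0V1: "V0 = {0..<Suc (N - 1)}" "V1 = insert (Suc (N - 1)) {0..<N - 1}"
  by (simp_all only: V0_def V1_def NS)

lemma cardXX: "card XX = Suc (N - 1)"
  using XX(2) NS by simp

abbreviation "WW \<equiv> W_poly m (M + 1) l N"

abbreviation "Wc \<equiv> W_const (M + 1) l N"

lemma Wc: "Wc \<noteq> 0"
  by (rule W_const_nonzero) simp

lemma WW_Dm: "WW z = Wc * Dm XX V0 (\<lambda>_. zz m z) (\<lambda>_. 0)"
  unfolding XX_def V0_def by (rule W_poly_Dm[OF m]) simp

lemma deriv_WW: "deriv WW z = Wc * Dm XX V1 (\<lambda>_. zz m z) (\<lambda>_. 0)"
  using deriv_W_poly[OF m, of "M + 1" l "N - 1" z] unfolding NS XX_def V1_def by simp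

lemma WT_Dcol: "W_tilde m (M + 1) l N z = Wc * (\<Sum>c<N. Dcol XX c (c + 2) (zz m z))"
  unfolding XX_def by (rule W_tilde_Dcol[OF m]) simp

lemma zsh_shift: "zsh sh w 1 = zsh (\<lambda>_. 0) w 1 + ee w * sh 1"
  by (simp add: zsh_def algebra_simps)

lemma qq_bigo:
  shows "(\<lambda>w. complex_of_real (qq w)) \<in> O[F](\<lambda>w. ee w ^ 2)"
  by (rule bigoI[where c = hh]) (use hh_pos in \<open>simp add: qq_def norm_mult norm_power\<close>)

text \<open>At the root the minor of \<open>V0\<close> is of first order and that of
  \<open>V1\<close> is not small, but the weight \<open>qq\<close> brings the two contributions to
  the same order \<open>ee * cnj ee\<close>. Dividing by it leaves the profile of the fundamental
  wave, with an error of order \<open>ee\<close>.\<close>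

lemma near_ratio:
  assumes F: "good F" and z0: "WW z0 = 0" "deriv WW z0 \<noteq> 0"
    and u: "\<forall>\<^sub>F w in F. zsh (\<lambda>_. 0) w 1 = z0 + ee w * (\<eta> w - \<Delta> w)"
    and \<eta>: "\<eta> \<in> O[F](\<lambda>_. 1 :: complex)" and X2: "X2 \<in> O[F](\<lambda>_. 1 :: complex)"
    and X2d: "(\<lambda>w. XL w 2 - X2 w) \<in> O[F](ee)"
    and \<Delta>: "\<And>w. \<Delta> w = X2 w * (W_tilde m (M + 1) l N z0 / deriv WW z0)"
  shows "(\<lambda>w. TN sh w / TN (\<lambda>_. 0) w - ((\<eta> w + sh 1) * cnj (\<eta> w - sh 1) + of_real hh) /
    (\<eta> w * cnj (\<eta> w) + of_real hh)) \<in> O[F](ee)"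
proof -
  define dd where "dd = Dm XX V1 (\<lambda>_. zz m z0) (\<lambda>_. 0)"
  define wt where "wt = (\<Sum>c<N. Dcol XX c (c + 2) (zz m z0))"
  have dd: "dd \<noteq> 0" using z0(2) unfolding deriv_WW dd_def by auto
  have D0: "Dm XX V0 (\<lambda>_. zz m z0) (\<lambda>_. 0) = 0" using z0(1) Wc unfolding WW_Dm by simp
  \<comment> \<open>\<open>\<Delta>\<close> is defined so that its shift of the first variable
    cancels the first-order contribution of the second variable.\<close>
  have \<Delta>dd: "\<Delta> w * dd = X2 w * wt" for w
    unfolding \<Delta> WT_Dcol deriv_WW dd_def[symmetric] wt_def[symmetric] using dd Wc by simp
  have \<Delta>b: "\<Delta> \<in> O[F](\<lambda>_. 1 :: complex)"
    unfolding \<Delta>[abs_def] by (intro bigo_mult_1 X2) simp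
  note eO = goodD(6)[OF F]
  have z1: "(\<lambda>w. zsh sh w 1 - z0) \<in> O[F](ee)" for sh
  proof -
    have "(\<lambda>w. ee w * (\<eta> w - \<Delta> w + sh 1)) \<in> O[F](ee)"
      by (intro bigo_mult_1 sum_in_bigo \<eta> \<Delta>b) auto
    moreover have "\<forall>\<^sub>F w in F. zsh sh w 1 - z0 = ee w * (\<eta> w - \<Delta> w + sh 1)"
      using u by eventually_elim (unfold zsh_shift[of sh], simp add: algebra_simps)
    ultimately show ?thesis by (rule bigo_eventually_eq)
  qed
  have E0: "(\<lambda>w. DD V0 sh w - ee w * (dd * (\<eta> w + sh 1))) \<in> O[F](\<lambda>w. ee w ^ 2)" for sh
  proof -
    have zz1: "zz m z0 1 = z0" by (simp add: zz_def)
    have zzr: "zz m z0 r = (if r = m then 1 else 0)" if "2 \<le> r" for r using that by (auto simp: zz_def)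
    have A: "(\<lambda>w. Dm XX {0..<Suc (N - 1)} (\<lambda>_. zsh sh w) (zs w) - Dm XX {0..<Suc (N - 1)} (\<lambda>_. zz m z0) (\<lambda>_. 0)
      - ((zsh sh w 1 - zz m z0 1) * Dcol XX (N - 1) (Suc (N - 1)) (zz m z0)
        + (zsh sh w 2 - zz m z0 2) * (\<Sum>c<Suc (N - 1). Dcol XX c (c + 2) (zz m z0))))
      \<in> O[F](\<lambda>w. ee w ^ 2)"
    proof (rule Dm_expand[OF eO cardXX])
      fix r :: nat assume "r \<in> {1, 2}"
      then show "(\<lambda>w. zsh sh w r - zz m z0 r) \<in> O[F](ee)"
        using z1[of sh] zz1 zsh_2[OF F, of 2 sh] zzr[of 2] by auto
    next
      fix r :: nat assume r: "3 \<le> r"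
      then have "zz m z0 r = (if r = m then 1 else 0)" by (intro zzr) simp
      then show "(\<lambda>w. zsh sh w r - zz m z0 r) \<in> O[F](\<lambda>w. ee w ^ 2)"
        using zsh_3[OF F r, of sh] by (simp only:)
    next
      fix r :: nat assume "1 \<le> r"
      then show "(\<lambda>w. zs w r) \<in> O[F](\<lambda>w. ee w ^ 2)" by (rule zs_bigo[OF F])
    qed (simp_all only: zs_def sc12 mult_zero_right)
    have A': "(\<lambda>w. DD V0 sh w - ((zsh sh w 1 - z0) * dd + (zsh sh w 2 - (if 2 = m then 1 else 0)) * wt))
        \<in> O[F](\<lambda>w. ee w ^ 2)"
      using A unfolding V0V1(1)[symmetric] DD_def[symmetric] D0 zz1 zzr[OF order.refl] NS wt_def[symmetric]
        Dcol_last[OF cardXX, unfolded V0V1(2)[symmetric] NS] dd_def[symmetric] diff_zero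
      unfolding V0_def[symmetric] V1_def[symmetric] unfolding D0 dd_def[symmetric] diff_zero .
    have B: "(\<lambda>w. (zsh sh w 2 - (if 2 = m then 1 else 0) - ee w ^ (2 - 1) * XL w 2) * wt) \<in> O[F](\<lambda>w. ee w ^ 2)"
      by (intro bigo_mult_1 zsh_rest[OF F]) auto
    have "(\<lambda>w. ee w * (XL w 2 - X2 w)) \<in> O[F](\<lambda>w. ee w * ee w)" by (intro landau_o.big.mult X2d) simp
    then have "(\<lambda>w. ee w * (XL w 2 - X2 w)) \<in> O[F](\<lambda>w. ee w ^ 2)" unfolding power2_eq_square .
    then have C: "(\<lambda>w. ee w * (XL w 2 - X2 w) * wt) \<in> O[F](\<lambda>w. ee w ^ 2)" by (rule bigo_mult_1) simp
    have "(\<lambda>w. DD V0 sh w - ((zsh sh w 1 - z0) * dd + ee w * X2 w * wt)) \<in> O[F](\<lambda>w. ee w ^ 2)"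
      using sum_in_bigo(1)[OF sum_in_bigo(1)[OF A' B] C] by (simp add: algebra_simps)
    moreover have "\<forall>\<^sub>F w in F. DD V0 sh w - ee w * (dd * (\<eta> w + sh 1)) =
        DD V0 sh w - ((zsh sh w 1 - z0) * dd + ee w * X2 w * wt)"
      using u
    proof eventually_elim
      case (elim w)
      have f: "ee w * X2 w * wt = ee w * (\<Delta> w * dd)" using \<Delta>dd[of w] by (simp only: mult.assoc)
      show ?case unfolding zsh_shift[of sh] f elim by (simp add: algebra_simps)
    qed
    ultimately show ?thesis by (rule bigo_eventually_eq)
  qed
  have E1: "(\<lambda>w. DD V1 sh w - dd) \<in> O[F](ee)" for sh
    unfolding dd_def by (rule DD_perturb[OF F z1]) simp
  have A_bigo: "(\<lambda>w. ee w * (dd * (\<eta> w + sh 1))) \<in> O[F](ee)" for sh :: "nat \<Rightarrow> complex"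
    by (intro bigo_mult_1 bigo_1_mult sum_in_bigo \<eta>) auto
  have D_bigo: "(\<lambda>w. DD V0 sh w) \<in> O[F](ee)" for sh
    using sum_in_bigo(1)[OF landau_o.big_trans[OF E0[of sh] ee2_bigo[OF F]] A_bigo[of sh]] by simp
  define d where "d = dd * cnj dd"
  have d: "d \<noteq> 0" using dd by (simp add: d_def)
  define G where "G sh w = (\<eta> w + sh 1) * cnj (\<eta> w - sh 1) + of_real hh" for sh :: "nat \<Rightarrow> complex" and w
  have Gb: "G sh \<in> O[F](\<lambda>_. 1 :: complex)" for sh
  proof -
    have c: "(\<lambda>_. d) \<in> O[F](\<lambda>_. 1 :: complex)" for d :: complex by simp
    show ?thesis unfolding G_def[abs_def]
      by (rule sum_in_bigo(1)[OF bigo_mult_1[OF sum_in_bigo(1)[OF \<eta> c] iffD2[OF bigo_cnj sum_in_bigo(2)[OF \<eta> c]]] c])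
  qed
  \<comment> \<open>Every error is the product of a second-order and a first-order quantity, where
    \<open>qq\<close> counts as second order.\<close>
  have main: "(\<lambda>w. TN sh w - ee w * cnj (ee w) * d * G sh w) \<in> O[F](\<lambda>w. ee w ^ 3)" for sh
  proof -
    let ?A = "\<lambda>sh w. ee w * (dd * (\<eta> w + sh 1))"
    let ?m = "\<lambda>r. - sh r"
    have e32: "(\<lambda>w. ee w ^ 2 * ee w) = (\<lambda>w. ee w ^ 3)" by (simp add: power3_eq_cube power2_eq_square fun_eq_iff)
    have e23: "(\<lambda>w. ee w * ee w ^ 2) = (\<lambda>w. ee w ^ 3)" by (simp add: power3_eq_cube power2_eq_square fun_eq_iff)
    have 1: "(\<lambda>w. (DD V0 sh w - ?A sh w) * cnj (DD V0 ?m w)) \<in> O[F](\<lambda>w. ee w ^ 3)"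
      using landau_o.big.mult[OF E0[of sh] iffD2[OF bigo_cnj D_bigo[of ?m]]] unfolding e32 .
    have 2: "(\<lambda>w. ?A sh w * cnj (DD V0 ?m w - ?A ?m w)) \<in> O[F](\<lambda>w. ee w ^ 3)"
      using landau_o.big.mult[OF A_bigo[of sh] iffD2[OF bigo_cnj E0[of ?m]]] unfolding e23 .
    have 3: "(\<lambda>w. (DD V1 sh w - dd) * cnj (DD V1 ?m w) + dd * cnj (DD V1 ?m w - dd)) \<in> O[F](ee)"
    proof (rule sum_in_bigo(1))
      show "(\<lambda>w. (DD V1 sh w - dd) * cnj (DD V1 ?m w)) \<in> O[F](ee)"
        by (rule bigo_mult_1[OF E1 iffD2[OF bigo_cnj DD_bigo_1[OF F]]])
      have "(\<lambda>_. dd) \<in> O[F](\<lambda>_. 1 :: complex)" by simp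
      then show "(\<lambda>w. dd * cnj (DD V1 ?m w - dd)) \<in> O[F](ee)"
        by (rule bigo_1_mult[OF _ iffD2[OF bigo_cnj E1]])
    qed
    have 4: "(\<lambda>w. of_real (qq w) * ((DD V1 sh w - dd) * cnj (DD V1 ?m w) + dd * cnj (DD V1 ?m w - dd))) \<in> O[F](\<lambda>w. ee w ^ 3)"
      using landau_o.big.mult[OF qq_bigo 3] unfolding e32 .
    have 5: "(\<lambda>w. TN sh w - (DD V0 sh w * cnj (DD V0 ?m w) + of_real (qq w) * DD V1 sh w * cnj (DD V1 ?m w))) \<in> O[F](\<lambda>w. ee w ^ 3)"
      by (rule landau_o.big_trans[OF TN_split[OF F]]) (rule bigo_power_le[OF eO], simp)
    have qq: "complex_of_real (qq w) = of_real hh * (ee w * cnj (ee w))" for w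
      using complex_norm_square[of "ee w"] by (simp add: qq_def)
    have "TN sh w - ee w * cnj (ee w) * d * G sh w =
      (TN sh w - (DD V0 sh w * cnj (DD V0 ?m w) + of_real (qq w) * DD V1 sh w * cnj (DD V1 ?m w)))
      + ((DD V0 sh w - ?A sh w) * cnj (DD V0 ?m w) + ?A sh w * cnj (DD V0 ?m w - ?A ?m w)
      + of_real (qq w) * ((DD V1 sh w - dd) * cnj (DD V1 ?m w) + dd * cnj (DD V1 ?m w - dd)))" for w
      unfolding G_def d_def qq by (simp add: algebra_simps)
    then show ?thesis using sum_in_bigo(1)[OF 5 sum_in_bigo(1)[OF sum_in_bigo(1)[OF 1 2] 4]] by (simp only:)
  qed
  define H where "H sh w = TN sh w * (1 / (ee w * cnj (ee w) * d))" for sh w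
  have alg: "a * (1 / z) - g = (a - z * g) * (1 / z)" if "z \<noteq> 0" for a z g :: complex
    using that by (simp add: field_simps)
  have HG: "(\<lambda>w. H sh w - G sh w) \<in> O[F](ee)" for sh
  proof -
    have "(\<lambda>w. (TN sh w - ee w * cnj (ee w) * d * G sh w) * (1 / (ee w * cnj (ee w) * d))) \<in> O[F](ee)"
      by (rule pow_three_over_square[OF main])
    moreover have "\<forall>\<^sub>F w in F. H sh w - G sh w = (TN sh w - ee w * cnj (ee w) * d * G sh w) * (1 / (ee w * cnj (ee w) * d))"
      using goodD(2)[OF F] by eventually_elim (unfold H_def, rule alg, simp add: d)
    ultimately show ?thesis by (rule bigo_eventually_eq)
  qed
  have "(\<lambda>w. H sh w / H (\<lambda>_. 0) w - G sh w / G (\<lambda>_. 0) w) \<in> O[F](ee)"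
  proof (rule ratio_perturb[OF goodD(1)[OF F] HG HG Gb hh_pos _ Gb], rule always_eventually, rule allI)
    fix w
    have "G (\<lambda>_. 0) w = of_real ((cmod (\<eta> w))\<^sup>2 + hh)"
      unfolding G_def using complex_norm_square[of "\<eta> w"] by simp
    then show "hh \<le> cmod (G (\<lambda>_. 0) w)" using hh_pos by (simp only: norm_of_real) simp
  qed
  moreover have "\<forall>\<^sub>F w in F. TN sh w / TN (\<lambda>_. 0) w - G sh w / G (\<lambda>_. 0) w = H sh w / H (\<lambda>_. 0) w - G sh w / G (\<lambda>_. 0) w"
    using goodD(2)[OF F] by eventually_elim (unfold H_def, subst mult_divide_mult_cancel_right, simp_all add: d)
  ultimately have "(\<lambda>w. TN sh w / TN (\<lambda>_. 0) w - G sh w / G (\<lambda>_. 0) w) \<in> O[F](ee)"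
    by (rule bigo_eventually_eq)
  then show ?thesis unfolding G_def by simp
qed

text \<open>Where \<open>W\<close> at the rescaled first variable dominates \<open>ee\<close>, the
  minor of \<open>V0\<close> is asymptotic to the same value for every shift, and all other terms
  are negligible against its square. So numerator and denominator are asymptotically equal.\<close>

lemma far_ratio:
  assumes F: "good F" and small: "ee \<in> o[F](\<lambda>w. WW (zsh (\<lambda>_. 0) w 1))"
  shows "((\<lambda>w. TN sh w / TN (\<lambda>_. 0) w) \<longlongrightarrow> 1) F"
proof -
  define Wn where "Wn w = Dm XX V0 (\<lambda>_. zz m (zsh (\<lambda>_. 0) w 1)) (\<lambda>_. 0)" for w
  have sm: "ee \<in> o[F](Wn)"
    using small Wc unfolding WW_Dm Wn_def[symmetric] by simp
  have Wnz: "\<forall>\<^sub>F w in F. Wn w \<noteq> 0"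
  proof -
    have "\<forall>\<^sub>F w in F. cmod (ee w) \<le> 1 * cmod (Wn w)" by (rule landau_o.smallD[OF sm]) simp
    then show ?thesis using goodD(2)[OF F] by eventually_elim auto
  qed
  have D0: "((\<lambda>w. DD V0 sh w / Wn w) \<longlongrightarrow> 1) F" for sh
  proof -
    have "(\<lambda>w. zsh sh w 1 - zsh (\<lambda>_. 0) w 1) \<in> O[F](ee)" unfolding zsh_shift[of sh] by simp
    from DD_perturb[OF F this zsh_1_bigo[OF F], of V0]
    have "(\<lambda>w. DD V0 sh w - Wn w) \<in> O[F](ee)" unfolding Wn_def .
    from smalloD_tendsto[OF landau_o.big_small_trans[OF this sm]]
    have "((\<lambda>w. (DD V0 sh w - Wn w) / Wn w + 1) \<longlongrightarrow> 0 + 1) F" by (intro tendsto_add tendsto_const)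
    moreover have "\<forall>\<^sub>F w in F. (DD V0 sh w - Wn w) / Wn w + 1 = DD V0 sh w / Wn w"
      using Wnz by eventually_elim (simp add: field_simps)
    ultimately have "((\<lambda>w. DD V0 sh w / Wn w) \<longlongrightarrow> 0 + 1) F" by (rule Lim_transform_eventually)
    then show ?thesis by simp
  qed
  have T: "((\<lambda>w. TN sh w / (Wn w * cnj (Wn w))) \<longlongrightarrow> 1) F" for sh
  proof -
    define R where "R w = TN sh w - DD V0 sh w * cnj (DD V0 (\<lambda>r. - sh r) w)" for w
    have "(\<lambda>w. TN sh w - (DD V0 sh w * cnj (DD V0 (\<lambda>r. - sh r) w)
      + of_real (qq w) * DD V1 sh w * cnj (DD V1 (\<lambda>r. - sh r) w))) \<in> O[F](\<lambda>w. ee w ^ 2)"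
      by (rule landau_o.big_trans[OF TN_split[OF F]]) (rule bigo_power_le[OF goodD(6)[OF F]], simp)
    moreover have "(\<lambda>w. of_real (qq w) * DD V1 sh w * cnj (DD V1 (\<lambda>r. - sh r) w)) \<in> O[F](\<lambda>w. ee w ^ 2)"
      by (intro bigo_mult_1 qq_bigo) (simp_all only: bigo_cnj DD_bigo_1[OF F])
    ultimately have "R \<in> O[F](\<lambda>w. ee w ^ 2)"
      using sum_in_bigo(1) unfolding R_def[abs_def] by fastforce
    moreover have "(\<lambda>w. ee w ^ 2) \<in> o[F](\<lambda>w. Wn w * cnj (Wn w))"
    proof (rule landau_o.small_big_trans)
      show "(\<lambda>w. ee w ^ 2) \<in> o[F](\<lambda>w. Wn w * Wn w)"
        unfolding power2_eq_square by (rule landau_o.small.mult[OF sm sm])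
      show "(\<lambda>w. Wn w * Wn w) \<in> O[F](\<lambda>w. Wn w * cnj (Wn w))"
        by (rule bigoI[where c = 1]) (simp add: norm_mult)
    qed
    ultimately have "((\<lambda>w. R w / (Wn w * cnj (Wn w))) \<longlongrightarrow> 0) F"
      by (rule smalloD_tendsto[OF landau_o.big_small_trans])
    moreover have "((\<lambda>w. (DD V0 sh w / Wn w) * cnj (DD V0 (\<lambda>r. - sh r) w / Wn w)) \<longlongrightarrow> 1 * cnj 1) F"
      by (intro tendsto_mult tendsto_cnj D0)
    ultimately have "((\<lambda>w. R w / (Wn w * cnj (Wn w)) + (DD V0 sh w / Wn w) * cnj (DD V0 (\<lambda>r. - sh r) w / Wn w)) \<longlongrightarrow> 0 + 1 * cnj 1) F"
      by (intro tendsto_add)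
    then show ?thesis by (simp add: R_def add_divide_distrib[symmetric])
  qed
  have "((\<lambda>w. (TN sh w / (Wn w * cnj (Wn w))) / (TN (\<lambda>_. 0) w / (Wn w * cnj (Wn w)))) \<longlongrightarrow> 1 / 1) F"
    by (intro tendsto_divide T) simp
  moreover have "\<forall>\<^sub>F w in F. (TN sh w / (Wn w * cnj (Wn w))) / (TN (\<lambda>_. 0) w / (Wn w * cnj (Wn w))) = TN sh w / TN (\<lambda>_. 0) w"
    using Wnz by eventually_elim simp
  ultimately have "((\<lambda>w. TN sh w / TN (\<lambda>_. 0) w) \<longlongrightarrow> 1 / 1) F" by (rule Lim_transform_eventually)
  then show ?thesis by simp
qed

section \<open>The inner region: reduction to the core\<close>

definition "YY = core m XX"

text \<open>Without the entry \<open>a m\<close> the variables stay bounded in the inner region; the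
  effect of that entry is transferred to the row set.\<close>

definition "xt sh w r = bs w r + sh r - (if r = m then fst w m else 0)"

definition "TY sh w = tauS YY (of_real hh) sc (\<lambda>r. cnj (sc r)) (\<lambda>_. xt sh w) (\<lambda>_ r. cnj (xt (\<lambda>r. - sh r) w r))"

lemma YY: "finite YY" "card YY = N" "YY \<in> VS"
proof -
  show "finite YY" "card YY = N" unfolding YY_def XX_def using m by (intro core_X0; simp)+
  have "YY \<subseteq> {0..l + N * (M + 1)}" unfolding YY_def XX_def using m by (intro core_X0) auto
  then show "YY \<in> VS" using \<open>card YY = N\<close> by (simp add: VS_def)
qed

lemma VS_fin: "V \<in> VS \<Longrightarrow> finite V \<and> card V = N"
  by (auto simp: VS_def intro: finite_subset)

lemma TY_expand:
  "TY sh w = (\<Sum>V\<in>VS. of_real hh ^ (\<Sum>V) * Dm YY V (\<lambda>_. xt sh w) sc * cnj (Dm YY V (\<lambda>_. xt (\<lambda>r. - sh r) w) sc))"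
proof -
  have sub: "YY \<subseteq> {0..l + N * (M + 1)}" using YY(3) by (simp add: VS_def)
  show ?thesis unfolding TY_def tauS_expand[OF sub] YY(2) VS_def Dm_cnj ..
qed

text \<open>All terms are non-negative, and the column set \<open>YY\<close> contributes a minor
  equal to 1.\<close>

lemma TY_lower: "hh ^ (\<Sum>YY) \<le> cmod (TY (\<lambda>_. 0) w)"
proof -
  have sub: "YY \<subseteq> {0..l + N * (M + 1)}" using YY(3) by (simp add: VS_def)
  let ?t = "\<lambda>V. hh ^ (\<Sum>V) * (cmod (Dm YY V (\<lambda>_. xt (\<lambda>_. 0) w) sc))\<^sup>2"
  have "TY (\<lambda>_. 0) w = of_real (\<Sum>V\<in>VS. ?t V)"
    unfolding TY_def minus_zero using tauS_cnj[OF sub, of hh sc "\<lambda>_. xt (\<lambda>_. 0) w"] unfolding YY(2) VS_def .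
  moreover have "?t YY \<le> (\<Sum>V\<in>VS. ?t V)"
    by (rule member_le_sum[OF YY(3)]) (use VS_facts(1) hh_pos in auto)
  moreover have "?t YY = hh ^ (\<Sum>YY)" by (simp add: Dm_self[OF YY(1)])
  moreover have "0 \<le> hh ^ (\<Sum>YY)" using hh_pos by simp
  ultimately show ?thesis by (simp only: norm_of_real)
qed

text \<open>After extraction of \<open>a m\<close> every row set \<open>W\<close> carries the power
  \<open>ee w ^ (\<Sum>W)\<close>. By \<open>core_minimal\<close> the core alone has the smallest
  exponent, and its constant \<open>Kc\<close> cancels in the quotient.\<close>

lemma inner_ratio:
  assumes e0: "(ee \<longlongrightarrow> 0) F" and enz: "\<forall>\<^sub>F w in F. ee w \<noteq> 0"
    and xb: "\<And>sh r. 1 \<le> r \<Longrightarrow> (\<lambda>w. xt sh w r) \<in> O[F](\<lambda>_. 1 :: complex)"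
  shows "(\<lambda>w. TT sh w / TT (\<lambda>_. 0) w - TY sh w / TY (\<lambda>_. 0) w) \<in> O[F](ee)"
proof -
  define Kc where "Kc = CW m XX YY"
  have m0: "m > 0" using m by simp
  have Kc: "Kc \<noteq> 0" unfolding Kc_def YY_def by (rule CW_core_nonzero[OF m0 XX(1)])
  have eO: "ee \<in> O[F](\<lambda>_. 1 :: complex)"
    by (rule landau_o.small_imp_big, rule smalloI_tendsto) (use e0 in auto)
  \<comment> \<open>The subtraction in the exponent is truncated. It is a true difference for row
    sets with nonzero \<open>CW\<close>, by \<open>ge\<close> below; the power is set to 0 for the
    others.\<close>
  define MM where "MM V sh w = (\<Sum>W\<in>VS. (if CW m XX W = 0 then 0 else ee w ^ (\<Sum>W - \<Sum>YY)) * CW m XX W * Dm W V (\<lambda>_. xt sh w) sc)" for V sh w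
  have ge: "\<Sum>YY \<le> \<Sum>W" "\<Sum>W = \<Sum>YY \<Longrightarrow> W = YY" if W: "W \<in> VS" "CW m XX W \<noteq> 0" for W
  proof -
    have f: "finite W" "card W = card XX" using VS_fin[OF W(1)] XX by auto
    note c = CW_nonzeroD(3)[OF XX(1) f W(2)]
    show "\<Sum>YY \<le> \<Sum>W" "\<Sum>W = \<Sum>YY \<Longrightarrow> W = YY"
      unfolding YY_def using core_minimal[OF m0 XX(1) f(1) c] by auto
  qed
  have Db: "(\<lambda>w. Dm W V (\<lambda>_. xt sh w) sc) \<in> O[F](\<lambda>_. 1 :: complex)" for W V sh
    by (rule Dm_bigo_1[where s = "\<lambda>_. sc"]) (use xb in auto)
  have MK: "(\<lambda>w. MM V sh w - Kc * Dm YY V (\<lambda>_. xt sh w) sc) \<in> O[F](ee)" for V sh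
  proof -
    let ?t = "\<lambda>w W. (if CW m XX W = 0 then 0 else ee w ^ (\<Sum>W - \<Sum>YY)) * CW m XX W * Dm W V (\<lambda>_. xt sh w) sc"
    have "MM V sh w - Kc * Dm YY V (\<lambda>_. xt sh w) sc = (\<Sum>W\<in>VS - {YY}. ?t w W)" for w
      unfolding MM_def using VS_facts(1) YY(3) Kc by (simp add: sum.remove[of VS YY] Kc_def)
    moreover have "(\<lambda>w. ?t w W) \<in> O[F](ee)" if W: "W \<in> VS - {YY}" for W
    proof (cases "CW m XX W = 0")
      case False
      then have "1 \<le> \<Sum>W - \<Sum>YY" using ge[of W] W by fastforce
      then have "(\<lambda>w. ee w ^ (\<Sum>W - \<Sum>YY)) \<in> O[F](\<lambda>w. ee w ^ 1)" by (rule bigo_power_le[OF eO])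
      then show ?thesis using False by (simp only: if_False) (intro bigo_mult_1 Db; simp)
    qed simp
    ultimately show ?thesis by (simp only:) (intro big_sum_in_bigo)
  qed
  have Mb: "(\<lambda>w. MM V sh w) \<in> O[F](\<lambda>_. 1 :: complex)" for V sh
    by (rule bigo_1_of_diff[OF MK eO]) (intro bigo_1_mult Db, simp)
  define Q where "Q sh w = (\<Sum>V\<in>VS. of_real hh ^ (\<Sum>V) * (MM V sh w * cnj (MM V (\<lambda>r. - sh r) w)))" for sh w
  have QT: "(\<lambda>w. Q sh w - Kc * cnj Kc * TY sh w) \<in> O[F](ee)" for sh
  proof -
    let ?D = "\<lambda>V sh w. Kc * Dm YY V (\<lambda>_. xt sh w) sc"
    have "Q sh w - Kc * cnj Kc * TY sh w = (\<Sum>V\<in>VS. of_real hh ^ (\<Sum>V) *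
        ((MM V sh w - ?D V sh w) * cnj (MM V (\<lambda>r. - sh r) w) + ?D V sh w * cnj (MM V (\<lambda>r. - sh r) w - ?D V (\<lambda>r. - sh r) w)))" for w
      unfolding Q_def TY_expand sum_distrib_left sum_subtractf[symmetric]
      by (intro sum.cong refl) (simp add: algebra_simps)
    moreover have "(\<lambda>w. \<Sum>V\<in>VS. of_real hh ^ (\<Sum>V) *
        ((MM V sh w - ?D V sh w) * cnj (MM V (\<lambda>r. - sh r) w) + ?D V sh w * cnj (MM V (\<lambda>r. - sh r) w - ?D V (\<lambda>r. - sh r) w))) \<in> O[F](ee)"
      by (intro big_sum_in_bigo bigo_1_mult sum_in_bigo bigo_mult_1 iffD2[OF bigo_cnj] MK Mb Db) auto
    ultimately show ?thesis by (simp only:)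
  qed
  have TYb: "TY sh \<in> O[F](\<lambda>_. 1 :: complex)" for sh
    unfolding TY_expand[abs_def]
    by (intro big_sum_in_bigo bigo_mult_1 bigo_1_mult iffD2[OF bigo_cnj] Db) auto
  have KTb: "(\<lambda>w. Kc * cnj Kc * TY sh w) \<in> O[F](\<lambda>_. 1 :: complex)" for sh
    by (intro bigo_1_mult TYb) auto
  have R: "(\<lambda>w. Q sh w / Q (\<lambda>_. 0) w - (Kc * cnj Kc * TY sh w) / (Kc * cnj Kc * TY (\<lambda>_. 0) w)) \<in> O[F](ee)"
  proof (rule ratio_perturb[OF e0 QT QT KTb _ _ KTb])
    show "0 < (cmod Kc)\<^sup>2 * hh ^ (\<Sum>YY)" using Kc hh_pos by simp
    show "\<forall>\<^sub>F w in F. (cmod Kc)\<^sup>2 * hh ^ (\<Sum>YY) \<le> cmod (Kc * cnj Kc * TY (\<lambda>_. 0) w)"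
      using TY_lower by (intro always_eventually) (auto simp: norm_mult power2_eq_square intro!: mult_left_mono)
  qed
  have QTT: "TT sh w * of_real ((cmod (ee w)) ^ (2 * \<Sum>XX)) = of_real ((cmod (ee w)) ^ (2 * \<Sum>YY)) * Q sh w"
    if nz: "ee w \<noteq> 0" for sh w
  proof -
    have ab: "of_real ((cmod (ee w)) ^ (2 * i)) = ee w ^ i * cnj (ee w ^ i)" for i
    proof -
      have "of_real ((cmod (ee w)) ^ (2 * i)) = (of_real ((cmod (ee w))\<^sup>2) :: complex) ^ i"
        by (simp add: power_mult)
      also have "\<dots> = (ee w * cnj (ee w)) ^ i" by (simp only: complex_norm_square)
      finally show ?thesis by (simp add: power_mult_distrib)
    qed
    define b where "b = rt (fst w m)"
    have b: "b ^ m = fst w m" "b \<noteq> 0" "ee w = 1 / b" using rt nz by (auto simp: b_def ee_def)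
    have D: "Dm XX V (\<lambda>_ r. bs w r + sh r) sc * ee w ^ (\<Sum>XX) = ee w ^ (\<Sum>YY) * MM V sh w" for V sh
    proof -
      have "(\<lambda>r. bs w r + sh r) = (\<lambda>r. xt sh w r + (if r = m then fst w m else 0))"
        by (auto simp: xt_def)
      then have "Dm XX V (\<lambda>_ r. bs w r + sh r) sc =
          (\<Sum>W\<in>VS. b ^ (\<Sum>XX) / b ^ (\<Sum>W) * CW m XX W * Dm W V (\<lambda>_. xt sh w) sc)"
        using Dm_remove_entry[OF m0 XX(3) b(1,2), of V "xt sh w" sc] XX(2) by (simp add: VS_def)
      then have "Dm XX V (\<lambda>_ r. bs w r + sh r) sc * ee w ^ (\<Sum>XX) =
          (\<Sum>W\<in>VS. b ^ (\<Sum>XX) / b ^ (\<Sum>W) * CW m XX W * Dm W V (\<lambda>_. xt sh w) sc * (1 / b) ^ (\<Sum>XX))"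
        unfolding b(3) by (simp only: sum_distrib_right)
      also have "\<dots> = (\<Sum>W\<in>VS. ee w ^ (\<Sum>W) * CW m XX W * Dm W V (\<lambda>_. xt sh w) sc)"
        unfolding b(3) by (intro sum.cong refl) (use b(2) in \<open>simp add: power_divide\<close>)
      also have "(\<Sum>W\<in>VS. ee w ^ (\<Sum>W) * CW m XX W * Dm W V (\<lambda>_. xt sh w) sc) = ee w ^ (\<Sum>YY) * MM V sh w"
        unfolding MM_def sum_distrib_left
      proof (rule sum.cong[OF refl])
        fix W assume W: "W \<in> VS"
        show "ee w ^ (\<Sum>W) * CW m XX W * Dm W V (\<lambda>_. xt sh w) sc = ee w ^ (\<Sum>YY) *
          ((if CW m XX W = 0 then 0 else ee w ^ (\<Sum>W - \<Sum>YY)) * CW m XX W * Dm W V (\<lambda>_. xt sh w) sc)"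
        proof (cases "CW m XX W = 0")
          case False
          then have "ee w ^ (\<Sum>W) = ee w ^ (\<Sum>YY) * ee w ^ (\<Sum>W - \<Sum>YY)"
            using ge(1)[OF W] by (simp flip: power_add)
          then show ?thesis using False by (simp only: if_False mult.assoc)
        qed simp
      qed
      finally show ?thesis .
    qed
    have "TT sh w = (\<Sum>V\<in>VS. of_real hh ^ (\<Sum>V) * Dm XX V (\<lambda>_ r. bs w r + sh r) sc *
        cnj (Dm XX V (\<lambda>_ r. bs w r + - sh r) sc))"
      unfolding TT_def tauS_expand[OF XX(3)] Dm_cnj[symmetric] XX(2) VS_def by simp
    then have "TT sh w * of_real ((cmod (ee w)) ^ (2 * \<Sum>XX)) =
        (\<Sum>V\<in>VS. of_real hh ^ (\<Sum>V) * (Dm XX V (\<lambda>_ r. bs w r + sh r) sc * ee w ^ (\<Sum>XX)) *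
        cnj (Dm XX V (\<lambda>_ r. bs w r + - sh r) sc * ee w ^ (\<Sum>XX)))"
      unfolding ab by (simp only: sum_distrib_right complex_cnj_mult) (simp only: mult_ac)
    also have "\<dots> = of_real ((cmod (ee w)) ^ (2 * \<Sum>YY)) * Q sh w"
      unfolding ab unfolding Q_def D sum_distrib_left by (intro sum.cong refl) (simp only: complex_cnj_mult mult_ac)
    finally show ?thesis .
  qed
  have "\<forall>\<^sub>F w in F. TT sh w / TT (\<lambda>_. 0) w - TY sh w / TY (\<lambda>_. 0) w =
      Q sh w / Q (\<lambda>_. 0) w - (Kc * cnj Kc * TY sh w) / (Kc * cnj Kc * TY (\<lambda>_. 0) w)"
    using enz
  proof eventually_elim
    case (elim w)
    let ?a = "complex_of_real ((cmod (ee w)) ^ (2 * \<Sum>XX))" and ?b = "complex_of_real ((cmod (ee w)) ^ (2 * \<Sum>YY))"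
    have a: "?a \<noteq> 0" "?b \<noteq> 0" using elim by simp_all
    have "TT sh w / TT (\<lambda>_. 0) w = (TT sh w * ?a) / (TT (\<lambda>_. 0) w * ?a)"
      by (rule mult_divide_mult_cancel_right[OF a(1), symmetric])
    also have "\<dots> = (?b * Q sh w) / (?b * Q (\<lambda>_. 0) w)" by (simp only: QTT[OF elim])
    also have "\<dots> = Q sh w / Q (\<lambda>_. 0) w" by (rule mult_divide_mult_cancel_left[OF a(2)])
    finally show ?case using Kc by simp
  qed
  then show ?thesis by (rule bigo_eventually_eq[OF R])
qed

end

section \<open>Positions of the fundamental waves and the inner region\<close>

lemma abs_le_sqrt_sum:
  fixes x y R :: real
  assumes "x\<^sup>2 + y\<^sup>2 \<le> R"
  shows "\<bar>x\<bar> \<le> sqrt R" "\<bar>y\<bar> \<le> sqrt R"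
proof -
  have "x\<^sup>2 \<le> R" "y\<^sup>2 \<le> R" using assms zero_le_power2[of x] zero_le_power2[of y] by linarith+
  then have "sqrt (x\<^sup>2) \<le> sqrt R" "sqrt (y\<^sup>2) \<le> sqrt R" by (simp_all only: real_sqrt_le_mono)
  then show "\<bar>x\<bar> \<le> sqrt R" "\<bar>y\<bar> \<le> sqrt R" by simp_all
qed

lemma sum_nat_real: "(\<Sum>i<n. real i) = real n * (real n - 1) / 2"
  by (induction n) (simp_all add: field_simps)

lemma square_sum_pairs:
  fixes f :: "nat \<Rightarrow> real"
  shows "(\<Sum>i=1..n. f i)\<^sup>2 = (\<Sum>i=1..n. (f i)\<^sup>2) + 2 * (\<Sum>j=1..n. \<Sum>i=1..<j. f i * f j)"
proof (induction n)
  case (Suc n)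
  have "(\<Sum>i=1..<Suc n. f i * f (Suc n)) = (\<Sum>i=1..n. f i) * f (Suc n)"
    by (simp add: sum_distrib_right atLeastLessThanSuc_atLeastAtMost)
  then show ?case using Suc by (simp add: power2_sum algebra_simps)
qed simp

lemma sum_Xset:
  fixes f :: "nat \<Rightarrow> real"
  shows "(\<Sum>n\<in>Xset M Nv. f n) = (\<Sum>I=1..M. \<Sum>i<Nv I. f ((M + 1) * i + I))"
proof -
  have "(\<Sum>I=1..M. \<Sum>i<Nv I. f ((M + 1) * i + I)) = (\<Sum>(I, i)\<in>(SIGMA I:{1..M}. {..<Nv I}). f ((M + 1) * i + I))"
    by (rule sum.Sigma) auto
  also have "\<dots> = (\<Sum>n\<in>Xset M Nv. f n)"
  proof (rule sum.reindex_bij_witness[where i = "\<lambda>n. (n mod (M + 1), n div (M + 1))" and j = "\<lambda>(I, i). (M + 1) * i + I"])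
    fix a assume a: "a \<in> (SIGMA I:{1..M}. {..<Nv I})"
    obtain I i where Ii: "a = (I, i)" "1 \<le> I" "I \<le> M" "i < Nv I" using a by auto
    note r = row_mod_div[OF Ii(3), of i]
    show "(case a of (I, i) \<Rightarrow> (M + 1) * i + I) \<in> Xset M Nv" unfolding Xset_def Ii(1) using r Ii by simp
    show "(((case a of (I, i) \<Rightarrow> (M + 1) * i + I)) mod (M + 1), ((case a of (I, i) \<Rightarrow> (M + 1) * i + I)) div (M + 1)) = a"
      unfolding Ii(1) using r by simp
    show "f (case a of (I, i) \<Rightarrow> (M + 1) * i + I) = (case a of (I, i) \<Rightarrow> f ((M + 1) * i + I))"
      unfolding Ii(1) by simp
  next
    fix n assume n: "n \<in> Xset M Nv"
    have "(M + 1) * (n div (M + 1)) + n mod (M + 1) = n" by (rule mult_div_mod_eq)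
    then show "(case (n mod (M + 1), n div (M + 1)) of (I, i) \<Rightarrow> (M + 1) * i + I) = n" by (simp only: prod.case)
    show "(n mod (M + 1), n div (M + 1)) \<in> (SIGMA I:{1..M}. {..<Nv I})" using n unfolding Xset_def by simp
  qed
  finally show ?thesis ..
qed

locale mk_simple = mk_wave +
  assumes simple: "\<forall>z. z \<noteq> 0 \<and> W_poly m (M + 1) l N z = 0 \<longrightarrow> deriv (W_poly m (M + 1) l N) z \<noteq> 0"

context mk_wave
begin

text \<open>A linear bijection from the real plane onto the complex numbers, since
  \<open>Im (p0\<^sup>2) \<noteq> 0\<close>, with inverse \<open>pos_x\<close> and
  \<open>pos_t\<close>. Multiplied by \<open>ee\<close>, it turns locations into arguments of
  \<open>W\<close>.\<close>

definition "Lf x t = p1 p * of_real x + 3 * p0\<^sup>2 * p1 p * of_real t" for x t :: real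

lemma Im_p0_sq: "Im (p0\<^sup>2) \<noteq> 0"
proof -
  have "Im (p0\<^sup>2) = 2 * Re p0 * Im p0" by (simp add: power2_eq_square)
  then show ?thesis using Re_p0 Im_p0 by simp
qed

lemma pos_formula:
  "pos_x p u = Re (u / p1 p) - Re (p0\<^sup>2) * Im (u / p1 p) / Im (p0\<^sup>2)"
  "pos_t p u = Im (u / p1 p) / (3 * Im (p0\<^sup>2))"
proof -
  define w q where "w = u / p1 p" and "q = p0\<^sup>2"
  have q: "Im q \<noteq> 0" using Im_p0_sq by (simp add: q_def)
  have 1: "\<i> * cnj q / p1 p * u = \<i> * (cnj q * w)" "1 / p1 p * u = w" by (simp_all add: w_def)
  have "pos_x p u = 1 / Im q * Re (\<i> * (cnj q * w))" unfolding pos_x_def p_0 q_def[symmetric] 1 ..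
  also have "\<dots> = Re w - Re q * Im w / Im q" using q by (simp add: field_simps)
  finally show "pos_x p u = Re (u / p1 p) - Re (p0\<^sup>2) * Im (u / p1 p) / Im (p0\<^sup>2)"
    unfolding w_def q_def .
  have "pos_t p u = 1 / (3 * Im q) * Im w" unfolding pos_t_def p_0 q_def[symmetric] 1 ..
  then show "pos_t p u = Im (u / p1 p) / (3 * Im (p0\<^sup>2))" unfolding w_def q_def by simp
qed

lemma Lf_pos: "Lf (pos_x p u) (pos_t p u) = u"
proof -
  define w q where "w = u / p1 p" and "q = p0\<^sup>2"
  have q: "Im q \<noteq> 0" using Im_p0_sq by (simp add: q_def)
  have x: "pos_x p u = Re w - Re q * Im w / Im q" and t: "pos_t p u = Im w / (3 * Im q)"
    unfolding w_def q_def by (rule pos_formula)+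
  have "complex_of_real (pos_x p u) + 3 * q * of_real (pos_t p u) = w"
    unfolding x t by (rule complex_eqI) (use q in \<open>simp_all add: field_simps\<close>)
  then have "p1 p * (complex_of_real (pos_x p u) + 3 * q * of_real (pos_t p u)) = u"
    using p1_nonzero by (simp add: w_def)
  then show ?thesis unfolding Lf_def q_def[symmetric] by (simp add: algebra_simps)
qed

lemma pos_Lf: "pos_x p (Lf x t) = x" "pos_t p (Lf x t) = t"
proof -
  have w: "Lf x t / p1 p = of_real x + 3 * p0\<^sup>2 * of_real t"
    using p1_nonzero by (simp add: Lf_def add_divide_distrib)
  have "Re (of_real x + 3 * p0\<^sup>2 * complex_of_real t) = x + 3 * Re (p0\<^sup>2) * t"
    "Im (of_real x + 3 * p0\<^sup>2 * complex_of_real t) = 3 * Im (p0\<^sup>2) * t"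
    by simp_all
  then show "pos_x p (Lf x t) = x" "pos_t p (Lf x t) = t"
    unfolding pos_formula w using Im_p0_sq by (simp_all del: Re_power2 Im_power2)
qed

lemma pos_diff: "pos_x p (u - u') = pos_x p u - pos_x p u'" "pos_t p (u - u') = pos_t p u - pos_t p u'"
  by (simp_all add: pos_x_def pos_t_def ring_distribs)

lemma Lf_diff: "Lf (x - x') (t - t') = Lf x t - Lf x' t'"
  by (simp add: Lf_def algebra_simps)

lemma pos_bound: "\<exists>C>0. \<forall>u. \<bar>pos_x p u\<bar> \<le> C * cmod u \<and> \<bar>pos_t p u\<bar> \<le> C * cmod u"
proof -
  define a1 a2 where "a1 = \<bar>1 / Im (p0\<^sup>2)\<bar> * cmod (\<i> * cnj (p0\<^sup>2) / p1 p)"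
    and "a2 = \<bar>1 / (3 * Im (p0\<^sup>2))\<bar> * cmod (1 / p1 p)"
  have a: "a1 \<ge> 0" "a2 \<ge> 0" unfolding a1_def a2_def by (intro mult_nonneg_nonneg abs_ge_zero norm_ge_zero)+
  have x: "\<bar>pos_x p u\<bar> \<le> a1 * cmod u" for u
    unfolding pos_x_def p_0 a1_def abs_mult mult.assoc norm_mult[symmetric]
    by (intro mult_left_mono abs_Re_le_cmod abs_ge_zero)
  have t: "\<bar>pos_t p u\<bar> \<le> a2 * cmod u" for u
    unfolding pos_t_def p_0 a2_def abs_mult mult.assoc norm_mult[symmetric]
    by (intro mult_left_mono abs_Im_le_cmod abs_ge_zero)
  have mono: "a1 * cmod u \<le> (a1 + a2 + 1) * cmod u" "a2 * cmod u \<le> (a1 + a2 + 1) * cmod u" for u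
    using a by (auto intro: mult_right_mono)
  show ?thesis
    by (intro exI[of _ "a1 + a2 + 1"] conjI allI order.trans[OF x mono(1)] order.trans[OF t mono(2)]) (use a in simp)
qed

lemma Lf_lower: "\<exists>\<kappa>>0. \<forall>x t. \<kappa> * sqrt (x\<^sup>2 + t\<^sup>2) \<le> cmod (Lf x t)"
proof -
  obtain C where C: "C > 0" "\<And>u. \<bar>pos_x p u\<bar> \<le> C * cmod u" "\<And>u. \<bar>pos_t p u\<bar> \<le> C * cmod u"
    using pos_bound by blast
  have "1 / (2 * C) * sqrt (x\<^sup>2 + t\<^sup>2) \<le> cmod (Lf x t)" for x t
  proof -
    have "sqrt (x\<^sup>2 + t\<^sup>2) \<le> \<bar>x\<bar> + \<bar>t\<bar>" by (rule sqrt_sum_squares_le_sum_abs)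
    also have "\<dots> \<le> 2 * C * cmod (Lf x t)" using C(2)[of "Lf x t"] C(3)[of "Lf x t"] unfolding pos_Lf by linarith
    finally show ?thesis using C(1) by (simp add: field_simps)
  qed
  then show ?thesis using C(1) by (intro exI[of _ "1 / (2 * C)"]) simp
qed

lemma Lf_upper: "cmod (Lf x t) \<le> cmod (p1 p) * \<bar>x\<bar> + cmod (3 * p0\<^sup>2 * p1 p) * \<bar>t\<bar>"
  unfolding Lf_def by (rule order.trans[OF norm_triangle_ineq]) (simp add: norm_mult)

lemma leading_loc_eq: "leading_loc p z0 b = (pos_x p (z0 * b), pos_t p (z0 * b))"
proof -
  have L: "p1 p * of_real x + 3 * (p 0)\<^sup>2 * p1 p * of_real t = Lf x t" for x t by (simp add: Lf_def p_0)
  show ?thesis unfolding leading_loc_def L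
  proof (rule the_equality)
    show "case (pos_x p (z0 * b), pos_t p (z0 * b)) of (xs, ts) \<Rightarrow> Lf xs ts = z0 * b" by (simp add: Lf_pos)
    fix y :: "real \<times> real" assume "case y of (xs, ts) \<Rightarrow> Lf xs ts = z0 * b"
    then have "Lf (fst y) (snd y) = z0 * b" by (simp add: case_prod_beta)
    then show "y = (pos_x p (z0 * b), pos_t p (z0 * b))" using pos_Lf[of "fst y" "snd y"] by (simp add: prod_eq_iff)
  qed
qed

definition "X2c z0 b = (alpha p 2 * of_real (pos_x p (z0 * b)) + beta p 2 * of_real (pos_t p (z0 * b))) / b"

lemma Delta_eq: "Delta p M m l N z0 b = X2c z0 b * (W_tilde m (M + 1) l N z0 / deriv (W_poly m (M + 1) l N) z0)"
  unfolding Delta_def leading_loc_eq X2c_def Let_def prod.case alpha_beta p_0 ..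

lemma X2c_bound: "\<exists>D. \<forall>b. cmod (X2c z0 b) \<le> D"
proof -
  obtain C where C: "C > 0" "\<And>u. \<bar>pos_x p u\<bar> \<le> C * cmod u" "\<And>u. \<bar>pos_t p u\<bar> \<le> C * cmod u"
    using pos_bound by blast
  define D where "D = (cmod (alpha p 2) + cmod (beta p 2)) * C * cmod z0"
  have "cmod (X2c z0 b) \<le> D" for b
  proof (cases "b = 0")
    \<comment> \<open>Division by 0 gives 0, so the bound also covers \<open>b = 0\<close>.\<close>
    case True
    have "0 \<le> D" unfolding D_def using C(1) by (intro mult_nonneg_nonneg add_nonneg_nonneg) auto
    then show ?thesis by (simp add: X2c_def True)
  next
    case False
    have "cmod (alpha p 2 * of_real (pos_x p (z0 * b)) + beta p 2 * of_real (pos_t p (z0 * b)))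
        \<le> cmod (alpha p 2) * \<bar>pos_x p (z0 * b)\<bar> + cmod (beta p 2) * \<bar>pos_t p (z0 * b)\<bar>"
      by (rule order.trans[OF norm_triangle_ineq]) (simp add: norm_mult)
    also have "\<dots> \<le> cmod (alpha p 2) * (C * cmod (z0 * b)) + cmod (beta p 2) * (C * cmod (z0 * b))"
      by (intro add_mono mult_left_mono C norm_ge_zero)
    also have "\<dots> = D * cmod b" by (simp add: D_def norm_mult algebra_simps)
    finally show ?thesis using False by (simp add: X2c_def norm_divide pos_divide_le_eq)
  qed
  then show ?thesis by blast
qed

lemma Delta_bound: "\<exists>D. \<forall>b. cmod (Delta p M m l N z0 b) \<le> D"
proof -
  obtain D where D: "\<And>b. cmod (X2c z0 b) \<le> D" using X2c_bound by blast
  show ?thesis unfolding Delta_eq norm_mult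
    by (intro exI[of _ "D * cmod (W_tilde m (M + 1) l N z0 / deriv (W_poly m (M + 1) l N) z0)"] allI
        mult_right_mono D norm_ge_zero)
qed

lemma Delta_bounded: "\<exists>D. \<forall>w. w \<noteq> 0 \<longrightarrow> cmod (Delta p M m l N z0 (rt w)) \<le> D"
  using Delta_bound by blast

lemma norm_rt_power: "cmod (rt z) ^ m = cmod z"
  using rt by (metis norm_power)

lemma norm_rt: "cmod (rt z) = cmod z powr (1 / m)"
proof (cases "z = 0")
  case True
  then have "rt z = 0" using norm_rt_power[of z] m by simp
  then show ?thesis using True by simp
next
  case False
  then have "rt z \<noteq> 0" using norm_rt_power[of z] m by (auto simp: power_0_left)
  then have "cmod (rt z) > 0" by simp
  then have "(cmod (rt z) ^ m) powr (1 / m) = cmod (rt z)"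
    using m by (simp add: powr_realpow[symmetric] powr_powr)
  then show ?thesis unfolding norm_rt_power ..
qed

lemma norm_ee: "cmod (ee w) = cmod (fst w m) powr (- 1 / m)"
proof -
  have "cmod (fst w m) powr (- 1 / m) = 1 / cmod (fst w m) powr (1 / m)"
    by (simp add: powr_minus_divide[symmetric])
  then show ?thesis by (simp add: ee_def norm_divide norm_rt)
qed

lemma rt_ge:
  assumes "0 \<le> A" "A ^ m \<le> cmod z"
  shows "A \<le> cmod (rt z)"
proof (rule ccontr)
  assume "\<not> A \<le> cmod (rt z)"
  then have "cmod (rt z) ^ m < A ^ m" using m by (intro power_strict_mono) auto
  then show False using assms norm_rt_power[of z] by simp
qed

lemma ee_regime:
  assumes anti: "\<And>A B. 0 < A \<Longrightarrow> A \<le> B \<Longrightarrow> S B \<subseteq> S A"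
    and large: "\<And>A w. w \<in> S A \<Longrightarrow> large_param m B A (fst w)"
  shows "(ee \<longlongrightarrow> 0) (regime S)" "\<forall>\<^sub>F w in regime S. ee w \<noteq> 0"
    "\<And>r. 1 \<le> r \<Longrightarrow> r \<noteq> m \<Longrightarrow> (\<lambda>w. fst w r) \<in> O[regime S](\<lambda>_. 1 :: complex)"
proof -
  have ev: "eventually P (regime S) \<longleftrightarrow> (\<exists>A>0. \<forall>w\<in>S A. P w)" for P
    by (rule eventually_regime) (rule anti)
  show "(ee \<longlongrightarrow> 0) (regime S)"
  proof (rule tendstoI)
    fix e :: real assume e: "0 < e"
    show "\<forall>\<^sub>F w in regime S. dist (ee w) 0 < e"
    proof (rule ev[THEN iffD2], intro exI[of _ "(2 / e) ^ m"] conjI ballI)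
      show "0 < (2 / e) ^ m" using e by simp
      fix w assume "w \<in> S ((2 / e) ^ m)"
      then have "(2 / e) ^ m \<le> cmod (fst w m)" using large unfolding large_param_def by blast
      then have 1: "2 / e \<le> cmod (rt (fst w m))" using e by (intro rt_ge) auto
      have "0 < 2 / e" using e by simp
      then have "0 < cmod (rt (fst w m))" using 1 by linarith
      then show "dist (ee w) 0 < e" using 1 e by (simp add: ee_def norm_divide field_simps)
    qed
  qed
  show "\<forall>\<^sub>F w in regime S. ee w \<noteq> 0"
  proof (rule ev[THEN iffD2], intro exI[of _ 1] conjI ballI)
    fix w assume "w \<in> S 1"
    then have "1 ^ m \<le> cmod (fst w m)" using large unfolding large_param_def by simp
    then have "1 \<le> cmod (rt (fst w m))" by (intro rt_ge) auto
    then show "ee w \<noteq> 0" by (auto simp: ee_def)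
  qed simp_all
  fix r :: nat assume r: "1 \<le> r" "r \<noteq> m"
  show "(\<lambda>w. fst w r) \<in> O[regime S](\<lambda>_. 1 :: complex)"
  proof (rule bigoI[where c = B], rule ev[THEN iffD2], intro exI[of _ 1] conjI ballI)
    fix w assume "w \<in> S 1"
    then show "cmod (fst w r) \<le> B * cmod 1" using large r unfolding large_param_def by simp
  qed simp_all
qed

lemma large_rt: "large_param m B 1 (fst w) \<Longrightarrow> 1 \<le> cmod (rt (fst w m))"
  using rt_ge[of 1 "fst w m"] by (simp add: large_param_def)

lemma good_regime:
  assumes anti: "\<And>A B. 0 < A \<Longrightarrow> A \<le> B \<Longrightarrow> S B \<subseteq> S A"
    and large: "\<And>A w. w \<in> S A \<Longrightarrow> large_param m B A (fst w)"
    and bound: "\<And>w. w \<in> S 1 \<Longrightarrow> \<bar>fst (snd w)\<bar> \<le> D * cmod (rt (fst w m)) \<and> \<bar>snd (snd w)\<bar> \<le> D * cmod (rt (fst w m))"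
  shows "good (regime S)"
proof -
  have ev: "eventually P (regime S) \<longleftrightarrow> (\<exists>A>0. \<forall>w\<in>S A. P w)" for P
    by (rule eventually_regime) (rule anti)
  have b: "\<bar>y\<bar> \<le> D * cmod (rt (fst w m)) \<Longrightarrow> cmod (of_real y * ee w) \<le> D * cmod 1" if "w \<in> S 1" for w and y :: real
  proof -
    assume y: "\<bar>y\<bar> \<le> D * cmod (rt (fst w m))"
    have "0 < cmod (rt (fst w m))" using large_rt[OF large[OF that]] by linarith
    then show ?thesis using y by (simp add: ee_def norm_mult norm_divide pos_divide_le_eq)
  qed
  have 1: "(\<lambda>w. of_real (fst (snd w)) * ee w) \<in> O[regime S](\<lambda>_. 1 :: complex)"
    by (rule bigoI[where c = D], rule ev[THEN iffD2], intro exI[of _ 1] conjI ballI b)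
       (use bound in simp_all)
  have 2: "(\<lambda>w. of_real (snd (snd w)) * ee w) \<in> O[regime S](\<lambda>_. 1 :: complex)"
    by (rule bigoI[where c = D], rule ev[THEN iffD2], intro exI[of _ 1] conjI ballI b)
       (use bound in simp_all)
  show ?thesis unfolding good_def using ee_regime[of S, OF anti large] 1 2 by blast
qed

lemma norm_plane_wave: "cmod (plane_wave M k c \<rho> n x t) = \<bar>\<rho> n\<bar>"
  unfolding plane_wave_def norm_mult norm_exp_i_times by simp

lemma zsh_Lf: "zsh (\<lambda>_. 0) w 1 = ee w * (Lf (fst (snd w)) (snd (snd w)) + fst w 1)"
  unfolding zsh_1 XL_def alpha_beta Lf_def by (simp add: algebra_simps)

lemma fundamental_wave_eq:
  fixes x t x0 t0 :: real
  defines "\<eta> \<equiv> Lf (x - x0) (t - t0)"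
  shows "fundamental_wave M k c \<rho> p x0 t0 n x t = plane_wave M k c \<rho> n x t *
    (((\<eta> + theta k p 1 n) * cnj (\<eta> - theta k p 1 n) + of_real hh) / (\<eta> * cnj \<eta> + of_real hh))"
proof -
  have 1: "p1 p * of_real (x - x0) + 3 * (p 0)\<^sup>2 * p1 p * of_real (t - t0) = \<eta>"
    by (simp only: \<eta>_def Lf_def p_0)
  have 2: "cnj (p1 p) * of_real (x - x0) + 3 * cnj ((p 0)\<^sup>2) * cnj (p1 p) * of_real (t - t0) - cnj (theta k p 1 n) = cnj (\<eta> - theta k p 1 n)"
    unfolding 1[symmetric] by simp
  have 3: "complex_of_real ((cmod \<eta>)\<^sup>2 + hh) = \<eta> * cnj \<eta> + of_real hh"
    using complex_norm_square[of \<eta>] by simp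
  show ?thesis unfolding fundamental_wave_def 1 2 hh_h0 3 ..
qed

lemma near_region:
  assumes z0: "z0 \<noteq> 0" "WW z0 = 0" "deriv WW z0 \<noteq> 0" and n: "n \<in> {1..M}" and B: "B > 0" and R: "R > 0"
  shows "\<exists>C>0. \<exists>A>0. \<forall>a x t. large_param m B A a \<and>
      (x - pos_x p (wave_centre p M m l N z0 (rt (a m)) (a 1)))\<^sup>2 + (t - pos_t p (wave_centre p M m l N z0 (rt (a m)) (a 1)))\<^sup>2 \<le> R \<longrightarrow>
      cmod (rogue_wave_type M k c \<rho> p l N a n x t -
        fundamental_wave M k c \<rho> p (pos_x p (wave_centre p M m l N z0 (rt (a m)) (a 1)))
          (pos_t p (wave_centre p M m l N z0 (rt (a m)) (a 1))) n x t)
      \<le> C * cmod (a m) powr (- 1 / m)"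
proof -
  define b where "b w = rt (fst w m)" for w :: "(nat \<Rightarrow> complex) \<times> real \<times> real"
  define wc where "wc w = wave_centre p M m l N z0 (b w) (fst w 1)" for w :: "(nat \<Rightarrow> complex) \<times> real \<times> real"
  define \<xi> where "\<xi> w = fst (snd w) - pos_x p (wc w)" for w
  define \<tau> where "\<tau> w = snd (snd w) - pos_t p (wc w)" for w
  define S where "S A = {w. large_param m B A (fst w) \<and> (\<xi> w)\<^sup>2 + (\<tau> w)\<^sup>2 \<le> R}" for A
  define \<Delta> where "\<Delta> w = Delta p M m l N z0 (b w)" for w
  define \<eta> where "\<eta> w = Lf (\<xi> w) (\<tau> w)" for w
  have anti: "S B' \<subseteq> S A'" if "0 < A'" "A' \<le> B'" for A' B'
    using that by (auto simp: S_def large_param_def)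
  have large: "large_param m B A (fst w)" if "w \<in> S A" for A w using that by (simp add: S_def)
  have ev: "eventually P (regime S) \<longleftrightarrow> (\<exists>A>0. \<forall>w\<in>S A. P w)" for P
    by (rule eventually_regime) (rule anti)
  obtain D0 where D0: "\<And>b. cmod (Delta p M m l N z0 b) \<le> D0" using Delta_bound by blast
  have D0p: "0 \<le> D0" using D0[of 0] norm_ge_zero order.trans by blast
  obtain C1 where C1: "C1 > 0" "\<And>u. \<bar>pos_x p u\<bar> \<le> C1 * cmod u" "\<And>u. \<bar>pos_t p u\<bar> \<le> C1 * cmod u"
    using pos_bound by blast
  obtain X0 where X0: "\<And>b. cmod (X2c z0 b) \<le> X0" using X2c_bound by blast
  have S1: "1 \<le> cmod (b w)" "cmod (fst w 1) \<le> B" "\<bar>\<xi> w\<bar> \<le> sqrt R" "\<bar>\<tau> w\<bar> \<le> sqrt R" if w: "w \<in> S 1" for w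
  proof -
    show "1 \<le> cmod (b w)" unfolding b_def by (rule large_rt[OF large[OF w]])
    show "cmod (fst w 1) \<le> B" using large[OF w] m unfolding large_param_def by auto
    show "\<bar>\<xi> w\<bar> \<le> sqrt R" "\<bar>\<tau> w\<bar> \<le> sqrt R" using w abs_le_sqrt_sum[of "\<xi> w" "\<tau> w" R] by (simp_all add: S_def)
  qed
  \<comment> \<open>The coordinates differ from those of the centre by at most
    \<open>sqrt R\<close>, and the centre grows like \<open>z0 * b w\<close>. Since
    \<open>cmod (b w) \<ge> 1\<close> on \<open>S 1\<close>, bounded terms are absorbed into a
    multiple of \<open>cmod (b w)\<close>.\<close>
  define D where "D = sqrt R + C1 * (cmod z0 + D0 + B)"
  have good: "good (regime S)"
  proof (rule good_regime[of S B D])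
    fix w assume w: "w \<in> S 1"
    have "cmod (wc w) \<le> cmod (z0 * b w) + cmod (\<Delta> w) + cmod (fst w 1)"
      unfolding wc_def wave_centre_def \<Delta>_def
      using norm_triangle_ineq4[of "z0 * b w - Delta p M m l N z0 (b w)" "fst w 1"]
        norm_triangle_ineq4[of "z0 * b w" "Delta p M m l N z0 (b w)"] by linarith
    also have "\<dots> \<le> cmod z0 * cmod (b w) + D0 + B"
      using S1(2)[OF w] D0[of "b w"] by (simp add: norm_mult \<Delta>_def)
    finally have 1: "C1 * cmod (wc w) \<le> C1 * (cmod z0 * cmod (b w) + D0 + B)" using C1(1) by simp
    have "D0 + B \<le> (D0 + B) * cmod (b w)" "sqrt R \<le> sqrt R * cmod (b w)"
      using S1(1)[OF w] D0p B R by (simp_all add: mult_le_cancel_left1)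
    moreover from this have "C1 * (cmod z0 * cmod (b w) + D0 + B) \<le> C1 * (cmod z0 * cmod (b w) + (D0 + B) * cmod (b w))"
      using C1(1) by simp
    ultimately have "sqrt R + C1 * (cmod z0 * cmod (b w) + D0 + B) \<le> sqrt R * cmod (b w) + C1 * (cmod z0 * cmod (b w) + (D0 + B) * cmod (b w))"
      by linarith
    also have "\<dots> = D * cmod (b w)" by (simp add: D_def algebra_simps)
    finally have 2: "sqrt R + C1 * cmod (wc w) \<le> D * cmod (b w)" using 1 by linarith
    show "\<bar>fst (snd w)\<bar> \<le> D * cmod (rt (fst w m)) \<and> \<bar>snd (snd w)\<bar> \<le> D * cmod (rt (fst w m))"
      using 2 S1(3,4)[OF w] C1(2,3)[of "wc w"] unfolding \<xi>_def \<tau>_def b_def[symmetric] by linarith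
  qed (use anti large in blast)+
  note g = goodD[OF good]
  have Lw: "Lf (fst (snd w)) (snd (snd w)) = \<eta> w + wc w" for w
    unfolding \<eta>_def \<xi>_def \<tau>_def Lf_diff Lf_pos by simp
  \<comment> \<open>The translation by \<open>a 1\<close> in \<open>wave_centre\<close> cancels the
    parameter \<open>a 1\<close> in the first variable; what is left is the offset
    \<open>\<eta>\<close> from the centre and the correction \<open>\<Delta>\<close>.\<close>
  have u: "\<forall>\<^sub>F w in regime S. zsh (\<lambda>_. 0) w 1 = z0 + ee w * (\<eta> w - \<Delta> w)"
    using g(2)
  proof eventually_elim
    case (elim w)
    have "ee w * b w = 1" using elim by (simp add: ee_def b_def)
    then have "ee w * (z0 * b w) = z0" by simp
    then show ?case unfolding zsh_Lf Lw wc_def wave_centre_def \<Delta>_def by (simp add: algebra_simps)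
  qed
  have \<eta>b: "\<eta> \<in> O[regime S](\<lambda>_. 1 :: complex)"
  proof (rule bigoI[where c = "cmod (p1 p) * sqrt R + cmod (3 * p0\<^sup>2 * p1 p) * sqrt R"], rule ev[THEN iffD2], intro exI[of _ 1] conjI ballI)
    fix w assume w: "w \<in> S 1"
    have "cmod (p1 p) * \<bar>\<xi> w\<bar> + cmod (3 * p0\<^sup>2 * p1 p) * \<bar>\<tau> w\<bar> \<le> cmod (p1 p) * sqrt R + cmod (3 * p0\<^sup>2 * p1 p) * sqrt R"
      by (intro add_mono mult_left_mono S1[OF w] norm_ge_zero)
    then show "cmod (\<eta> w) \<le> (cmod (p1 p) * sqrt R + cmod (3 * p0\<^sup>2 * p1 p) * sqrt R) * cmod (1 :: complex)"
      using Lf_upper[of "\<xi> w" "\<tau> w"] unfolding \<eta>_def norm_one mult_1_right by linarith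
  qed simp_all
  have X2b: "(\<lambda>w. X2c z0 (b w)) \<in> O[regime S](\<lambda>_. 1 :: complex)"
    by (rule bigoI[where c = X0]) (use X0 in simp)
  have \<Delta>b: "\<Delta> \<in> O[regime S](\<lambda>_. 1 :: complex)"
    by (rule bigoI[where c = D0]) (use D0 in \<open>simp add: \<Delta>_def\<close>)
  \<comment> \<open>\<open>Delta\<close> uses the leading-order location, the second variable the
    actual one. They differ by a bounded amount, and the factor \<open>ee\<close> makes the
    difference small.\<close>
  have X2d: "(\<lambda>w. XL w 2 - X2c z0 (b w)) \<in> O[regime S](ee)"
  proof -
    define y where "y w = \<eta> w - \<Delta> w - fst w 1" for w
    have yb: "y \<in> O[regime S](\<lambda>_. 1 :: complex)"
      unfolding y_def[abs_def] by (intro sum_in_bigo \<eta>b \<Delta>b g(3)) (use m in auto)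
    have dx: "fst (snd w) - pos_x p (z0 * b w) = pos_x p (y w)" "snd (snd w) - pos_t p (z0 * b w) = pos_t p (y w)" for w
    proof -
      have "y w = Lf (fst (snd w)) (snd (snd w)) - z0 * b w"
        unfolding Lw y_def wc_def wave_centre_def \<Delta>_def by simp
      then show "fst (snd w) - pos_x p (z0 * b w) = pos_x p (y w)" "snd (snd w) - pos_t p (z0 * b w) = pos_t p (y w)"
        by (simp_all only: pos_diff pos_Lf)
    qed
    have "(\<lambda>w. complex_of_real (pos_x p (y w))) \<in> O[regime S](y)" "(\<lambda>w. complex_of_real (pos_t p (y w))) \<in> O[regime S](y)"
      by (rule bigoI[where c = C1], use C1 in simp)+
    note pb = landau_o.big_trans[OF this(1) yb] landau_o.big_trans[OF this(2) yb]
    have "(\<lambda>w. ee w * (alpha p 2 * of_real (pos_x p (y w)) + beta p 2 * of_real (pos_t p (y w)))) \<in> O[regime S](ee)"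
      by (intro bigo_mult_1 sum_in_bigo bigo_1_mult pb) simp_all
    moreover have "XL w 2 - X2c z0 (b w) = ee w * (alpha p 2 * of_real (pos_x p (y w)) + beta p 2 * of_real (pos_t p (y w)))" for w
    proof -
      have "X2c z0 (b w) = ee w * (alpha p 2 * of_real (pos_x p (z0 * b w)) + beta p 2 * of_real (pos_t p (z0 * b w)))"
        by (simp add: X2c_def ee_def b_def)
      then show ?thesis unfolding XL_def dx[symmetric] by (simp add: algebra_simps)
    qed
    ultimately show ?thesis by (simp only:)
  qed
  let ?sh = "\<lambda>r. theta k p r n"
  let ?G = "\<lambda>w. ((\<eta> w + ?sh 1) * cnj (\<eta> w - ?sh 1) + of_real hh) / (\<eta> w * cnj (\<eta> w) + of_real hh)"
  have "(\<lambda>w. TN ?sh w / TN (\<lambda>_. 0) w - ?G w) \<in> O[regime S](ee)"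
    by (rule near_ratio[OF good z0(2,3) u \<eta>b X2b X2d]) (simp add: \<Delta>_def Delta_eq)
  then obtain C where C: "C > 0" "\<forall>\<^sub>F w in regime S. cmod (TN ?sh w / TN (\<lambda>_. 0) w - ?G w) \<le> C * cmod (ee w)"
    by (rule landau_o.bigE)
  have "\<forall>\<^sub>F w in regime S. ee w \<noteq> 0 \<and> cmod (TN ?sh w / TN (\<lambda>_. 0) w - ?G w) \<le> C * cmod (ee w)"
    using eventually_conj[OF g(2) C(2)] .
  then obtain A where A: "A > 0" "\<forall>w\<in>S A. ee w \<noteq> 0 \<and> cmod (TN ?sh w / TN (\<lambda>_. 0) w - ?G w) \<le> C * cmod (ee w)"
    unfolding ev by blast
  have pos: "0 < \<bar>\<rho> n\<bar> * C + 1" using C(1) by (simp add: add_nonneg_pos)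
  show ?thesis
  proof (rule exI[of _ "\<bar>\<rho> n\<bar> * C + 1"], rule conjI, rule pos, rule exI[of _ A], intro conjI allI impI A(1))
    fix a :: "nat \<Rightarrow> complex" and x t :: real
    define w where "w = (a, x, t)"
    assume "large_param m B A a \<and>
      (x - pos_x p (wave_centre p M m l N z0 (rt (a m)) (a 1)))\<^sup>2 + (t - pos_t p (wave_centre p M m l N z0 (rt (a m)) (a 1)))\<^sup>2 \<le> R"
    then have "w \<in> S A" by (simp add: S_def \<xi>_def \<tau>_def wc_def b_def w_def)
    then have w: "ee w \<noteq> 0" "cmod (TN ?sh w / TN (\<lambda>_. 0) w - ?G w) \<le> C * cmod (ee w)" using A(2) by blast+
    have f: "fundamental_wave M k c \<rho> p (pos_x p (wave_centre p M m l N z0 (rt (a m)) (a 1)))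
          (pos_t p (wave_centre p M m l N z0 (rt (a m)) (a 1))) n x t = plane_wave M k c \<rho> n x t * ?G w"
      unfolding fundamental_wave_eq by (simp only: \<eta>_def \<xi>_def \<tau>_def wc_def b_def w_def fst_conv snd_conv)
    have "rogue_wave_type M k c \<rho> p l N a n x t = TN ?sh w / TN (\<lambda>_. 0) w * plane_wave M k c \<rho> n x t"
      unfolding v_ratio[OF n] w_def[symmetric] TT_ratio[OF w(1)] ..
    then have "cmod (rogue_wave_type M k c \<rho> p l N a n x t - plane_wave M k c \<rho> n x t * ?G w) =
        cmod (plane_wave M k c \<rho> n x t * (TN ?sh w / TN (\<lambda>_. 0) w - ?G w))"
      by (simp only: right_diff_distrib mult.commute)
    also have "\<dots> = \<bar>\<rho> n\<bar> * cmod (TN ?sh w / TN (\<lambda>_. 0) w - ?G w)" by (simp only: norm_mult norm_plane_wave)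
    also have "\<dots> \<le> \<bar>\<rho> n\<bar> * (C * cmod (ee w))" by (intro mult_left_mono w(2) abs_ge_zero)
    also have "\<dots> \<le> (\<bar>\<rho> n\<bar> * C + 1) * cmod (ee w)" by (simp add: algebra_simps)
    also have "cmod (ee w) = cmod (a m) powr (- 1 / m)" unfolding norm_ee by (simp add: w_def)
    finally show "cmod (rogue_wave_type M k c \<rho> p l N a n x t -
        fundamental_wave M k c \<rho> p (pos_x p (wave_centre p M m l N z0 (rt (a m)) (a 1)))
          (pos_t p (wave_centre p M m l N z0 (rt (a m)) (a 1))) n x t)
      \<le> (\<bar>\<rho> n\<bar> * C + 1) * cmod (a m) powr (- 1 / m)" unfolding f .
  qed
qed


lemma TT_sub_plane_wave:
  assumes "n \<in> {1..M}" "cmod (TT (\<lambda>r. theta k p r n) (a, x, t) / TT (\<lambda>_. 0) (a, x, t) - q) \<le> e" "\<bar>\<rho> n\<bar> * e \<le> \<epsilon>"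
  shows "cmod (rogue_wave_type M k c \<rho> p l N a n x t - q * plane_wave M k c \<rho> n x t) \<le> \<epsilon>"
proof -
  have "cmod (rogue_wave_type M k c \<rho> p l N a n x t - q * plane_wave M k c \<rho> n x t) =
      cmod (TT (\<lambda>r. theta k p r n) (a, x, t) / TT (\<lambda>_. 0) (a, x, t) - q) * \<bar>\<rho> n\<bar>"
    unfolding v_ratio[OF assms(1)] left_diff_distrib[symmetric] norm_mult norm_plane_wave ..
  also have "\<dots> \<le> e * \<bar>\<rho> n\<bar>" by (intro mult_right_mono assms(2) abs_ge_zero)
  finally show ?thesis using assms(3) by (simp add: mult.commute)
qed

section \<open>Root count and identification of the lower-order wave\<close>

lemma WW_PW: "W_poly m (M + 1) l N z = poly (PW m (M + 1) l N) z"
  using m by (intro poly_PW) auto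

lemma deriv_WW_PW: "deriv WW z = poly (pderiv (PW m (M + 1) l N)) z"
proof -
  have "WW = poly (PW m (M + 1) l N)" by (rule ext) (rule WW_PW)
  then show ?thesis by (simp only: DERIV_imp_deriv[OF poly_DERIV])
qed

lemma PW_facts:
  "degree (PW m (M + 1) l N) = \<Sum>XX - sigma0 N"
  "\<And>i. i < \<Sum>YY - sigma0 N \<Longrightarrow> coeff (PW m (M + 1) l N) i = 0"
  "coeff (PW m (M + 1) l N) (\<Sum>YY - sigma0 N) \<noteq> 0"
proof -
  have "m > 0" "M + 1 > 0" using m by simp_all
  note * = PW_order_degree[OF this, where l = l and N = N]
  show "degree (PW m (M + 1) l N) = \<Sum>XX - sigma0 N" unfolding XX_def by (rule *(1))
  show "\<And>i. i < \<Sum>YY - sigma0 N \<Longrightarrow> coeff (PW m (M + 1) l N) i = 0" unfolding YY_def XX_def by (rule *(2))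
  show "coeff (PW m (M + 1) l N) (\<Sum>YY - sigma0 N) \<noteq> 0" unfolding YY_def XX_def by (rule *(3))
qed

lemma Gam_eq: "Gam (M + 1) l N = real (\<Sum>XX) - real (sigma0 N)"
proof -
  have "inj_on (\<lambda>i. l + i * (M + 1)) {0..<N}"
  proof (rule inj_onI)
    fix x y assume "l + x * (M + 1) = l + y * (M + 1)"
    then have "x * (M + 1) = y * (M + 1)" by (simp only: add_left_cancel)
    then have "x = y \<or> M + 1 = 0" by (simp only: mult_cancel2)
    then show "x = y" by simp
  qed
  then have "\<Sum>XX = (\<Sum>i<N. l + i * (M + 1))"
    unfolding XX_def X0_def by (simp add: sum.reindex atLeast0LessThan)
  then have "real (\<Sum>XX) = (\<Sum>i<N. real l + real i * (real M + 1))" by (simp add: algebra_simps)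
  also have "\<dots> = real N * real l + real N * (real N - 1) / 2 * (real M + 1)"
    by (simp only: sum.distrib sum_distrib_right[symmetric] sum_nat_real) simp
  finally have 1: "real (\<Sum>XX) = real N * real l + real N * (real N - 1) / 2 * (real M + 1)" .
  have 2: "real (sigma0 N) = real N * (real N - 1) / 2"
    unfolding sigma0_def of_nat_sum sum_nat_real ..
  show ?thesis unfolding 1 2 Gam_def by (simp add: field_simps)
qed

definition "Nl I = nat (low_order M m l N I)"

lemma
  shows low_nonneg: "\<And>I. I \<in> {1..M} \<Longrightarrow> low_order M m l N I \<ge> 0"
    and YY_shift: "\<exists>j. {0..<j} \<subseteq> YY \<and> {n. n + j \<in> YY} = Xset M Nl"
proof -
  have "1 < M + 1" "0 < m" "l < M + 1" using M m l by auto
  from N_low_core[OF this(1,2) ndvd this(3), of N]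
  obtain j where j: "{0..<j} \<subseteq> YY" "{n. n + j \<in> YY} = SH (M + 1) (\<lambda>i. if i = 0 then 0 else N_low (int m) (int (M + 1)) (int l) (int N) i)"
    and pos: "\<And>i. 1 \<le> i \<Longrightarrow> i < int (M + 1) \<Longrightarrow> 0 \<le> N_low (int m) (int (M + 1)) (int l) (int N) i"
    unfolding normalises_def YY_def XX_def by blast
  show "low_order M m l N I \<ge> 0" if "I \<in> {1..M}" for I
    unfolding low_order_def by (rule pos) (use that in auto)
  have "SH (M + 1) (\<lambda>i. if i = 0 then 0 else N_low (int m) (int (M + 1)) (int l) (int N) i) = Xset M Nl"
  proof (rule Set.set_eqI)
    fix n
    define q i where "q = n mod (M + 1)" and "i = n div (M + 1)"
    have q: "q \<le> M" unfolding q_def by (metis Suc_eq_plus1 less_Suc_eq_le mod_less_divisor zero_less_Suc)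
    have 1: "n \<in> SH (M + 1) (\<lambda>i. if i = 0 then 0 else N_low (int m) (int (M + 1)) (int l) (int N) i) \<longleftrightarrow>
        int i < (if int q = 0 then 0 else low_order M m l N q)"
      unfolding SH_def mem_Collect_eq low_order_def q_def i_def ..
    have 2: "n \<in> Xset M Nl \<longleftrightarrow> q \<in> {1..M} \<and> i < Nl q" unfolding Xset_def mem_Collect_eq q_def i_def ..
    show "n \<in> SH (M + 1) (\<lambda>i. if i = 0 then 0 else N_low (int m) (int (M + 1)) (int l) (int N) i) \<longleftrightarrow> n \<in> Xset M Nl"
      unfolding 1 2 Nl_def using q by (cases "q = 0") auto
  qed
  then show "\<exists>j. {0..<j} \<subseteq> YY \<and> {n. n + j \<in> YY} = Xset M Nl" using j by auto
qed

text \<open>\<open>YY\<close> is an interval of length \<open>j\<close> together with the row set of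
  the lower-order wave moved up by \<open>j\<close>. Subtracting \<open>sigma0 N\<close> eliminates
  \<open>j\<close>, and the products of distinct orders come from the square of the total number of
  rows.\<close>

lemma Gam0_eq: "Gam0 (M + 1) (low_order M m l N) = real (\<Sum>YY) - real (sigma0 N)"
proof -
  obtain j where j: "{0..<j} \<subseteq> YY" "{n. n + j \<in> YY} = Xset M Nl" using YY_shift by blast
  have YX: "YY = {0..<j} \<union> (\<lambda>n. n + j) ` Xset M Nl"
  proof (intro equalityI subsetI)
    fix y assume y: "y \<in> YY"
    show "y \<in> {0..<j} \<union> (\<lambda>n. n + j) ` Xset M Nl"
    proof (cases "y < j")
      case False
      then have "(y - j) + j \<in> YY" "y = (y - j) + j" using y by simp_all
      then show ?thesis unfolding j(2)[symmetric] by blast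
    qed simp
  next
    fix y assume "y \<in> {0..<j} \<union> (\<lambda>n. n + j) ` Xset M Nl"
    then show "y \<in> YY" using j(1) unfolding j(2)[symmetric] by blast
  qed
  have fin: "finite (Xset M Nl)"
  proof -
    have "finite ((\<lambda>n. n + j) ` Xset M Nl)" using YY(1) unfolding YX by simp
    then show ?thesis by (rule finite_imageD) (simp add: inj_on_def)
  qed
  have inj: "inj_on (\<lambda>n. n + j) (Xset M Nl)" by (simp add: inj_on_def)
  have disj: "{0..<j} \<inter> (\<lambda>n. n + j) ` Xset M Nl = {}" by auto
  define N' where "N' = real (card (Xset M Nl))"
  have "card YY = j + card (Xset M Nl)"
    unfolding YX using fin disj by (simp add: card_Un_disjoint card_image[OF inj])
  then have N': "real N = real j + N'" using YY(2) by (simp add: N'_def)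
  have "\<Sum>YY = \<Sum>{0..<j} + (\<Sum>n\<in>Xset M Nl. n + j)"
    unfolding YX using fin disj by (simp add: sum.union_disjoint sum.reindex[OF inj])
  then have SY: "real (\<Sum>YY) = real j * (real j - 1) / 2 + (\<Sum>n\<in>Xset M Nl. real n) + N' * real j"
    by (simp add: sum.distrib N'_def atLeast0LessThan sum_nat_real[symmetric])
  define f where "f I = real (Nl I)" for I
  have lo: "of_int (low_order M m l N I) = f I" if "I \<in> {1..M}" for I
    using low_nonneg[OF that] by (simp add: f_def Nl_def)
  have N'f: "N' = (\<Sum>I=1..M. f I)"
    using sum_Xset[of "\<lambda>_. 1" M Nl] by (simp add: N'_def f_def)
  have SX: "(\<Sum>n\<in>Xset M Nl. real n) = (\<Sum>I=1..M. (real M + 1) * (f I * (f I - 1) / 2) + f I * real I)"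
  proof -
    have "(\<Sum>i<Nl I. real ((M + 1) * i + I)) = (real M + 1) * (f I * (f I - 1) / 2) + f I * real I" for I
    proof -
      have "(\<Sum>i<Nl I. real ((M + 1) * i + I)) = (\<Sum>i<Nl I. (real M + 1) * real i + real I)"
        by (intro sum.cong refl) (simp add: algebra_simps)
      also have "\<dots> = (real M + 1) * (\<Sum>i<Nl I. real i) + f I * real I"
        by (simp only: sum.distrib sum_distrib_left[symmetric] sum_constant card_lessThan f_def)
      finally show ?thesis unfolding sum_nat_real f_def .
    qed
    then show ?thesis unfolding sum_Xset by simp
  qed
  have s0: "real (sigma0 N) = real N * (real N - 1) / 2"
    unfolding sigma0_def of_nat_sum sum_nat_real ..
  define P where "P = (\<Sum>j=1..M. \<Sum>i=1..<j. f i * f j)"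
  have sq: "N' * N' = (\<Sum>I=1..M. (f I)\<^sup>2) + 2 * P"
    using square_sum_pairs[of f M] unfolding N'f P_def power2_eq_square .
  have "Gam0 (M + 1) (low_order M m l N) = (\<Sum>I=1..M. f I / 2 * (real M * (f I - 1) + 2 * real I)) - P"
  proof -
    have "(\<Sum>i=1..M. of_int (low_order M m l N i) / 2 * (real M * (of_int (low_order M m l N i) - 1) + 2 * real i)) =
        (\<Sum>I=1..M. f I / 2 * (real M * (f I - 1) + 2 * real I))"
      by (intro sum.cong refl) (simp add: lo)
    moreover have "(\<Sum>j=1..M. \<Sum>i=1..<j. real_of_int (low_order M m l N i) * of_int (low_order M m l N j)) = P"
      unfolding P_def by (intro sum.cong refl) (simp add: lo)
    ultimately show ?thesis unfolding Gam0_def by simp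
  qed
  also have "(\<Sum>I=1..M. f I / 2 * (real M * (f I - 1) + 2 * real I)) =
      (\<Sum>I=1..M. ((real M + 1) * (f I * (f I - 1) / 2) + f I * real I) - (f I)\<^sup>2 * (1 / 2) + f I * (1 / 2))"
    by (intro sum.cong refl) (simp add: field_simps power2_eq_square)
  also have "\<dots> = (\<Sum>n\<in>Xset M Nl. real n) - (\<Sum>I=1..M. (f I)\<^sup>2) * (1 / 2) + N' * (1 / 2)"
    unfolding SX N'f by (simp only: sum.distrib sum_subtractf sum_distrib_right)
  also have "\<dots> - P = (\<Sum>n\<in>Xset M Nl. real n) - N' * (N' - 1) / 2"
    using sq by (simp add: field_simps)
  also have "\<dots> = real (\<Sum>YY) - real (sigma0 N)"
    unfolding SY s0 N' by (simp add: field_simps)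
  finally show ?thesis .
qed

lemma sigma0_le_YY: "sigma0 N \<le> \<Sum>YY" "sigma0 N \<le> \<Sum>XX"
  using sigma0_le[OF YY(1)] sigma0_le[OF XX(1)] YY(2) XX(2) by simp_all

text \<open>If all orders were 0, \<open>Gam0\<close> would be 0, the core would have the smallest
  possible sum, and the constant coefficient of \<open>W\<close> would not vanish.\<close>

lemma low_exists:
  assumes "W_poly m (M + 1) l N 0 = 0"
  shows "\<exists>j\<in>{1..M}. low_order M m l N j \<noteq> 0"
proof (rule ccontr)
  assume "\<not> ?thesis"
  then have z: "low_order M m l N j = 0" if "j \<in> {1..M}" for j using that by blast
  have "(\<Sum>j=1..M. \<Sum>i=1..<j. real_of_int (low_order M m l N i) * of_int (low_order M m l N j)) = 0"
    by (intro sum.neutral ballI) (simp add: z)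
  moreover have "(\<Sum>i=1..M. of_int (low_order M m l N i) / 2 * (real M * (of_int (low_order M m l N i) - 1) + 2 * real i)) = 0"
    by (intro sum.neutral ballI) (simp add: z)
  ultimately have "Gam0 (M + 1) (low_order M m l N) = 0" unfolding Gam0_def by simp
  then have "real (\<Sum>YY) = real (sigma0 N)" unfolding Gam0_eq by linarith
  then have "\<Sum>YY = sigma0 N" by (simp only: of_nat_eq_iff)
  then have "coeff (PW m (M + 1) l N) 0 \<noteq> 0" using PW_facts(3) by simp
  then show False using assms unfolding WW_PW by (simp add: poly_0_coeff_0)
qed

text \<open>The factor \<open>q\<close> is the same for all shifts \<open>sh\<close>, so the
  quotients of determinants coincide. After the deletion of the initial interval the variables on
  the two sides differ only at multiples of \<open>M + 1\<close> and at \<open>m\<close>, where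
  \<open>Dm_closed\<close> permits any change.\<close>

lemma TY_low:
  assumes ah: "\<forall>j\<ge>1. \<forall>I\<in>{1..M}. \<not> (M + 1) dvd j \<longrightarrow> ah j I = a j"
  shows "\<exists>q. q \<noteq> 0 \<and> (\<forall>sh. TY sh (a, x, t) = q * tauS (Xset M Nl) (of_real hh) sc (\<lambda>r. cnj (sc r))
      (\<lambda>n r. bs (\<lambda>i. ah i (n mod (M + 1)), x, t) r + sh r)
      (\<lambda>n r. cnj (bs (\<lambda>i. ah i (n mod (M + 1)), x, t) r - sh r)))"
proof -
  obtain j where j: "{0..<j} \<subseteq> YY" "{n. n + j \<in> YY} = Xset M Nl" using YY_shift by blast
  obtain e where e: "\<And>x y. tauS YY (of_real hh) sc (\<lambda>r. cnj (sc r)) (\<lambda>_. x) (\<lambda>_. y) =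
      of_real hh ^ e * tauS (Xset M Nl) (of_real hh) sc (\<lambda>r. cnj (sc r)) (\<lambda>_ r. x r + of_nat j * sc r) (\<lambda>_ r. y r + of_nat j * cnj (sc r))"
    using tauS_shift_iter[OF YY(1) j(1), of "of_real hh" sc "\<lambda>r. cnj (sc r)"] unfolding j(2) by blast
  have Xb: "Xset M Nl \<subseteq> {0..l + N * (M + 1)}"
  proof
    fix n assume "n \<in> Xset M Nl"
    then have "n + j \<in> YY" unfolding j(2)[symmetric] by simp
    then show "n \<in> {0..l + N * (M + 1)}" using YY(3) unfolding VS_def by auto
  qed
  have finX: "finite (Xset M Nl)" by (rule finite_subset[OF Xb]) simp
  define y where "y sh r = xt sh (a, x, t) r + of_nat j * sc r" for sh r
  define z where "z sh n r = bs (\<lambda>i. ah i (n mod (M + 1)), x, t) r + sh r" for sh n r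
  have Dm: "Dm (Xset M Nl) V (z sh) sc = Dm (Xset M Nl) V (\<lambda>_. y sh) sc" for V sh
  proof -
    define c where "c n r = z sh n r - y sh r" for n r
    have "Dm (Xset M Nl) V (\<lambda>n r. c n r + y sh r) sc = Dm (Xset M Nl) V (\<lambda>_. y sh) sc"
    proof (rule Dm_closed[OF finX])
      fix n n' r :: nat
      assume n: "n \<in> Xset M Nl" and n': "n' \<in> Xset M Nl" and r: "1 \<le> r" "r \<le> n'" and c: "c n r \<noteq> 0"
      have nI: "n mod (M + 1) \<in> {1..M}" using n unfolding Xset_def by blast
      have "(M + 1) dvd r \<or> r = m"
      proof (rule ccontr)
        assume no: "\<not> ((M + 1) dvd r \<or> r = m)"
        then have "ah r (n mod (M + 1)) = a r" using ah r(1) nI by blast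
        moreover have "sc r = 0" unfolding sc_def by (rule s_coeff_zero) (use no in \<open>simp add: K_def\<close>)
        ultimately have "c n r = 0" using no by (simp add: c_def z_def y_def xt_def bs_def)
        then show False using c by simp
      qed
      then show "n' - r \<in> Xset M Nl"
      proof
        \<comment> \<open>Every class mod \<open>M + 1\<close> of \<open>Xset\<close> is filled from
          the bottom.\<close>
        assume "(M + 1) dvd r"
        then obtain d where d: "r = (M + 1) * d" by blast
        then have "(n' - r) mod (M + 1) = n' mod (M + 1)" by (intro mod_diff_multiple[OF _ r(2)]) (simp only: d dvd_triv_left)
        moreover have "(n' - r) div (M + 1) \<le> n' div (M + 1)" by (intro div_le_mono) simp
        ultimately show ?thesis using n' unfolding Xset_def by auto
      next
        \<comment> \<open>Closure under subtraction of \<open>m\<close> is inherited from the core;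
          the shift by \<open>j\<close> does no harm because \<open>r \<le> n'\<close>.\<close>
        assume rm: "r = m"
        have "n' + j \<in> core m XX" using n' unfolding j(2)[symmetric] YY_def by simp
        then have "n' + j - m \<in> core m XX" using m r(2) rm by (intro core_diff) auto
        moreover have "n' + j - m = (n' - r) + j" using r(2) rm by simp
        ultimately show ?thesis unfolding j(2)[symmetric] YY_def by simp
      qed
    qed
    then show ?thesis by (simp add: c_def)
  qed
  have y2: "cnj (xt (\<lambda>r. - sh r) (a, x, t) r) + of_nat j * cnj (sc r) = cnj (y (\<lambda>r. - sh r) r)" for sh r
    by (simp add: y_def)
  have z2: "cnj (bs (\<lambda>i. ah i (n mod (M + 1)), x, t) r - sh r) = cnj (z (\<lambda>r. - sh r) n r)" for n sh r
    by (simp add: z_def)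
  have "TY sh (a, x, t) = of_real hh ^ e * tauS (Xset M Nl) (of_real hh) sc (\<lambda>r. cnj (sc r))
      (\<lambda>n r. bs (\<lambda>i. ah i (n mod (M + 1)), x, t) r + sh r)
      (\<lambda>n r. cnj (bs (\<lambda>i. ah i (n mod (M + 1)), x, t) r - sh r))" for sh
  proof -
    have "tauS (Xset M Nl) (of_real hh) sc (\<lambda>r. cnj (sc r)) (\<lambda>_. y sh) (\<lambda>_ r. cnj (y (\<lambda>r. - sh r) r)) =
        tauS (Xset M Nl) (of_real hh) sc (\<lambda>r. cnj (sc r)) (z sh) (\<lambda>n r. cnj (z (\<lambda>r. - sh r) n r))"
      unfolding tauS_expand[OF Xb] Dm_cnj Dm ..
    then show ?thesis unfolding TY_def e y_def[symmetric] y2 z_def[symmetric] z2 by simp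
  qed
  moreover have "complex_of_real hh ^ e \<noteq> 0" using hh_pos by simp
  ultimately show ?thesis by blast
qed

lemma inner_region:
  assumes n: "n \<in> {1..M}" and B: "B > 0" and R: "R > 0" and \<epsilon>: "\<epsilon> > 0"
  shows "\<exists>A>0. \<forall>a ah x t. large_param m B A a \<and>
      (\<forall>j\<ge>1. \<forall>I\<in>{1..M}. \<not> (M + 1) dvd j \<longrightarrow> ah j I = a j) \<and> x\<^sup>2 + t\<^sup>2 \<le> R \<longrightarrow>
      cmod (rogue_wave_type M k c \<rho> p l N a n x t -
        rogue_wave M k c \<rho> p (\<lambda>j. nat (low_order M m l N j)) ah n x t) \<le> \<epsilon>"
proof -
  define S where "S A = {w :: (nat \<Rightarrow> complex) \<times> real \<times> real. large_param m B A (fst w) \<and> (fst (snd w))\<^sup>2 + (snd (snd w))\<^sup>2 \<le> R}" for A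
  have anti: "S B' \<subseteq> S A'" if "0 < A'" "A' \<le> B'" for A' B'
    using that by (auto simp: S_def large_param_def)
  have large: "large_param m B A (fst w)" if "w \<in> S A" for A w using that by (simp add: S_def)
  have ev: "eventually P (regime S) \<longleftrightarrow> (\<exists>A>0. \<forall>w\<in>S A. P w)" for P
    by (rule eventually_regime) (rule anti)
  have e0: "(ee \<longlongrightarrow> 0) (regime S)" and enz: "\<forall>\<^sub>F w in regime S. ee w \<noteq> 0"
    and fb: "\<And>r. 1 \<le> r \<Longrightarrow> r \<noteq> m \<Longrightarrow> (\<lambda>w. fst w r) \<in> O[regime S](\<lambda>_. 1 :: complex)"
    using ee_regime[of S B] anti large by blast+
  have S1: "\<bar>fst (snd w)\<bar> \<le> sqrt R" "\<bar>snd (snd w)\<bar> \<le> sqrt R" if "w \<in> S 1" for w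
    using abs_le_sqrt_sum[of "fst (snd w)" "snd (snd w)" R] that by (simp_all add: S_def)
  have xb: "(\<lambda>w. complex_of_real (fst (snd w))) \<in> O[regime S](\<lambda>_. 1 :: complex)"
    "(\<lambda>w. complex_of_real (snd (snd w))) \<in> O[regime S](\<lambda>_. 1 :: complex)"
    by (rule bigoI[where c = "sqrt R"], unfold ev, intro exI[of _ 1] conjI ballI, use S1 in simp_all)+
  have xtb: "(\<lambda>w. xt sh w r) \<in> O[regime S](\<lambda>_. 1 :: complex)" if r: "1 \<le> r" for sh :: "nat \<Rightarrow> complex" and r
  proof -
    have c: "(\<lambda>_. d) \<in> O[regime S](\<lambda>_. 1 :: complex)" for d :: complex by simp
    have f: "(\<lambda>w. if r = m then 0 else fst w r) \<in> O[regime S](\<lambda>_. 1 :: complex)"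
      by (cases "r = m") (use fb r in simp_all)
    have "xt sh w r = alpha p r * of_real (fst (snd w)) + beta p r * of_real (snd (snd w)) + (if r = m then 0 else fst w r) + sh r" for w
      by (simp add: xt_def bs_def)
    moreover have "(\<lambda>w. alpha p r * of_real (fst (snd w)) + beta p r * of_real (snd (snd w)) + (if r = m then 0 else fst w r) + sh r) \<in> O[regime S](\<lambda>_. 1 :: complex)"
      by (intro sum_in_bigo(1)[OF sum_in_bigo(1)[OF sum_in_bigo(1)[OF bigo_1_mult[OF c xb(1)] bigo_1_mult[OF c xb(2)]] f] c])
    ultimately show ?thesis by (simp only:)
  qed
  let ?sh = "\<lambda>r. theta k p r n"
  let ?d = "\<lambda>w. TT ?sh w / TT (\<lambda>_. 0) w - TY ?sh w / TY (\<lambda>_. 0) w"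
  have "?d \<in> O[regime S](ee)" by (rule inner_ratio[OF e0 enz xtb])
  then obtain C where C: "C > 0" "\<forall>\<^sub>F w in regime S. cmod (?d w) \<le> C * cmod (ee w)" by (rule landau_o.bigE)
  define e where "e = \<epsilon> / ((\<bar>\<rho> n\<bar> + 1) * C)"
  have e: "e > 0" using \<epsilon> C(1) by (simp add: e_def)
  have "\<forall>\<^sub>F w in regime S. cmod (?d w) \<le> C * e"
    using C(2) tendstoD[OF e0 e]
  proof eventually_elim
    case (elim w)
    have "C * cmod (ee w) \<le> C * e" using elim(2) C(1) by simp
    then show ?case using elim(1) by linarith
  qed
  then obtain A where A: "A > 0" "\<forall>w\<in>S A. cmod (?d w) \<le> C * e" unfolding ev by blast
  have re: "\<bar>\<rho> n\<bar> * (C * e) \<le> \<epsilon>"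
  proof -
    have "(\<bar>\<rho> n\<bar> + 1) * (C * e) = \<epsilon>" using C(1) by (simp add: e_def)
    moreover have "0 \<le> C * e" using C(1) e by simp
    ultimately show ?thesis by (simp add: distrib_right)
  qed
  show ?thesis
  proof (intro exI[of _ A] conjI allI impI A(1))
    fix a :: "nat \<Rightarrow> complex" and ah x t
    assume H: "large_param m B A a \<and> (\<forall>j\<ge>1. \<forall>I\<in>{1..M}. \<not> (M + 1) dvd j \<longrightarrow> ah j I = a j) \<and> x\<^sup>2 + t\<^sup>2 \<le> R"
    then have "(a, x, t) \<in> S A" by (simp add: S_def)
    then have d: "cmod (?d (a, x, t)) \<le> C * e" using A(2) by blast
    obtain q where q: "q \<noteq> 0" "\<And>sh. TY sh (a, x, t) = q * tauS (Xset M Nl) (of_real hh) sc (\<lambda>r. cnj (sc r))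
      (\<lambda>n r. bs (\<lambda>i. ah i (n mod (M + 1)), x, t) r + sh r)
      (\<lambda>n r. cnj (bs (\<lambda>i. ah i (n mod (M + 1)), x, t) r - sh r))"
      using TY_low[of ah a x t] H by blast
    have "rogue_wave M k c \<rho> p (\<lambda>j. nat (low_order M m l N j)) ah n x t =
        TY ?sh (a, x, t) / TY (\<lambda>_. 0) (a, x, t) * plane_wave M k c \<rho> n x t"
      unfolding rogue_wave_low[OF n] Nl_def[abs_def, symmetric] q(2) mult_divide_mult_cancel_left[OF q(1)] ..
    then show "cmod (rogue_wave_type M k c \<rho> p l N a n x t -
        rogue_wave M k c \<rho> p (\<lambda>j. nat (low_order M m l N j)) ah n x t) \<le> \<epsilon>"
      using TT_sub_plane_wave[OF n d re] by (simp only:)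
  qed
qed

end

section \<open>The number of fundamental waves and the background away from them\<close>

context mk_simple
begin

abbreviation "ZZ \<equiv> {z. z \<noteq> 0 \<and> W_poly m (M + 1) l N z = 0}"

lemma PW_simple: "z \<noteq> 0 \<Longrightarrow> poly (PW m (M + 1) l N) z = 0 \<Longrightarrow> poly (pderiv (PW m (M + 1) l N)) z \<noteq> 0"
  using simple unfolding WW_PW deriv_WW_PW by blast

lemma card_ZZ:
  shows finite_ZZ: "finite ZZ"
    and "real (card ZZ) = Gam (M + 1) l N - Gam0 (M + 1) (low_order M m l N)"
proof -
  note Z = card_nonzero_simple_roots[OF PW_facts(2,3) PW_simple, folded WW_PW]
  show "finite ZZ" by (rule Z(1))
  have "card ZZ + (\<Sum>YY - sigma0 N) = \<Sum>XX - sigma0 N" using Z(2) unfolding PW_facts(1) .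
  then have "real (card ZZ) + (real (\<Sum>YY) - real (sigma0 N)) = real (\<Sum>XX) - real (sigma0 N)"
    using sigma0_le_YY by linarith
  then show "real (card ZZ) = Gam (M + 1) l N - Gam0 (M + 1) (low_order M m l N)"
    unfolding Gam_eq Gam0_eq by linarith
qed

lemma far_region:
  assumes n: "n \<in> {1..M}" and B: "B > 0" and \<delta>: "\<delta> > 0" and K: "K' > 0" and \<epsilon>: "\<epsilon> > 0"
  shows "\<exists>R>0. \<exists>A>0. \<forall>a x t. large_param m B A a \<and>
      \<delta> * cmod (a m) powr (1 / m) \<le> sqrt (x\<^sup>2 + t\<^sup>2) \<and>
      sqrt (x\<^sup>2 + t\<^sup>2) \<le> K' * cmod (a m) powr (1 / m) \<and>
      (\<forall>z0\<in>ZZ. (x - pos_x p (wave_centre p M m l N z0 (rt (a m)) (a 1)))\<^sup>2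
        + (t - pos_t p (wave_centre p M m l N z0 (rt (a m)) (a 1)))\<^sup>2 \<ge> R) \<longrightarrow>
      cmod (rogue_wave_type M k c \<rho> p l N a n x t - plane_wave M k c \<rho> n x t) \<le> \<epsilon>"
proof -
  define b where "b w = rt (fst w m)" for w :: "(nat \<Rightarrow> complex) \<times> real \<times> real"
  define wc where "wc z0 w = wave_centre p M m l N z0 (b w) (fst w 1)" for z0 and w :: "(nat \<Rightarrow> complex) \<times> real \<times> real"
  define \<xi> where "\<xi> z0 w = fst (snd w) - pos_x p (wc z0 w)" for z0 w
  define \<tau> where "\<tau> z0 w = snd (snd w) - pos_t p (wc z0 w)" for z0 w
  define rad where "rad w = sqrt ((fst (snd w))\<^sup>2 + (snd (snd w))\<^sup>2)" for w :: "(nat \<Rightarrow> complex) \<times> real \<times> real"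
  \<comment> \<open>The same \<open>A\<close> bounds \<open>a m\<close> from below and the squared
    distance to all centres, so one limit governs both.\<close>
  define S where "S A = {w. large_param m B A (fst w) \<and> \<delta> * cmod (b w) \<le> rad w \<and> rad w \<le> K' * cmod (b w) \<and>
    (\<forall>z0\<in>ZZ. (\<xi> z0 w)\<^sup>2 + (\<tau> z0 w)\<^sup>2 \<ge> A)}" for A
  have anti: "S B' \<subseteq> S A'" if "0 < A'" "A' \<le> B'" for A' B'
    using that unfolding S_def large_param_def by (auto intro: order.trans)
  have large: "large_param m B A (fst w)" if "w \<in> S A" for A w using that by (simp add: S_def)
  have ev: "eventually P (regime S) \<longleftrightarrow> (\<exists>A>0. \<forall>w\<in>S A. P w)" for P
    by (rule eventually_regime) (rule anti)
  have good: "good (regime S)"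
  proof (rule good_regime[of S B K'])
    fix w assume "w \<in> S 1"
    then have "rad w \<le> K' * cmod (rt (fst w m))" by (simp add: S_def b_def)
    moreover have "\<bar>fst (snd w)\<bar> \<le> rad w" "\<bar>snd (snd w)\<bar> \<le> rad w"
      unfolding rad_def by (rule abs_le_sqrt_sum, rule order.refl)+
    ultimately show "\<bar>fst (snd w)\<bar> \<le> K' * cmod (rt (fst w m)) \<and> \<bar>snd (snd w)\<bar> \<le> K' * cmod (rt (fst w m))"
      by linarith
  qed (use anti large in blast)+
  note g = goodD[OF good]
  obtain \<kappa> where \<kappa>: "\<kappa> > 0" "\<And>x t. \<kappa> * sqrt (x\<^sup>2 + t\<^sup>2) \<le> cmod (Lf x t)" using Lf_lower by blast
  have "\<forall>z0. \<exists>D. \<forall>b. cmod (Delta p M m l N z0 b) \<le> D" using Delta_bound by blast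
  then obtain Df where Df: "\<And>z0 b. cmod (Delta p M m l N z0 b) \<le> Df z0" by metis
  define D where "D = (\<Sum>z0\<in>ZZ. Df z0)"
  have D: "cmod (Delta p M m l N z0 b) \<le> D" if "z0 \<in> ZZ" for z0 b
  proof -
    have "0 \<le> Df z" for z using Df[of z 0] norm_ge_zero order.trans by blast
    then have "Df z0 \<le> D" unfolding D_def by (intro member_le_sum[OF that _ finite_ZZ])
    then show ?thesis using Df[of z0 b] by linarith
  qed
  have P0: "PW m (M + 1) l N \<noteq> 0" using PW_facts(3) by auto
  have "\<kappa> * \<delta> / 2 > 0" using \<kappa>(1) \<delta> by simp
  from poly_lower_bound[OF P0 this PW_simple, folded WW_PW]
  obtain c0 where c0: "c0 > 0" "\<And>u r. \<kappa> * \<delta> / 2 \<le> cmod u \<Longrightarrow> 0 \<le> r \<Longrightarrow> r \<le> 1 \<Longrightarrow>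
      (\<forall>z0\<in>ZZ. r \<le> cmod (u - z0)) \<Longrightarrow> c0 * r \<le> cmod (WW u)"
    by auto
  have small: "ee \<in> o[regime S](\<lambda>w. WW (zsh (\<lambda>_. 0) w 1))"
  proof (rule landau_o.smallI)
    fix c :: real assume c: "c > 0"
    \<comment> \<open>\<open>T\<close> is the separation from the roots, in units of
      \<open>ee\<close>, for which \<open>c * (c0 * T) = 1\<close>. \<open>A0\<close> is chosen so
      that a distance \<open>sqrt A0\<close> from a centre guarantees this separation even after
      \<open>Delta\<close> is subtracted.\<close>
    define T where "T = 1 / (c * c0)"
    have T: "T > 0" using c c0(1) by (simp add: T_def)
    define A0 where "A0 = 1 + ((\<bar>D\<bar> + T) / \<kappa>)\<^sup>2"
    have A0: "A0 > 0" unfolding A0_def by (simp add: add_pos_nonneg)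
    have sA: "(\<bar>D\<bar> + T) \<le> \<kappa> * sqrt A0"
    proof -
      have "(\<bar>D\<bar> + T) / \<kappa> \<le> sqrt A0" by (rule real_le_rsqrt) (simp add: A0_def)
      then show ?thesis using \<kappa>(1) by (simp add: pos_divide_le_eq mult.commute)
    qed
    have "0 < min (1 / T) (\<kappa> * \<delta> / (2 * B))" using T \<kappa>(1) \<delta> B by simp
    note e0 = tendstoD[OF g(1) this]
    have in_S: "\<forall>\<^sub>F w in regime S. w \<in> S A0 \<and> w \<in> S 1"
      unfolding ev using A0 anti[of A0 "max A0 1"] anti[of 1 "max A0 1"]
      by (intro exI[of _ "max A0 1"]) auto
    show "\<forall>\<^sub>F w in regime S. cmod (ee w) \<le> c * cmod (WW (zsh (\<lambda>_. 0) w 1))"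
      using e0 in_S g(2)
    proof eventually_elim
      case (elim w)
      define u where "u = zsh (\<lambda>_. 0) w 1"
      have eb: "ee w * b w = 1" using elim(3) by (simp add: ee_def b_def)
      have neb: "cmod (ee w) * cmod (b w) = 1" using arg_cong[OF eb, of cmod] by (simp add: norm_mult)
      have eT: "cmod (ee w) * T \<le> 1" "cmod (ee w) * B \<le> \<kappa> * \<delta> / 2"
      proof -
        have "cmod (ee w) \<le> 1 / T" "cmod (ee w) \<le> \<kappa> * \<delta> / (2 * B)" using elim(1) by simp_all
        then show "cmod (ee w) * T \<le> 1" "cmod (ee w) * B \<le> \<kappa> * \<delta> / 2" using T B by (simp_all add: field_simps)
      qed
      have a1: "cmod (fst w 1) \<le> B" using large[of w 1] elim(2) m unfolding large_param_def by auto
      have uL: "u = ee w * Lf (fst (snd w)) (snd (snd w)) + ee w * fst w 1"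
        unfolding u_def zsh_Lf by (simp add: distrib_left)
      \<comment> \<open>At distance \<open>\<delta> * cmod (b w)\<close> from the origin the
        location contributes at least \<open>\<kappa> * \<delta>\<close> to the rescaled variable,
        and the parameter \<open>a 1\<close> takes away at most half of it. This keeps the root 0 of
        \<open>W\<close> at a distance.\<close>
      have ubig: "\<kappa> * \<delta> / 2 \<le> cmod u"
      proof -
        have "\<delta> * cmod (b w) \<le> rad w" using elim(2) by (simp add: S_def)
        then have "\<kappa> * (\<delta> * cmod (b w)) \<le> \<kappa> * rad w" using \<kappa>(1) by simp
        also have "\<dots> \<le> cmod (Lf (fst (snd w)) (snd (snd w)))" unfolding rad_def by (rule \<kappa>(2))
        finally have "cmod (ee w) * (\<kappa> * (\<delta> * cmod (b w))) \<le> cmod (ee w * Lf (fst (snd w)) (snd (snd w)))"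
          unfolding norm_mult by (rule mult_left_mono) simp
        moreover have "cmod (ee w) * (\<kappa> * (\<delta> * cmod (b w))) = \<kappa> * \<delta> * (cmod (ee w) * cmod (b w))" by simp
        ultimately have 1: "\<kappa> * \<delta> \<le> cmod (ee w * Lf (fst (snd w)) (snd (snd w)))" unfolding neb by simp
        have "cmod (ee w * fst w 1) \<le> cmod (ee w) * B" unfolding norm_mult by (rule mult_left_mono[OF a1]) simp
        then have 2: "cmod (ee w * fst w 1) \<le> \<kappa> * \<delta> / 2" using eT(2) by linarith
        have "cmod (ee w * Lf (fst (snd w)) (snd (snd w))) \<le> cmod u + cmod (ee w * fst w 1)"
          using norm_triangle_ineq4[of u "ee w * fst w 1"] unfolding uL by simp
        then show ?thesis using 1 2 by linarith
      qed
      have usep: "cmod (ee w) * T \<le> cmod (u - z0)" if z0: "z0 \<in> ZZ" for z0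
      proof -
        let ?\<eta> = "Lf (\<xi> z0 w) (\<tau> z0 w)"
        have L: "Lf (fst (snd w)) (snd (snd w)) = ?\<eta> + wc z0 w"
          unfolding \<xi>_def \<tau>_def Lf_diff Lf_pos by simp
        have "u - z0 = ee w * (?\<eta> - Delta p M m l N z0 (b w)) + (ee w * b w - 1) * z0"
          unfolding uL L wc_def wave_centre_def by (simp add: algebra_simps)
        then have uz: "u - z0 = ee w * (?\<eta> - Delta p M m l N z0 (b w))" unfolding eb by simp
        have "A0 \<le> (\<xi> z0 w)\<^sup>2 + (\<tau> z0 w)\<^sup>2" using elim(2) z0 unfolding S_def by blast
        then have "\<kappa> * sqrt A0 \<le> \<kappa> * sqrt ((\<xi> z0 w)\<^sup>2 + (\<tau> z0 w)\<^sup>2)" using \<kappa>(1) by simp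
        also have "\<dots> \<le> cmod ?\<eta>" by (rule \<kappa>(2))
        finally have "\<bar>D\<bar> + T \<le> cmod ?\<eta>" using sA by linarith
        moreover have "cmod ?\<eta> \<le> cmod (?\<eta> - Delta p M m l N z0 (b w)) + cmod (Delta p M m l N z0 (b w))"
          using norm_triangle_ineq[of "?\<eta> - Delta p M m l N z0 (b w)" "Delta p M m l N z0 (b w)"] by simp
        ultimately have "T \<le> cmod (?\<eta> - Delta p M m l N z0 (b w))" using D[OF z0, of "b w"] by linarith
        then show ?thesis unfolding uz norm_mult by (rule mult_left_mono) simp
      qed
      have "c0 * (cmod (ee w) * T) \<le> cmod (WW u)"
        by (rule c0(2)[OF ubig]) (use T eT(1) usep in simp_all)
      then have "c * (c0 * (cmod (ee w) * T)) \<le> c * cmod (WW u)" using c by simp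
      moreover have "c * (c0 * (cmod (ee w) * T)) = cmod (ee w)" using c c0(1) by (simp add: T_def)
      ultimately show ?case unfolding u_def by simp
    qed
  qed
  let ?sh = "\<lambda>r. theta k p r n"
  have e: "\<epsilon> / (\<bar>\<rho> n\<bar> + 1) > 0" using \<epsilon> by (simp add: add_nonneg_pos)
  have "\<forall>\<^sub>F w in regime S. dist (TN ?sh w / TN (\<lambda>_. 0) w) 1 < \<epsilon> / (\<bar>\<rho> n\<bar> + 1) \<and> ee w \<noteq> 0"
    using eventually_conj[OF tendstoD[OF far_ratio[OF good small] e] g(2)] .
  then obtain A where A: "A > 0" "\<forall>w\<in>S A. dist (TN ?sh w / TN (\<lambda>_. 0) w) 1 < \<epsilon> / (\<bar>\<rho> n\<bar> + 1) \<and> ee w \<noteq> 0"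
    unfolding ev by blast
  have re: "\<bar>\<rho> n\<bar> * (\<epsilon> / (\<bar>\<rho> n\<bar> + 1)) \<le> \<epsilon>"
    using \<epsilon> by (simp add: pos_divide_le_eq add_nonneg_pos algebra_simps)
  show ?thesis
  proof (intro exI[of _ A] conjI allI impI A(1))
    fix a x t
    assume H: "large_param m B A a \<and>
      \<delta> * cmod (a m) powr (1 / m) \<le> sqrt (x\<^sup>2 + t\<^sup>2) \<and>
      sqrt (x\<^sup>2 + t\<^sup>2) \<le> K' * cmod (a m) powr (1 / m) \<and>
      (\<forall>z0\<in>ZZ. (x - pos_x p (wave_centre p M m l N z0 (rt (a m)) (a 1)))\<^sup>2
        + (t - pos_t p (wave_centre p M m l N z0 (rt (a m)) (a 1)))\<^sup>2 \<ge> A)"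
    then have "(a, x, t) \<in> S A"
      unfolding S_def mem_Collect_eq rad_def \<xi>_def \<tau>_def wc_def b_def fst_conv snd_conv norm_rt .
    then have w: "dist (TN ?sh (a, x, t) / TN (\<lambda>_. 0) (a, x, t)) 1 < \<epsilon> / (\<bar>\<rho> n\<bar> + 1)" "ee (a, x, t) \<noteq> 0"
      using A(2) by blast+
    have "cmod (TT ?sh (a, x, t) / TT (\<lambda>_. 0) (a, x, t) - 1) \<le> \<epsilon> / (\<bar>\<rho> n\<bar> + 1)"
      unfolding TT_ratio[OF w(2)] using w(1) by (simp add: dist_norm)
    from TT_sub_plane_wave[OF n this re]
    show "cmod (rogue_wave_type M k c \<rho> p l N a n x t - plane_wave M k c \<rho> n x t) \<le> \<epsilon>" by simp
  qed
qed

lemma near_region_ZZ: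
  assumes z0: "z0 \<in> ZZ" and n: "n \<in> {1..M}" and B: "B > 0" and R: "R > 0"
  shows "\<exists>C>0. \<exists>A>0. \<forall>a x t. large_param m B A a \<and>
      (x - pos_x p (wave_centre p M m l N z0 (rt (a m)) (a 1)))\<^sup>2 + (t - pos_t p (wave_centre p M m l N z0 (rt (a m)) (a 1)))\<^sup>2 \<le> R \<longrightarrow>
      cmod (rogue_wave_type M k c \<rho> p l N a n x t -
        fundamental_wave M k c \<rho> p (pos_x p (wave_centre p M m l N z0 (rt (a m)) (a 1)))
          (pos_t p (wave_centre p M m l N z0 (rt (a m)) (a 1))) n x t)
      \<le> C * cmod (a m) powr (- 1 / m)"
  by (rule near_region[OF _ _ _ n B R]) (use z0 simple in auto)

end

theorem theorem6p3:
  fixes M l N m :: nat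
    and lam1 :: real and k \<rho> c :: "nat \<Rightarrow> real"
    and p0 :: complex and p :: "complex \<Rightarrow> complex"
    and rt :: "complex \<Rightarrow> complex"
  assumes "M \<ge> 2" and "l \<in> {1..M}" and "N \<ge> 1" and "m \<ge> 2" and "\<not> (M + 1) dvd m"
    and "lam1 > 0"
    and "\<forall>j\<in>{1..M}. k j = k 1 + lam1 * (sin (pi / (M + 1)) * cot (j * pi / (M + 1)) - cos (pi / (M + 1)))"
    and "\<forall>j\<in>{1..M}. \<rho> j > 0 \<and> (c j = 1 \<or> c j = -1)"
    and "\<forall>j\<in>{1..M}. c j * (\<rho> j)\<^sup>2 =
           (-1) ^ j * (\<Prod>i\<in>{1..M} - {j}. inverse (k j - k i))
             * (lam1 * sin (pi / (M + 1)) / sin (j * pi / (M + 1))) ^ (M + 1)"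
    and "p0 = Complex (lam1 * sin (pi / (M + 1))) (k 1 - lam1 * cos (pi / (M + 1))) \<or>
         p0 = Complex (- lam1 * sin (pi / (M + 1))) (k 1 - lam1 * cos (pi / (M + 1)))"
    and "Re p0 * Im p0 \<noteq> 0"
    and "p analytic_on {0}" and "p 0 = p0"
    and "\<forall>\<^sub>F \<kappa> in nhds 0. FM M k c \<rho> (p \<kappa>) =
           FM M k c \<rho> p0 / of_nat (M + 1) *
             (\<Sum>n=1..M+1. exp (of_real (cos (2 * n * pi / (M + 1))) * \<kappa>)
                          * cos (of_real (sin (2 * n * pi / (M + 1))) * \<kappa>))"
    and "\<forall>w. rt w ^ m = w"
    and "\<forall>z. z \<noteq> 0 \<and> W_poly m (M + 1) l N z = 0 \<longrightarrow> deriv (W_poly m (M + 1) l N) z \<noteq> 0"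
  defines "Z \<equiv> {z. z \<noteq> 0 \<and> W_poly m (M + 1) l N z = 0}"
    and "v \<equiv> rogue_wave_type M k c \<rho> p l N"
    and "cx \<equiv> (\<lambda>z0 a. pos_x p (wave_centre p M m l N z0 (rt (a m)) (a 1)))"
    and "ct \<equiv> (\<lambda>z0 a. pos_t p (wave_centre p M m l N z0 (rt (a m)) (a 1)))"
  shows
    \<comment> \<open>outer region: number of fundamental waves, \<open>Delta = O(1)\<close>, shape and position, and
        plane-wave background away from them\<close>
    "(finite Z \<and> real (card Z) = Gam (M + 1) l N - Gam0 (M + 1) (low_order M m l N)) \<and>
     (\<forall>z0\<in>Z. \<exists>D. \<forall>w. w \<noteq> 0 \<longrightarrow> cmod (Delta p M m l N z0 (rt w)) \<le> D) \<and>
     (\<forall>z0\<in>Z. \<forall>n\<in>{1..M}. \<forall>B>0. \<forall>R>0. \<exists>C>0. \<exists>A>0. \<forall>a x t.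
        large_param m B A a \<and> (x - cx z0 a)\<^sup>2 + (t - ct z0 a)\<^sup>2 \<le> R \<longrightarrow>
        cmod (v a n x t - fundamental_wave M k c \<rho> p (cx z0 a) (ct z0 a) n x t)
          \<le> C * cmod (a m) powr (- 1 / m)) \<and>
     (\<forall>n\<in>{1..M}. \<forall>B>0. \<forall>\<delta>>0. \<forall>K>0. \<forall>\<epsilon>>0. \<exists>R>0. \<exists>A>0. \<forall>a x t.
        large_param m B A a \<and>
        \<delta> * cmod (a m) powr (1 / m) \<le> sqrt (x\<^sup>2 + t\<^sup>2) \<and>
        sqrt (x\<^sup>2 + t\<^sup>2) \<le> K * cmod (a m) powr (1 / m) \<and>
        (\<forall>z0\<in>Z. (x - cx z0 a)\<^sup>2 + (t - ct z0 a)\<^sup>2 \<ge> R) \<longrightarrow>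
        cmod (v a n x t - plane_wave M k c \<rho> n x t) \<le> \<epsilon>) \<and>
    \<comment> \<open>inner region\<close>
     (W_poly m (M + 1) l N 0 = 0 \<longrightarrow>
        (\<forall>j\<in>{1..M}. low_order M m l N j \<ge> 0) \<and> (\<exists>j\<in>{1..M}. low_order M m l N j \<noteq> 0) \<and>
        (\<forall>n\<in>{1..M}. \<forall>B>0. \<forall>R>0. \<forall>\<epsilon>>0. \<exists>A>0. \<forall>a ah x t.
           large_param m B A a \<and>
           (\<forall>j\<ge>1. \<forall>I\<in>{1..M}. \<not> (M + 1) dvd j \<longrightarrow> ah j I = a j) \<and>
           x\<^sup>2 + t\<^sup>2 \<le> R \<longrightarrow>
           cmod (v a n x t - rogue_wave M k c \<rho> p (\<lambda>j. nat (low_order M m l N j)) ah n x t) \<le> \<epsilon>))"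
proof -
  have re: "Re p0 \<noteq> 0" "Im p0 \<noteq> 0" using assms(11) by auto
  interpret mk_simple M lam1 k \<rho> c p0 p l N m rt
    by unfold_locales (fact assms(1-16) re)+
  show ?thesis unfolding Z_def v_def cx_def ct_def
    by (intro conjI impI ballI allI finite_ZZ card_ZZ(2) Delta_bounded near_region_ZZ far_region
        low_nonneg low_exists inner_region) assumption+
qed

end
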